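(* Let $\mathbb T$ be the theory of bounded distributive lattices and assume (SQCP), i.e. $\mathbb I[\mathsf i]$ is quasi-coherent. Then for any $\mathbb I$-algebra $A$, the path space $(\operatorname{Spec}A)^{\mathbb I}$ classifies the satisfaction order on $\operatorname{Spec}A$: the map $(\operatorname{Spec}A)^{\mathbb I}\to\operatorname{Spec}A\times\operatorname{Spec}A$, $\gamma\mapsto(\gamma(0),\gamma(1))$, is an embedding whose image is $\{(x,y)\mid\forall a:A.\ x(a)\le_{\mathbb I}y(a)\}$.
   Context: We work in intensional type theory with function extensionality. $\mathbb I$ is a bounded distributive lattice; an $\mathbb I$-algebra is a bounded distributive lattice $A$ with a homomorphism $\mathbb I\to A$. $\operatorname{Spec}A:=\mathbb I\text{-}\mathbf{Alg}(A,\mathbb I)$; $\mathcal O X:=\mathbb I^X$ with pointwise operations. $A$ is quasi-coherent if $\iota_A:A\to\mathcal O\operatorname{Spec}A$, $a\mapsto(x\mapsto x(a))$, is an isomorphism. $\mathbb I[\mathsf i]$ is the free $\mathbb I$-algebra on one generator. $\le_{\mathbb I}$ is the lattice order of $\mathbb I$. *)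

theory Defs
  imports Main
begin

text \<open>
  The theorem belongs to constructive type theory: inside the classical logic of HOL every function
  between lattices exists, in particular the one exchanging \<open>0\<close> and \<open>1\<close>, and quasi-coherence of
  \<open>\<I>[i]\<close> would force \<open>0 = 1\<close>. The type theory is therefore an object of study here: its syntax and
  judgements are defined, and the theorem says that a certain closed type is inhabited.
\<close>

section \<open>Intensional type theory with function extensionality\<close>

text \<open>
  Martin-Loef type theory with a non-cumulative hierarchy of Russell universes, \<open>\<Pi>\<close>- and
  \<open>\<Sigma>\<close>-types with judgemental \<open>\<beta>\<close> and \<open>\<eta>\<close>, intensional identity types with based path induction, and
  function extensionality as an axiom without computation rule. Only the type formers that the theorem
  mentions are present, so a closed term of a type in this theory is one in every extension by further
  types, axioms or equations.

  Variables are de Bruijn indices. \<open>Pi A B\<close>, \<open>Sig A B\<close> and \<open>Lam A t\<close> bind one variable in their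
  second argument. \<open>J C d p\<close> binds two variables in \<open>C\<close>: the end point (index 1) and the path
  (index 0). A context lists the type of the most recent variable first.
\<close>

datatype tm =
    Var nat
  | Univ nat
  | Pi tm tm
  | Lam tm tm
  | App tm tm
  | Sig tm tm
  | Tuple tm tm
  | Fst tm
  | Snd tm
  | Id tm tm tm
  | Refl tm
  | J tm tm tm
  | Funext tm

definition up_ren :: "(nat \<Rightarrow> nat) \<Rightarrow> nat \<Rightarrow> nat" where
  "up_ren \<xi> = case_nat 0 (\<lambda>n. Suc (\<xi> n))"

primrec ren :: "(nat \<Rightarrow> nat) \<Rightarrow> tm \<Rightarrow> tm" where
  "ren \<xi> (Var n) = Var (\<xi> n)"
| "ren \<xi> (Univ l) = Univ l"
| "ren \<xi> (Pi A B) = Pi (ren \<xi> A) (ren (up_ren \<xi>) B)"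
| "ren \<xi> (Lam A t) = Lam (ren \<xi> A) (ren (up_ren \<xi>) t)"
| "ren \<xi> (App f a) = App (ren \<xi> f) (ren \<xi> a)"
| "ren \<xi> (Sig A B) = Sig (ren \<xi> A) (ren (up_ren \<xi>) B)"
| "ren \<xi> (Tuple a b) = Tuple (ren \<xi> a) (ren \<xi> b)"
| "ren \<xi> (Fst p) = Fst (ren \<xi> p)"
| "ren \<xi> (Snd p) = Snd (ren \<xi> p)"
| "ren \<xi> (Id A a b) = Id (ren \<xi> A) (ren \<xi> a) (ren \<xi> b)"
| "ren \<xi> (Refl a) = Refl (ren \<xi> a)"
| "ren \<xi> (J C d p) = J (ren (up_ren (up_ren \<xi>)) C) (ren \<xi> d) (ren \<xi> p)"
| "ren \<xi> (Funext h) = Funext (ren \<xi> h)"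

definition shift :: "nat \<Rightarrow> tm \<Rightarrow> tm" where
  "shift k = ren (\<lambda>n. k + n)"

definition up :: "(nat \<Rightarrow> tm) \<Rightarrow> nat \<Rightarrow> tm" where
  "up \<sigma> = case_nat (Var 0) (\<lambda>n. shift 1 (\<sigma> n))"

primrec subst :: "(nat \<Rightarrow> tm) \<Rightarrow> tm \<Rightarrow> tm" where
  "subst \<sigma> (Var n) = \<sigma> n"
| "subst \<sigma> (Univ l) = Univ l"
| "subst \<sigma> (Pi A B) = Pi (subst \<sigma> A) (subst (up \<sigma>) B)"
| "subst \<sigma> (Lam A t) = Lam (subst \<sigma> A) (subst (up \<sigma>) t)"
| "subst \<sigma> (App f a) = App (subst \<sigma> f) (subst \<sigma> a)"
| "subst \<sigma> (Sig A B) = Sig (subst \<sigma> A) (subst (up \<sigma>) B)"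
| "subst \<sigma> (Tuple a b) = Tuple (subst \<sigma> a) (subst \<sigma> b)"
| "subst \<sigma> (Fst p) = Fst (subst \<sigma> p)"
| "subst \<sigma> (Snd p) = Snd (subst \<sigma> p)"
| "subst \<sigma> (Id A a b) = Id (subst \<sigma> A) (subst \<sigma> a) (subst \<sigma> b)"
| "subst \<sigma> (Refl a) = Refl (subst \<sigma> a)"
| "subst \<sigma> (J C d p) = J (subst (up (up \<sigma>)) C) (subst \<sigma> d) (subst \<sigma> p)"
| "subst \<sigma> (Funext h) = Funext (subst \<sigma> h)"

definition inst :: "tm \<Rightarrow> tm \<Rightarrow> tm" where
  "inst B a = subst (case_nat a Var) B"

definition inst2 :: "tm \<Rightarrow> tm \<Rightarrow> tm \<Rightarrow> tm" where
  "inst2 C b p = subst (case_nat p (case_nat b Var)) C"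

text \<open>
  The context in which the motive of \<open>J\<close> for paths in \<open>A\<close> starting at \<open>a\<close> lives.
\<close>

definition path_ctx :: "tm \<Rightarrow> tm \<Rightarrow> tm list \<Rightarrow> tm list" where
  "path_ctx A a \<Gamma> = Id (shift 1 A) (shift 1 a) (Var 0) # A # \<Gamma>"

definition htpy :: "tm \<Rightarrow> tm \<Rightarrow> tm \<Rightarrow> tm \<Rightarrow> tm" where
  "htpy A B f g = Pi A (Id B (App (shift 1 f) (Var 0)) (App (shift 1 g) (Var 0)))"

inductive
      ctx :: "tm list \<Rightarrow> bool"
  and typing :: "tm list \<Rightarrow> tm \<Rightarrow> tm \<Rightarrow> bool"  ("_ \<turnstile> _ \<Colon> _" [50, 50, 50] 50)
  and jeq :: "tm list \<Rightarrow> tm \<Rightarrow> tm \<Rightarrow> tm \<Rightarrow> bool"  ("_ \<turnstile> _ \<doteq> _ \<Colon> _" [50, 50, 50, 50] 50)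
where
  ctx_nil: "ctx []"
| ctx_cons: "ctx \<Gamma> \<Longrightarrow> \<Gamma> \<turnstile> A \<Colon> Univ i \<Longrightarrow> ctx (A # \<Gamma>)"

| t_var: "ctx \<Gamma> \<Longrightarrow> n < length \<Gamma> \<Longrightarrow> \<Gamma> \<turnstile> Var n \<Colon> shift (Suc n) (\<Gamma> ! n)"
| t_univ: "ctx \<Gamma> \<Longrightarrow> \<Gamma> \<turnstile> Univ i \<Colon> Univ (Suc i)"
| t_conv: "\<Gamma> \<turnstile> t \<Colon> A \<Longrightarrow> \<Gamma> \<turnstile> A \<doteq> B \<Colon> Univ i \<Longrightarrow> \<Gamma> \<turnstile> t \<Colon> B"
| t_pi: "\<Gamma> \<turnstile> A \<Colon> Univ i \<Longrightarrow> A # \<Gamma> \<turnstile> B \<Colon> Univ j \<Longrightarrow> \<Gamma> \<turnstile> Pi A B \<Colon> Univ (max i j)"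
| t_lam: "\<Gamma> \<turnstile> A \<Colon> Univ i \<Longrightarrow> A # \<Gamma> \<turnstile> B \<Colon> Univ j \<Longrightarrow> A # \<Gamma> \<turnstile> t \<Colon> B \<Longrightarrow>
    \<Gamma> \<turnstile> Lam A t \<Colon> Pi A B"
| t_app: "\<Gamma> \<turnstile> A \<Colon> Univ i \<Longrightarrow> A # \<Gamma> \<turnstile> B \<Colon> Univ j \<Longrightarrow>
    \<Gamma> \<turnstile> f \<Colon> Pi A B \<Longrightarrow> \<Gamma> \<turnstile> a \<Colon> A \<Longrightarrow> \<Gamma> \<turnstile> App f a \<Colon> inst B a"
| t_sig: "\<Gamma> \<turnstile> A \<Colon> Univ i \<Longrightarrow> A # \<Gamma> \<turnstile> B \<Colon> Univ j \<Longrightarrow> \<Gamma> \<turnstile> Sig A B \<Colon> Univ (max i j)"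
| t_pair: "\<Gamma> \<turnstile> A \<Colon> Univ i \<Longrightarrow> A # \<Gamma> \<turnstile> B \<Colon> Univ j \<Longrightarrow>
    \<Gamma> \<turnstile> a \<Colon> A \<Longrightarrow> \<Gamma> \<turnstile> b \<Colon> inst B a \<Longrightarrow> \<Gamma> \<turnstile> Tuple a b \<Colon> Sig A B"
| t_fst: "\<Gamma> \<turnstile> A \<Colon> Univ i \<Longrightarrow> A # \<Gamma> \<turnstile> B \<Colon> Univ j \<Longrightarrow>
    \<Gamma> \<turnstile> p \<Colon> Sig A B \<Longrightarrow> \<Gamma> \<turnstile> Fst p \<Colon> A"
| t_snd: "\<Gamma> \<turnstile> A \<Colon> Univ i \<Longrightarrow> A # \<Gamma> \<turnstile> B \<Colon> Univ j \<Longrightarrow>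
    \<Gamma> \<turnstile> p \<Colon> Sig A B \<Longrightarrow> \<Gamma> \<turnstile> Snd p \<Colon> inst B (Fst p)"
| t_id: "\<Gamma> \<turnstile> A \<Colon> Univ i \<Longrightarrow> \<Gamma> \<turnstile> a \<Colon> A \<Longrightarrow> \<Gamma> \<turnstile> b \<Colon> A \<Longrightarrow> \<Gamma> \<turnstile> Id A a b \<Colon> Univ i"
| t_refl: "\<Gamma> \<turnstile> A \<Colon> Univ i \<Longrightarrow> \<Gamma> \<turnstile> a \<Colon> A \<Longrightarrow> \<Gamma> \<turnstile> Refl a \<Colon> Id A a a"
| t_J: "\<Gamma> \<turnstile> A \<Colon> Univ i \<Longrightarrow> \<Gamma> \<turnstile> a \<Colon> A \<Longrightarrow> path_ctx A a \<Gamma> \<turnstile> C \<Colon> Univ j \<Longrightarrow>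
    \<Gamma> \<turnstile> d \<Colon> inst2 C a (Refl a) \<Longrightarrow> \<Gamma> \<turnstile> b \<Colon> A \<Longrightarrow> \<Gamma> \<turnstile> p \<Colon> Id A a b \<Longrightarrow>
    \<Gamma> \<turnstile> J C d p \<Colon> inst2 C b p"
| t_funext: "\<Gamma> \<turnstile> A \<Colon> Univ i \<Longrightarrow> A # \<Gamma> \<turnstile> B \<Colon> Univ j \<Longrightarrow>
    \<Gamma> \<turnstile> f \<Colon> Pi A B \<Longrightarrow> \<Gamma> \<turnstile> g \<Colon> Pi A B \<Longrightarrow> \<Gamma> \<turnstile> h \<Colon> htpy A B f g \<Longrightarrow>
    \<Gamma> \<turnstile> Funext h \<Colon> Id (Pi A B) f g"

| e_refl: "\<Gamma> \<turnstile> t \<Colon> A \<Longrightarrow> \<Gamma> \<turnstile> t \<doteq> t \<Colon> A"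
| e_sym: "\<Gamma> \<turnstile> t \<doteq> u \<Colon> A \<Longrightarrow> \<Gamma> \<turnstile> u \<doteq> t \<Colon> A"
| e_trans: "\<Gamma> \<turnstile> t \<doteq> u \<Colon> A \<Longrightarrow> \<Gamma> \<turnstile> u \<doteq> v \<Colon> A \<Longrightarrow> \<Gamma> \<turnstile> t \<doteq> v \<Colon> A"
| e_conv: "\<Gamma> \<turnstile> t \<doteq> u \<Colon> A \<Longrightarrow> \<Gamma> \<turnstile> A \<doteq> B \<Colon> Univ i \<Longrightarrow> \<Gamma> \<turnstile> t \<doteq> u \<Colon> B"
| e_pi: "\<Gamma> \<turnstile> A \<Colon> Univ i \<Longrightarrow> \<Gamma> \<turnstile> A \<doteq> A' \<Colon> Univ i \<Longrightarrow> A # \<Gamma> \<turnstile> B \<doteq> B' \<Colon> Univ j \<Longrightarrow>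
    \<Gamma> \<turnstile> Pi A B \<doteq> Pi A' B' \<Colon> Univ (max i j)"
| e_lam: "\<Gamma> \<turnstile> A \<Colon> Univ i \<Longrightarrow> A # \<Gamma> \<turnstile> B \<Colon> Univ j \<Longrightarrow>
    \<Gamma> \<turnstile> A \<doteq> A' \<Colon> Univ i \<Longrightarrow> A # \<Gamma> \<turnstile> t \<doteq> t' \<Colon> B \<Longrightarrow>
    \<Gamma> \<turnstile> Lam A t \<doteq> Lam A' t' \<Colon> Pi A B"
| e_app: "\<Gamma> \<turnstile> A \<Colon> Univ i \<Longrightarrow> A # \<Gamma> \<turnstile> B \<Colon> Univ j \<Longrightarrow>
    \<Gamma> \<turnstile> f \<doteq> f' \<Colon> Pi A B \<Longrightarrow> \<Gamma> \<turnstile> a \<doteq> a' \<Colon> A \<Longrightarrow> \<Gamma> \<turnstile> App f a \<doteq> App f' a' \<Colon> inst B a"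
| e_sig: "\<Gamma> \<turnstile> A \<Colon> Univ i \<Longrightarrow> \<Gamma> \<turnstile> A \<doteq> A' \<Colon> Univ i \<Longrightarrow> A # \<Gamma> \<turnstile> B \<doteq> B' \<Colon> Univ j \<Longrightarrow>
    \<Gamma> \<turnstile> Sig A B \<doteq> Sig A' B' \<Colon> Univ (max i j)"
| e_pair: "\<Gamma> \<turnstile> A \<Colon> Univ i \<Longrightarrow> A # \<Gamma> \<turnstile> B \<Colon> Univ j \<Longrightarrow>
    \<Gamma> \<turnstile> a \<doteq> a' \<Colon> A \<Longrightarrow> \<Gamma> \<turnstile> b \<doteq> b' \<Colon> inst B a \<Longrightarrow> \<Gamma> \<turnstile> Tuple a b \<doteq> Tuple a' b' \<Colon> Sig A B"
| e_fst: "\<Gamma> \<turnstile> A \<Colon> Univ i \<Longrightarrow> A # \<Gamma> \<turnstile> B \<Colon> Univ j \<Longrightarrow>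
    \<Gamma> \<turnstile> p \<doteq> p' \<Colon> Sig A B \<Longrightarrow> \<Gamma> \<turnstile> Fst p \<doteq> Fst p' \<Colon> A"
| e_snd: "\<Gamma> \<turnstile> A \<Colon> Univ i \<Longrightarrow> A # \<Gamma> \<turnstile> B \<Colon> Univ j \<Longrightarrow>
    \<Gamma> \<turnstile> p \<doteq> p' \<Colon> Sig A B \<Longrightarrow> \<Gamma> \<turnstile> Snd p \<doteq> Snd p' \<Colon> inst B (Fst p)"
| e_id: "\<Gamma> \<turnstile> A \<doteq> A' \<Colon> Univ i \<Longrightarrow> \<Gamma> \<turnstile> a \<doteq> a' \<Colon> A \<Longrightarrow> \<Gamma> \<turnstile> b \<doteq> b' \<Colon> A \<Longrightarrow>
    \<Gamma> \<turnstile> Id A a b \<doteq> Id A' a' b' \<Colon> Univ i"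
| e_refl_cong: "\<Gamma> \<turnstile> A \<Colon> Univ i \<Longrightarrow> \<Gamma> \<turnstile> a \<doteq> a' \<Colon> A \<Longrightarrow> \<Gamma> \<turnstile> Refl a \<doteq> Refl a' \<Colon> Id A a a"
| e_J: "\<Gamma> \<turnstile> A \<Colon> Univ i \<Longrightarrow> \<Gamma> \<turnstile> a \<Colon> A \<Longrightarrow> path_ctx A a \<Gamma> \<turnstile> C \<doteq> C' \<Colon> Univ j \<Longrightarrow>
    \<Gamma> \<turnstile> d \<doteq> d' \<Colon> inst2 C a (Refl a) \<Longrightarrow> \<Gamma> \<turnstile> b \<Colon> A \<Longrightarrow> \<Gamma> \<turnstile> p \<doteq> p' \<Colon> Id A a b \<Longrightarrow>
    \<Gamma> \<turnstile> J C d p \<doteq> J C' d' p' \<Colon> inst2 C b p"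
| e_funext: "\<Gamma> \<turnstile> A \<Colon> Univ i \<Longrightarrow> A # \<Gamma> \<turnstile> B \<Colon> Univ j \<Longrightarrow>
    \<Gamma> \<turnstile> f \<Colon> Pi A B \<Longrightarrow> \<Gamma> \<turnstile> g \<Colon> Pi A B \<Longrightarrow> \<Gamma> \<turnstile> h \<doteq> h' \<Colon> htpy A B f g \<Longrightarrow>
    \<Gamma> \<turnstile> Funext h \<doteq> Funext h' \<Colon> Id (Pi A B) f g"

| e_beta: "\<Gamma> \<turnstile> A \<Colon> Univ i \<Longrightarrow> A # \<Gamma> \<turnstile> B \<Colon> Univ j \<Longrightarrow> A # \<Gamma> \<turnstile> t \<Colon> B \<Longrightarrow> \<Gamma> \<turnstile> a \<Colon> A \<Longrightarrow>
    \<Gamma> \<turnstile> App (Lam A t) a \<doteq> inst t a \<Colon> inst B a"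
| e_eta: "\<Gamma> \<turnstile> A \<Colon> Univ i \<Longrightarrow> A # \<Gamma> \<turnstile> B \<Colon> Univ j \<Longrightarrow> \<Gamma> \<turnstile> f \<Colon> Pi A B \<Longrightarrow>
    \<Gamma> \<turnstile> f \<doteq> Lam A (App (shift 1 f) (Var 0)) \<Colon> Pi A B"
| e_fst_beta: "\<Gamma> \<turnstile> A \<Colon> Univ i \<Longrightarrow> A # \<Gamma> \<turnstile> B \<Colon> Univ j \<Longrightarrow>
    \<Gamma> \<turnstile> a \<Colon> A \<Longrightarrow> \<Gamma> \<turnstile> b \<Colon> inst B a \<Longrightarrow> \<Gamma> \<turnstile> Fst (Tuple a b) \<doteq> a \<Colon> A"
| e_snd_beta: "\<Gamma> \<turnstile> A \<Colon> Univ i \<Longrightarrow> A # \<Gamma> \<turnstile> B \<Colon> Univ j \<Longrightarrow>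
    \<Gamma> \<turnstile> a \<Colon> A \<Longrightarrow> \<Gamma> \<turnstile> b \<Colon> inst B a \<Longrightarrow> \<Gamma> \<turnstile> Snd (Tuple a b) \<doteq> b \<Colon> inst B a"
| e_sig_eta: "\<Gamma> \<turnstile> A \<Colon> Univ i \<Longrightarrow> A # \<Gamma> \<turnstile> B \<Colon> Univ j \<Longrightarrow> \<Gamma> \<turnstile> p \<Colon> Sig A B \<Longrightarrow>
    \<Gamma> \<turnstile> p \<doteq> Tuple (Fst p) (Snd p) \<Colon> Sig A B"
| e_J_beta: "\<Gamma> \<turnstile> A \<Colon> Univ i \<Longrightarrow> \<Gamma> \<turnstile> a \<Colon> A \<Longrightarrow> path_ctx A a \<Gamma> \<turnstile> C \<Colon> Univ j \<Longrightarrow>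
    \<Gamma> \<turnstile> d \<Colon> inst2 C a (Refl a) \<Longrightarrow> \<Gamma> \<turnstile> J C d (Refl a) \<doteq> d \<Colon> inst2 C a (Refl a)"


section \<open>Notation for terms\<close>

text \<open>
  To write terms with binders rather than indices, an expression denotes a function from the number of
  variables in scope to terms. A variable introduced at depth \<open>d\<close> has index \<open>e - Suc d\<close> at depth \<open>e\<close>.
  Since expressions adapt to the depth at which they are used, HOL functions between expressions serve
  as capture-avoiding abbreviations, and an expression without free variables is read at depth \<open>0\<close>.
\<close>

type_synonym expr = "nat \<Rightarrow> tm"

definition bind :: "(expr \<Rightarrow> expr) \<Rightarrow> nat \<Rightarrow> tm" where
  "bind B d = B (\<lambda>e. Var (e - Suc d)) (Suc d)"

definition univ :: "nat \<Rightarrow> expr" where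
  "univ l = (\<lambda>d. Univ l)"

definition pi_ty :: "expr \<Rightarrow> (expr \<Rightarrow> expr) \<Rightarrow> expr" where
  "pi_ty A B = (\<lambda>d. Pi (A d) (bind B d))"

definition lam :: "expr \<Rightarrow> (expr \<Rightarrow> expr) \<Rightarrow> expr" where
  "lam A t = (\<lambda>d. Lam (A d) (bind t d))"

definition app :: "expr \<Rightarrow> expr \<Rightarrow> expr"  (infixl "\<cdot>" 90) where
  "f \<cdot> a = (\<lambda>d. App (f d) (a d))"

definition sig_ty :: "expr \<Rightarrow> (expr \<Rightarrow> expr) \<Rightarrow> expr" where
  "sig_ty A B = (\<lambda>d. Sig (A d) (bind B d))"

definition pair :: "expr \<Rightarrow> expr \<Rightarrow> expr" where
  "pair a b = (\<lambda>d. Tuple (a d) (b d))"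

definition pr1 :: "expr \<Rightarrow> expr" where
  "pr1 p = (\<lambda>d. Fst (p d))"

definition pr2 :: "expr \<Rightarrow> expr" where
  "pr2 p = (\<lambda>d. Snd (p d))"

definition id_ty :: "expr \<Rightarrow> expr \<Rightarrow> expr \<Rightarrow> expr"  ("_ =\<^bsub>_\<^esub> _" [66, 0, 66] 65) where
  "(a =\<^bsub>A\<^esub> b) = (\<lambda>d. Id (A d) (a d) (b d))"

syntax
  "_pi" :: "pttrn \<Rightarrow> expr \<Rightarrow> expr \<Rightarrow> expr"  ("(3\<Pi> _ : _./ _)" [0, 0, 10] 10)
  "_lam" :: "pttrn \<Rightarrow> expr \<Rightarrow> expr \<Rightarrow> expr"  ("(3\<^bold>\<lambda> _ : _./ _)" [0, 0, 10] 10)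
  "_sig" :: "pttrn \<Rightarrow> expr \<Rightarrow> expr \<Rightarrow> expr"  ("(3\<Sigma> _ : _./ _)" [0, 0, 10] 10)
translations
  "\<Pi> x : A. B" \<rightleftharpoons> "CONST pi_ty A (\<lambda>x. B)"
  "\<^bold>\<lambda> x : A. t" \<rightleftharpoons> "CONST lam A (\<lambda>x. t)"
  "\<Sigma> x : A. B" \<rightleftharpoons> "CONST sig_ty A (\<lambda>x. B)"

definition arr :: "expr \<Rightarrow> expr \<Rightarrow> expr"  (infixr "\<rightarrow>" 60) where
  "A \<rightarrow> B = (\<Pi> x : A. B)"

definition prod_ty :: "expr \<Rightarrow> expr \<Rightarrow> expr"  (infixr "\<otimes>" 63) where
  "A \<otimes> B = (\<Sigma> x : A. B)"

definition inhabited :: "expr \<Rightarrow> bool" where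
  "inhabited A \<longleftrightarrow> (\<exists>t. [] \<turnstile> t \<Colon> A 0)"


section \<open>Sets, embeddings, images\<close>

definition is_prop :: "expr \<Rightarrow> expr" where
  "is_prop A = (\<Pi> x : A. \<Pi> y : A. x =\<^bsub>A\<^esub> y)"

definition is_set :: "expr \<Rightarrow> expr" where
  "is_set A = (\<Pi> x : A. \<Pi> y : A. is_prop (x =\<^bsub>A\<^esub> y))"

definition is_contr :: "expr \<Rightarrow> expr" where
  "is_contr A = (\<Sigma> c : A. \<Pi> x : A. c =\<^bsub>A\<^esub> x)"

definition fiber :: "expr \<Rightarrow> expr \<Rightarrow> expr \<Rightarrow> expr \<Rightarrow> expr" where
  "fiber X Y f y = (\<Sigma> x : X. f \<cdot> x =\<^bsub>Y\<^esub> y)"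

definition is_embedding :: "expr \<Rightarrow> expr \<Rightarrow> expr \<Rightarrow> expr" where
  "is_embedding X Y f = (\<Pi> y : Y. is_prop (fiber X Y f y))"

text \<open>
  The image of an embedding: its fibres are propositions, so being in the image (the truncation of
  the fibre) is the same as having an element in the fibre.
\<close>

definition has_image :: "expr \<Rightarrow> expr \<Rightarrow> expr \<Rightarrow> (expr \<Rightarrow> expr) \<Rightarrow> expr" where
  "has_image X Y f S = (\<Pi> y : Y. (fiber X Y f y \<rightarrow> S y) \<otimes> (S y \<rightarrow> fiber X Y f y))"


section \<open>Bounded distributive lattices and algebras over them\<close>

text \<open>
  The operations of an object-level structure are collected in a HOL record; quantification over
  structures is the corresponding iterated \<open>\<Pi>\<close>-type.
\<close>

record lat =
  carr :: expr
  lbot :: expr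
  ltop :: expr
  lmeet :: expr
  ljoin :: expr

record alg = lat +
  str :: expr

definition lattice_laws :: "'a lat_scheme \<Rightarrow> expr" where
  "lattice_laws L =
    (let A = carr L; b = lbot L; t = ltop L;
         meet = (\<lambda>x y. lmeet L \<cdot> x \<cdot> y); join = (\<lambda>x y. ljoin L \<cdot> x \<cdot> y) in
      is_set A
    \<otimes> (\<Pi> x : A. \<Pi> y : A. \<Pi> z : A. meet (meet x y) z =\<^bsub>A\<^esub> meet x (meet y z))
    \<otimes> (\<Pi> x : A. \<Pi> y : A. \<Pi> z : A. join (join x y) z =\<^bsub>A\<^esub> join x (join y z))
    \<otimes> (\<Pi> x : A. \<Pi> y : A. meet x y =\<^bsub>A\<^esub> meet y x)
    \<otimes> (\<Pi> x : A. \<Pi> y : A. join x y =\<^bsub>A\<^esub> join y x)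
    \<otimes> (\<Pi> x : A. \<Pi> y : A. meet x (join x y) =\<^bsub>A\<^esub> x)
    \<otimes> (\<Pi> x : A. \<Pi> y : A. join x (meet x y) =\<^bsub>A\<^esub> x)
    \<otimes> (\<Pi> x : A. meet x t =\<^bsub>A\<^esub> x)
    \<otimes> (\<Pi> x : A. join x b =\<^bsub>A\<^esub> x)
    \<otimes> (\<Pi> x : A. \<Pi> y : A. \<Pi> z : A. meet x (join y z) =\<^bsub>A\<^esub> join (meet x y) (meet x z)))"

definition leq :: "'a lat_scheme \<Rightarrow> expr \<Rightarrow> expr \<Rightarrow> expr" where
  "leq L x y = (lmeet L \<cdot> x \<cdot> y =\<^bsub>carr L\<^esub> x)"

definition lat_hom_laws :: "'a lat_scheme \<Rightarrow> 'b lat_scheme \<Rightarrow> expr \<Rightarrow> expr" where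
  "lat_hom_laws A B f =
      (f \<cdot> lbot A =\<^bsub>carr B\<^esub> lbot B)
    \<otimes> (f \<cdot> ltop A =\<^bsub>carr B\<^esub> ltop B)
    \<otimes> (\<Pi> x : carr A. \<Pi> y : carr A.
        f \<cdot> (lmeet A \<cdot> x \<cdot> y) =\<^bsub>carr B\<^esub> lmeet B \<cdot> (f \<cdot> x) \<cdot> (f \<cdot> y))
    \<otimes> (\<Pi> x : carr A. \<Pi> y : carr A.
        f \<cdot> (ljoin A \<cdot> x \<cdot> y) =\<^bsub>carr B\<^esub> ljoin B \<cdot> (f \<cdot> x) \<cdot> (f \<cdot> y))"

definition all_lat :: "nat \<Rightarrow> (lat \<Rightarrow> expr) \<Rightarrow> expr" where
  "all_lat l P =
    (\<Pi> C : univ l. \<Pi> b : C. \<Pi> t : C. \<Pi> m : C \<rightarrow> C \<rightarrow> C. \<Pi> j : C \<rightarrow> C \<rightarrow> C.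
      let L = \<lparr>carr = C, lbot = b, ltop = t, lmeet = m, ljoin = j\<rparr>
      in lattice_laws L \<rightarrow> P L)"

definition all_alg :: "nat \<Rightarrow> lat \<Rightarrow> (alg \<Rightarrow> expr) \<Rightarrow> expr" where
  "all_alg l I P = all_lat l (\<lambda>L. \<Pi> s : carr I \<rightarrow> carr L.
      lat_hom_laws I L s \<rightarrow> P (lat.extend L \<lparr>str = s\<rparr>))"

definition alg_hom_laws :: "lat \<Rightarrow> alg \<Rightarrow> alg \<Rightarrow> expr \<Rightarrow> expr" where
  "alg_hom_laws I A B f =
    lat_hom_laws A B f \<otimes> (\<Pi> r : carr I. f \<cdot> (str A \<cdot> r) =\<^bsub>carr B\<^esub> str B \<cdot> r)"

definition alg_hom :: "lat \<Rightarrow> alg \<Rightarrow> alg \<Rightarrow> expr" where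
  "alg_hom I A B = (\<Sigma> f : carr A \<rightarrow> carr B. alg_hom_laws I A B f)"

definition is_alg_iso :: "lat \<Rightarrow> alg \<Rightarrow> alg \<Rightarrow> expr \<Rightarrow> expr" where
  "is_alg_iso I A B f =
      alg_hom_laws I A B f
    \<otimes> (\<Sigma> g : alg_hom I B A.
        (\<Pi> a : carr A. pr1 g \<cdot> (f \<cdot> a) =\<^bsub>carr A\<^esub> a)
      \<otimes> (\<Pi> b : carr B. f \<cdot> (pr1 g \<cdot> b) =\<^bsub>carr B\<^esub> b))"

definition base_alg :: "lat \<Rightarrow> alg" where
  "base_alg I = lat.extend I \<lparr>str = (\<^bold>\<lambda> r : carr I. r)\<rparr>"

definition Spec :: "lat \<Rightarrow> alg \<Rightarrow> expr" where
  "Spec I A = alg_hom I A (base_alg I)"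

definition fun_alg :: "lat \<Rightarrow> expr \<Rightarrow> alg" where
  "fun_alg I X =
    \<lparr>carr = X \<rightarrow> carr I,
     lbot = (\<^bold>\<lambda> x : X. lbot I),
     ltop = (\<^bold>\<lambda> x : X. ltop I),
     lmeet = (\<^bold>\<lambda> f : X \<rightarrow> carr I. \<^bold>\<lambda> g : X \<rightarrow> carr I. \<^bold>\<lambda> x : X. lmeet I \<cdot> (f \<cdot> x) \<cdot> (g \<cdot> x)),
     ljoin = (\<^bold>\<lambda> f : X \<rightarrow> carr I. \<^bold>\<lambda> g : X \<rightarrow> carr I. \<^bold>\<lambda> x : X. ljoin I \<cdot> (f \<cdot> x) \<cdot> (g \<cdot> x)),
     str = (\<^bold>\<lambda> r : carr I. \<^bold>\<lambda> x : X. r)\<rparr>"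

definition iota :: "lat \<Rightarrow> alg \<Rightarrow> expr" where
  "iota I A = (\<^bold>\<lambda> a : carr A. \<^bold>\<lambda> x : Spec I A. pr1 x \<cdot> a)"

definition quasi_coherent :: "lat \<Rightarrow> alg \<Rightarrow> expr" where
  "quasi_coherent I A = is_alg_iso I A (fun_alg I (Spec I A)) (iota I A)"

text \<open>
  \<open>F\<close> is free on the generator \<open>i\<close>, with respect to the algebras in the \<open>l\<close>-th universe.
\<close>

definition is_free_on :: "nat \<Rightarrow> lat \<Rightarrow> alg \<Rightarrow> expr \<Rightarrow> expr" where
  "is_free_on l I F i =
    all_alg l I (\<lambda>B. \<Pi> b : carr B. is_contr (\<Sigma> h : alg_hom I F B. pr1 h \<cdot> i =\<^bsub>carr B\<^esub> b))"

text \<open>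
  The type \<open>X\<^sup>\<I>\<close> of paths in \<open>X\<close> and the map sending \<open>\<gamma>\<close> to \<open>(\<gamma>(0), \<gamma>(1))\<close>.
\<close>

definition path_space :: "lat \<Rightarrow> expr \<Rightarrow> expr" where
  "path_space I X = carr I \<rightarrow> X"

definition endpoints :: "lat \<Rightarrow> expr \<Rightarrow> expr" where
  "endpoints I X = (\<^bold>\<lambda> c : path_space I X. pair (c \<cdot> lbot I) (c \<cdot> ltop I))"

definition satisfaction_order :: "lat \<Rightarrow> alg \<Rightarrow> expr \<Rightarrow> expr" where
  "satisfaction_order I A p = (\<Pi> a : carr A. leq I (pr1 (pr1 p) \<cdot> a) (pr1 (pr2 p) \<cdot> a))"

end

theory Submission
  imports Defs
begin

text \<open>
  By freeness and quasi-coherence every function \<open>f\<close> on the lattice \<open>\<I>\<close> has the form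
  \<open>x \<mapsto> x(p)\<close> for some \<open>p : \<I>[i]\<close>, where points \<open>x\<close> of \<open>\<I>[i]\<close> are identified with elements of \<open>\<I>\<close>. The maps
  satisfying \<open>f(r) = f(0) \<or> (f(1) \<and> r)\<close> form an \<open>\<I>\<close>-algebra containing the identity, so freeness gives
  a homomorphism from \<open>\<I>[i]\<close> into it, and uniqueness of lifts shows that \<open>f\<close> itself is of this form. Applied
  to \<open>r \<mapsto> \<gamma>(r)(a)\<close>, this expresses a path by its end points and shows \<open>\<gamma>(0)(a) \<le> \<gamma>(1)(a)\<close>; conversely
  \<open>r \<mapsto> (a \<mapsto> x(a) \<or> (y(a) \<and> r))\<close> is a path of homomorphisms as soon as \<open>x(a) \<le> y(a)\<close> for all \<open>a\<close>.

  Proof terms are not written down: \<open>tr \<Gamma> P\<close> says that \<open>P\<close> has some element in the context \<open>\<Gamma>\<close>, and the rules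
  of the type theory become rules about \<open>tr\<close> in which a binder is entered by passing to an arbitrary extension
  of the context, as in Kripke semantics. Computation rules enter only through the identities that they induce.
\<close>


section \<open>Renaming and substitution\<close>

text \<open>Freeness is available only as a universal property, so the normal form
  \<open>x \<or> (y \<and> r)\<close> of a lattice polynomial in one variable cannot be read off
  syntax; it is extracted by mapping into an algebra that consists of maps of this form. That target
  has to be built inside the theory, at exactly the level \<open>l\<close> at which freeness is
  assumed, and its carrier has to be proved a set. Two points carry the argument. Closure under
  meets: distributivity produces cross terms, and these are absorbed because an affine map satisfies
  \<open>f(0) \<le> f(1)\<close>, which follows from its own equation at \<open>r = 1\<close>.
  Identification of \<open>f\<close>: let \<open>k\<close> lift the generator to the identity map
  and let \<open>p\<close> represent \<open>f\<close>. For each \<open>s\<close>, the point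
  \<open>x\<close> with \<open>x(i) = s\<close> and the homomorphism \<open>k\<close> followed by
  evaluation at \<open>s\<close> both send the generator to \<open>s\<close>. By uniqueness they
  agree at \<open>p\<close>, so \<open>f(s) = x(p) = k(p)(s)\<close>, and \<open>k(p)\<close> is
  affine.\<close>

lemma up_ren_comp: "up_ren \<xi> \<circ> up_ren \<zeta> = up_ren (\<xi> \<circ> \<zeta>)"
  by (auto simp: up_ren_def fun_eq_iff split: nat.split)

lemma ren_ren: "ren \<xi> (ren \<zeta> t) = ren (\<xi> \<circ> \<zeta>) t"
  by (induction t arbitrary: \<xi> \<zeta>) (auto simp: up_ren_comp)

lemma up_comp_up_ren: "up \<sigma> \<circ> up_ren \<xi> = up (\<sigma> \<circ> \<xi>)"
  by (auto simp: up_ren_def up_def fun_eq_iff split: nat.split)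

lemma subst_ren: "subst \<sigma> (ren \<xi> t) = subst (\<sigma> \<circ> \<xi>) t"
  by (induction t arbitrary: \<xi> \<sigma>) (auto simp: up_comp_up_ren)

lemma up_ren_Var: "up (Var \<circ> \<xi>) = Var \<circ> up_ren \<xi>"
  by (auto simp: up_ren_def up_def shift_def fun_eq_iff split: nat.split)

lemma ren_eq_subst: "ren \<xi> t = subst (Var \<circ> \<xi>) t"
  by (induction t arbitrary: \<xi>) (auto simp: up_ren_Var)

lemma ren_comp_up: "ren (up_ren \<xi>) \<circ> up \<sigma> = up (ren \<xi> \<circ> \<sigma>)"
  by (auto simp: up_ren_def up_def shift_def fun_eq_iff ren_ren intro!: arg_cong2[where f = ren]
      split: nat.split)

lemma ren_subst: "ren \<xi> (subst \<sigma> t) = subst (ren \<xi> \<circ> \<sigma>) t"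
  by (induction t arbitrary: \<xi> \<sigma>) (auto simp: ren_comp_up)

lemma subst_shift1: "subst (up \<tau>) (shift 1 t) = shift 1 (subst \<tau> t)"
  by (auto simp: shift_def subst_ren ren_subst up_def fun_eq_iff intro!: arg_cong2[where f = subst])

lemma subst_comp_up: "subst (up \<tau>) \<circ> up \<sigma> = up (subst \<tau> \<circ> \<sigma>)"
proof
  fix n show "(subst (up \<tau>) \<circ> up \<sigma>) n = up (subst \<tau> \<circ> \<sigma>) n"
    using subst_shift1 by (cases n) (auto simp: up_def)
qed

text \<open>The last of four fusion laws. Their order is forced by \<open>up\<close>, which shifts
  by a renaming: pushing a substitution below a binder needs \<open>subst_shift1\<close>, and that
  rests on the two mixed laws \<open>subst_ren\<close> and \<open>ren_subst\<close>.\<close>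

lemma subst_subst: "subst \<tau> (subst \<sigma> t) = subst (subst \<tau> \<circ> \<sigma>) t"
  by (induction t arbitrary: \<tau> \<sigma>) (auto simp: subst_comp_up)

lemma up_Var: "up Var = Var"
  by (auto simp: up_def shift_def fun_eq_iff split: nat.split)

lemma subst_Var [simp]: "subst Var t = t"
  by (induction t) (auto simp: up_Var)

lemma shift_0 [simp]: "shift 0 t = t"
  by (simp add: shift_def ren_eq_subst comp_def)

lemma shift_Var [simp]: "shift k (Var n) = Var (k + n)"
  by (simp add: shift_def)

lemma shift_shift: "shift j (shift k t) = shift (j + k) t"
  by (auto simp: shift_def ren_ren intro!: arg_cong2[where f = ren])

lemma ren_inst: "ren \<xi> (inst B a) = inst (ren (up_ren \<xi>) B) (ren \<xi> a)"
  by (auto simp: inst_def subst_ren ren_subst up_ren_def fun_eq_iff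
      intro!: arg_cong2[where f = subst] split: nat.split)

lemma ren_inst2: "ren \<xi> (inst2 C b p) = inst2 (ren (up_ren (up_ren \<xi>)) C) (ren \<xi> b) (ren \<xi> p)"
  by (auto simp: inst2_def subst_ren ren_subst up_ren_def fun_eq_iff
      intro!: arg_cong2[where f = subst] split: nat.split)

lemma subst_inst: "subst \<sigma> (inst B a) = inst (subst (up \<sigma>) B) (subst \<sigma> a)"
  by (auto simp: inst_def subst_subst up_def fun_eq_iff shift_def subst_ren comp_def
      intro!: arg_cong2[where f = subst] split: nat.split)

lemma subst_inst2: "subst \<sigma> (inst2 C b p) = inst2 (subst (up (up \<sigma>)) C) (subst \<sigma> b) (subst \<sigma> p)"
  by (auto simp: inst2_def subst_subst up_def fun_eq_iff shift_def subst_ren comp_def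
      intro!: arg_cong2[where f = subst] split: nat.split)

lemma ren_shift1: "ren (up_ren \<xi>) (shift 1 t) = shift 1 (ren \<xi> t)"
  by (auto simp: shift_def ren_ren up_ren_def intro!: arg_cong2[where f = ren])

lemma up_ren_0 [simp]: "up_ren \<xi> 0 = 0"
  by (simp add: up_ren_def)

lemma up_0 [simp]: "up \<sigma> 0 = Var 0"
  by (simp add: up_def)

lemma ren_htpy: "ren \<xi> (htpy A B f g) = htpy (ren \<xi> A) (ren (up_ren \<xi>) B) (ren \<xi> f) (ren \<xi> g)"
  by (simp add: htpy_def ren_shift1[simplified])

lemma subst_htpy:
  "subst \<sigma> (htpy A B f g) = htpy (subst \<sigma> A) (subst (up \<sigma>) B) (subst \<sigma> f) (subst \<sigma> g)"
  by (simp add: htpy_def subst_shift1[simplified])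


section \<open>Stability of the judgements\<close>

text \<open>Every rule has a premise in the context of its conclusion, down to \<open>t_var\<close>
  and \<open>t_univ\<close>, which ask for \<open>ctx\<close>. The trivial first clause is there
  because the three judgements are defined simultaneously and induction expects a conclusion for
  each.\<close>

lemma judgement_ctx:
  "ctx \<Gamma> \<Longrightarrow> True"
  "\<Gamma> \<turnstile> t \<Colon> A \<Longrightarrow> ctx \<Gamma>"
  "\<Gamma> \<turnstile> t \<doteq> u \<Colon> A \<Longrightarrow> ctx \<Gamma>"
  by (induction rule: ctx_typing_jeq.inducts) auto

text \<open>Well-formedness of the target is part of the notion because the rules for variables and
  universes ask for it again after renaming.\<close>

definition wren :: "(nat \<Rightarrow> nat) \<Rightarrow> tm list \<Rightarrow> tm list \<Rightarrow> bool" where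
  "wren \<xi> \<Gamma> \<Delta> \<longleftrightarrow> ctx \<Delta> \<and> (\<forall>n<length \<Gamma>. \<xi> n < length \<Delta> \<and>
     ren \<xi> (shift (Suc n) (\<Gamma> ! n)) = shift (Suc (\<xi> n)) (\<Delta> ! \<xi> n))"

lemma wrenD: "wren \<xi> \<Gamma> \<Delta> \<Longrightarrow> ctx \<Delta>"
  by (simp add: wren_def)

lemma wren_up:
  assumes "wren \<xi> \<Gamma> \<Delta>" "\<Delta> \<turnstile> ren \<xi> A \<Colon> Univ i"
  shows "wren (up_ren \<xi>) (A # \<Gamma>) (ren \<xi> A # \<Delta>)"
  unfolding wren_def
proof (intro conjI allI impI)
  show "ctx (ren \<xi> A # \<Delta>)" using assms by (auto simp: wren_def intro: ctx_cons)
  fix n assume n: "n < length (A # \<Gamma>)"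
  have *: "shift (Suc k) t = shift 1 (shift k t)" for k t by (simp add: shift_shift)
  show "up_ren \<xi> n < length (ren \<xi> A # \<Delta>)"
    using assms n by (cases n) (auto simp: wren_def up_ren_def)
  show "ren (up_ren \<xi>) (shift (Suc n) ((A # \<Gamma>) ! n)) =
      shift (Suc (up_ren \<xi> n)) ((ren \<xi> A # \<Delta>) ! up_ren \<xi> n)"
  proof (cases n)
    case 0 then show ?thesis using ren_shift1[of \<xi> A] by simp
  next
    case (Suc k)
    then have "ren \<xi> (shift (Suc k) (\<Gamma> ! k)) = shift (Suc (\<xi> k)) (\<Delta> ! \<xi> k)"
      using assms n by (auto simp: wren_def)
    then show ?thesis unfolding Suc *[of "Suc k"] ren_shift1
      by (simp add: ren_shift1 up_ren_def shift_shift)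
  qed
qed

lemma ren_Suc_comp: "ren (Suc \<circ> \<xi>) t = shift 1 (ren \<xi> t)"
  by (auto simp: shift_def ren_ren intro!: arg_cong2[where f = ren])

lemma wren_Suc:
  assumes "wren \<xi> \<Gamma> \<Delta>" "ctx (B # \<Delta>)"
  shows "wren (Suc \<circ> \<xi>) \<Gamma> (B # \<Delta>)"
  unfolding wren_def
proof (intro conjI allI impI)
  fix n assume n: "n < length \<Gamma>"
  show "(Suc \<circ> \<xi>) n < length (B # \<Delta>)" using assms n by (auto simp: wren_def)
  have e: "ren \<xi> (shift (Suc n) (\<Gamma> ! n)) = shift (Suc (\<xi> n)) (\<Delta> ! \<xi> n)"
    using assms n by (auto simp: wren_def)
  show "ren (Suc \<circ> \<xi>) (shift (Suc n) (\<Gamma> ! n)) =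
      shift (Suc ((Suc \<circ> \<xi>) n)) ((B # \<Delta>) ! (Suc \<circ> \<xi>) n)"
    unfolding ren_Suc_comp by (simp add: e shift_shift)
qed (use assms in auto)

lemma path_ctxI:
  assumes "\<Gamma> \<turnstile> A \<Colon> Univ i" "A # \<Gamma> \<turnstile> shift 1 A \<Colon> Univ i" "A # \<Gamma> \<turnstile> shift 1 a \<Colon> shift 1 A"
  shows "A # \<Gamma> \<turnstile> Id (shift 1 A) (shift 1 a) (Var 0) \<Colon> Univ i"
proof -
  have c: "ctx (A # \<Gamma>)" using assms judgement_ctx by blast
  have "A # \<Gamma> \<turnstile> Var 0 \<Colon> shift 1 A" using t_var[OF c, of 0] by simp
  then show ?thesis using assms by (auto intro: t_id)
qed

text \<open>The hypotheses range over all renamings because \<open>path_ctx\<close> mentions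
  \<open>A\<close> and \<open>a\<close> weakened by its own first entry. The induction hypotheses of
  the \<open>J\<close> rules can thus be applied to \<open>Suc \<circ> \<xi>\<close> as well, before
  any weakening lemma exists.\<close>

lemma wren_path:
  assumes w: "wren \<xi> \<Gamma> \<Delta>"
    and A: "\<And>\<Delta> \<xi>. wren \<xi> \<Gamma> \<Delta> \<Longrightarrow> \<Delta> \<turnstile> ren \<xi> A \<Colon> Univ i"
    and a: "\<And>\<Delta> \<xi>. wren \<xi> \<Gamma> \<Delta> \<Longrightarrow> \<Delta> \<turnstile> ren \<xi> a \<Colon> ren \<xi> A"
  shows "wren (up_ren (up_ren \<xi>)) (path_ctx A a \<Gamma>) (path_ctx (ren \<xi> A) (ren \<xi> a) \<Delta>)"
proof -
  have c: "ctx (ren \<xi> A # \<Delta>)" using A[OF w] w by (auto intro: ctx_cons simp: wren_def)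
  have "ren \<xi> A # \<Delta> \<turnstile> Id (shift 1 (ren \<xi> A)) (shift 1 (ren \<xi> a)) (Var 0) \<Colon> Univ i"
    using path_ctxI[OF A[OF w]] A[OF wren_Suc[OF w c]] a[OF wren_Suc[OF w c]]
    by (simp add: ren_Suc_comp[simplified])
  moreover have "ren (up_ren \<xi>) (Id (shift 1 A) (shift 1 a) (Var 0)) =
      Id (shift 1 (ren \<xi> A)) (shift 1 (ren \<xi> a)) (Var 0)"
    by (simp add: ren_shift1[simplified])
  ultimately show ?thesis
    unfolding path_ctx_def using wren_up[OF wren_up[OF w A[OF w]]] by metis
qed

text \<open>The rules for \<open>J\<close> are treated by hand because their motive lives over
  \<open>path_ctx\<close>, two binders deep; the eta rule because its right hand side contains a
  \<open>shift\<close>. All other rules are reapplied after commuting renaming with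
  \<open>inst\<close> and \<open>htpy\<close>.\<close>

lemma judgement_ren:
  "ctx \<Gamma> \<Longrightarrow> True"
  "\<Gamma> \<turnstile> t \<Colon> A \<Longrightarrow> wren \<xi> \<Gamma> \<Delta> \<Longrightarrow> \<Delta> \<turnstile> ren \<xi> t \<Colon> ren \<xi> A"
  "\<Gamma> \<turnstile> t \<doteq> u \<Colon> A \<Longrightarrow> wren \<xi> \<Gamma> \<Delta> \<Longrightarrow> \<Delta> \<turnstile> ren \<xi> t \<doteq> ren \<xi> u \<Colon> ren \<xi> A"
proof (induction arbitrary: and \<xi> \<Delta> and \<xi> \<Delta> rule: ctx_typing_jeq.inducts)
  case (t_var \<Gamma> n)
  then show ?case using ctx_typing_jeq.t_var[of \<Delta> "\<xi> n"] by (simp add: wren_def)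
next
  case (t_J \<Gamma> A i a C j d b p)
  have "wren (up_ren (up_ren \<xi>)) (path_ctx A a \<Gamma>) (path_ctx (ren \<xi> A) (ren \<xi> a) \<Delta>)"
    using t_J by (intro wren_path) auto
  then show ?case using t_J by (auto simp: ren_inst2 intro!: ctx_typing_jeq.t_J)
next
  case (e_J \<Gamma> A i a C C' j d d' b p p')
  have "wren (up_ren (up_ren \<xi>)) (path_ctx A a \<Gamma>) (path_ctx (ren \<xi> A) (ren \<xi> a) \<Delta>)"
    using e_J by (intro wren_path) auto
  then show ?case using e_J by (auto simp: ren_inst2 intro!: ctx_typing_jeq.e_J)
next
  case (e_J_beta \<Gamma> A i a C j d)
  have "wren (up_ren (up_ren \<xi>)) (path_ctx A a \<Gamma>) (path_ctx (ren \<xi> A) (ren \<xi> a) \<Delta>)"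
    using e_J_beta by (intro wren_path) auto
  then show ?case using e_J_beta by (auto simp: ren_inst2 intro!: ctx_typing_jeq.e_J_beta)
next
  case (e_eta \<Gamma> A i B j f)
  then show ?case
    using ctx_typing_jeq.e_eta[of \<Delta> "ren \<xi> A" i "ren (up_ren \<xi>) B" j "ren \<xi> f"] wren_up
    by (fastforce simp: ren_shift1[simplified])
qed (simp_all add: ren_inst ren_htpy, (blast intro: ctx_typing_jeq.intros wren_up wrenD)+)

lemma weakening:
  assumes "\<Gamma> \<turnstile> t \<Colon> A" "ctx (B # \<Gamma>)"
  shows "B # \<Gamma> \<turnstile> shift 1 t \<Colon> shift 1 A"
proof -
  have "wren (\<lambda>n. n) \<Gamma> \<Gamma>"
    using assms judgement_ctx by (auto simp: wren_def ren_eq_subst comp_def)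
  from judgement_ren(2)[OF assms(1) wren_Suc[OF this assms(2)]]
  show ?thesis by (simp add: shift_def comp_def)
qed

lemma ext_weakening:
  assumes "\<Gamma> \<turnstile> t \<Colon> A" "ctx (\<Theta> @ \<Gamma>)"
  shows "\<Theta> @ \<Gamma> \<turnstile> shift (length \<Theta>) t \<Colon> shift (length \<Theta>) A"
proof -
  have "wren (\<lambda>n. length \<Theta> + n) \<Gamma> (\<Theta> @ \<Gamma>)"
    using assms(2) by (auto simp: wren_def nth_append shift_shift shift_def[symmetric])
  from judgement_ren(2)[OF assms(1) this] show ?thesis by (simp add: shift_def)
qed

section \<open>Stability under substitution\<close>

definition wsub :: "(nat \<Rightarrow> tm) \<Rightarrow> tm list \<Rightarrow> tm list \<Rightarrow> bool" where
  "wsub \<sigma> \<Gamma> \<Delta> \<longleftrightarrow> ctx \<Delta> \<and> (\<forall>n<length \<Gamma>. \<Delta> \<turnstile> \<sigma> n \<Colon> subst \<sigma> (shift (Suc n) (\<Gamma> ! n)))"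

lemma wsubD: "wsub \<sigma> \<Gamma> \<Delta> \<Longrightarrow> ctx \<Delta>"
  by (simp add: wsub_def)

lemma subst_shift_comp: "subst (shift 1 \<circ> \<sigma>) t = shift 1 (subst \<sigma> t)"
  by (simp add: shift_def ren_subst comp_def)

text \<open>Weakening, hence stability under renaming, is needed here: every substituted term moves
  to a longer context.\<close>

lemma wsub_Suc:
  assumes "wsub \<sigma> \<Gamma> \<Delta>" "ctx (B # \<Delta>)"
  shows "wsub (shift 1 \<circ> \<sigma>) \<Gamma> (B # \<Delta>)"
  using assms weakening[OF _ assms(2)] unfolding wsub_def subst_shift_comp by auto

lemma wsub_up:
  assumes "wsub \<sigma> \<Gamma> \<Delta>" "\<Delta> \<turnstile> subst \<sigma> A \<Colon> Univ i"
  shows "wsub (up \<sigma>) (A # \<Gamma>) (subst \<sigma> A # \<Delta>)"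
  unfolding wsub_def
proof (intro conjI allI impI)
  show c: "ctx (subst \<sigma> A # \<Delta>)" using assms by (auto simp: wsub_def intro: ctx_cons)
  fix n assume n: "n < length (A # \<Gamma>)"
  show "subst \<sigma> A # \<Delta> \<turnstile> up \<sigma> n \<Colon> subst (up \<sigma>) (shift (Suc n) ((A # \<Gamma>) ! n))"
  proof (cases n)
    case 0 then show ?thesis using t_var[OF c, of 0] by (simp add: subst_shift1[simplified])
  next
    case (Suc k)
    have "subst (up \<sigma>) (shift (Suc n) (\<Gamma> ! k)) = shift 1 (subst \<sigma> (shift (Suc k) (\<Gamma> ! k)))"
      unfolding Suc subst_shift1[symmetric] by (simp add: shift_shift)
    then show ?thesis using weakening[OF _ c] assms n Suc by (auto simp: wsub_def up_def)
  qed
qed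

lemma wsub_path:
  assumes w: "wsub \<sigma> \<Gamma> \<Delta>"
    and A: "\<And>\<Delta> \<sigma>. wsub \<sigma> \<Gamma> \<Delta> \<Longrightarrow> \<Delta> \<turnstile> subst \<sigma> A \<Colon> Univ i"
    and a: "\<And>\<Delta> \<sigma>. wsub \<sigma> \<Gamma> \<Delta> \<Longrightarrow> \<Delta> \<turnstile> subst \<sigma> a \<Colon> subst \<sigma> A"
  shows "wsub (up (up \<sigma>)) (path_ctx A a \<Gamma>) (path_ctx (subst \<sigma> A) (subst \<sigma> a) \<Delta>)"
proof -
  have c: "ctx (subst \<sigma> A # \<Delta>)" using A[OF w] w by (auto intro: ctx_cons simp: wsub_def)
  have "subst \<sigma> A # \<Delta> \<turnstile> Id (shift 1 (subst \<sigma> A)) (shift 1 (subst \<sigma> a)) (Var 0) \<Colon> Univ i"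
    using path_ctxI[OF A[OF w]] A[OF wsub_Suc[OF w c]] a[OF wsub_Suc[OF w c]]
    by (simp add: subst_shift_comp[simplified])
  moreover have "subst (up \<sigma>) (Id (shift 1 A) (shift 1 a) (Var 0)) =
      Id (shift 1 (subst \<sigma> A)) (shift 1 (subst \<sigma> a)) (Var 0)"
    by (simp add: subst_shift1[simplified])
  ultimately show ?thesis
    unfolding path_ctx_def using wsub_up[OF wsub_up[OF w A[OF w]]] by metis
qed

lemma judgement_subst:
  "ctx \<Gamma> \<Longrightarrow> True"
  "\<Gamma> \<turnstile> t \<Colon> A \<Longrightarrow> wsub \<sigma> \<Gamma> \<Delta> \<Longrightarrow> \<Delta> \<turnstile> subst \<sigma> t \<Colon> subst \<sigma> A"
  "\<Gamma> \<turnstile> t \<doteq> u \<Colon> A \<Longrightarrow> wsub \<sigma> \<Gamma> \<Delta> \<Longrightarrow> \<Delta> \<turnstile> subst \<sigma> t \<doteq> subst \<sigma> u \<Colon> subst \<sigma> A"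
proof (induction arbitrary: and \<sigma> \<Delta> and \<sigma> \<Delta> rule: ctx_typing_jeq.inducts)
  case (t_var \<Gamma> n)
  then show ?case by (simp add: wsub_def)
next
  case (t_J \<Gamma> A i a C j d b p)
  have "wsub (up (up \<sigma>)) (path_ctx A a \<Gamma>) (path_ctx (subst \<sigma> A) (subst \<sigma> a) \<Delta>)"
    using t_J by (intro wsub_path) auto
  then show ?case using t_J by (auto simp: subst_inst2 intro!: ctx_typing_jeq.t_J)
next
  case (e_J \<Gamma> A i a C C' j d d' b p p')
  have "wsub (up (up \<sigma>)) (path_ctx A a \<Gamma>) (path_ctx (subst \<sigma> A) (subst \<sigma> a) \<Delta>)"
    using e_J by (intro wsub_path) auto
  then show ?case using e_J by (auto simp: subst_inst2 intro!: ctx_typing_jeq.e_J)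
next
  case (e_J_beta \<Gamma> A i a C j d)
  have "wsub (up (up \<sigma>)) (path_ctx A a \<Gamma>) (path_ctx (subst \<sigma> A) (subst \<sigma> a) \<Delta>)"
    using e_J_beta by (intro wsub_path) auto
  then show ?case using e_J_beta by (auto simp: subst_inst2 intro!: ctx_typing_jeq.e_J_beta)
next
  case (e_eta \<Gamma> A i B j f)
  then show ?case
    using ctx_typing_jeq.e_eta[of \<Delta> "subst \<sigma> A" i "subst (up \<sigma>) B" j "subst \<sigma> f"] wsub_up
    by (fastforce simp: subst_shift1[simplified])
qed (simp_all add: subst_inst subst_htpy, (blast intro: ctx_typing_jeq.intros wsub_up wsubD)+)

lemma typing_inst:
  assumes "A # \<Gamma> \<turnstile> t \<Colon> B" "\<Gamma> \<turnstile> a \<Colon> A"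
  shows "\<Gamma> \<turnstile> inst t a \<Colon> inst B a"
proof -
  have "wsub (case_nat a Var) (A # \<Gamma>) \<Gamma>"
    unfolding wsub_def
  proof (intro conjI allI impI)
    show c: "ctx \<Gamma>" using assms(2) judgement_ctx by blast
    fix n assume n: "n < length (A # \<Gamma>)"
    have "subst (case_nat a Var) (shift (Suc k) u) = shift k u" for k u
      by (simp add: shift_def subst_ren) (simp add: ren_eq_subst comp_def)
    then show "\<Gamma> \<turnstile> case_nat a Var n \<Colon>
        subst (case_nat a Var) (shift (Suc n) ((A # \<Gamma>) ! n))"
      using assms(2) t_var[OF c] n by (cases n) auto
  qed
  from judgement_subst(2)[OF assms(1) this] show ?thesis by (simp add: inst_def)
qed

text \<open>Conversion does no harm: it changes the type of a term and not the term, and the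
  conclusion speaks of the term alone. Injectivity of the type formers with respect to judgemental
  equality is therefore never at stake.\<close>

lemma typing_inversion:
  "ctx \<Gamma> \<Longrightarrow> True"
  "\<Gamma> \<turnstile> t \<Colon> X \<Longrightarrow>
    (\<forall>A B. t = Pi A B \<or> t = Sig A B \<longrightarrow> (\<exists>i j. \<Gamma> \<turnstile> A \<Colon> Univ i \<and> A # \<Gamma> \<turnstile> B \<Colon> Univ j)) \<and>
    (\<forall>A a b. t = Id A a b \<longrightarrow> (\<exists>i. \<Gamma> \<turnstile> A \<Colon> Univ i \<and> \<Gamma> \<turnstile> a \<Colon> A \<and> \<Gamma> \<turnstile> b \<Colon> A))"
  "\<Gamma> \<turnstile> t \<doteq> u \<Colon> A \<Longrightarrow> True"
  by (induction rule: ctx_typing_jeq.inducts) auto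


section \<open>Naturality of expressions\<close>

text \<open>
  A function between expressions need not commute with substitution, so this has to be required where the
  typing rules substitute. In a world \<open>(\<sigma>, m, n)\<close> the substitution \<open>\<sigma>\<close> leads from depth \<open>m\<close> to depth \<open>n\<close>, and
  \<open>rel\<close> says that it carries \<open>e\<close> to \<open>e'\<close>, also below further binders. Naturality of an expression or of a
  function between expressions is then the statement of parametricity for \<open>rel\<close> in the worlds that fix
  the outermost \<open>d\<close> variables; it is proved by one rule for each term former.
\<close>

type_synonym world = "(nat \<Rightarrow> tm) \<times> nat \<times> nat"

definition lift :: "nat \<Rightarrow> world \<Rightarrow> world" where
  "lift j = (\<lambda>(\<sigma>, m, n). ((up ^^ j) \<sigma>, m + j, n + j))"

definition rel :: "world \<Rightarrow> expr \<Rightarrow> expr \<Rightarrow> bool" where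
  "rel = (\<lambda>(\<sigma>, m, n) e e'. \<forall>j. subst ((up ^^ j) \<sigma>) (e (m + j)) = e' (n + j))"

text \<open>Outer variables have the large de Bruijn indices: the outermost \<open>d\<close> of them
  start at \<open>a\<close> in depth \<open>d + a\<close> and at \<open>b\<close> in depth
  \<open>d + b\<close>. What \<open>\<sigma>\<close> does to the \<open>a\<close> inner variables is
  left open.\<close>

definition fixes_outer :: "nat \<Rightarrow> world \<Rightarrow> bool" where
  "fixes_outer d = (\<lambda>(\<sigma>, m, n). \<exists>a b. m = d + a \<and> n = d + b \<and> (\<forall>j. \<sigma> (a + j) = Var (b + j)))"

text \<open>The diagonal of \<open>rel\<close>: \<open>e\<close> depends on the outermost
  \<open>d\<close> variables only, and its reading at a greater depth is the weakening of its
  reading at depth \<open>d\<close>.\<close>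

definition ex :: "nat \<Rightarrow> expr \<Rightarrow> bool" where
  "ex d e \<longleftrightarrow> (\<forall>w. fixes_outer d w \<longrightarrow> rel w e e)"

definition fam :: "nat \<Rightarrow> (expr \<Rightarrow> expr) \<Rightarrow> bool" where
  "fam d B \<longleftrightarrow> (\<forall>w x x'. fixes_outer d w \<longrightarrow> rel w x x' \<longrightarrow> rel w (B x) (B x'))"

definition fam2 :: "nat \<Rightarrow> (expr \<Rightarrow> expr \<Rightarrow> expr) \<Rightarrow> bool" where
  "fam2 d C \<longleftrightarrow> (\<forall>w x x' y y'. fixes_outer d w \<longrightarrow> rel w x x' \<longrightarrow> rel w y y' \<longrightarrow> rel w (C x y) (C x' y'))"

definition rfl :: "expr \<Rightarrow> expr" where
  "rfl a = (\<lambda>d. Refl (a d))"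

lemma up_pow_less: "i < k \<Longrightarrow> (up ^^ k) \<sigma> i = Var i"
  by (induction k arbitrary: i) (auto simp: up_def split: nat.split)

lemma up_pow_add: "(up ^^ k) \<sigma> (k + i) = shift k (\<sigma> i)"
  by (induction k) (auto simp: up_def shift_shift)

lemma relD: "rel (\<sigma>, m, n) e e' \<Longrightarrow> subst \<sigma> (e m) = e' n"
  unfolding rel_def prod.case by (drule spec[of _ 0]) simp

lemma rel_lift: "rel w e e' \<Longrightarrow> rel (lift j w) e e'"
proof (cases w)
  case (fields \<sigma> m n)
  assume r: "rel w e e'"
  have "subst ((up ^^ i) ((up ^^ j) \<sigma>)) (e (m + j + i)) = e' (n + j + i)" for i
  proof -
    have "subst ((up ^^ (i + j)) \<sigma>) (e (m + (i + j))) = e' (n + (i + j))"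
      using r unfolding rel_def fields prod.case by blast
    then show ?thesis by (simp add: funpow_add ac_simps)
  qed
  then show ?thesis by (simp add: rel_def lift_def fields)
qed

lemma fixes_outer_lift: "fixes_outer d w \<Longrightarrow> fixes_outer d (lift j w)"
proof (cases w)
  case (fields \<sigma> m n)
  assume "fixes_outer d w"
  then obtain a b where *: "m = d + a" "n = d + b" "\<sigma> (a + i) = Var (b + i)" for i
    by (auto simp: fields fixes_outer_def)
  have "(up ^^ j) \<sigma> (j + a + i) = Var (j + b + i)" for i
    using up_pow_add[of j \<sigma> "a + i"] * by (simp add: add.assoc)
  then have "m + j = d + (j + a) \<and> n + j = d + (j + b) \<and>
      (\<forall>i. (up ^^ j) \<sigma> (j + a + i) = Var (j + b + i))"
    using * by simp
  then show ?thesis unfolding fields fixes_outer_def lift_def prod.case by blast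
qed

lemma fixes_outer_mono: "fixes_outer d' w \<Longrightarrow> d \<le> d' \<Longrightarrow> fixes_outer d w"
proof (cases w)
  case (fields \<sigma> m n)
  assume "fixes_outer d' w" and "d \<le> d'"
  then obtain a b c where *: "d' = d + c" "m = d' + a" "n = d' + b" "\<sigma> (a + i) = Var (b + i)" for i
    by (auto simp: fields fixes_outer_def le_iff_add)
  have "m = d + (a + c) \<and> n = d + (b + c) \<and> (\<forall>i. \<sigma> (a + c + i) = Var (b + c + i))"
    using * by (simp add: add.assoc)
  then show ?thesis unfolding fields fixes_outer_def prod.case by blast
qed

lemma ex_mono: "ex d e \<Longrightarrow> d \<le> d' \<Longrightarrow> ex d' e"
  using fixes_outer_mono unfolding ex_def by blast

lemma fam_mono: "fam d B \<Longrightarrow> d \<le> d' \<Longrightarrow> fam d' B"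
  using fixes_outer_mono unfolding fam_def by blast

lemma fam2_mono: "fam2 d B \<Longrightarrow> d \<le> d' \<Longrightarrow> fam2 d' B"
  using fixes_outer_mono unfolding fam2_def by blast

lemma ex_rel: "fixes_outer d w \<Longrightarrow> ex d e \<Longrightarrow> rel w e e"
  unfolding ex_def by blast

lemma fam_rel: "fixes_outer d w \<Longrightarrow> fam d B \<Longrightarrow> rel w x x' \<Longrightarrow> rel w (B x) (B x')"
  unfolding fam_def by blast

lemma fam2_rel: "fixes_outer d w \<Longrightarrow> fam2 d B \<Longrightarrow> rel w x x' \<Longrightarrow> rel w y y' \<Longrightarrow> rel w (B x y) (B x' y')"
  unfolding fam2_def by blast

lemma famI: "(\<And>w x x'. fixes_outer d w \<Longrightarrow> rel w x x' \<Longrightarrow> rel w (B x) (B x')) \<Longrightarrow> fam d B"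
  unfolding fam_def by blast

lemma fam2I: "(\<And>w x x' y y'. fixes_outer d w \<Longrightarrow> rel w x x' \<Longrightarrow> rel w y y' \<Longrightarrow> rel w (C x y) (C x' y')) \<Longrightarrow>
    fam2 d C"
  unfolding fam2_def by blast

lemma ex_intro: "(\<And>w. fixes_outer d w \<Longrightarrow> rel w e e) \<Longrightarrow> ex d e"
  unfolding ex_def by blast

text \<open>After \<open>i\<close> further binders the variable in question has index
  \<open>i\<close> on both sides, and \<open>up\<close> applied \<open>Suc j + i\<close> times
  leaves this index alone.\<close>

lemma rel_var: "rel (lift (Suc j) (\<sigma>, m, n)) (\<lambda>e. Var (e - Suc (m + j))) (\<lambda>e. Var (e - Suc (n + j)))"
  unfolding rel_def lift_def
proof (clarsimp simp del: funpow.simps)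
  fix i
  have "(up ^^ i) ((up ^^ Suc j) \<sigma>) i = Var i"
    using up_pow_add[of i "(up ^^ Suc j) \<sigma>" 0] up_pow_less[of 0 "Suc j" \<sigma>] by simp
  then show "(up ^^ i) ((up ^^ Suc j) \<sigma>) i = Var i" .
qed

text \<open>Parametricity is used at a single argument, the freshly bound variable, which
  \<open>rel_var\<close> relates to itself across the two depths.\<close>

lemma rel_bind:
  assumes "\<And>j x x'. rel (lift (Suc j) w) x x' \<Longrightarrow> rel (lift (Suc j) w) (B x) (B' x')"
  shows "case w of (\<sigma>, m, n) \<Rightarrow> \<forall>j. subst ((up ^^ Suc j) \<sigma>) (bind B (m + j)) = bind B' (n + j)"
proof (cases w)
  case (fields \<sigma> m n)
  have "subst ((up ^^ Suc j) \<sigma>) (bind B (m + j)) = bind B' (n + j)" for j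
  proof -
    have "rel (lift (Suc j) w) (B (\<lambda>e. Var (e - Suc (m + j)))) (B' (\<lambda>e. Var (e - Suc (n + j))))"
      unfolding fields by (intro assms[unfolded fields] rel_var)
    then show ?thesis
      unfolding lift_def fields bind_def prod.case by (drule_tac relD) simp
  qed
  then show ?thesis by (simp add: fields del: funpow.simps)
qed

section \<open>Closure of the relation under the term formers\<close>

lemma rel_univ: "rel w (univ l) (univ l)"
  by (cases w) (auto simp: rel_def univ_def)

lemma rel_app: "rel w f f' \<Longrightarrow> rel w a a' \<Longrightarrow> rel w (f \<cdot> a) (f' \<cdot> a')"
  by (cases w) (auto simp: rel_def app_def)

lemma rel_pair: "rel w a a' \<Longrightarrow> rel w b b' \<Longrightarrow> rel w (pair a b) (pair a' b')"
  by (cases w) (auto simp: rel_def pair_def)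

lemma rel_pr1: "rel w a a' \<Longrightarrow> rel w (pr1 a) (pr1 a')"
  by (cases w) (auto simp: rel_def pr1_def)

lemma rel_pr2: "rel w a a' \<Longrightarrow> rel w (pr2 a) (pr2 a')"
  by (cases w) (auto simp: rel_def pr2_def)

lemma rel_rfl: "rel w a a' \<Longrightarrow> rel w (rfl a) (rfl a')"
  by (cases w) (auto simp: rel_def rfl_def)

lemma rel_id: "rel w A A' \<Longrightarrow> rel w a a' \<Longrightarrow> rel w b b' \<Longrightarrow> rel w (a =\<^bsub>A\<^esub> b) (a' =\<^bsub>A'\<^esub> b')"
  by (cases w) (auto simp: rel_def id_ty_def)

lemma rel_pi:
  assumes "rel w A A'" "\<And>j x x'. rel (lift (Suc j) w) x x' \<Longrightarrow> rel (lift (Suc j) w) (B x) (B' x')"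
  shows "rel w (pi_ty A B) (pi_ty A' B')"
  using assms(1) rel_bind[OF assms(2)] by (cases w) (auto simp: rel_def pi_ty_def)

lemma rel_sig:
  assumes "rel w A A'" "\<And>j x x'. rel (lift (Suc j) w) x x' \<Longrightarrow> rel (lift (Suc j) w) (B x) (B' x')"
  shows "rel w (sig_ty A B) (sig_ty A' B')"
  using assms(1) rel_bind[OF assms(2)] by (cases w) (auto simp: rel_def sig_ty_def)

lemma rel_lam:
  assumes "rel w A A'" "\<And>j x x'. rel (lift (Suc j) w) x x' \<Longrightarrow> rel (lift (Suc j) w) (B x) (B' x')"
  shows "rel w (lam A B) (lam A' B')"
  using assms(1) rel_bind[OF assms(2)] by (cases w) (auto simp: rel_def lam_def)

lemma rel_arr: "rel w A A' \<Longrightarrow> rel w B B' \<Longrightarrow> rel w (A \<rightarrow> B) (A' \<rightarrow> B')"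
  unfolding arr_def by (intro rel_pi rel_lift)

lemma rel_prod: "rel w A A' \<Longrightarrow> rel w B B' \<Longrightarrow> rel w (A \<otimes> B) (A' \<otimes> B')"
  unfolding prod_ty_def by (intro rel_sig rel_lift)

lemmas par = famI fam2I rel_pi rel_sig rel_lam rel_arr rel_prod rel_id rel_app rel_pair rel_pr1 rel_pr2
  rel_rfl rel_univ

text \<open>
  To be tried last and in this order: they descend to an outer world, which loses the variables bound
  in between.
\<close>

lemmas par_leaf = fixes_outer_lift ex_rel rel_lift

text \<open>Weakening by \<open>n - d\<close> variables is itself a world, from depth
  \<open>d\<close> to depth \<open>n\<close>, and it fixes the outermost \<open>d\<close>
  variables.\<close>

lemma exD: "ex d e \<Longrightarrow> d \<le> n \<Longrightarrow> e n = shift (n - d) (e d)"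
proof -
  assume *: "ex d e" "d \<le> n"
  have "fixes_outer d (\<lambda>i. Var (n - d + i), d, n)"
    using *(2) by (auto simp: fixes_outer_def le_iff_add)
  then have "rel (\<lambda>i. Var (n - d + i), d, n) e e" using * unfolding ex_def by blast
  then show "e n = shift (n - d) (e d)"
    unfolding shift_def ren_eq_subst comp_def by (drule_tac relD) simp
qed

lemma ex_add: "ex d e \<Longrightarrow> e (d + j) = shift j (e d)"
  using exD[of d e "d + j"] by simp

lemma ex_shift: "ex d (\<lambda>n. shift (n - d) t)"
proof (rule ex_intro)
  fix w assume w: "fixes_outer d w"
  obtain \<sigma> m n where f: "w = (\<sigma>, m, n)" by (cases w)
  obtain a b where *: "m = d + a" "n = d + b" "\<sigma> (a + i) = Var (b + i)" for i
    using w by (auto simp: f fixes_outer_def)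
  have "(up ^^ j) \<sigma> (a + j + i) = Var (b + j + i)" for i j
    using up_pow_add[of j \<sigma> "a + i"] * by (simp add: ac_simps)
  then have "subst ((up ^^ j) \<sigma>) (shift (a + j) t) = shift (b + j) t" for j
    unfolding shift_def subst_ren by (simp add: comp_def ren_eq_subst)
  then show "rel w (\<lambda>n. shift (n - d) t) (\<lambda>n. shift (n - d) t)" by (simp add: rel_def f * add.assoc)
qed

lemma ex_var: "ex (Suc d) (\<lambda>e. Var (e - Suc d))"
  using ex_shift[of "Suc d" "Var 0"] by simp

lemma ex_fam: "fam d B \<Longrightarrow> ex d a \<Longrightarrow> ex d (B a)"
  by (auto simp: fam_def ex_def)

lemma ex_pi: "ex d A \<Longrightarrow> fam d B \<Longrightarrow> ex d (pi_ty A B)"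
  by (rule ex_intro, rule rel_pi) (auto intro: ex_rel fam_rel fixes_outer_lift)

lemma ex_sig: "ex d A \<Longrightarrow> fam d B \<Longrightarrow> ex d (sig_ty A B)"
  by (rule ex_intro, rule rel_sig) (auto intro: ex_rel fam_rel fixes_outer_lift)

lemma ex_lam: "ex d A \<Longrightarrow> fam d B \<Longrightarrow> ex d (lam A B)"
  by (rule ex_intro, rule rel_lam) (auto intro: ex_rel fam_rel fixes_outer_lift)

lemma ex_id: "ex d A \<Longrightarrow> ex d a \<Longrightarrow> ex d b \<Longrightarrow> ex d (a =\<^bsub>A\<^esub> b)"
  by (auto simp: ex_def intro: rel_id)

lemma ex_idD: "ex d (a =\<^bsub>A\<^esub> b) \<Longrightarrow> ex d A \<and> ex d a \<and> ex d b"
  by (auto simp: split_paired_all ex_def rel_def id_ty_def)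

lemma ex_piD: "ex d (pi_ty A B) \<Longrightarrow> ex d A"
  by (auto simp: ex_def rel_def pi_ty_def)

lemma ex_sigD: "ex d (sig_ty A B) \<Longrightarrow> ex d A"
  by (auto simp: ex_def rel_def sig_ty_def)

text \<open>This is what naturality is for: the typing rules substitute into the term
  \<open>bind B d\<close>, while proofs apply the HOL function \<open>B\<close>. The substitution of
  \<open>a d\<close> for the last variable is a world from depth \<open>Suc d\<close> to depth
  \<open>d\<close>.\<close>

lemma inst_bind:
  assumes "fam d B" "ex d a"
  shows "inst (bind B d) (a d) = B a d"
proof -
  let ?w = "(case_nat (a d) Var, Suc d, d)"
  have "fixes_outer d ?w" by (auto simp: fixes_outer_def)
  moreover have "rel ?w (\<lambda>e. Var (e - Suc d)) a"
    using up_pow_add[of _ "case_nat (a d) Var" 0] by (simp add: rel_def ex_add[OF assms(2)])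
  ultimately have "rel ?w (B (\<lambda>e. Var (e - Suc d))) (B a)" using assms unfolding fam_def by blast
  then show ?thesis unfolding inst_def bind_def by (rule relD)
qed

lemma inst2_bind:
  assumes "fam2 d C" "ex d b" "ex d p"
  shows "inst2 (C (\<lambda>e. Var (e - Suc d)) (\<lambda>e. Var (e - Suc (Suc d))) (Suc (Suc d))) (b d) (p d) = C b p d"
proof -
  let ?w = "(case_nat (p d) (case_nat (b d) Var), Suc (Suc d), d)"
  have "fixes_outer d ?w" by (auto simp: fixes_outer_def)
  moreover have "rel ?w (\<lambda>e. Var (e - Suc d)) b"
    using up_pow_add[of _ "case_nat (p d) (case_nat (b d) Var)" 1] by (simp add: rel_def ex_add[OF assms(2)])
  moreover have "rel ?w (\<lambda>e. Var (e - Suc (Suc d))) p"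
    using up_pow_add[of _ "case_nat (p d) (case_nat (b d) Var)" 0] by (simp add: rel_def ex_add[OF assms(3)])
  ultimately have "rel ?w (C (\<lambda>e. Var (e - Suc d)) (\<lambda>e. Var (e - Suc (Suc d)))) (C b p)"
    using assms unfolding fam2_def by blast
  then show ?thesis unfolding inst2_def by (rule relD)
qed


section \<open>Types, elements and truth in a context\<close>

text \<open>The level is recorded separately from \<open>ty\<close> because freeness speaks of
  algebras in one fixed universe and the hierarchy is not cumulative.\<close>

definition tp :: "tm list \<Rightarrow> nat \<Rightarrow> expr \<Rightarrow> bool" where
  "tp \<Gamma> i A \<longleftrightarrow> ex (length \<Gamma>) A \<and> \<Gamma> \<turnstile> A (length \<Gamma>) \<Colon> Univ i"

definition ty :: "tm list \<Rightarrow> expr \<Rightarrow> bool" where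
  "ty \<Gamma> A \<longleftrightarrow> (\<exists>i. tp \<Gamma> i A)"

definition el :: "tm list \<Rightarrow> expr \<Rightarrow> expr \<Rightarrow> bool" where
  "el \<Gamma> A t \<longleftrightarrow> ty \<Gamma> A \<and> ex (length \<Gamma>) t \<and> \<Gamma> \<turnstile> t (length \<Gamma>) \<Colon> A (length \<Gamma>)"

definition tr :: "tm list \<Rightarrow> expr \<Rightarrow> bool" where
  "tr \<Gamma> P \<longleftrightarrow> (\<exists>t. el \<Gamma> P t)"

definition ext :: "tm list \<Rightarrow> tm list \<Rightarrow> bool" where
  "ext \<Gamma> \<Delta> \<longleftrightarrow> ctx \<Delta> \<and> (\<exists>\<Theta>. \<Delta> = \<Theta> @ \<Gamma>)"

lemma ext_length: "ext \<Gamma> \<Delta> \<Longrightarrow> length \<Gamma> \<le> length \<Delta>"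
  by (auto simp: ext_def)

lemma ext_trans: "ext \<Gamma> \<Delta> \<Longrightarrow> ext \<Delta> \<Theta> \<Longrightarrow> ext \<Gamma> \<Theta>"
  by (auto simp: ext_def)

lemma ty_ctx: "ty \<Gamma> A \<Longrightarrow> ctx \<Gamma>"
  using judgement_ctx by (auto simp: ty_def tp_def)

lemma ext_refl: "ty \<Gamma> A \<Longrightarrow> ext \<Gamma> \<Gamma>"
  using ty_ctx by (auto simp: ext_def)

lemma ext_typing:
  assumes "ext \<Gamma> \<Delta>" "\<Gamma> \<turnstile> t (length \<Gamma>) \<Colon> A (length \<Gamma>)" "ex (length \<Gamma>) t" "ex (length \<Gamma>) A"
  shows "\<Delta> \<turnstile> t (length \<Delta>) \<Colon> A (length \<Delta>)"
proof -
  obtain \<Theta> where "\<Delta> = \<Theta> @ \<Gamma>" "ctx (\<Theta> @ \<Gamma>)" using assms by (auto simp: ext_def)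
  then show ?thesis
    using ext_weakening[OF assms(2)] exD[OF assms(3), of "length \<Delta>"] exD[OF assms(4), of "length \<Delta>"] by simp
qed

lemma ex_univ: "ex d (univ l)"
  by (rule ex_intro, rule rel_univ)

lemma tp_ext:
  assumes "ext \<Gamma> \<Delta>" "tp \<Gamma> i A"
  shows "tp \<Delta> i A"
  using ext_typing[OF assms(1), of A "univ i"] ex_mono[OF _ ext_length[OF assms(1)]] assms(2) ex_univ
  unfolding tp_def univ_def by blast

lemma ty_ext: "ext \<Gamma> \<Delta> \<Longrightarrow> ty \<Gamma> A \<Longrightarrow> ty \<Delta> A"
  unfolding ty_def using tp_ext by blast

lemma el_ext: "ext \<Gamma> \<Delta> \<Longrightarrow> el \<Gamma> A t \<Longrightarrow> el \<Delta> A t"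
  unfolding el_def using ext_typing ex_mono[OF _ ext_length] ty_ext unfolding ty_def tp_def by blast

lemma tr_ext: "ext \<Gamma> \<Delta> \<Longrightarrow> tr \<Gamma> A \<Longrightarrow> tr \<Delta> A"
  unfolding tr_def using el_ext by blast

lemma fam_ext: "ext \<Gamma> \<Delta> \<Longrightarrow> fam (length \<Gamma>) B \<Longrightarrow> fam (length \<Delta>) B"
  using ext_length fam_mono by blast

lemma fam2_ext: "ext \<Gamma> \<Delta> \<Longrightarrow> fam2 (length \<Gamma>) B \<Longrightarrow> fam2 (length \<Delta>) B"
  using ext_length fam2_mono by blast

lemma ex_ext: "ext \<Gamma> \<Delta> \<Longrightarrow> ex (length \<Gamma>) B \<Longrightarrow> ex (length \<Delta>) B"
  using ext_length ex_mono by blast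

lemmas mono = tp_ext ty_ext el_ext tr_ext fam_ext fam2_ext ex_ext

lemma tp_ty: "tp \<Gamma> i A \<Longrightarrow> ty \<Gamma> A"
  by (auto simp: ty_def)

lemma el_ty: "el \<Gamma> A t \<Longrightarrow> ty \<Gamma> A"
  by (auto simp: el_def)

lemma tr_ty: "tr \<Gamma> A \<Longrightarrow> ty \<Gamma> A"
  by (auto simp: el_def tr_def)

lemma el_tr: "el \<Gamma> A t \<Longrightarrow> tr \<Gamma> A"
  by (auto simp: tr_def)

lemma tp_ex: "tp \<Gamma> i A \<Longrightarrow> ex (length \<Gamma>) A"
  by (auto simp: tp_def)

lemma ty_ex: "ty \<Gamma> A \<Longrightarrow> ex (length \<Gamma>) A"
  by (auto simp: ty_def tp_def)

lemma el_ex: "el \<Gamma> A t \<Longrightarrow> ex (length \<Gamma>) t"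
  by (auto simp: el_def)

lemma el_ex_ty: "el \<Gamma> A t \<Longrightarrow> ex (length \<Gamma>) A"
  by (auto simp: el_def ty_ex)

text \<open>A derivation yields a bare term in one context. Reading it at greater depths through
  \<open>shift\<close> turns it into a natural expression, as \<open>el\<close> requires.\<close>

lemma trI: "ty \<Gamma> P \<Longrightarrow> \<Gamma> \<turnstile> t \<Colon> P (length \<Gamma>) \<Longrightarrow> tr \<Gamma> P"
  using ex_shift[of "length \<Gamma>" t]
  by (auto simp: tr_def el_def intro!: exI[of _ "\<lambda>n. shift (n - length \<Gamma>) t"])

lemma tyI: "ex (length \<Gamma>) A \<Longrightarrow> \<Gamma> \<turnstile> A (length \<Gamma>) \<Colon> Univ i \<Longrightarrow> ty \<Gamma> A"
  by (auto simp: ty_def tp_def)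

lemma tyD: "ty \<Gamma> A \<Longrightarrow> \<exists>i. \<Gamma> \<turnstile> A (length \<Gamma>) \<Colon> Univ i"
  by (auto simp: ty_def tp_def)

text \<open>Hypotheses that quantify over all extensions and all elements are discharged by using
  them at this one extension, with the new variable as the element.\<close>

lemma generic_element:
  assumes "ty \<Gamma> A"
  shows "ext \<Gamma> (A (length \<Gamma>) # \<Gamma>)"
    "el (A (length \<Gamma>) # \<Gamma>) A (\<lambda>e. Var (e - Suc (length \<Gamma>)))"
proof -
  obtain i where i: "\<Gamma> \<turnstile> A (length \<Gamma>) \<Colon> Univ i" using assms tyD by blast
  then have c: "ctx (A (length \<Gamma>) # \<Gamma>)" using judgement_ctx by (auto intro: ctx_cons)
  then show e: "ext \<Gamma> (A (length \<Gamma>) # \<Gamma>)" by (auto simp: ext_def)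
  have "A (Suc (length \<Gamma>)) = shift 1 (A (length \<Gamma>))"
    using exD[of "length \<Gamma>" A "Suc (length \<Gamma>)"] ty_ex[OF assms] by simp
  then show "el (A (length \<Gamma>) # \<Gamma>) A (\<lambda>e. Var (e - Suc (length \<Gamma>)))"
    using ty_ext[OF e assms] ex_var t_var[OF c, of 0] by (auto simp: el_def)
qed

lemma tp_univ: "ctx \<Gamma> \<Longrightarrow> tp \<Gamma> (Suc l) (univ l)"
  using rel_univ by (auto simp: tp_def univ_def ex_def intro: t_univ)

lemma ty_univ: "ctx \<Gamma> \<Longrightarrow> ty \<Gamma> (univ l)"
  using tp_univ tp_ty by blast

text \<open>Universes are in Russell style, so their elements are types with no decoding in
  between.\<close>

lemma el_univ: "el \<Gamma> (univ l) A \<longleftrightarrow> tp \<Gamma> l A"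
  using ty_univ judgement_ctx by (auto simp: el_def tp_def) (auto simp: univ_def)

context
  fixes \<Gamma> A B
  assumes A: "ty \<Gamma> A" and B: "fam (length \<Gamma>) B"
begin

lemma ty_binder:
  assumes "\<And>\<Delta> x. ext \<Gamma> \<Delta> \<Longrightarrow> el \<Delta> A x \<Longrightarrow> ty \<Delta> (B x)"
  shows "\<exists>j. A (length \<Gamma>) # \<Gamma> \<turnstile> bind B (length \<Gamma>) \<Colon> Univ j"
  using assms[OF generic_element[OF A]] by (auto simp: ty_def tp_def bind_def)

lemma tp_binder:
  assumes "\<And>\<Delta> x. ext \<Gamma> \<Delta> \<Longrightarrow> el \<Delta> A x \<Longrightarrow> tp \<Delta> j (B x)"
  shows "A (length \<Gamma>) # \<Gamma> \<turnstile> bind B (length \<Gamma>) \<Colon> Univ j"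
  using assms[OF generic_element[OF A]] by (auto simp: tp_def bind_def)

lemma ty_pi: "(\<And>\<Delta> x. ext \<Gamma> \<Delta> \<Longrightarrow> el \<Delta> A x \<Longrightarrow> ty \<Delta> (B x)) \<Longrightarrow> ty \<Gamma> (pi_ty A B)"
  using ty_binder tyD[OF A] ex_pi[OF ty_ex[OF A] B] t_pi by (fastforce intro: tyI simp: pi_ty_def)

lemma ty_sig: "(\<And>\<Delta> x. ext \<Gamma> \<Delta> \<Longrightarrow> el \<Delta> A x \<Longrightarrow> ty \<Delta> (B x)) \<Longrightarrow> ty \<Gamma> (sig_ty A B)"
  using ty_binder tyD[OF A] ex_sig[OF ty_ex[OF A] B] t_sig by (fastforce intro: tyI simp: sig_ty_def)

lemma tp_pi:
  "tp \<Gamma> i A \<Longrightarrow> (\<And>\<Delta> x. ext \<Gamma> \<Delta> \<Longrightarrow> el \<Delta> A x \<Longrightarrow> tp \<Delta> j (B x)) \<Longrightarrow> tp \<Gamma> (max i j) (pi_ty A B)"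
  using tp_binder ex_pi[OF ty_ex[OF A] B] t_pi by (fastforce simp: pi_ty_def tp_def)

lemma tp_sig:
  "tp \<Gamma> i A \<Longrightarrow> (\<And>\<Delta> x. ext \<Gamma> \<Delta> \<Longrightarrow> el \<Delta> A x \<Longrightarrow> tp \<Delta> j (B x)) \<Longrightarrow> tp \<Gamma> (max i j) (sig_ty A B)"
  using tp_binder ex_sig[OF ty_ex[OF A] B] t_sig by (fastforce simp: sig_ty_def tp_def)

lemma el_lam:
  assumes "fam (length \<Gamma>) t" and t: "\<And>\<Delta> x. ext \<Gamma> \<Delta> \<Longrightarrow> el \<Delta> A x \<Longrightarrow> el \<Delta> (B x) (t x)"
  shows "el \<Gamma> (pi_ty A B) (lam A t)"
proof -
  have "A (length \<Gamma>) # \<Gamma> \<turnstile> bind t (length \<Gamma>) \<Colon> bind B (length \<Gamma>)"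
    using t[OF generic_element[OF A]] by (auto simp: el_def bind_def)
  moreover obtain j where "A (length \<Gamma>) # \<Gamma> \<turnstile> bind B (length \<Gamma>) \<Colon> Univ j"
    using ty_binder el_ty[OF t] by blast
  ultimately show ?thesis
    using tyD[OF A] ty_pi[OF el_ty[OF t]] ex_lam[OF ty_ex[OF A] assms(1)]
    by (auto simp: el_def pi_ty_def lam_def intro: t_lam)
qed

text \<open>In contrast to \<open>el_lam\<close>, the elements of \<open>B x\<close> may be chosen
  separately in each extension, without any naturality: only the term found over the generic element
  is abstracted.\<close>

lemma tr_piI:
  assumes t: "\<And>\<Delta> x. ext \<Gamma> \<Delta> \<Longrightarrow> el \<Delta> A x \<Longrightarrow> tr \<Delta> (B x)"
  shows "tr \<Gamma> (pi_ty A B)"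
proof -
  obtain t where "A (length \<Gamma>) # \<Gamma> \<turnstile> t \<Colon> bind B (length \<Gamma>)"
    using t[OF generic_element[OF A]] by (auto simp: tr_def el_def bind_def)
  moreover obtain j where "A (length \<Gamma>) # \<Gamma> \<turnstile> bind B (length \<Gamma>) \<Colon> Univ j"
    using ty_binder tr_ty[OF t] by blast
  moreover obtain i where "\<Gamma> \<turnstile> A (length \<Gamma>) \<Colon> Univ i" using tyD[OF A] by blast
  ultimately have "\<Gamma> \<turnstile> Lam (A (length \<Gamma>)) t \<Colon> pi_ty A B (length \<Gamma>)"
    by (auto simp: pi_ty_def intro: t_lam)
  then show ?thesis using trI ty_pi[OF tr_ty[OF t]] by blast
qed

end

section \<open>Inversion, elimination and computation rules\<close>

lemma pi_inversion:
  assumes "ty \<Gamma> (pi_ty A B)"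
  shows "ty \<Gamma> A" "\<exists>j. A (length \<Gamma>) # \<Gamma> \<turnstile> bind B (length \<Gamma>) \<Colon> Univ j"
proof -
  from assms obtain i where "\<Gamma> \<turnstile> Pi (A (length \<Gamma>)) (bind B (length \<Gamma>)) \<Colon> Univ i"
    by (auto simp: ty_def tp_def pi_ty_def)
  from typing_inversion(2)[OF this]
  show "\<exists>j. A (length \<Gamma>) # \<Gamma> \<turnstile> bind B (length \<Gamma>) \<Colon> Univ j" "ty \<Gamma> A"
    using ex_piD[OF ty_ex[OF assms]] by (auto intro: tyI)
qed

lemma sig_inversion:
  assumes "ty \<Gamma> (sig_ty A B)"
  shows "ty \<Gamma> A" "\<exists>j. A (length \<Gamma>) # \<Gamma> \<turnstile> bind B (length \<Gamma>) \<Colon> Univ j"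
proof -
  from assms obtain i where "\<Gamma> \<turnstile> Sig (A (length \<Gamma>)) (bind B (length \<Gamma>)) \<Colon> Univ i"
    by (auto simp: ty_def tp_def sig_ty_def)
  from typing_inversion(2)[OF this]
  show "\<exists>j. A (length \<Gamma>) # \<Gamma> \<turnstile> bind B (length \<Gamma>) \<Colon> Univ j" "ty \<Gamma> A"
    using ex_sigD[OF ty_ex[OF assms]] by (auto intro: tyI)
qed

lemma id_inversion:
  assumes "ty \<Gamma> (a =\<^bsub>A\<^esub> b)"
  shows "ty \<Gamma> A" "el \<Gamma> A a" "el \<Gamma> A b"
proof -
  from assms obtain i where "\<Gamma> \<turnstile> Id (A (length \<Gamma>)) (a (length \<Gamma>)) (b (length \<Gamma>)) \<Colon> Univ i"
    by (auto simp: ty_def tp_def id_ty_def)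
  from typing_inversion(2)[OF this]
  show "ty \<Gamma> A" "el \<Gamma> A a" "el \<Gamma> A b"
    using ex_idD[OF ty_ex[OF assms]] by (auto simp: el_def intro: tyI)
qed

lemma ty_inst:
  assumes "\<exists>j. A (length \<Gamma>) # \<Gamma> \<turnstile> bind B (length \<Gamma>) \<Colon> Univ j" "fam (length \<Gamma>) B" "el \<Gamma> A a"
  shows "ty \<Gamma> (B a)"
proof -
  have a: "\<Gamma> \<turnstile> a (length \<Gamma>) \<Colon> A (length \<Gamma>)" using assms(3) by (auto simp: el_def)
  obtain j where "A (length \<Gamma>) # \<Gamma> \<turnstile> bind B (length \<Gamma>) \<Colon> Univ j" using assms(1) by blast
  from typing_inst[OF this a] have "\<Gamma> \<turnstile> B a (length \<Gamma>) \<Colon> Univ j"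
    using inst_bind[OF assms(2) el_ex[OF assms(3)]] by (simp add: inst_def)
  then show ?thesis using ex_fam[OF assms(2) el_ex[OF assms(3)]] by (auto intro: tyI)
qed

lemma el_app:
  assumes "el \<Gamma> (pi_ty A B) f" "fam (length \<Gamma>) B" "el \<Gamma> A a"
  shows "el \<Gamma> (B a) (f \<cdot> a)"
proof -
  note i = pi_inversion[OF el_ty[OF assms(1)]]
  obtain k where "\<Gamma> \<turnstile> A (length \<Gamma>) \<Colon> Univ k" using i(1) tyD by blast
  moreover obtain j where "A (length \<Gamma>) # \<Gamma> \<turnstile> bind B (length \<Gamma>) \<Colon> Univ j" using i(2) by blast
  ultimately have "\<Gamma> \<turnstile> (f \<cdot> a) (length \<Gamma>) \<Colon> B a (length \<Gamma>)"
    using assms t_app inst_bind[OF assms(2) el_ex[OF assms(3)]]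
    by (fastforce simp: el_def app_def pi_ty_def)
  moreover have "ex (length \<Gamma>) (f \<cdot> a)" using assms by (auto simp: el_def ex_def intro: rel_app)
  ultimately show ?thesis using ty_inst[OF i(2) assms(2,3)] by (auto simp: el_def)
qed

lemma tr_piD: "tr \<Gamma> (pi_ty A B) \<Longrightarrow> fam (length \<Gamma>) B \<Longrightarrow> el \<Gamma> A a \<Longrightarrow> tr \<Gamma> (B a)"
  unfolding tr_def using el_app by blast

lemma el_pair:
  assumes "el \<Gamma> A a" "el \<Gamma> (B a) b" "fam (length \<Gamma>) B" "ty \<Gamma> (sig_ty A B)"
  shows "el \<Gamma> (sig_ty A B) (pair a b)"
proof -
  note i = sig_inversion[OF assms(4)]
  obtain k where "\<Gamma> \<turnstile> A (length \<Gamma>) \<Colon> Univ k" using i(1) tyD by blast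
  moreover obtain j where "A (length \<Gamma>) # \<Gamma> \<turnstile> bind B (length \<Gamma>) \<Colon> Univ j" using i(2) by blast
  ultimately have "\<Gamma> \<turnstile> pair a b (length \<Gamma>) \<Colon> sig_ty A B (length \<Gamma>)"
    using assms t_pair inst_bind[OF assms(3) el_ex[OF assms(1)]]
    by (fastforce simp: el_def pair_def sig_ty_def)
  moreover have "ex (length \<Gamma>) (pair a b)" using assms by (auto simp: el_def ex_def intro: rel_pair)
  ultimately show ?thesis using assms(4) by (auto simp: el_def)
qed

lemma el_pr1:
  assumes "el \<Gamma> (sig_ty A B) p"
  shows "el \<Gamma> A (pr1 p)"
proof -
  note i = sig_inversion[OF el_ty[OF assms]]
  have "ex (length \<Gamma>) (pr1 p)" using assms by (auto simp: el_def ex_def intro: rel_pr1)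
  then show ?thesis using assms i tyD[OF i(1)] by (auto simp: el_def pr1_def sig_ty_def intro: t_fst)
qed

lemma el_pr2:
  assumes "el \<Gamma> (sig_ty A B) p" "fam (length \<Gamma>) B"
  shows "el \<Gamma> (B (pr1 p)) (pr2 p)"
proof -
  note i = sig_inversion[OF el_ty[OF assms(1)]]
  obtain k where "\<Gamma> \<turnstile> A (length \<Gamma>) \<Colon> Univ k" using i(1) tyD by blast
  moreover obtain j where "A (length \<Gamma>) # \<Gamma> \<turnstile> bind B (length \<Gamma>) \<Colon> Univ j" using i(2) by blast
  ultimately have "\<Gamma> \<turnstile> pr2 p (length \<Gamma>) \<Colon> B (pr1 p) (length \<Gamma>)"
    using assms t_snd inst_bind[OF assms(2) el_ex[OF el_pr1[OF assms(1)]]]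
    by (fastforce simp: el_def pr2_def pr1_def sig_ty_def)
  moreover have "ex (length \<Gamma>) (pr2 p)" using assms by (auto simp: el_def ex_def intro: rel_pr2)
  ultimately show ?thesis using ty_inst[OF i(2) assms(2) el_pr1[OF assms(1)]] by (auto simp: el_def)
qed

lemma ty_id: "el \<Gamma> A a \<Longrightarrow> el \<Gamma> A b \<Longrightarrow> ty \<Gamma> (a =\<^bsub>A\<^esub> b)"
  using ex_id[of "length \<Gamma>" A a b] tyD[of \<Gamma> A]
  by (auto simp: el_def ty_ex id_ty_def intro!: tyI t_id)

lemma tp_id: "tp \<Gamma> i A \<Longrightarrow> el \<Gamma> A a \<Longrightarrow> el \<Gamma> A b \<Longrightarrow> tp \<Gamma> i (a =\<^bsub>A\<^esub> b)"
  using ex_id[of "length \<Gamma>" A a b]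
  by (auto simp: el_def tp_def id_ty_def intro!: t_id)

lemma el_rfl: "el \<Gamma> A a \<Longrightarrow> el \<Gamma> (a =\<^bsub>A\<^esub> a) (rfl a)"
  using ty_id[of \<Gamma> A a a] tyD[of \<Gamma> A]
  by (auto simp: el_def ex_def id_ty_def rfl_def[of a] intro: t_refl) (auto simp flip: rfl_def intro: rel_rfl)

lemma id_refl: "el \<Gamma> A a \<Longrightarrow> tr \<Gamma> (a =\<^bsub>A\<^esub> a)"
  using el_rfl el_tr by blast

text \<open>Reflexivity at \<open>a\<close>, retyped along the congruence rule of \<open>Id\<close>
  in its last argument.\<close>

lemma id_jeq:
  assumes "el \<Gamma> A a" "el \<Gamma> A b" "\<Gamma> \<turnstile> a (length \<Gamma>) \<doteq> b (length \<Gamma>) \<Colon> A (length \<Gamma>)"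
  shows "tr \<Gamma> (a =\<^bsub>A\<^esub> b)"
proof -
  obtain i where i: "\<Gamma> \<turnstile> A (length \<Gamma>) \<Colon> Univ i" using el_ty[OF assms(1)] tyD by blast
  have a: "\<Gamma> \<turnstile> a (length \<Gamma>) \<Colon> A (length \<Gamma>)" using assms(1) by (auto simp: el_def)
  show ?thesis
    by (rule trI[OF ty_id[OF assms(1,2)]], unfold id_ty_def, rule t_conv[OF t_refl[OF i a]])
      (rule e_id[OF e_refl[OF i] e_refl[OF a] assms(3)])
qed

lemma tr_J:
  assumes A: "el \<Gamma> A a" and C: "fam2 (length \<Gamma>) C"
    and ty: "\<And>\<Delta> x p. ext \<Gamma> \<Delta> \<Longrightarrow> el \<Delta> A x \<Longrightarrow> el \<Delta> (a =\<^bsub>A\<^esub> x) p \<Longrightarrow> ty \<Delta> (C x p)"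
    and d: "tr \<Gamma> (C a (rfl a))" and b: "el \<Gamma> A b" and p: "el \<Gamma> (a =\<^bsub>A\<^esub> b) p"
  shows "tr \<Gamma> (C b p)"
proof -
  \<comment> \<open>The end point is introduced at depth \<open>?d\<close> and the path at depth
    \<open>Suc ?d\<close>, which matches the order of the entries of \<open>path_ctx\<close> and
    gives them indices 1 and 0 in the motive.\<close>
  let ?d = "length \<Gamma>" let ?x = "\<lambda>e. Var (e - Suc ?d)" let ?\<Delta> = "A ?d # \<Gamma>"
  let ?p = "\<lambda>e. Var (e - Suc (Suc ?d))" let ?P = "a =\<^bsub>A\<^esub> ?x"
  note g = generic_element[OF el_ty[OF A]]
  have P: "ty ?\<Delta> ?P" by (rule ty_id[OF el_ext[OF g(1) A] g(2)])
  note g' = generic_element[OF P, simplified]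
  have "path_ctx (A ?d) (a ?d) \<Gamma> = ?P (Suc ?d) # ?\<Delta>"
    using exD[OF el_ex[OF A], of "Suc ?d"] exD[OF el_ex_ty[OF A], of "Suc ?d"]
    by (simp add: path_ctx_def id_ty_def)
  moreover have "ty (?P (Suc ?d) # ?\<Delta>) (C ?x ?p)"
    using ty[OF ext_trans[OF g(1) g'(1)] el_ext[OF g'(1) g(2)] g'(2)] .
  then obtain j where "?P (Suc ?d) # ?\<Delta> \<turnstile> C ?x ?p (Suc (Suc ?d)) \<Colon> Univ j"
    by (auto simp: ty_def tp_def)
  ultimately have c: "path_ctx (A ?d) (a ?d) \<Gamma> \<turnstile> C ?x ?p (Suc (Suc ?d)) \<Colon> Univ j" by simp
  obtain t where t: "\<Gamma> \<turnstile> t \<Colon> C a (rfl a) ?d" using d by (auto simp: tr_def el_def)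
  obtain i where i: "\<Gamma> \<turnstile> A ?d \<Colon> Univ i" using el_ty[OF A] tyD by blast
  have "\<Gamma> \<turnstile> J (C ?x ?p (Suc (Suc ?d))) t (p ?d) \<Colon> inst2 (C ?x ?p (Suc (Suc ?d))) (b ?d) (p ?d)"
    using t inst2_bind[OF C el_ex[OF A] el_ex[OF el_rfl[OF A]]] A b p
    by (intro t_J[OF i _ c]) (auto simp: el_def id_ty_def rfl_def)
  then have "\<Gamma> \<turnstile> J (C ?x ?p (Suc (Suc ?d))) t (p ?d) \<Colon> C b p ?d"
    using inst2_bind[OF C el_ex[OF b] el_ex[OF p]] by simp
  then show ?thesis
    using trI ty[OF ext_refl[OF el_ty[OF A]] b p] by blast
qed

lemma id_beta:
  assumes "ty \<Gamma> A" "fam (length \<Gamma>) B" "fam (length \<Gamma>) t" "el \<Gamma> A a"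
    and t: "\<And>\<Delta> x. ext \<Gamma> \<Delta> \<Longrightarrow> el \<Delta> A x \<Longrightarrow> el \<Delta> (B x) (t x)"
  shows "tr \<Gamma> (lam A t \<cdot> a =\<^bsub>B a\<^esub> t a)"
proof (rule id_jeq)
  note l = el_lam[OF assms(1,2,3) t]
  show "el \<Gamma> (B a) (lam A t \<cdot> a)" using l assms(2,4) by (rule el_app)
  show "el \<Gamma> (B a) (t a)" using t ext_refl assms by blast
  have "A (length \<Gamma>) # \<Gamma> \<turnstile> bind t (length \<Gamma>) \<Colon> bind B (length \<Gamma>)"
    using t[OF generic_element[OF assms(1)]] by (auto simp: el_def bind_def)
  moreover obtain j where "A (length \<Gamma>) # \<Gamma> \<turnstile> bind B (length \<Gamma>) \<Colon> Univ j"
    using pi_inversion(2)[OF el_ty[OF l]] by blast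
  moreover obtain i where "\<Gamma> \<turnstile> A (length \<Gamma>) \<Colon> Univ i" using assms(1) tyD by blast
  ultimately show "\<Gamma> \<turnstile> (lam A t \<cdot> a) (length \<Gamma>) \<doteq> t a (length \<Gamma>) \<Colon> B a (length \<Gamma>)"
    using e_beta inst_bind[OF assms(2) el_ex[OF assms(4)]] inst_bind[OF assms(3) el_ex[OF assms(4)]] assms(4)
    by (fastforce simp: el_def app_def lam_def)
qed

lemma id_pr1_beta:
  assumes "el \<Gamma> A a" "el \<Gamma> (B a) b" "fam (length \<Gamma>) B" "ty \<Gamma> (sig_ty A B)"
  shows "tr \<Gamma> (pr1 (pair a b) =\<^bsub>A\<^esub> a)"
proof (rule id_jeq)
  show "el \<Gamma> A (pr1 (pair a b))" using el_pr1[OF el_pair[OF assms]] .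
  note i = sig_inversion[OF assms(4)]
  obtain k where "\<Gamma> \<turnstile> A (length \<Gamma>) \<Colon> Univ k" using i(1) tyD by blast
  moreover obtain j where "A (length \<Gamma>) # \<Gamma> \<turnstile> bind B (length \<Gamma>) \<Colon> Univ j" using i(2) by blast
  ultimately show "\<Gamma> \<turnstile> pr1 (pair a b) (length \<Gamma>) \<doteq> a (length \<Gamma>) \<Colon> A (length \<Gamma>)"
    using assms e_fst_beta inst_bind[OF assms(3) el_ex[OF assms(1)]]
    by (fastforce simp: el_def pr1_def pair_def)
qed (rule assms)

lemma id_sig_eta:
  assumes "el \<Gamma> (sig_ty A B) p" "fam (length \<Gamma>) B"
  shows "tr \<Gamma> (p =\<^bsub>sig_ty A B\<^esub> pair (pr1 p) (pr2 p))"
proof (rule id_jeq)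
  show "el \<Gamma> (sig_ty A B) (pair (pr1 p) (pr2 p))"
    using el_pair el_pr1 el_pr2 assms el_ty by blast
  note i = sig_inversion[OF el_ty[OF assms(1)]]
  obtain k where "\<Gamma> \<turnstile> A (length \<Gamma>) \<Colon> Univ k" using i(1) tyD by blast
  moreover obtain j where "A (length \<Gamma>) # \<Gamma> \<turnstile> bind B (length \<Gamma>) \<Colon> Univ j" using i(2) by blast
  ultimately show "\<Gamma> \<turnstile> p (length \<Gamma>) \<doteq> pair (pr1 p) (pr2 p) (length \<Gamma>) \<Colon> sig_ty A B (length \<Gamma>)"
    using assms e_sig_eta by (fastforce simp: el_def pr1_def pr2_def pair_def sig_ty_def)
qed (rule assms)

lemma id_funext:
  assumes f: "el \<Gamma> (pi_ty A B) f" and g: "el \<Gamma> (pi_ty A B) g" and B: "fam (length \<Gamma>) B"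
    and h: "\<And>\<Delta> x. ext \<Gamma> \<Delta> \<Longrightarrow> el \<Delta> A x \<Longrightarrow> tr \<Delta> (f \<cdot> x =\<^bsub>B x\<^esub> g \<cdot> x)"
  shows "tr \<Gamma> (f =\<^bsub>pi_ty A B\<^esub> g)"
proof -
  let ?H = "\<Pi> x : A. f \<cdot> x =\<^bsub>B x\<^esub> g \<cdot> x" let ?d = "length \<Gamma>"
  note i = pi_inversion[OF el_ty[OF f]]
  have "fam ?d (\<lambda>x. f \<cdot> x =\<^bsub>B x\<^esub> g \<cdot> x)"
    using el_ex[OF f] el_ex[OF g] B by (auto simp: ex_def fam_def intro!: rel_id rel_app)
  from tr_piI[OF i(1) this h] obtain t where "\<Gamma> \<turnstile> t \<Colon> ?H ?d" by (auto simp: tr_def el_def)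
  \<comment> \<open>Below the binder \<open>f\<close> and \<open>g\<close> are read one level
    deeper, where naturality makes them the shifted copies that \<open>htpy\<close> writes
    down.\<close>
  moreover have "?H ?d = htpy (A ?d) (bind B ?d) (f ?d) (g ?d)"
    using exD[OF el_ex[OF f], of "Suc ?d"] exD[OF el_ex[OF g], of "Suc ?d"]
    by (simp add: htpy_def pi_ty_def id_ty_def bind_def app_def)
  moreover obtain k where "\<Gamma> \<turnstile> A ?d \<Colon> Univ k" using i(1) tyD by blast
  moreover obtain j where "A ?d # \<Gamma> \<turnstile> bind B ?d \<Colon> Univ j" using i(2) by blast
  ultimately have "\<Gamma> \<turnstile> Funext t \<Colon> Id (Pi (A ?d) (bind B ?d)) (f ?d) (g ?d)"
    using f g by (auto simp: el_def pi_ty_def intro!: t_funext)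
  then show ?thesis
    using trI[OF ty_id[OF f g]] by (simp add: id_ty_def pi_ty_def)
qed


section \<open>Reasoning with identities\<close>

lemma fam_const: "ex d C \<Longrightarrow> fam d (\<lambda>_. C)"
  by (rule famI) (rule ex_rel)

lemma tr_idD: "tr \<Gamma> (a =\<^bsub>A\<^esub> b) \<Longrightarrow> ty \<Gamma> A" "tr \<Gamma> (a =\<^bsub>A\<^esub> b) \<Longrightarrow> el \<Gamma> A a" "tr \<Gamma> (a =\<^bsub>A\<^esub> b) \<Longrightarrow> el \<Gamma> A b"
  using id_inversion tr_ty by blast+

text \<open>Path induction with a motive that ignores the path.\<close>

lemma id_subst:
  assumes eq: "tr \<Gamma> (a =\<^bsub>A\<^esub> b)" and P: "fam (length \<Gamma>) P"
    and ty: "\<And>\<Delta> x. ext \<Gamma> \<Delta> \<Longrightarrow> el \<Delta> A x \<Longrightarrow> ty \<Delta> (P x)" and Pa: "tr \<Gamma> (P a)"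
  shows "tr \<Gamma> (P b)"
proof -
  obtain p where p: "el \<Gamma> (a =\<^bsub>A\<^esub> b) p" using eq by (auto simp: tr_def)
  have "fam2 (length \<Gamma>) (\<lambda>x p. P x)" by (rule fam2I) (rule fam_rel[OF _ P])
  from tr_J[OF tr_idD(2)[OF eq] this ty Pa tr_idD(3)[OF eq] p] show ?thesis by blast
qed

lemma id_sym:
  assumes "tr \<Gamma> (a =\<^bsub>A\<^esub> b)"
  shows "tr \<Gamma> (b =\<^bsub>A\<^esub> a)"
proof -
  note A = tr_idD[OF assms]
  show ?thesis
    by (rule id_subst[OF assms, where P = "\<lambda>x. x =\<^bsub>A\<^esub> a"])
      (insert A, (assumption | rule par | (rule el_ex, assumption) | (rule ty_ex, assumption) | rule par_leaf)+,
       auto intro: ty_id el_ext id_refl)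
qed

lemma id_trans [trans]:
  assumes "tr \<Gamma> (a =\<^bsub>A\<^esub> b)" "tr \<Gamma> (b =\<^bsub>A\<^esub> c)"
  shows "tr \<Gamma> (a =\<^bsub>A\<^esub> c)"
proof -
  note A = tr_idD[OF assms(1)] tr_idD(3)[OF assms(2)]
  show ?thesis
    by (rule id_subst[OF assms(2), where P = "\<lambda>x. a =\<^bsub>A\<^esub> x"])
      (insert A assms, (assumption | rule par | (rule el_ex, assumption) | (rule ty_ex, assumption) | rule par_leaf)+,
       auto intro: ty_id el_ext)
qed

lemma id_cong:
  assumes eq: "tr \<Gamma> (a =\<^bsub>A\<^esub> b)" and h: "fam (length \<Gamma>) h"
    and el: "\<And>\<Delta> x. ext \<Gamma> \<Delta> \<Longrightarrow> el \<Delta> A x \<Longrightarrow> el \<Delta> B (h x)" and B: "ty \<Gamma> B"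
  shows "tr \<Gamma> (h a =\<^bsub>B\<^esub> h b)"
proof -
  note A = tr_idD[OF eq]
  have ha: "el \<Gamma> B (h a)" using el ext_refl A by blast
  show ?thesis
    by (rule id_subst[OF eq, where P = "\<lambda>x. h a =\<^bsub>B\<^esub> h x"])
      (insert A B ha, (assumption | rule par | (rule el_ex, assumption) | (rule ty_ex, assumption) | rule fam_rel[OF _ h] | rule par_leaf)+,
       auto intro: ty_id el_ext el id_refl)
qed

lemma id_happly:
  assumes eq: "tr \<Gamma> (f =\<^bsub>pi_ty A B\<^esub> g)" and B: "fam (length \<Gamma>) B" and a: "el \<Gamma> A a"
  shows "tr \<Gamma> (f \<cdot> a =\<^bsub>B a\<^esub> g \<cdot> a)"
proof (rule id_cong[OF eq, where h = "\<lambda>f. f \<cdot> a"])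
  show "fam (length \<Gamma>) (\<lambda>f. f \<cdot> a)" using el_ex[OF a] by (auto simp: ex_def fam_def intro!: rel_app)
  fix \<Delta> x assume "ext \<Gamma> \<Delta>" "el \<Delta> (pi_ty A B) x"
  then show "el \<Delta> (B a) (x \<cdot> a)" using el_app[OF _ fam_ext[OF _ B] el_ext[OF _ a]] by blast
next
  show "ty \<Gamma> (B a)" using el_ty[OF el_app[OF tr_idD(2)[OF eq] B a]] .
qed

lemma id_pr1:
  assumes "tr \<Gamma> (u =\<^bsub>sig_ty A B\<^esub> v)"
  shows "tr \<Gamma> (pr1 u =\<^bsub>A\<^esub> pr1 v)"
  using assms sig_inversion(1) tr_idD(1)[OF assms]
  by (intro id_cong[OF assms, where h = pr1] famI rel_pr1 el_pr1)

lemma ty_arr: "ty \<Gamma> A \<Longrightarrow> ty \<Gamma> B \<Longrightarrow> ty \<Gamma> (A \<rightarrow> B)"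
  unfolding arr_def by (intro ty_pi fam_const ty_ex) (auto intro: ty_ext)

lemma ty_prod: "ty \<Gamma> A \<Longrightarrow> ty \<Gamma> B \<Longrightarrow> ty \<Gamma> (A \<otimes> B)"
  unfolding prod_ty_def by (intro ty_sig fam_const ty_ex) (auto intro: ty_ext)

lemma tp_arr: "tp \<Gamma> i A \<Longrightarrow> tp \<Gamma> j B \<Longrightarrow> tp \<Gamma> (max i j) (A \<rightarrow> B)"
  unfolding arr_def by (intro tp_pi fam_const tp_ex tp_ty) (auto intro: tp_ext)

lemma el_arr: "ty \<Gamma> B \<Longrightarrow> el \<Gamma> (A \<rightarrow> B) f \<Longrightarrow> el \<Gamma> A a \<Longrightarrow> el \<Gamma> B (f \<cdot> a)"
  unfolding arr_def using el_app[of \<Gamma> A "\<lambda>_. B"] fam_const ty_ex by blast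

lemma el_arr2:
  "ty \<Gamma> B \<Longrightarrow> ty \<Gamma> C \<Longrightarrow> el \<Gamma> (A \<rightarrow> B \<rightarrow> C) f \<Longrightarrow> el \<Gamma> A a \<Longrightarrow> el \<Gamma> B b \<Longrightarrow> el \<Gamma> C (f \<cdot> a \<cdot> b)"
  using el_arr ty_arr by blast

lemma el_lam_arr:
  assumes "ty \<Gamma> A" "ty \<Gamma> B" "fam (length \<Gamma>) t" "\<And>\<Delta> x. ext \<Gamma> \<Delta> \<Longrightarrow> el \<Delta> A x \<Longrightarrow> el \<Delta> B (t x)"
  shows "el \<Gamma> (A \<rightarrow> B) (lam A t)"
  unfolding arr_def using assms by (intro el_lam fam_const ty_ex) auto

lemma id_beta_arr:
  assumes "ty \<Gamma> A" "ty \<Gamma> B" "fam (length \<Gamma>) t" "\<And>\<Delta> x. ext \<Gamma> \<Delta> \<Longrightarrow> el \<Delta> A x \<Longrightarrow> el \<Delta> B (t x)" "el \<Gamma> A a"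
  shows "tr \<Gamma> (lam A t \<cdot> a =\<^bsub>B\<^esub> t a)"
  using assms by (intro id_beta[where B = "\<lambda>_. B"] fam_const ty_ex) auto

lemma id_app_arr:
  assumes B: "ty \<Gamma> B" and f: "tr \<Gamma> (f =\<^bsub>A \<rightarrow> B\<^esub> g)" and a: "tr \<Gamma> (a =\<^bsub>A\<^esub> b)"
  shows "tr \<Gamma> (f \<cdot> a =\<^bsub>B\<^esub> g \<cdot> b)"
proof -
  have "tr \<Gamma> (f \<cdot> a =\<^bsub>B\<^esub> f \<cdot> b)"
  proof (rule id_cong[OF a, where h = "\<lambda>x. f \<cdot> x"])
    show "fam (length \<Gamma>) (\<lambda>x. f \<cdot> x)"
      using el_ex[OF tr_idD(2)[OF f]] by (auto simp: ex_def fam_def intro!: rel_app)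
  qed (use B el_arr mono tr_idD[OF f] in blast)+
  also have "tr \<Gamma> (f \<cdot> b =\<^bsub>B\<^esub> g \<cdot> b)"
    using id_happly[OF f[unfolded arr_def] fam_const[OF ty_ex[OF B]] tr_idD(3)[OF a]] .
  finally show ?thesis .
qed

lemma id_funext_arr:
  assumes "ty \<Gamma> B" "el \<Gamma> (A \<rightarrow> B) f" "el \<Gamma> (A \<rightarrow> B) g"
    "\<And>\<Delta> x. ext \<Gamma> \<Delta> \<Longrightarrow> el \<Delta> A x \<Longrightarrow> tr \<Delta> (f \<cdot> x =\<^bsub>B\<^esub> g \<cdot> x)"
  shows "tr \<Gamma> (f =\<^bsub>A \<rightarrow> B\<^esub> g)"
  using assms unfolding arr_def by (intro id_funext fam_const ty_ex) auto

lemma tr_arrI: "ty \<Gamma> A \<Longrightarrow> ty \<Gamma> B \<Longrightarrow> (\<And>\<Delta>. ext \<Gamma> \<Delta> \<Longrightarrow> tr \<Delta> A \<Longrightarrow> tr \<Delta> B) \<Longrightarrow> tr \<Gamma> (A \<rightarrow> B)"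
  unfolding arr_def by (intro tr_piI fam_const ty_ex) (auto intro: el_tr)

lemma el_prodI: "el \<Gamma> A a \<Longrightarrow> el \<Gamma> B b \<Longrightarrow> el \<Gamma> (A \<otimes> B) (pair a b)"
  using ty_prod[OF el_ty el_ty] unfolding prod_ty_def by (intro el_pair fam_const el_ex_ty) auto

lemma el_prod1: "el \<Gamma> (A \<otimes> B) p \<Longrightarrow> el \<Gamma> A (pr1 p)"
  unfolding prod_ty_def by (rule el_pr1)

lemma el_prod2: "ty \<Gamma> B \<Longrightarrow> el \<Gamma> (A \<otimes> B) p \<Longrightarrow> el \<Gamma> B (pr2 p)"
  unfolding prod_ty_def using el_pr2[of \<Gamma> A "\<lambda>_. B"] fam_const ty_ex by blast

lemma tr_prodI: "tr \<Gamma> A \<Longrightarrow> tr \<Gamma> B \<Longrightarrow> tr \<Gamma> (A \<otimes> B)"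
  unfolding tr_def using el_prodI by blast

lemma tr_prod1: "tr \<Gamma> (A \<otimes> B) \<Longrightarrow> tr \<Gamma> A"
  unfolding tr_def using el_prod1 by blast

lemma tr_prod2: "ty \<Gamma> B \<Longrightarrow> tr \<Gamma> (A \<otimes> B) \<Longrightarrow> tr \<Gamma> B"
  unfolding tr_def using el_prod2 by blast

lemma tr_sigI:
  "el \<Gamma> A a \<Longrightarrow> tr \<Gamma> (B a) \<Longrightarrow> fam (length \<Gamma>) B \<Longrightarrow> ty \<Gamma> (sig_ty A B) \<Longrightarrow> tr \<Gamma> (sig_ty A B)"
  unfolding tr_def using el_pair by blast

lemma id_prod_eta:
  assumes "ty \<Gamma> B" "el \<Gamma> (A \<otimes> B) p"
  shows "tr \<Gamma> (p =\<^bsub>A \<otimes> B\<^esub> pair (pr1 p) (pr2 p))"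
  using id_sig_eta[of \<Gamma> A "\<lambda>_. B" p] assms unfolding prod_ty_def by (auto intro: fam_const ty_ex)

text \<open>Both sides are eta-expanded; in between one component is exchanged at a time by
  congruence, which is possible because the second factor does not depend on the first.\<close>

lemma id_prodI:
  assumes B: "ty \<Gamma> B" and u: "el \<Gamma> (A \<otimes> B) u" and v: "el \<Gamma> (A \<otimes> B) v"
    and 1: "tr \<Gamma> (pr1 u =\<^bsub>A\<^esub> pr1 v)" and 2: "tr \<Gamma> (pr2 u =\<^bsub>B\<^esub> pr2 v)"
  shows "tr \<Gamma> (u =\<^bsub>A \<otimes> B\<^esub> v)"
proof -
  note AB = el_ty[OF u]
  have "tr \<Gamma> (pair (pr1 u) (pr2 u) =\<^bsub>A \<otimes> B\<^esub> pair (pr1 v) (pr2 u))"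
    using el_prod2[OF B u] by (intro id_cong[OF 1, where h = "\<lambda>x. pair x (pr2 u)"] AB)
      (auto simp: fam_def intro: rel_pair ex_rel el_ex el_prodI el_ext)
  also have "tr \<Gamma> (pair (pr1 v) (pr2 u) =\<^bsub>A \<otimes> B\<^esub> pair (pr1 v) (pr2 v))"
    using el_prod1[OF v] by (intro id_cong[OF 2, where h = "\<lambda>x. pair (pr1 v) x"] AB)
      (auto simp: fam_def intro: rel_pair ex_rel el_ex el_prodI el_ext)
  finally show ?thesis
    by (rule id_trans[OF id_prod_eta[OF B u] id_trans[OF _ id_sym[OF id_prod_eta[OF B v]]]])
qed

lemma id_pr1_pair:
  assumes "el \<Gamma> A a" "el \<Gamma> B b"
  shows "tr \<Gamma> (pr1 (pair a b) =\<^bsub>A\<^esub> a)"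
  using assms el_ty
  by (intro id_pr1_beta[where B = "\<lambda>_. B"] fam_const el_ex_ty ty_prod[unfolded prod_ty_def])

lemma id_pr2_pair:
  assumes a: "el \<Gamma> A a" and b: "el \<Gamma> B b"
  shows "tr \<Gamma> (pr2 (pair a b) =\<^bsub>B\<^esub> b)"
proof (rule id_jeq[OF el_prod2[OF el_ty[OF b] el_prodI[OF a b]] b])
  note i = sig_inversion[OF ty_prod[OF el_ty[OF a] el_ty[OF b], unfolded prod_ty_def]]
  obtain k where "\<Gamma> \<turnstile> A (length \<Gamma>) \<Colon> Univ k" using i(1) tyD by blast
  moreover obtain j where "A (length \<Gamma>) # \<Gamma> \<turnstile> bind (\<lambda>_. B) (length \<Gamma>) \<Colon> Univ j" using i(2) by blast
  ultimately show "\<Gamma> \<turnstile> pr2 (pair a b) (length \<Gamma>) \<doteq> b (length \<Gamma>) \<Colon> B (length \<Gamma>)"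
    using a b e_snd_beta inst_bind[OF fam_const[OF el_ex_ty[OF b]] el_ex[OF a]]
    by (fastforce simp: el_def pr2_def pair_def)
qed

lemma id_pr2:
  assumes B: "ty \<Gamma> B" and uv: "tr \<Gamma> (u =\<^bsub>A \<otimes> B\<^esub> v)"
  shows "tr \<Gamma> (pr2 u =\<^bsub>B\<^esub> pr2 v)"
  using el_prod2[OF ty_ext[OF _ B]] B by (intro id_cong[OF uv, where h = pr2] famI rel_pr2)

lemma beta2_arr:
  assumes A: "ty \<Gamma> A" and B: "ty \<Gamma> B" and C: "ty \<Gamma> C" and t: "fam2 (length \<Gamma>) t"
    and el: "\<And>\<Delta> x y. ext \<Gamma> \<Delta> \<Longrightarrow> el \<Delta> A x \<Longrightarrow> el \<Delta> B y \<Longrightarrow> el \<Delta> C (t x y)"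
  shows "el \<Gamma> (A \<rightarrow> B \<rightarrow> C) (\<^bold>\<lambda> x : A. \<^bold>\<lambda> y : B. t x y)"
    and "el \<Gamma> A a \<Longrightarrow> el \<Gamma> B b \<Longrightarrow> tr \<Gamma> ((\<^bold>\<lambda> x : A. \<^bold>\<lambda> y : B. t x y) \<cdot> a \<cdot> b =\<^bsub>C\<^esub> t a b)"
proof -
  have f1: "fam (length \<Gamma>) (\<lambda>x. \<^bold>\<lambda> y : B. t x y)"
    by (insert ty_ex[OF B], (assumption | rule par fam2_rel[OF _ t] | rule par_leaf)+)
  have f2: "fam (length \<Delta>) (\<lambda>y. t x y)" if "ext \<Gamma> \<Delta>" "el \<Delta> A x" for \<Delta> x
    by (insert el_ex[OF that(2)], (assumption | rule par fam2_rel[OF _ fam2_ext[OF that(1) t]] | rule par_leaf)+)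
  have inner: "el \<Delta> (B \<rightarrow> C) (\<^bold>\<lambda> y : B. t x y)" if "ext \<Gamma> \<Delta>" "el \<Delta> A x" for \<Delta> x
    by (rule el_lam_arr[OF ty_ext[OF that(1) B] ty_ext[OF that(1) C] f2[OF that]])
      (blast intro: el ext_trans[OF that(1)] el_ext that(2))
  note BC = ty_arr[OF B C]
  show "el \<Gamma> (A \<rightarrow> B \<rightarrow> C) (\<^bold>\<lambda> x : A. \<^bold>\<lambda> y : B. t x y)"
    by (rule el_lam_arr[OF A BC f1 inner])
  assume a: "el \<Gamma> A a" and b: "el \<Gamma> B b"
  have "tr \<Gamma> ((\<^bold>\<lambda> x : A. \<^bold>\<lambda> y : B. t x y) \<cdot> a \<cdot> b =\<^bsub>C\<^esub> (\<^bold>\<lambda> y : B. t a y) \<cdot> b)"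
    by (rule id_app_arr[OF C id_beta_arr[OF A BC f1 inner a] id_refl[OF b]])
  also have "tr \<Gamma> ((\<^bold>\<lambda> y : B. t a y) \<cdot> b =\<^bsub>C\<^esub> t a b)"
    by (rule id_beta_arr[OF B C f2[OF ext_refl[OF A] a] _ b]) (blast intro: el el_ext a)
  finally show "tr \<Gamma> ((\<^bold>\<lambda> x : A. \<^bold>\<lambda> y : B. t x y) \<cdot> a \<cdot> b =\<^bsub>C\<^esub> t a b)" .
qed


section \<open>Propositions and sets\<close>

lemma rel_is_prop: "rel w A A' \<Longrightarrow> rel w (is_prop A) (is_prop A')"
  unfolding is_prop_def by (assumption | rule par | rule par_leaf)+

lemma rel_is_set: "rel w A A' \<Longrightarrow> rel w (is_set A) (is_set A')"
  unfolding is_set_def by (assumption | rule par rel_is_prop | rule par_leaf)+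

lemma rel_is_contr: "rel w A A' \<Longrightarrow> rel w (is_contr A) (is_contr A')"
  unfolding is_contr_def by (assumption | rule par | rule par_leaf)+

lemma fam_is_prop:
  assumes "ty \<Gamma> A"
  shows "fam (length \<Gamma>) (\<lambda>x. \<Pi> y : A. x =\<^bsub>A\<^esub> y)" "fam (length \<Gamma>) (\<lambda>x. \<Pi> y : A. is_prop (x =\<^bsub>A\<^esub> y))"
  by (insert ty_ex[OF assms], (assumption | rule par rel_is_prop | rule par_leaf)+)

lemma fam_id:
  assumes "el \<Gamma> A a"
  shows "fam (length \<Gamma>) (\<lambda>x. a =\<^bsub>A\<^esub> x)" "fam (length \<Gamma>) (\<lambda>x. is_prop (a =\<^bsub>A\<^esub> x))"
  by (insert el_ex[OF assms] el_ex_ty[OF assms], (assumption | rule par rel_is_prop | rule par_leaf)+)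

lemma tr_is_propI:
  assumes "ty \<Gamma> A" "\<And>\<Delta> a b. ext \<Gamma> \<Delta> \<Longrightarrow> el \<Delta> A a \<Longrightarrow> el \<Delta> A b \<Longrightarrow> tr \<Delta> (a =\<^bsub>A\<^esub> b)"
  shows "tr \<Gamma> (is_prop A)"
  unfolding is_prop_def
proof (rule tr_piI[OF assms(1) fam_is_prop(1)[OF assms(1)]])
  fix \<Delta> x assume e: "ext \<Gamma> \<Delta>" and x: "el \<Delta> A x"
  then show "tr \<Delta> (\<Pi> y : A. x =\<^bsub>A\<^esub> y)"
    using assms(1) by (intro tr_piI fam_id assms(2)) (auto intro: mono ext_trans[OF e])
qed

lemma tr_is_propD: "tr \<Gamma> (is_prop A) \<Longrightarrow> el \<Gamma> A a \<Longrightarrow> el \<Gamma> A b \<Longrightarrow> tr \<Gamma> (a =\<^bsub>A\<^esub> b)"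
  unfolding is_prop_def
  using tr_piD[of \<Gamma> A "\<lambda>x. \<Pi> y : A. x =\<^bsub>A\<^esub> y" a] tr_piD[of \<Gamma> A "\<lambda>y. a =\<^bsub>A\<^esub> y" b] fam_is_prop fam_id el_ty
  by blast

lemma ty_is_prop:
  assumes "ty \<Gamma> A"
  shows "ty \<Gamma> (is_prop A)"
  unfolding is_prop_def
proof (rule ty_pi[OF assms(1) fam_is_prop(1)[OF assms(1)]])
  fix \<Delta> x assume "ext \<Gamma> \<Delta>" "el \<Delta> A x"
  then show "ty \<Delta> (\<Pi> y : A. x =\<^bsub>A\<^esub> y)"
    using assms by (intro ty_pi fam_id) (auto intro: mono ty_id)
qed

lemma tr_is_prop_ty: "tr \<Gamma> (is_prop A) \<Longrightarrow> ty \<Gamma> A"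
  using pi_inversion(1) tr_ty unfolding is_prop_def by blast

lemma ty_is_set:
  assumes "ty \<Gamma> A"
  shows "ty \<Gamma> (is_set A)"
  unfolding is_set_def
proof (rule ty_pi[OF assms(1) fam_is_prop(2)[OF assms(1)]])
  fix \<Delta> x assume "ext \<Gamma> \<Delta>" "el \<Delta> A x"
  then show "ty \<Delta> (\<Pi> y : A. is_prop (x =\<^bsub>A\<^esub> y))"
    using assms by (intro ty_pi fam_id) (auto intro: mono ty_id ty_is_prop)
qed

lemma tr_is_setI:
  assumes "ty \<Gamma> A" "\<And>\<Delta> a b. ext \<Gamma> \<Delta> \<Longrightarrow> el \<Delta> A a \<Longrightarrow> el \<Delta> A b \<Longrightarrow> tr \<Delta> (is_prop (a =\<^bsub>A\<^esub> b))"
  shows "tr \<Gamma> (is_set A)"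
  unfolding is_set_def
proof (rule tr_piI[OF assms(1) fam_is_prop(2)[OF assms(1)]])
  fix \<Delta> x assume e: "ext \<Gamma> \<Delta>" and x: "el \<Delta> A x"
  then show "tr \<Delta> (\<Pi> y : A. is_prop (x =\<^bsub>A\<^esub> y))"
    using assms(1) by (intro tr_piI fam_id assms(2)) (auto intro: mono ext_trans[OF e])
qed

lemma is_prop_id: "tr \<Gamma> (is_set A) \<Longrightarrow> el \<Gamma> A a \<Longrightarrow> el \<Gamma> A b \<Longrightarrow> tr \<Gamma> (is_prop (a =\<^bsub>A\<^esub> b))"
  unfolding is_set_def
  using tr_piD[of \<Gamma> A "\<lambda>x. \<Pi> y : A. is_prop (x =\<^bsub>A\<^esub> y)" a] tr_piD[of \<Gamma> A "\<lambda>y. is_prop (a =\<^bsub>A\<^esub> y)" b]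
    fam_is_prop fam_id el_ty
  by blast

lemma is_prop_pi:
  assumes "ty \<Gamma> A" "fam (length \<Gamma>) B" "\<And>\<Delta> x. ext \<Gamma> \<Delta> \<Longrightarrow> el \<Delta> A x \<Longrightarrow> tr \<Delta> (is_prop (B x))"
  shows "tr \<Gamma> (is_prop (pi_ty A B))"
proof (rule tr_is_propI)
  show "ty \<Gamma> (pi_ty A B)" using assms tr_is_prop_ty by (intro ty_pi) auto
  fix \<Delta> f g assume e: "ext \<Gamma> \<Delta>" and f: "el \<Delta> (pi_ty A B) f" and g: "el \<Delta> (pi_ty A B) g"
  note B = fam_ext[OF e assms(2)]
  show "tr \<Delta> (f =\<^bsub>pi_ty A B\<^esub> g)"
  proof (rule id_funext[OF f g B])
    fix \<Theta> x assume e': "ext \<Delta> \<Theta>" and x: "el \<Theta> A x"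
    show "tr \<Theta> (f \<cdot> x =\<^bsub>B x\<^esub> g \<cdot> x)"
      using assms(3)[OF ext_trans[OF e e'] x] el_ext[OF e'] f g fam_ext[OF e' B] x
      by (intro tr_is_propD el_app) auto
  qed
qed

text \<open>Comparing second components over a path would require transport. Instead the second
  component is quantified: "\<open>u\<close> equals every pair over \<open>pr1 u\<close>" is a
  statement about the first component alone and can be carried along the path \<open>1\<close> to
  \<open>pr1 v\<close>.\<close>

lemma id_sig_prop:
  assumes u: "el \<Gamma> (sig_ty A B) u" and v: "el \<Gamma> (sig_ty A B) v" and B: "fam (length \<Gamma>) B"
    and isp: "\<And>\<Delta> x. ext \<Gamma> \<Delta> \<Longrightarrow> el \<Delta> A x \<Longrightarrow> tr \<Delta> (is_prop (B x))"
    and 1: "tr \<Gamma> (pr1 u =\<^bsub>A\<^esub> pr1 v)"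
  shows "tr \<Gamma> (u =\<^bsub>sig_ty A B\<^esub> v)"
proof -
  let ?S = "sig_ty A B"
  note S = el_ty[OF u] and exs = el_ex[OF u] ty_ex[OF el_ty[OF u]] ty_ex[OF sig_inversion(1)[OF el_ty[OF u]]]
  note tB = tr_is_prop_ty[OF isp]
  have fam: "fam (length \<Gamma>) (\<lambda>x. \<Pi> b : B x. u =\<^bsub>?S\<^esub> pair x b)"
    by (insert exs, (assumption | rule par fam_rel[OF _ B] | rule par_leaf)+)
  have fam': "fam (length \<Delta>) (\<lambda>b. u =\<^bsub>?S\<^esub> pair x b)" if "ext \<Gamma> \<Delta>" "ex (length \<Delta>) x" for x \<Delta>
    by (insert exs[THEN ex_ext[OF that(1)]] that(2),
      (assumption | rule par fam_rel[OF _ fam_ext[OF that(1) B]] | rule par_leaf)+)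
  have pr: "el \<Delta> ?S (pair x b)" if "ext \<Gamma> \<Delta>" "el \<Delta> A x" "el \<Delta> (B x) b" for \<Delta> x b
    using el_pair[OF that(2,3) fam_ext[OF that(1) B] ty_ext[OF that(1) S]] .
  \<comment> \<open>Over \<open>pr1 u\<close> itself the statement is eta for \<open>u\<close>
    together with the fact that all elements of \<open>B (pr1 u)\<close> are identical.\<close>
  have "tr \<Gamma> (\<Pi> b : B (pr1 u). u =\<^bsub>?S\<^esub> pair (pr1 u) b)"
  proof (rule tr_piI[OF el_ty[OF el_pr2[OF u B]] fam'[OF ext_refl[OF S] el_ex[OF el_pr1[OF u]]]])
    fix \<Delta> b assume e: "ext \<Gamma> \<Delta>" and b: "el \<Delta> (B (pr1 u)) b"
    note u' = el_ext[OF e u] and B' = fam_ext[OF e B]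
    have "tr \<Delta> (pr2 u =\<^bsub>B (pr1 u)\<^esub> b)"
      using isp[OF e el_pr1[OF u']] el_pr2[OF u' B'] b by (rule tr_is_propD)
    then show "tr \<Delta> (u =\<^bsub>?S\<^esub> pair (pr1 u) b)"
    proof (rule id_subst[OF _ fam'[OF e el_ex[OF el_pr1[OF u']]]])
      show "tr \<Delta> (u =\<^bsub>?S\<^esub> pair (pr1 u) (pr2 u))" using id_sig_eta[OF u' B'] .
      fix \<Theta> x assume "ext \<Delta> \<Theta>" "el \<Theta> (B (pr1 u)) x"
      then show "ty \<Theta> (u =\<^bsub>?S\<^esub> pair (pr1 u) x)"
        using e u by (intro ty_id pr el_pr1) (auto intro: ext_trans el_ext)
    qed
  qed
  then have "tr \<Gamma> (\<Pi> b : B (pr1 v). u =\<^bsub>?S\<^esub> pair (pr1 v) b)"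
  proof (rule id_subst[OF 1 fam, rotated])
    fix \<Delta> x assume e: "ext \<Gamma> \<Delta>" and x: "el \<Delta> A x"
    show "ty \<Delta> (\<Pi> b : B x. u =\<^bsub>?S\<^esub> pair x b)"
    proof (rule ty_pi[OF tB[OF e x] fam'[OF e el_ex[OF x]]])
      fix \<Theta> b assume e': "ext \<Delta> \<Theta>" and "el \<Theta> (B x) b"
      then show "ty \<Theta> (u =\<^bsub>?S\<^esub> pair x b)"
        using el_ext[OF e' x] el_ext[OF ext_trans[OF e e'] u] ext_trans[OF e e'] by (intro ty_id pr) auto
    qed
  qed
  from tr_piD[OF this fam'[OF ext_refl[OF S] el_ex[OF el_pr1[OF v]]] el_pr2[OF v B]]
  show ?thesis by (rule id_trans[OF _ id_sym[OF id_sig_eta[OF v B]]])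
qed

lemma is_prop_prod:
  assumes A: "tr \<Gamma> (is_prop A)" and B: "tr \<Gamma> (is_prop B)"
  shows "tr \<Gamma> (is_prop (A \<otimes> B))"
proof (rule tr_is_propI)
  show "ty \<Gamma> (A \<otimes> B)" using assms tr_is_prop_ty by (intro ty_prod)
  fix \<Delta> u v assume e: "ext \<Gamma> \<Delta>" and u: "el \<Delta> (A \<otimes> B) u" and v: "el \<Delta> (A \<otimes> B) v"
  show "tr \<Delta> (u =\<^bsub>A \<otimes> B\<^esub> v)"
    using u v tr_ext[OF e A] tr_ext[OF e B] tr_is_prop_ty
    by (intro id_prodI) (auto intro: tr_is_propD el_prod1 el_prod2)
qed

text \<open>
  Since function extensionality has no computation rule, the identity types of function types are not
  directly accessible. They are propositions by Hedberg's argument: every \<open>p : x = y\<close> is equal to a value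
  that depends only on an element of the proposition \<open>R x y\<close>.
\<close>

lemma is_setI_rel:
  assumes X: "ty \<Gamma> X" and R: "fam2 (length \<Gamma>) R"
    and refl: "\<And>\<Delta> x. ext \<Gamma> \<Delta> \<Longrightarrow> el \<Delta> X x \<Longrightarrow> tr \<Delta> (R x x)"
    and isp: "\<And>\<Delta> x y. ext \<Gamma> \<Delta> \<Longrightarrow> el \<Delta> X x \<Longrightarrow> el \<Delta> X y \<Longrightarrow> tr \<Delta> (is_prop (R x y))"
    and id: "\<And>\<Delta> x y. ext \<Gamma> \<Delta> \<Longrightarrow> el \<Delta> X x \<Longrightarrow> el \<Delta> X y \<Longrightarrow> tr \<Delta> (R x y) \<Longrightarrow> tr \<Delta> (x =\<^bsub>X\<^esub> y)"
  shows "tr \<Gamma> (is_set X)"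
proof (rule tr_is_setI[OF X])
  fix \<Gamma>' x y0 assume e0: "ext \<Gamma> \<Gamma>'" and x: "el \<Gamma>' X x" and y0: "el \<Gamma>' X y0"
  note X' = ty_ext[OF e0 X] and R' = fam2_ext[OF e0 R]
  note ex = ty_ex[OF X'] el_ex[OF x]
  have R1: "ty \<Delta> (R x y)" if "ext \<Gamma>' \<Delta>" "el \<Delta> X y" for \<Delta> y
    using tr_is_prop_ty[OF isp[OF ext_trans[OF e0 that(1)] el_ext[OF that(1) x] that(2)]] .
  have I1: "ty \<Delta> (x =\<^bsub>X\<^esub> y)" if "ext \<Gamma>' \<Delta>" "el \<Delta> X y" for \<Delta> y
    using ty_id el_ext[OF that(1) x] that(2) .
  have famG: "fam (length \<Gamma>') (\<lambda>y. R x y \<rightarrow> x =\<^bsub>X\<^esub> y)" and famF: "fam (length \<Gamma>') (\<lambda>y. x =\<^bsub>X\<^esub> y \<rightarrow> R x y)"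
    by (insert ex, (assumption | rule par fam2_rel[OF _ R'] | rule par_leaf)+)
  \<comment> \<open>\<open>g\<close> selects a path for each element of \<open>R x y\<close>. In the
    other direction, \<open>f\<close> below arises by transporting the reflexivity element of
    \<open>R\<close> along a path.\<close>
  have "tr \<Gamma>' (\<Pi> y : X. R x y \<rightarrow> x =\<^bsub>X\<^esub> y)"
  proof (rule tr_piI[OF X' famG], rule tr_arrI)
    fix \<Delta> y \<Delta>' assume *: "ext \<Gamma>' \<Delta>" "el \<Delta> X y" "ext \<Delta> \<Delta>'" "tr \<Delta>' (R x y)"
    note e = ext_trans[OF *(1) *(3)]
    show "tr \<Delta>' (x =\<^bsub>X\<^esub> y)" using id[OF ext_trans[OF e0 e] el_ext[OF e x] el_ext[OF *(3,2)] *(4)] .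
  qed (fact R1 I1)+
  then obtain g where g: "el \<Gamma>' (\<Pi> y : X. R x y \<rightarrow> x =\<^bsub>X\<^esub> y) g" by (auto simp: tr_def)
  have "tr \<Gamma>' (\<Pi> y : X. x =\<^bsub>X\<^esub> y \<rightarrow> R x y)"
  proof (rule tr_piI[OF X' famF], rule tr_arrI)
    fix \<Delta> y \<Delta>' assume *: "ext \<Gamma>' \<Delta>" "el \<Delta> X y" "ext \<Delta> \<Delta>'" "tr \<Delta>' (x =\<^bsub>X\<^esub> y)"
    note e = ext_trans[OF *(1) *(3)]
    show "tr \<Delta>' (R x y)"
    proof (rule id_subst[OF *(4), where P = "\<lambda>y. R x y"])
      show "fam (length \<Delta>') (R x)"
        by (insert ex_ext[OF e ex(2)], (assumption | rule par fam2_rel[OF _ fam2_ext[OF e R']] | rule par_leaf)+)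
    qed (auto intro: R1 ext_trans[OF e] refl[OF ext_trans[OF e0 e] el_ext[OF e x]])
  qed (fact R1 I1)+
  then obtain f where f: "el \<Gamma>' (\<Pi> y : X. x =\<^bsub>X\<^esub> y \<rightarrow> R x y) f" by (auto simp: tr_def)
  have G: "el \<Delta> (x =\<^bsub>X\<^esub> y) (g \<cdot> y \<cdot> r)" if "ext \<Gamma>' \<Delta>" "el \<Delta> X y" "el \<Delta> (R x y) r" for \<Delta> y r
    using el_app[OF el_ext[OF that(1) g] fam_ext[OF that(1) famG] that(2)] that I1 by (auto intro: el_arr)
  have F: "el \<Delta> (R x y) (f \<cdot> y \<cdot> p)" if "ext \<Gamma>' \<Delta>" "el \<Delta> X y" "el \<Delta> (x =\<^bsub>X\<^esub> y) p" for \<Delta> y p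
    using el_app[OF el_ext[OF that(1) f] fam_ext[OF that(1) famF] that(2)] that R1 by (auto intro: el_arr)
  note e1 = ext_refl[OF X']
  obtain r where r: "el \<Gamma>' (R x x) r" using refl[OF e0 x] by (auto simp: tr_def)
  \<comment> \<open>The round trip through \<open>R\<close> sends reflexivity to this loop, up to
    identity, and the loop need not be reflexivity. The correction \<open>c\<close> constructed next
    undoes it.\<close>
  define q where "q = g \<cdot> x \<cdot> r"
  have q: "el \<Gamma>' (x =\<^bsub>X\<^esub> x) q" unfolding q_def using G[OF e1 x r] .
  \<comment> \<open>An element of \<open>?T z\<close> turns paths from \<open>x\<close> into paths
    from \<open>z\<close>, and \<open>?S\<close> asks that it send \<open>q\<close> to reflexivity,
    as composition with the inverse of \<open>q\<close> would. No algebra of paths has to be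
    developed: path induction on \<open>q\<close> reduces the existence of such a map to the
    identity.\<close>
  let ?T = "\<lambda>z. \<Pi> y : X. x =\<^bsub>X\<^esub> y \<rightarrow> z =\<^bsub>X\<^esub> y"
  let ?S = "\<lambda>z q c. c \<cdot> z \<cdot> q =\<^bsub>z =\<^bsub>X\<^esub> z\<^esub> rfl z"
  have famT: "fam (length \<Delta>) (\<lambda>y. x =\<^bsub>X\<^esub> y \<rightarrow> z =\<^bsub>X\<^esub> y)" if "ext \<Gamma>' \<Delta>" "ex (length \<Delta>) z" for \<Delta> z
    by (insert ex_ext[OF that(1) ex(1)] ex_ext[OF that(1) ex(2)] that(2), (assumption | rule par | rule par_leaf)+)
  have famS: "fam (length \<Delta>) (\<lambda>c. ?S z q c)" if "ext \<Gamma>' \<Delta>" "ex (length \<Delta>) z" "ex (length \<Delta>) q" for \<Delta> z q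
    by (insert ex_ext[OF that(1) ex(1)] ex_ext[OF that(1) ex(2)] that(2,3), (assumption | rule par | rule par_leaf)+)
  have tyT: "ty \<Delta> (?T z)" if "ext \<Gamma>' \<Delta>" "el \<Delta> X z" for \<Delta> z
    by (rule ty_pi[OF ty_ext[OF that(1) X'] famT[OF that(1) el_ex[OF that(2)]]], rule ty_arr)
      (use that in \<open>auto intro: I1 ext_trans ty_id el_ext\<close>)
  have elS: "el \<Delta> (z =\<^bsub>X\<^esub> y) (c \<cdot> y \<cdot> q)"
    if "ext \<Gamma>' \<Delta>" "el \<Delta> X z" "el \<Delta> X y" "el \<Delta> (x =\<^bsub>X\<^esub> y) q" "el \<Delta> (?T z) c" for \<Delta> z y q c
    using el_app[OF that(5) famT[OF that(1) el_ex[OF that(2)]] that(3)] that by (auto intro: el_arr ty_id)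
  have tyS: "ty \<Delta> (\<Sigma> c : ?T z. ?S z q c)" if "ext \<Gamma>' \<Delta>" "el \<Delta> X z" "el \<Delta> (x =\<^bsub>X\<^esub> z) q" for \<Delta> z q
    by (rule ty_sig[OF tyT[OF that(1,2)] famS[OF that(1) el_ex[OF that(2)] el_ex[OF that(3)]]], rule ty_id)
      (use that in \<open>auto intro: el_rfl elS ext_trans el_ext\<close>)
  have "tr \<Gamma>' (\<Sigma> c : ?T x. ?S x q c)"
  proof (rule tr_J[where C = "\<lambda>z q. \<Sigma> c : ?T z. ?S z q c", OF x _ tyS _ x q])
    show "fam2 (length \<Gamma>') (\<lambda>z q. \<Sigma> c : ?T z. ?S z q c)"
      by (insert ex, (assumption | rule par | rule par_leaf)+)
    define c where "c = (\<^bold>\<lambda> y : X. \<^bold>\<lambda> p : x =\<^bsub>X\<^esub> y. p)"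
    have inner: "el \<Delta> (x =\<^bsub>X\<^esub> y \<rightarrow> x =\<^bsub>X\<^esub> y) (\<^bold>\<lambda> p : x =\<^bsub>X\<^esub> y. p)" if "ext \<Gamma>' \<Delta>" "el \<Delta> X y" for \<Delta> y
      using I1[OF that] by (intro el_lam_arr) (auto simp: fam_def)
    have fc: "fam (length \<Gamma>') (\<lambda>y. \<^bold>\<lambda> p : x =\<^bsub>X\<^esub> y. p)"
      by (insert ex, (assumption | rule par | rule par_leaf)+)
    have c: "el \<Gamma>' (?T x) c" unfolding c_def
      by (rule el_lam[OF X' famT[OF e1 el_ex[OF x]] fc inner])
    have "tr \<Gamma>' (c \<cdot> x =\<^bsub>x =\<^bsub>X\<^esub> x \<rightarrow> x =\<^bsub>X\<^esub> x\<^esub> (\<^bold>\<lambda> p : x =\<^bsub>X\<^esub> x. p))" unfolding c_def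
      by (rule id_beta[OF X' famT[OF e1 el_ex[OF x]] fc x inner])
    from id_app_arr[OF I1[OF e1 x] this id_refl[OF el_rfl[OF x]]]
    have "tr \<Gamma>' (c \<cdot> x \<cdot> rfl x =\<^bsub>x =\<^bsub>X\<^esub> x\<^esub> (\<^bold>\<lambda> p : x =\<^bsub>X\<^esub> x. p) \<cdot> rfl x)" .
    also have "tr \<Gamma>' ((\<^bold>\<lambda> p : x =\<^bsub>X\<^esub> x. p) \<cdot> rfl x =\<^bsub>x =\<^bsub>X\<^esub> x\<^esub> rfl x)"
      using I1[OF e1 x] el_rfl[OF x] by (intro id_beta_arr) (auto simp: fam_def)
    finally show "tr \<Gamma>' (\<Sigma> c : ?T x. ?S x (rfl x) c)"
      using c famS[OF e1 el_ex[OF x] el_ex[OF el_rfl[OF x]]] tyS[OF e1 x el_rfl[OF x]] by (intro tr_sigI)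
  qed
  then obtain s where s: "el \<Gamma>' (\<Sigma> c : ?T x. ?S x q c) s" by (auto simp: tr_def)
  define c where "c = pr1 s"
  have c: "el \<Gamma>' (?T x) c" unfolding c_def using el_pr1[OF s] .
  have cq: "tr \<Gamma>' (c \<cdot> x \<cdot> q =\<^bsub>x =\<^bsub>X\<^esub> x\<^esub> rfl x)" unfolding c_def
    using el_tr[OF el_pr2[OF s famS[OF e1 el_ex[OF x] el_ex[OF q]]]] .
  have K: "el \<Delta> (x =\<^bsub>X\<^esub> y) (c \<cdot> y \<cdot> (g \<cdot> y \<cdot> r))" if "ext \<Gamma>' \<Delta>" "el \<Delta> X y" "el \<Delta> (R x y) r" for \<Delta> y r
    using elS[OF that(1) el_ext[OF that(1) x] that(2) G[OF that] el_ext[OF that(1) c]] .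
  have famK: "fam (length \<Delta>) (\<lambda>r. c \<cdot> y \<cdot> (g \<cdot> y \<cdot> r))" if "ext \<Gamma>' \<Delta>" "ex (length \<Delta>) y" for \<Delta> y
    by (insert ex_ext[OF that(1) el_ex[OF g]] ex_ext[OF that(1) el_ex[OF c]] that(2),
      (assumption | rule par | rule par_leaf)+)
  \<comment> \<open>Path induction on \<open>p\<close>. At reflexivity, \<open>f\<close> yields an
    element identical to \<open>r\<close> because \<open>R x x\<close> is a proposition,
    \<open>g\<close> turns it into \<open>q\<close>, and \<open>c\<close> cancels
    \<open>q\<close>.\<close>
  have main: "tr \<Delta> (c \<cdot> y \<cdot> (g \<cdot> y \<cdot> (f \<cdot> y \<cdot> p)) =\<^bsub>x =\<^bsub>X\<^esub> y\<^esub> p)"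
    if e: "ext \<Gamma>' \<Delta>" and y: "el \<Delta> X y" and p: "el \<Delta> (x =\<^bsub>X\<^esub> y) p" for \<Delta> y p
  proof (rule tr_J[OF el_ext[OF e x] _ _ _ y p])
    have exs: "ex (length \<Delta>) X" "ex (length \<Delta>) x" "ex (length \<Delta>) f" "ex (length \<Delta>) g" "ex (length \<Delta>) c"
      using ex el_ex[OF f] el_ex[OF g] el_ex[OF c] by (auto intro: ex_ext[OF e])
    show "fam2 (length \<Delta>) (\<lambda>y p. c \<cdot> y \<cdot> (g \<cdot> y \<cdot> (f \<cdot> y \<cdot> p)) =\<^bsub>x =\<^bsub>X\<^esub> y\<^esub> p)"
      by (insert exs, (assumption | rule par | rule par_leaf)+)
    show "ty \<Theta> (c \<cdot> y \<cdot> (g \<cdot> y \<cdot> (f \<cdot> y \<cdot> p)) =\<^bsub>x =\<^bsub>X\<^esub> y\<^esub> p)"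
      if "ext \<Delta> \<Theta>" "el \<Theta> X y" "el \<Theta> (x =\<^bsub>X\<^esub> y) p" for \<Theta> y p
      using that ext_trans[OF e that(1)] by (intro ty_id K F)
    have "tr \<Gamma>' (f \<cdot> x \<cdot> rfl x =\<^bsub>R x x\<^esub> r)"
      using isp[OF e0 x x] F[OF e1 x el_rfl[OF x]] r by (rule tr_is_propD)
    then have "tr \<Gamma>' (c \<cdot> x \<cdot> (g \<cdot> x \<cdot> (f \<cdot> x \<cdot> rfl x)) =\<^bsub>x =\<^bsub>X\<^esub> x\<^esub> c \<cdot> x \<cdot> (g \<cdot> x \<cdot> r))"
      using famK[OF e1 el_ex[OF x]] K[OF _ el_ext[OF _ x]] I1[OF e1 x]
      by (intro id_cong[where h = "\<lambda>r. c \<cdot> x \<cdot> (g \<cdot> x \<cdot> r)"])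
    from id_trans[OF this cq[unfolded q_def]] show "tr \<Delta> (c \<cdot> x \<cdot> (g \<cdot> x \<cdot> (f \<cdot> x \<cdot> rfl x)) =\<^bsub>x =\<^bsub>X\<^esub> x\<^esub> rfl x)"
      by (rule tr_ext[OF e])
  qed
  show "tr \<Gamma>' (is_prop (x =\<^bsub>X\<^esub> y0))"
  proof (rule tr_is_propI[OF I1[OF e1 y0]])
    fix \<Delta> p p' assume e: "ext \<Gamma>' \<Delta>" and p: "el \<Delta> (x =\<^bsub>X\<^esub> y0) p" and p': "el \<Delta> (x =\<^bsub>X\<^esub> y0) p'"
    note y = el_ext[OF e y0]
    \<comment> \<open>By \<open>main\<close> each path is recovered from its image in the
      proposition \<open>R x y0\<close>, where the two images coincide.\<close>
    have "tr \<Delta> (f \<cdot> y0 \<cdot> p =\<^bsub>R x y0\<^esub> f \<cdot> y0 \<cdot> p')"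
      using isp[OF ext_trans[OF e0 e] el_ext[OF e x] y] F[OF e y p] F[OF e y p'] by (rule tr_is_propD)
    then have "tr \<Delta> (c \<cdot> y0 \<cdot> (g \<cdot> y0 \<cdot> (f \<cdot> y0 \<cdot> p)) =\<^bsub>x =\<^bsub>X\<^esub> y0\<^esub> c \<cdot> y0 \<cdot> (g \<cdot> y0 \<cdot> (f \<cdot> y0 \<cdot> p')))"
      using famK[OF e el_ex[OF y]] K[OF ext_trans[OF e] el_ext[OF _ y]] I1[OF e y]
      by (intro id_cong[where h = "\<lambda>r. c \<cdot> y0 \<cdot> (g \<cdot> y0 \<cdot> r)"])
    then show "tr \<Delta> (p =\<^bsub>x =\<^bsub>X\<^esub> y0\<^esub> p')"
      by (rule id_trans[OF id_sym[OF main[OF e y p]] id_trans[OF _ main[OF e y p']]])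
  qed
qed


section \<open>Iterated products\<close>

definition fam3 :: "nat \<Rightarrow> (expr \<Rightarrow> expr \<Rightarrow> expr \<Rightarrow> expr) \<Rightarrow> bool" where
  "fam3 d P \<longleftrightarrow> (\<forall>w x x' y y' z z'. fixes_outer d w \<longrightarrow> rel w x x' \<longrightarrow> rel w y y' \<longrightarrow> rel w z z' \<longrightarrow>
     rel w (P x y z) (P x' y' z'))"

lemma fam3I:
  "(\<And>w x x' y y' z z'. fixes_outer d w \<Longrightarrow> rel w x x' \<Longrightarrow> rel w y y' \<Longrightarrow> rel w z z' \<Longrightarrow>
    rel w (P x y z) (P x' y' z')) \<Longrightarrow> fam3 d P"
  unfolding fam3_def by blast

lemma fam3_rel:
  "fixes_outer d w \<Longrightarrow> fam3 d P \<Longrightarrow> rel w x x' \<Longrightarrow> rel w y y' \<Longrightarrow> rel w z z' \<Longrightarrow> rel w (P x y z) (P x' y' z')"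
  unfolding fam3_def by blast

lemma fam3_ext: "ext \<Gamma> \<Delta> \<Longrightarrow> fam3 (length \<Gamma>) B \<Longrightarrow> fam3 (length \<Delta>) B"
  using ext_length fixes_outer_mono unfolding fam3_def by blast

text \<open>
  Being a type and being true obey the same introduction rules, so these are stated for both at once.
\<close>

lemma pi_intro:
  assumes "Q \<in> {ty, tr}" "ty \<Gamma> A" "fam (length \<Gamma>) B" "\<And>\<Delta> x. ext \<Gamma> \<Delta> \<Longrightarrow> el \<Delta> A x \<Longrightarrow> Q \<Delta> (B x)"
  shows "Q \<Gamma> (pi_ty A B)"
  using assms(1) ty_pi[OF assms(2,3)] tr_piI[OF assms(2,3)] assms(4) by auto

lemma arr_intro:
  assumes "Q \<in> {ty, tr}" "ty \<Gamma> A" "ex (length \<Gamma>) B" "\<And>\<Delta>. ext \<Gamma> \<Delta> \<Longrightarrow> tr \<Delta> A \<Longrightarrow> Q \<Delta> B"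
  shows "Q \<Gamma> (A \<rightarrow> B)"
  unfolding arr_def by (rule pi_intro[OF assms(1,2) fam_const[OF assms(3)]]) (blast intro: assms(4) el_tr)

lemma pi2_intro:
  assumes Q: "Q \<in> {ty, tr}" and A: "ty \<Gamma> A" and B: "ty \<Gamma> B" and P: "fam2 (length \<Gamma>) P"
    and q: "\<And>\<Delta> x y. ext \<Gamma> \<Delta> \<Longrightarrow> el \<Delta> A x \<Longrightarrow> el \<Delta> B y \<Longrightarrow> Q \<Delta> (P x y)"
  shows "Q \<Gamma> (\<Pi> x : A. \<Pi> y : B. P x y)"
proof (rule pi_intro[OF Q A])
  show "fam (length \<Gamma>) (\<lambda>x. \<Pi> y : B. P x y)"
    by (insert ty_ex[OF B], (assumption | rule par fam2_rel[OF _ P] | rule par_leaf)+)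
  fix \<Delta> x assume e: "ext \<Gamma> \<Delta>" and x: "el \<Delta> A x"
  show "Q \<Delta> (\<Pi> y : B. P x y)"
  proof (rule pi_intro[OF Q ty_ext[OF e B]])
    show "fam (length \<Delta>) (\<lambda>y. P x y)"
      by (insert el_ex[OF x], (assumption | rule par fam2_rel[OF _ fam2_ext[OF e P]] | rule par_leaf)+)
  qed (auto intro: q ext_trans[OF e] el_ext x)
qed

lemma pi3_intro:
  assumes Q: "Q \<in> {ty, tr}" and A: "ty \<Gamma> A" and B: "ty \<Gamma> B" and C: "ty \<Gamma> C" and P: "fam3 (length \<Gamma>) P"
    and q: "\<And>\<Delta> x y z. ext \<Gamma> \<Delta> \<Longrightarrow> el \<Delta> A x \<Longrightarrow> el \<Delta> B y \<Longrightarrow> el \<Delta> C z \<Longrightarrow> Q \<Delta> (P x y z)"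
  shows "Q \<Gamma> (\<Pi> x : A. \<Pi> y : B. \<Pi> z : C. P x y z)"
proof (rule pi_intro[OF Q A])
  show "fam (length \<Gamma>) (\<lambda>x. \<Pi> y : B. \<Pi> z : C. P x y z)"
    by (insert ty_ex[OF B] ty_ex[OF C], (assumption | rule par fam3_rel[OF _ P] | rule par_leaf)+)
  fix \<Delta> x assume e: "ext \<Gamma> \<Delta>" and x: "el \<Delta> A x"
  show "Q \<Delta> (\<Pi> y : B. \<Pi> z : C. P x y z)"
  proof (rule pi2_intro[OF Q ty_ext[OF e B] ty_ext[OF e C]])
    show "fam2 (length \<Delta>) (\<lambda>y. P x y)"
      by (insert el_ex[OF x], (assumption | rule par fam3_rel[OF _ fam3_ext[OF e P]] | rule par_leaf)+)
  qed (auto intro: q ext_trans[OF e] el_ext x)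
qed

lemma tr_pi2D:
  assumes t: "tr \<Gamma> (\<Pi> x : A. \<Pi> y : B. P x y)" and B: "ex (length \<Gamma>) B" and P: "fam2 (length \<Gamma>) P"
    and a: "el \<Gamma> A a" and b: "el \<Gamma> B b"
  shows "tr \<Gamma> (P a b)"
proof -
  have "fam (length \<Gamma>) (\<lambda>x. \<Pi> y : B. P x y)"
    by (insert B, (assumption | rule par fam2_rel[OF _ P] | rule par_leaf)+)
  moreover have "fam (length \<Gamma>) (\<lambda>y. P a y)"
    by (insert el_ex[OF a], (assumption | rule par fam2_rel[OF _ P] | rule par_leaf)+)
  ultimately show ?thesis using tr_piD[OF tr_piD[OF t _ a] _ b] by blast
qed

lemma tr_pi3D:
  assumes t: "tr \<Gamma> (\<Pi> x : A. \<Pi> y : B. \<Pi> z : C. P x y z)"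
    and B: "ex (length \<Gamma>) B" and C: "ex (length \<Gamma>) C" and P: "fam3 (length \<Gamma>) P"
    and a: "el \<Gamma> A a" and b: "el \<Gamma> B b" and c: "el \<Gamma> C c"
  shows "tr \<Gamma> (P a b c)"
proof -
  have "fam2 (length \<Gamma>) (\<lambda>x y. \<Pi> z : C. P x y z)"
    by (insert C, (assumption | rule par fam3_rel[OF _ P] | rule par_leaf)+)
  from tr_pi2D[OF t B this a b] have "tr \<Gamma> (\<Pi> z : C. P a b z)" .
  moreover have "fam (length \<Gamma>) (\<lambda>z. P a b z)"
    by (insert el_ex[OF a] el_ex[OF b], (assumption | rule par fam3_rel[OF _ P] | rule par_leaf)+)
  ultimately show ?thesis using tr_piD c by blast
qed

lemma tr_pi_iff:
  assumes "ty \<Gamma> A" "fam (length \<Gamma>) P"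
  shows "tr \<Gamma> (\<Pi> x : A. P x) \<longleftrightarrow> (\<forall>\<Delta> x. ext \<Gamma> \<Delta> \<longrightarrow> el \<Delta> A x \<longrightarrow> tr \<Delta> (P x))"
  using assms tr_piD[OF tr_ext _ ] fam_ext tr_piI[OF assms] by blast

lemma tr_pi2_iff:
  assumes "ty \<Gamma> A" "ty \<Gamma> B" "fam2 (length \<Gamma>) P"
  shows "tr \<Gamma> (\<Pi> x : A. \<Pi> y : B. P x y) \<longleftrightarrow>
    (\<forall>\<Delta> x y. ext \<Gamma> \<Delta> \<longrightarrow> el \<Delta> A x \<longrightarrow> el \<Delta> B y \<longrightarrow> tr \<Delta> (P x y))" (is "?l \<longleftrightarrow> ?r")
proof
  assume ?l
  then show ?r using tr_pi2D[OF tr_ext] ex_ext[OF _ ty_ex[OF assms(2)]] fam2_ext[OF _ assms(3)] by blast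
qed (use pi2_intro[of tr, OF _ assms] in blast)

lemma tr_pi3_iff:
  assumes "ty \<Gamma> A" "ty \<Gamma> B" "ty \<Gamma> C" "fam3 (length \<Gamma>) P"
  shows "tr \<Gamma> (\<Pi> x : A. \<Pi> y : B. \<Pi> z : C. P x y z) \<longleftrightarrow>
    (\<forall>\<Delta> x y z. ext \<Gamma> \<Delta> \<longrightarrow> el \<Delta> A x \<longrightarrow> el \<Delta> B y \<longrightarrow> el \<Delta> C z \<longrightarrow> tr \<Delta> (P x y z))" (is "?l \<longleftrightarrow> ?r")
proof
  assume ?l
  then show ?r
    using tr_pi3D[OF tr_ext] ex_ext[OF _ ty_ex[OF assms(2)]] ex_ext[OF _ ty_ex[OF assms(3)]]
      fam3_ext[OF _ assms(4)] by blast
qed (use pi3_intro[of tr, OF _ assms] in blast)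

lemma tr_prod_cong:
  "ty \<Gamma> A \<Longrightarrow> ty \<Gamma> B \<Longrightarrow> tr \<Gamma> A \<longleftrightarrow> P \<Longrightarrow> tr \<Gamma> B \<longleftrightarrow> Q \<Longrightarrow> tr \<Gamma> (A \<otimes> B) \<longleftrightarrow> P \<and> Q"
  using tr_prodI tr_prod1 tr_prod2 by blast


section \<open>Naturality for structures\<close>

text \<open>Polymorphic in the record extension, so that the same relation applies to the lattice
  part of an algebra.\<close>

definition rlat :: "world \<Rightarrow> 'a lat_scheme \<Rightarrow> 'b lat_scheme \<Rightarrow> bool" where
  "rlat w L L' \<longleftrightarrow> rel w (carr L) (carr L') \<and> rel w (lbot L) (lbot L') \<and> rel w (ltop L) (ltop L') \<and>
     rel w (lmeet L) (lmeet L') \<and> rel w (ljoin L) (ljoin L')"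

definition ralg :: "world \<Rightarrow> alg \<Rightarrow> alg \<Rightarrow> bool" where
  "ralg w A A' \<longleftrightarrow> rlat w A A' \<and> rel w (str A) (str A')"

definition exlat :: "nat \<Rightarrow> 'a lat_scheme \<Rightarrow> bool" where
  "exlat d L \<longleftrightarrow> ex d (carr L) \<and> ex d (lbot L) \<and> ex d (ltop L) \<and> ex d (lmeet L) \<and> ex d (ljoin L)"

definition exalg :: "nat \<Rightarrow> alg \<Rightarrow> bool" where
  "exalg d A \<longleftrightarrow> exlat d A \<and> ex d (str A)"

lemma rlat_lift: "rlat w L L' \<Longrightarrow> rlat (lift j w) L L'"
  by (auto simp: rlat_def rel_lift)

lemma ralg_lift: "ralg w L L' \<Longrightarrow> ralg (lift j w) L L'"
  by (auto simp: ralg_def rel_lift rlat_lift)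

lemma exlat_rlat: "fixes_outer d w \<Longrightarrow> exlat d L \<Longrightarrow> rlat w L L"
  by (auto simp: rlat_def exlat_def ex_rel)

lemma exalg_ralg: "fixes_outer d w \<Longrightarrow> exalg d L \<Longrightarrow> ralg w L L"
  by (auto simp: ralg_def exalg_def ex_rel exlat_rlat)

lemma ralg_rlat: "ralg w A A' \<Longrightarrow> rlat w A A'"
  by (simp add: ralg_def)

lemma rlat_fields:
  assumes "rlat w L L'"
  shows "rel w (carr L) (carr L')" "rel w (lbot L) (lbot L')" "rel w (ltop L) (ltop L')"
     "rel w (lmeet L) (lmeet L')" "rel w (ljoin L) (ljoin L')"
  using assms by (auto simp: rlat_def)

lemma ralg_str: "ralg w A A' \<Longrightarrow> rel w (str A) (str A')"
  by (simp add: ralg_def)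

lemmas par_fields = rlat_fields[OF ralg_rlat] ralg_str

lemma rel_lattice_laws: "rlat w L L' \<Longrightarrow> rel w (lattice_laws L) (lattice_laws L')"
  unfolding lattice_laws_def Let_def rlat_def
  by (elim conjE, (assumption | rule par rel_is_set | rule par_leaf)+)

lemma rel_leq: "rlat w L L' \<Longrightarrow> rel w x x' \<Longrightarrow> rel w y y' \<Longrightarrow> rel w (leq L x y) (leq L' x' y')"
  unfolding leq_def rlat_def
  by (elim conjE, (assumption | rule par | rule par_leaf)+)

lemma rel_lat_hom_laws:
  "rlat w L L' \<Longrightarrow> rlat w K K' \<Longrightarrow> rel w f f' \<Longrightarrow> rel w (lat_hom_laws L K f) (lat_hom_laws L' K' f')"
  unfolding lat_hom_laws_def rlat_def
  by (elim conjE, (assumption | rule par | rule par_leaf)+)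

lemma rel_alg_hom_laws:
  "rlat w I I' \<Longrightarrow> ralg w L L' \<Longrightarrow> ralg w K K' \<Longrightarrow> rel w f f' \<Longrightarrow>
    rel w (alg_hom_laws I L K f) (alg_hom_laws I' L' K' f')"
  unfolding alg_hom_laws_def
  by (assumption | rule par rel_lat_hom_laws ralg_rlat | (rule rlat_fields, assumption) |
      (rule par_fields, assumption) | rule par_leaf)+

lemma rel_alg_hom:
  "rlat w I I' \<Longrightarrow> ralg w L L' \<Longrightarrow> ralg w K K' \<Longrightarrow> rel w (alg_hom I L K) (alg_hom I' L' K')"
  unfolding alg_hom_def
  by (assumption | rule par rel_alg_hom_laws | (rule rlat_fields, assumption) |
      (rule par_fields, assumption) | rule par_leaf rlat_lift ralg_lift)+

lemma rel_is_alg_iso: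
  "rlat w I I' \<Longrightarrow> ralg w L L' \<Longrightarrow> ralg w K K' \<Longrightarrow> rel w f f' \<Longrightarrow>
    rel w (is_alg_iso I L K f) (is_alg_iso I' L' K' f')"
  unfolding is_alg_iso_def
  by (assumption | rule par rel_alg_hom_laws rel_alg_hom | (rule rlat_fields, assumption) |
      (rule par_fields, assumption) | rule par_leaf rlat_lift ralg_lift)+

lemma ralg_base_alg: "rlat w I I' \<Longrightarrow> ralg w (base_alg I) (base_alg I')"
  unfolding base_alg_def ralg_def rlat_def lat.extend_def
  by (auto intro!: rel_lam)

lemma rel_Spec: "rlat w I I' \<Longrightarrow> ralg w L L' \<Longrightarrow> rel w (Spec I L) (Spec I' L')"
  unfolding Spec_def by (intro rel_alg_hom ralg_base_alg)

lemma ralg_fun_alg: "rlat w I I' \<Longrightarrow> rel w X X' \<Longrightarrow> ralg w (fun_alg I X) (fun_alg I' X')"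
  unfolding fun_alg_def ralg_def rlat_def
  by (simp, elim conjE, intro conjI; (assumption | rule par | rule par_leaf)+)

lemma rel_iota: "rlat w I I' \<Longrightarrow> ralg w L L' \<Longrightarrow> rel w (iota I L) (iota I' L')"
  unfolding iota_def
  by (assumption | rule par rel_Spec | (rule par_fields, assumption) | rule par_leaf rlat_lift ralg_lift)+

lemma rel_quasi_coherent: "rlat w I I' \<Longrightarrow> ralg w L L' \<Longrightarrow> rel w (quasi_coherent I L) (quasi_coherent I' L')"
  unfolding quasi_coherent_def by (intro rel_is_alg_iso ralg_fun_alg rel_Spec rel_iota)

lemma lift_lift: "lift j (lift k w) = lift (j + k) w"
  by (cases w) (simp add: lift_def funpow_add ac_simps)

text \<open>\<open>P\<close> has to respect the relation only in worlds \<open>lift j w\<close>,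
  because the structure to which it is applied consists of variables bound inside;
  \<open>lift_lift\<close> merges the five binders into one lift.\<close>

lemma rel_all_lat:
  assumes "\<And>j L L'. rlat (lift j w) L L' \<Longrightarrow> rel (lift j w) (P L) (P' L')"
  shows "rel w (all_lat l P) (all_lat l P')"
  unfolding all_lat_def Let_def
proof (rule rel_pi[OF rel_univ])
  fix j1 C C' assume C: "rel (lift (Suc j1) w) C C'"
  show "rel (lift (Suc j1) w)
    (\<Pi> b : C. \<Pi> t : C. \<Pi> m : C \<rightarrow> C \<rightarrow> C. \<Pi> j : C \<rightarrow> C \<rightarrow> C.
      lattice_laws \<lparr>carr = C, lbot = b, ltop = t, lmeet = m, ljoin = j\<rparr> \<rightarrow>
      P \<lparr>carr = C, lbot = b, ltop = t, lmeet = m, ljoin = j\<rparr>)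
    (\<Pi> b : C'. \<Pi> t : C'. \<Pi> m : C' \<rightarrow> C' \<rightarrow> C'. \<Pi> j : C' \<rightarrow> C' \<rightarrow> C'.
      lattice_laws \<lparr>carr = C', lbot = b, ltop = t, lmeet = m, ljoin = j\<rparr> \<rightarrow>
      P' \<lparr>carr = C', lbot = b, ltop = t, lmeet = m, ljoin = j\<rparr>)"
  proof (intro rel_pi, goal_cases)
    case 1 show ?case by (rule C)
  next
    case (2 j2 b b') show ?case by (intro rel_lift C)
  next
    case (3 j2 b b' j3 t t') show ?case by (intro rel_arr rel_lift C)
  next
    case (4 j2 b b' j3 t t' j4 m m') show ?case by (intro rel_arr rel_lift C)
  next
    case (5 j2 b b' j3 t t' j4 m m' j5 j j')
    let ?L = "\<lparr>carr = C, lbot = b, ltop = t, lmeet = m, ljoin = j\<rparr>"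
    let ?L' = "\<lparr>carr = C', lbot = b', ltop = t', lmeet = m', ljoin = j'\<rparr>"
    have L: "rlat (lift (Suc j5) (lift (Suc j4) (lift (Suc j3) (lift (Suc j2) (lift (Suc j1) w))))) ?L ?L'"
      unfolding rlat_def using 5 C by (simp add: rel_lift)
    show ?case
      using assms[OF L[unfolded lift_lift]] by (intro rel_arr rel_lattice_laws L) (simp only: lift_lift)
  qed
qed

lemma rel_all_alg:
  assumes I: "rlat w I I'" and P: "\<And>j L L'. ralg (lift j w) L L' \<Longrightarrow> rel (lift j w) (P L) (P' L')"
  shows "rel w (all_alg l I P) (all_alg l I' P')"
  unfolding all_alg_def
proof (rule rel_all_lat, rule rel_pi)
  fix j and L L' :: lat assume L: "rlat (lift j w) L L'"
  show "rel (lift j w) (carr I \<rightarrow> carr L) (carr I' \<rightarrow> carr L')"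
    using rlat_fields[OF L] rlat_fields[OF rlat_lift[OF I]] by (intro rel_arr)
  fix k s s' assume s: "rel (lift (Suc k) (lift j w)) s s'"
  let ?A = "lat.extend L \<lparr>str = s\<rparr>" and ?A' = "lat.extend L' \<lparr>str = s'\<rparr>"
  have "ralg (lift (Suc k) (lift j w)) ?A ?A'"
    using rlat_lift[OF L, of "Suc k"] s by (simp add: ralg_def rlat_def lat.extend_def)
  from P[OF this[unfolded lift_lift]]
  have "rel (lift (Suc k) (lift j w)) (P ?A) (P' ?A')" unfolding lift_lift .
  then show "rel (lift (Suc k) (lift j w)) (lat_hom_laws I L s \<rightarrow> P ?A) (lat_hom_laws I' L' s' \<rightarrow> P' ?A')"
    by (intro rel_arr rel_lat_hom_laws rlat_lift I L s)
qed

lemma rel_is_free_on: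
  assumes I: "rlat w I I'" and F: "ralg w F F'" and i: "rel w i i'"
  shows "rel w (is_free_on l I F i) (is_free_on l I' F' i')"
  unfolding is_free_on_def
proof (rule rel_all_alg[OF I])
  fix j B B' assume B: "ralg (lift j w) B B'"
  note * = rlat_lift[OF I, of j] ralg_lift[OF F, of j] rel_lift[OF i, of j] B
  show "rel (lift j w) (\<Pi> b : carr B. is_contr (\<Sigma> h : alg_hom I F B. pr1 h \<cdot> i =\<^bsub>carr B\<^esub> b))
      (\<Pi> b : carr B'. is_contr (\<Sigma> h : alg_hom I' F' B'. pr1 h \<cdot> i' =\<^bsub>carr B'\<^esub> b))"
    by (insert *, (assumption | rule par rel_is_contr rel_alg_hom | (rule par_fields, assumption) |
        rule par_fields, rule ralg_lift, assumption |
        rule rlat_lift, assumption | rule par_leaf rlat_lift ralg_lift)+)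
qed

lemma rel_path_space: "rlat w I I' \<Longrightarrow> rel w X X' \<Longrightarrow> rel w (path_space I X) (path_space I' X')"
  unfolding path_space_def by (intro rel_arr rlat_fields)

lemma rel_endpoints: "rlat w I I' \<Longrightarrow> rel w X X' \<Longrightarrow> rel w (endpoints I X) (endpoints I' X')"
  unfolding endpoints_def
  by (assumption | rule par rel_path_space | (rule rlat_fields, assumption) | rule par_leaf rlat_lift ralg_lift)+

lemma rel_satisfaction_order:
  "rlat w I I' \<Longrightarrow> ralg w A A' \<Longrightarrow> rel w p p' \<Longrightarrow>
    rel w (satisfaction_order I A p) (satisfaction_order I' A' p')"
  unfolding satisfaction_order_def
  by (assumption | rule par rel_leq | (rule par_fields, assumption) | rule par_leaf rlat_lift ralg_lift)+

lemma rel_fiber: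
  "rel w X X' \<Longrightarrow> rel w Y Y' \<Longrightarrow> rel w f f' \<Longrightarrow> rel w y y' \<Longrightarrow> rel w (fiber X Y f y) (fiber X' Y' f' y')"
  unfolding fiber_def by (assumption | rule par | rule par_leaf)+

lemma rel_is_embedding:
  "rel w X X' \<Longrightarrow> rel w Y Y' \<Longrightarrow> rel w f f' \<Longrightarrow> rel w (is_embedding X Y f) (is_embedding X' Y' f')"
  unfolding is_embedding_def by (assumption | rule par rel_is_prop rel_fiber | rule par_leaf)+

lemma rel_has_image:
  assumes "rel w X X'" "rel w Y Y'" "rel w f f'"
    and S: "\<And>j y y'. rel (lift (Suc j) w) y y' \<Longrightarrow> rel (lift (Suc j) w) (S y) (S' y')"
  shows "rel w (has_image X Y f S) (has_image X' Y' f' S')"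
  unfolding has_image_def
  by (insert assms(1-3), (assumption | rule par rel_fiber | (rule S, assumption) | rule par_leaf)+)


section \<open>Distributive lattices in the type theory\<close>

text \<open>Typed operations without laws. This is the information available when the types of laws
  and of homomorphisms have to be shown well formed.\<close>

definition plat :: "tm list \<Rightarrow> 'a lat_scheme \<Rightarrow> bool" where
  "plat \<Gamma> L \<longleftrightarrow> ty \<Gamma> (carr L) \<and> el \<Gamma> (carr L) (lbot L) \<and> el \<Gamma> (carr L) (ltop L) \<and>
     el \<Gamma> (carr L \<rightarrow> carr L \<rightarrow> carr L) (lmeet L) \<and> el \<Gamma> (carr L \<rightarrow> carr L \<rightarrow> carr L) (ljoin L)"

definition lat :: "tm list \<Rightarrow> 'a lat_scheme \<Rightarrow> bool" where
  "lat \<Gamma> L \<longleftrightarrow> plat \<Gamma> L \<and> tr \<Gamma> (lattice_laws L)"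

lemma plat_ext: "ext \<Gamma> \<Delta> \<Longrightarrow> plat \<Gamma> L \<Longrightarrow> plat \<Delta> L"
  by (auto simp: plat_def intro: mono)

lemma lat_ext: "ext \<Gamma> \<Delta> \<Longrightarrow> lat \<Gamma> L \<Longrightarrow> lat \<Delta> L"
  by (auto simp: lat_def intro: mono plat_ext)

lemma plat_exlat: "plat \<Gamma> L \<Longrightarrow> exlat (length \<Gamma>) L"
  by (auto simp: plat_def exlat_def intro: el_ex ty_ex)

lemma lat_plat: "lat \<Gamma> L \<Longrightarrow> plat \<Gamma> L"
  by (simp add: lat_def)

lemma plat_fields:
  assumes "plat \<Gamma> L"
  shows plat_ty: "ty \<Gamma> (carr L)" and el_bot: "el \<Gamma> (carr L) (lbot L)" and el_top: "el \<Gamma> (carr L) (ltop L)"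
    and el_meet: "el \<Gamma> (carr L) x \<Longrightarrow> el \<Gamma> (carr L) y \<Longrightarrow> el \<Gamma> (carr L) (lmeet L \<cdot> x \<cdot> y)"
    and el_join: "el \<Gamma> (carr L) x \<Longrightarrow> el \<Gamma> (carr L) y \<Longrightarrow> el \<Gamma> (carr L) (ljoin L \<cdot> x \<cdot> y)"
  using assms by (auto simp: plat_def intro: el_arr2)

lemma id_meet:
  "plat \<Gamma> L \<Longrightarrow> tr \<Gamma> (x =\<^bsub>carr L\<^esub> x') \<Longrightarrow> tr \<Gamma> (y =\<^bsub>carr L\<^esub> y') \<Longrightarrow>
    tr \<Gamma> (lmeet L \<cdot> x \<cdot> y =\<^bsub>carr L\<^esub> lmeet L \<cdot> x' \<cdot> y')"
  by (intro id_app_arr) (auto simp: plat_def intro: ty_arr id_refl)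

lemma id_join:
  "plat \<Gamma> L \<Longrightarrow> tr \<Gamma> (x =\<^bsub>carr L\<^esub> x') \<Longrightarrow> tr \<Gamma> (y =\<^bsub>carr L\<^esub> y') \<Longrightarrow>
    tr \<Gamma> (ljoin L \<cdot> x \<cdot> y =\<^bsub>carr L\<^esub> ljoin L \<cdot> x' \<cdot> y')"
  by (intro id_app_arr) (auto simp: plat_def intro: ty_arr id_refl)

text \<open>The laws are moved from one nested product type to HOL statements about all extensions.
  They are used in this form for a given lattice and established in this form for the affine
  maps.\<close>

lemma lattice_laws_iff:
  assumes L: "plat \<Gamma> L"
  shows "ty \<Gamma> (lattice_laws L)"
    "tr \<Gamma> (lattice_laws L) \<longleftrightarrow> tr \<Gamma> (is_set (carr L)) \<and>
      (\<forall>\<Delta> x y z. ext \<Gamma> \<Delta> \<longrightarrow> el \<Delta> (carr L) x \<longrightarrow> el \<Delta> (carr L) y \<longrightarrow> el \<Delta> (carr L) z \<longrightarrow>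
        tr \<Delta> (lmeet L \<cdot> (lmeet L \<cdot> x \<cdot> y) \<cdot> z =\<^bsub>carr L\<^esub> lmeet L \<cdot> x \<cdot> (lmeet L \<cdot> y \<cdot> z))) \<and>
      (\<forall>\<Delta> x y z. ext \<Gamma> \<Delta> \<longrightarrow> el \<Delta> (carr L) x \<longrightarrow> el \<Delta> (carr L) y \<longrightarrow> el \<Delta> (carr L) z \<longrightarrow>
        tr \<Delta> (ljoin L \<cdot> (ljoin L \<cdot> x \<cdot> y) \<cdot> z =\<^bsub>carr L\<^esub> ljoin L \<cdot> x \<cdot> (ljoin L \<cdot> y \<cdot> z))) \<and>
      (\<forall>\<Delta> x y. ext \<Gamma> \<Delta> \<longrightarrow> el \<Delta> (carr L) x \<longrightarrow> el \<Delta> (carr L) y \<longrightarrow>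
        tr \<Delta> (lmeet L \<cdot> x \<cdot> y =\<^bsub>carr L\<^esub> lmeet L \<cdot> y \<cdot> x)) \<and>
      (\<forall>\<Delta> x y. ext \<Gamma> \<Delta> \<longrightarrow> el \<Delta> (carr L) x \<longrightarrow> el \<Delta> (carr L) y \<longrightarrow>
        tr \<Delta> (ljoin L \<cdot> x \<cdot> y =\<^bsub>carr L\<^esub> ljoin L \<cdot> y \<cdot> x)) \<and>
      (\<forall>\<Delta> x y. ext \<Gamma> \<Delta> \<longrightarrow> el \<Delta> (carr L) x \<longrightarrow> el \<Delta> (carr L) y \<longrightarrow>
        tr \<Delta> (lmeet L \<cdot> x \<cdot> (ljoin L \<cdot> x \<cdot> y) =\<^bsub>carr L\<^esub> x)) \<and>
      (\<forall>\<Delta> x y. ext \<Gamma> \<Delta> \<longrightarrow> el \<Delta> (carr L) x \<longrightarrow> el \<Delta> (carr L) y \<longrightarrow>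
        tr \<Delta> (ljoin L \<cdot> x \<cdot> (lmeet L \<cdot> x \<cdot> y) =\<^bsub>carr L\<^esub> x)) \<and>
      (\<forall>\<Delta> x. ext \<Gamma> \<Delta> \<longrightarrow> el \<Delta> (carr L) x \<longrightarrow> tr \<Delta> (lmeet L \<cdot> x \<cdot> ltop L =\<^bsub>carr L\<^esub> x)) \<and>
      (\<forall>\<Delta> x. ext \<Gamma> \<Delta> \<longrightarrow> el \<Delta> (carr L) x \<longrightarrow> tr \<Delta> (ljoin L \<cdot> x \<cdot> lbot L =\<^bsub>carr L\<^esub> x)) \<and>
      (\<forall>\<Delta> x y z. ext \<Gamma> \<Delta> \<longrightarrow> el \<Delta> (carr L) x \<longrightarrow> el \<Delta> (carr L) y \<longrightarrow> el \<Delta> (carr L) z \<longrightarrow>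
        tr \<Delta> (lmeet L \<cdot> x \<cdot> (ljoin L \<cdot> y \<cdot> z) =\<^bsub>carr L\<^esub> ljoin L \<cdot> (lmeet L \<cdot> x \<cdot> y) \<cdot> (lmeet L \<cdot> x \<cdot> z)))"
    (is "_ \<longleftrightarrow> ?laws")
proof -
  have exs: "ex (length \<Gamma>) (carr L)" "ex (length \<Gamma>) (lbot L)" "ex (length \<Gamma>) (ltop L)"
      "ex (length \<Gamma>) (lmeet L)" "ex (length \<Gamma>) (ljoin L)"
    using plat_exlat[OF L] by (auto simp: exlat_def)
  have fams: "fam3 (length \<Gamma>) (\<lambda>x y z. lmeet L \<cdot> (lmeet L \<cdot> x \<cdot> y) \<cdot> z =\<^bsub>carr L\<^esub> lmeet L \<cdot> x \<cdot> (lmeet L \<cdot> y \<cdot> z))"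
    "fam3 (length \<Gamma>) (\<lambda>x y z. ljoin L \<cdot> (ljoin L \<cdot> x \<cdot> y) \<cdot> z =\<^bsub>carr L\<^esub> ljoin L \<cdot> x \<cdot> (ljoin L \<cdot> y \<cdot> z))"
    "fam2 (length \<Gamma>) (\<lambda>x y. lmeet L \<cdot> x \<cdot> y =\<^bsub>carr L\<^esub> lmeet L \<cdot> y \<cdot> x)"
    "fam2 (length \<Gamma>) (\<lambda>x y. ljoin L \<cdot> x \<cdot> y =\<^bsub>carr L\<^esub> ljoin L \<cdot> y \<cdot> x)"
    "fam2 (length \<Gamma>) (\<lambda>x y. lmeet L \<cdot> x \<cdot> (ljoin L \<cdot> x \<cdot> y) =\<^bsub>carr L\<^esub> x)"
    "fam2 (length \<Gamma>) (\<lambda>x y. ljoin L \<cdot> x \<cdot> (lmeet L \<cdot> x \<cdot> y) =\<^bsub>carr L\<^esub> x)"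
    "fam (length \<Gamma>) (\<lambda>x. lmeet L \<cdot> x \<cdot> ltop L =\<^bsub>carr L\<^esub> x)"
    "fam (length \<Gamma>) (\<lambda>x. ljoin L \<cdot> x \<cdot> lbot L =\<^bsub>carr L\<^esub> x)"
    "fam3 (length \<Gamma>) (\<lambda>x y z. lmeet L \<cdot> x \<cdot> (ljoin L \<cdot> y \<cdot> z) =\<^bsub>carr L\<^esub> ljoin L \<cdot> (lmeet L \<cdot> x \<cdot> y) \<cdot> (lmeet L \<cdot> x \<cdot> z))"
    by (insert exs, (assumption | rule par fam3I | rule par_leaf)+)
  note C = plat_ty[OF L]
  note L' = plat_ext[OF _ L]
  have Q: "ty \<in> {ty, tr}" by simp
  note cl = ty_id el_meet el_join el_bot el_top L'
  note tys = pi3_intro[OF Q C C C fams(1)] pi3_intro[OF Q C C C fams(2)] pi2_intro[OF Q C C fams(3)]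
    pi2_intro[OF Q C C fams(4)] pi2_intro[OF Q C C fams(5)] pi2_intro[OF Q C C fams(6)]
    pi_intro[OF Q C fams(7)] pi_intro[OF Q C fams(8)] pi3_intro[OF Q C C C fams(9)] ty_is_set[OF C]
  show "ty \<Gamma> (lattice_laws L)"
    unfolding lattice_laws_def Let_def by (intro ty_prod tys; (intro cl; assumption)+)
  note iffs = tr_pi3_iff[OF C C C fams(1)] tr_pi3_iff[OF C C C fams(2)] tr_pi2_iff[OF C C fams(3)]
    tr_pi2_iff[OF C C fams(4)] tr_pi2_iff[OF C C fams(5)] tr_pi2_iff[OF C C fams(6)]
    tr_pi_iff[OF C fams(7)] tr_pi_iff[OF C fams(8)] tr_pi3_iff[OF C C C fams(9)]
  show "tr \<Gamma> (lattice_laws L) \<longleftrightarrow> ?laws"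
    unfolding lattice_laws_def Let_def
    by (intro tr_prod_cong ty_prod tys iffs refl; (intro cl; assumption))
qed


section \<open>Equational reasoning in distributive lattices\<close>

text \<open>The carrier is explicit because the intended model is a set of classes of elements
  inside a larger HOL type.\<close>

locale bdl =
  fixes Q :: "'a set" and m j :: "'a \<Rightarrow> 'a \<Rightarrow> 'a" and z u :: 'a
  assumes closed [simp]: "z \<in> Q" "u \<in> Q" "x \<in> Q \<Longrightarrow> y \<in> Q \<Longrightarrow> m x y \<in> Q" "x \<in> Q \<Longrightarrow> y \<in> Q \<Longrightarrow> j x y \<in> Q"
    and m_assoc: "x \<in> Q \<Longrightarrow> y \<in> Q \<Longrightarrow> v \<in> Q \<Longrightarrow> m (m x y) v = m x (m y v)"
    and j_assoc: "x \<in> Q \<Longrightarrow> y \<in> Q \<Longrightarrow> v \<in> Q \<Longrightarrow> j (j x y) v = j x (j y v)"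
    and m_comm: "x \<in> Q \<Longrightarrow> y \<in> Q \<Longrightarrow> m x y = m y x"
    and j_comm: "x \<in> Q \<Longrightarrow> y \<in> Q \<Longrightarrow> j x y = j y x"
    and absorb_m [simp]: "x \<in> Q \<Longrightarrow> y \<in> Q \<Longrightarrow> m x (j x y) = x"
    and absorb_j [simp]: "x \<in> Q \<Longrightarrow> y \<in> Q \<Longrightarrow> j x (m x y) = x"
    and m_top [simp]: "x \<in> Q \<Longrightarrow> m x u = x"
    and j_bot [simp]: "x \<in> Q \<Longrightarrow> j x z = x"
    and distrib: "x \<in> Q \<Longrightarrow> y \<in> Q \<Longrightarrow> v \<in> Q \<Longrightarrow> m x (j y v) = j (m x y) (m x v)"
begin

lemma m_left_comm: "x \<in> Q \<Longrightarrow> y \<in> Q \<Longrightarrow> v \<in> Q \<Longrightarrow> m x (m y v) = m y (m x v)"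
  using m_assoc m_comm by metis

lemma j_left_comm: "x \<in> Q \<Longrightarrow> y \<in> Q \<Longrightarrow> v \<in> Q \<Longrightarrow> j x (j y v) = j y (j x v)"
  using j_assoc j_comm by metis

lemma m_idem: "x \<in> Q \<Longrightarrow> m x x = x"
  using absorb_m[of x "m x x"] by simp

lemma m_bot: "x \<in> Q \<Longrightarrow> m x z = z"
  using absorb_j[of z x] j_bot[of "m z x"] j_comm[of z "m z x"] m_comm[of x z] by simp

lemma distrib_right: "x \<in> Q \<Longrightarrow> y \<in> Q \<Longrightarrow> v \<in> Q \<Longrightarrow> m (j y v) x = j (m y x) (m v x)"
  using distrib[of x y v] by (simp add: m_comm)

lemma line_bot: "x \<in> Q \<Longrightarrow> y \<in> Q \<Longrightarrow> j x (m y z) = x"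
  by (simp add: m_bot)

lemma join_le: "x \<in> Q \<Longrightarrow> y \<in> Q \<Longrightarrow> m x y = x \<Longrightarrow> j x y = y"
  using absorb_j[of y x] by (metis j_comm m_comm)

lemma line_top: "x \<in> Q \<Longrightarrow> y \<in> Q \<Longrightarrow> m x y = x \<Longrightarrow> j x (m y u) = y"
  by (simp add: join_le)

text \<open>The equation says \<open>y = x \<or> y\<close>, and absorption does the rest. Read with
  \<open>x = f(0)\<close> and \<open>y = f(1)\<close>, this is why an affine map has ordered end
  points.\<close>

lemma line_le: "x \<in> Q \<Longrightarrow> y \<in> Q \<Longrightarrow> y = j x (m y u) \<Longrightarrow> m x y = x"
  using absorb_m[of x y] by simp

lemma line_unit: "r \<in> Q \<Longrightarrow> j z (m u r) = r"
  using j_comm[of z r] m_comm[of u r] by simp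

lemma line_join:
  assumes "x \<in> Q" "y \<in> Q" "x' \<in> Q" "y' \<in> Q" "r \<in> Q"
  shows "j (j x (m y r)) (j x' (m y' r)) = j (j x x') (m (j y y') r)"
  using assms by (simp add: distrib_right j_assoc j_left_comm)

text \<open>Distributivity gives the expected two terms and the cross terms
  \<open>y \<and> r \<and> x'\<close> and \<open>x \<and> y' \<and> r\<close>. Since
  \<open>x\<close> lies below \<open>y\<close> and \<open>x'\<close> below \<open>y'\<close>, both
  cross terms lie below \<open>y \<and> y' \<and> r\<close> and are absorbed. This is what closes
  the affine maps under meets.\<close>

lemma line_meet:
  assumes [simp]: "x \<in> Q" "y \<in> Q" "x' \<in> Q" "y' \<in> Q" "r \<in> Q" and le: "m x y = x" "m x' y' = x'"
  shows "m (j x (m y r)) (j x' (m y' r)) = j (m x x') (m (m y y') r)"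
proof -
  define w where "w = m (m y y') r"
  have [simp]: "w \<in> Q" by (simp add: w_def)
  have "m (j x (m y r)) (j x' (m y' r)) =
      j (j (m x x') (m (m y r) x')) (j (m x (m y' r)) (m (m y r) (m y' r)))"
    by (simp add: distrib distrib_right)
  moreover have "m (m y r) x' = m x' w"
    unfolding w_def by (subst le(2)[symmetric]) (simp add: m_assoc m_comm m_left_comm)
  moreover have "m x (m y' r) = m x w"
    unfolding w_def by (subst le(1)[symmetric]) (simp add: m_assoc)
  moreover have "m (m y r) (m y' r) = w"
    using m_idem[of r] unfolding w_def by (simp add: m_assoc m_left_comm)
  moreover have "j (m x' w) w = w" "j (m x w) w = w"
    using absorb_j[of w x] absorb_j[of w x'] j_comm m_comm by auto
  ultimately have "m (j x (m y r)) (j x' (m y' r)) = j (m x x') w"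
    by (simp add: j_assoc)
  then show ?thesis by (simp add: w_def)
qed

end

text \<open>
  Passing to classes of elements up to identity turns the identities of the type theory in a fixed context
  into equations of HOL, to which the simplifier applies.
\<close>

definition cls :: "tm list \<Rightarrow> expr \<Rightarrow> expr \<Rightarrow> expr set" where
  "cls \<Gamma> A a = {b. tr \<Gamma> (a =\<^bsub>A\<^esub> b)}"

text \<open>The operation on classes goes through chosen representatives; \<open>cop_cls\<close>
  shows that the choice does not matter for classes of elements.\<close>

definition cop :: "tm list \<Rightarrow> expr \<Rightarrow> expr \<Rightarrow> expr set \<Rightarrow> expr set \<Rightarrow> expr set" where
  "cop \<Gamma> A f X Y = cls \<Gamma> A (f \<cdot> (SOME a. a \<in> X) \<cdot> (SOME b. b \<in> Y))"

lemma cls_eq_iff: "el \<Gamma> A a \<Longrightarrow> el \<Gamma> A b \<Longrightarrow> cls \<Gamma> A a = cls \<Gamma> A b \<longleftrightarrow> tr \<Gamma> (a =\<^bsub>A\<^esub> b)"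
  unfolding cls_def set_eq_iff mem_Collect_eq by (blast intro: id_refl id_sym id_trans)

lemma cop_cls:
  assumes A: "ty \<Gamma> A" and f: "el \<Gamma> (A \<rightarrow> A \<rightarrow> A) f" and a: "el \<Gamma> A a" and b: "el \<Gamma> A b"
  shows "cop \<Gamma> A f (cls \<Gamma> A a) (cls \<Gamma> A b) = cls \<Gamma> A (f \<cdot> a \<cdot> b)"
proof -
  have s: "tr \<Gamma> (a =\<^bsub>A\<^esub> (SOME x. x \<in> cls \<Gamma> A a))" if "el \<Gamma> A a" for a
    using someI[of "\<lambda>x. x \<in> cls \<Gamma> A a" a] id_refl[OF that] by (simp add: cls_def)
  have t: "tr \<Gamma> (f \<cdot> a \<cdot> b =\<^bsub>A\<^esub> f \<cdot> (SOME x. x \<in> cls \<Gamma> A a) \<cdot> (SOME x. x \<in> cls \<Gamma> A b))"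
    by (rule id_app_arr[OF A id_app_arr[OF ty_arr[OF A A] id_refl[OF f] s[OF a]] s[OF b]])
  show ?thesis unfolding cop_def using cls_eq_iff tr_idD(2,3)[OF t] t by blast
qed

lemma lat_laws:
  assumes L: "lat \<Gamma> L"
  shows lat_is_set: "tr \<Gamma> (is_set (carr L))"
    and "el \<Gamma> (carr L) x \<Longrightarrow> el \<Gamma> (carr L) y \<Longrightarrow> el \<Gamma> (carr L) z \<Longrightarrow>
      tr \<Gamma> (lmeet L \<cdot> (lmeet L \<cdot> x \<cdot> y) \<cdot> z =\<^bsub>carr L\<^esub> lmeet L \<cdot> x \<cdot> (lmeet L \<cdot> y \<cdot> z))"
    and "el \<Gamma> (carr L) x \<Longrightarrow> el \<Gamma> (carr L) y \<Longrightarrow> el \<Gamma> (carr L) z \<Longrightarrow>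
      tr \<Gamma> (ljoin L \<cdot> (ljoin L \<cdot> x \<cdot> y) \<cdot> z =\<^bsub>carr L\<^esub> ljoin L \<cdot> x \<cdot> (ljoin L \<cdot> y \<cdot> z))"
    and "el \<Gamma> (carr L) x \<Longrightarrow> el \<Gamma> (carr L) y \<Longrightarrow>
      tr \<Gamma> (lmeet L \<cdot> x \<cdot> y =\<^bsub>carr L\<^esub> lmeet L \<cdot> y \<cdot> x)"
    and "el \<Gamma> (carr L) x \<Longrightarrow> el \<Gamma> (carr L) y \<Longrightarrow>
      tr \<Gamma> (ljoin L \<cdot> x \<cdot> y =\<^bsub>carr L\<^esub> ljoin L \<cdot> y \<cdot> x)"
    and "el \<Gamma> (carr L) x \<Longrightarrow> el \<Gamma> (carr L) y \<Longrightarrow>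
      tr \<Gamma> (lmeet L \<cdot> x \<cdot> (ljoin L \<cdot> x \<cdot> y) =\<^bsub>carr L\<^esub> x)"
    and id_absorb_join: "el \<Gamma> (carr L) x \<Longrightarrow> el \<Gamma> (carr L) y \<Longrightarrow>
      tr \<Gamma> (ljoin L \<cdot> x \<cdot> (lmeet L \<cdot> x \<cdot> y) =\<^bsub>carr L\<^esub> x)"
    and "el \<Gamma> (carr L) x \<Longrightarrow> tr \<Gamma> (lmeet L \<cdot> x \<cdot> ltop L =\<^bsub>carr L\<^esub> x)"
    and "el \<Gamma> (carr L) x \<Longrightarrow> tr \<Gamma> (ljoin L \<cdot> x \<cdot> lbot L =\<^bsub>carr L\<^esub> x)"
    and "el \<Gamma> (carr L) x \<Longrightarrow> el \<Gamma> (carr L) y \<Longrightarrow> el \<Gamma> (carr L) z \<Longrightarrow>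
      tr \<Gamma> (lmeet L \<cdot> x \<cdot> (ljoin L \<cdot> y \<cdot> z) =\<^bsub>carr L\<^esub> ljoin L \<cdot> (lmeet L \<cdot> x \<cdot> y) \<cdot> (lmeet L \<cdot> x \<cdot> z))"
proof -
  note e = ext_refl[OF plat_ty[OF lat_plat[OF L]]]
  note h = L[unfolded lat_def lattice_laws_iff(2)[OF lat_plat[OF L]], THEN conjunct2]
  note h1 = h[THEN conjunct2] note h2 = h1[THEN conjunct2] note h3 = h2[THEN conjunct2]
  note h4 = h3[THEN conjunct2] note h5 = h4[THEN conjunct2] note h6 = h5[THEN conjunct2]
  note h7 = h6[THEN conjunct2] note h8 = h7[THEN conjunct2] note h9 = h8[THEN conjunct2]
  show "tr \<Gamma> (is_set (carr L))" by (rule h[THEN conjunct1])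
  let ?m = "\<lambda>x y. lmeet L \<cdot> x \<cdot> y" and ?j = "\<lambda>x y. ljoin L \<cdot> x \<cdot> y" and ?C = "carr L"
  { assume x: "el \<Gamma> ?C x"
    show "tr \<Gamma> (?m x (ltop L) =\<^bsub>?C\<^esub> x)" "tr \<Gamma> (?j x (lbot L) =\<^bsub>?C\<^esub> x)"
      by (fact h7[THEN conjunct1, rule_format, OF e x] h8[THEN conjunct1, rule_format, OF e x])+
    assume y: "el \<Gamma> ?C y"
    show "tr \<Gamma> (?m x y =\<^bsub>?C\<^esub> ?m y x)" "tr \<Gamma> (?j x y =\<^bsub>?C\<^esub> ?j y x)"
      "tr \<Gamma> (?m x (?j x y) =\<^bsub>?C\<^esub> x)" "tr \<Gamma> (?j x (?m x y) =\<^bsub>?C\<^esub> x)"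
      by (fact h3[THEN conjunct1, rule_format, OF e x y] h4[THEN conjunct1, rule_format, OF e x y]
          h5[THEN conjunct1, rule_format, OF e x y] h6[THEN conjunct1, rule_format, OF e x y])+
    assume z: "el \<Gamma> ?C z"
    show "tr \<Gamma> (?m (?m x y) z =\<^bsub>?C\<^esub> ?m x (?m y z))" "tr \<Gamma> (?j (?j x y) z =\<^bsub>?C\<^esub> ?j x (?j y z))"
      "tr \<Gamma> (?m x (?j y z) =\<^bsub>?C\<^esub> ?j (?m x y) (?m x z))"
      by (fact h1[THEN conjunct1, rule_format, OF e x y z] h2[THEN conjunct1, rule_format, OF e x y z]
          h9[rule_format, OF e x y z])+ }
qed

lemma lat_bdl:
  assumes L: "lat \<Gamma> L"
  shows "bdl (cls \<Gamma> (carr L) ` {a. el \<Gamma> (carr L) a}) (cop \<Gamma> (carr L) (lmeet L)) (cop \<Gamma> (carr L) (ljoin L))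
    (cls \<Gamma> (carr L) (lbot L)) (cls \<Gamma> (carr L) (ltop L))"
proof -
  note P = lat_plat[OF L]
  have cop: "cop \<Gamma> (carr L) (lmeet L) (cls \<Gamma> (carr L) a) (cls \<Gamma> (carr L) b) = cls \<Gamma> (carr L) (lmeet L \<cdot> a \<cdot> b)"
    "cop \<Gamma> (carr L) (ljoin L) (cls \<Gamma> (carr L) a) (cls \<Gamma> (carr L) b) = cls \<Gamma> (carr L) (ljoin L \<cdot> a \<cdot> b)"
    if "el \<Gamma> (carr L) a" "el \<Gamma> (carr L) b" for a b
    using cop_cls[OF plat_ty[OF P]] that P by (auto simp: plat_def)
  show ?thesis
    by unfold_locales
      (use P in \<open>auto simp: cop el_bot el_top el_meet el_join cls_eq_iff lat_laws[OF L] intro!: imageI del: equalityI\<close>)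
qed

section \<open>Identities between segments, transferred to the type theory\<close>

context
  fixes \<Gamma> and L :: "'a lat_scheme"
  assumes L: "lat \<Gamma> L"
begin

interpretation bdl "cls \<Gamma> (carr L) ` {a. el \<Gamma> (carr L) a}" "cop \<Gamma> (carr L) (lmeet L)"
    "cop \<Gamma> (carr L) (ljoin L)" "cls \<Gamma> (carr L) (lbot L)" "cls \<Gamma> (carr L) (ltop L)"
  by (rule lat_bdl[OF L])

private abbreviation c where "c \<equiv> cls \<Gamma> (carr L)"

private lemmas cl = el_bot el_top el_meet el_join lat_plat[OF L]

private lemma cop: "el \<Gamma> (carr L) a \<Longrightarrow> el \<Gamma> (carr L) b \<Longrightarrow>
      cop \<Gamma> (carr L) (lmeet L) (c a) (c b) = c (lmeet L \<cdot> a \<cdot> b)"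
    "el \<Gamma> (carr L) a \<Longrightarrow> el \<Gamma> (carr L) b \<Longrightarrow>
      cop \<Gamma> (carr L) (ljoin L) (c a) (c b) = c (ljoin L \<cdot> a \<cdot> b)"
  using cop_cls[OF plat_ty[OF lat_plat[OF L]]] lat_plat[OF L] by (auto simp: plat_def)

lemma id_line_bot:
  "el \<Gamma> (carr L) x \<Longrightarrow> el \<Gamma> (carr L) y \<Longrightarrow>
    tr \<Gamma> (ljoin L \<cdot> x \<cdot> (lmeet L \<cdot> y \<cdot> lbot L) =\<^bsub>carr L\<^esub> x)"
  using line_bot[of "c x" "c y"] by (simp add: cop cl cls_eq_iff)

lemma id_line_top:
  "tr \<Gamma> (leq L x y) \<Longrightarrow> tr \<Gamma> (ljoin L \<cdot> x \<cdot> (lmeet L \<cdot> y \<cdot> ltop L) =\<^bsub>carr L\<^esub> y)"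
  if "el \<Gamma> (carr L) x" "el \<Gamma> (carr L) y"
  using line_top[of "c x" "c y"] that by (simp add: cop cl cls_eq_iff leq_def del: m_top)

lemma leq_line:
  "tr \<Gamma> (y =\<^bsub>carr L\<^esub> ljoin L \<cdot> x \<cdot> (lmeet L \<cdot> y \<cdot> ltop L)) \<Longrightarrow> tr \<Gamma> (leq L x y)"
  if "el \<Gamma> (carr L) x" "el \<Gamma> (carr L) y"
  using line_le[of "c x" "c y"] that by (simp add: cop cl cls_eq_iff leq_def del: m_top)

lemma id_line_unit:
  "el \<Gamma> (carr L) r \<Longrightarrow> tr \<Gamma> (ljoin L \<cdot> lbot L \<cdot> (lmeet L \<cdot> ltop L \<cdot> r) =\<^bsub>carr L\<^esub> r)"
  using line_unit[of "c r"] by (simp add: cop cl cls_eq_iff)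

lemma id_line_join:
  assumes "el \<Gamma> (carr L) x" "el \<Gamma> (carr L) y" "el \<Gamma> (carr L) x'" "el \<Gamma> (carr L) y'" "el \<Gamma> (carr L) r"
  shows "tr \<Gamma> (ljoin L \<cdot> (ljoin L \<cdot> x \<cdot> (lmeet L \<cdot> y \<cdot> r)) \<cdot> (ljoin L \<cdot> x' \<cdot> (lmeet L \<cdot> y' \<cdot> r))
    =\<^bsub>carr L\<^esub> ljoin L \<cdot> (ljoin L \<cdot> x \<cdot> x') \<cdot> (lmeet L \<cdot> (ljoin L \<cdot> y \<cdot> y') \<cdot> r))"
  using line_join[of "c x" "c y" "c x'" "c y'" "c r"] assms by (simp add: cop cl cls_eq_iff)

lemma id_line_meet:
  assumes "el \<Gamma> (carr L) x" "el \<Gamma> (carr L) y" "el \<Gamma> (carr L) x'" "el \<Gamma> (carr L) y'" "el \<Gamma> (carr L) r"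
    and "tr \<Gamma> (leq L x y)" "tr \<Gamma> (leq L x' y')"
  shows "tr \<Gamma> (lmeet L \<cdot> (ljoin L \<cdot> x \<cdot> (lmeet L \<cdot> y \<cdot> r)) \<cdot> (ljoin L \<cdot> x' \<cdot> (lmeet L \<cdot> y' \<cdot> r))
    =\<^bsub>carr L\<^esub> ljoin L \<cdot> (lmeet L \<cdot> x \<cdot> x') \<cdot> (lmeet L \<cdot> (lmeet L \<cdot> y \<cdot> y') \<cdot> r))"
  using line_meet[of "c x" "c y" "c x'" "c y'" "c r"] assms by (simp add: cop cl cls_eq_iff leq_def)

end


section \<open>Algebras and homomorphisms\<close>

lemmas par_struct = par rel_is_prop rel_is_set rel_is_contr rel_lattice_laws rel_leq rel_lat_hom_laws
  rel_alg_hom_laws rel_alg_hom rel_is_alg_iso ralg_base_alg rel_Spec ralg_fun_alg rel_iota rel_quasi_coherent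
  rel_is_free_on rel_path_space rel_endpoints rel_satisfaction_order rel_fiber rel_is_embedding rel_has_image

lemmas leaf_struct = fixes_outer_lift exlat_rlat exalg_ralg ex_rel rlat_lift ralg_lift rel_lift

definition palg :: "tm list \<Rightarrow> lat \<Rightarrow> alg \<Rightarrow> bool" where
  "palg \<Gamma> I A \<longleftrightarrow> plat \<Gamma> A \<and> el \<Gamma> (carr I \<rightarrow> carr A) (str A)"

definition alg :: "tm list \<Rightarrow> lat \<Rightarrow> alg \<Rightarrow> bool" where
  "alg \<Gamma> I A \<longleftrightarrow> lat \<Gamma> A \<and> el \<Gamma> (carr I \<rightarrow> carr A) (str A) \<and> tr \<Gamma> (lat_hom_laws I A (str A))"

lemma alg_palg: "alg \<Gamma> I A \<Longrightarrow> palg \<Gamma> I A"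
  by (simp add: alg_def palg_def lat_def)

lemma alg_lat: "alg \<Gamma> I A \<Longrightarrow> lat \<Gamma> A"
  by (simp add: alg_def)

lemma palg_plat: "palg \<Gamma> I A \<Longrightarrow> plat \<Gamma> A"
  by (simp add: palg_def)

lemma palg_ext: "ext \<Gamma> \<Delta> \<Longrightarrow> palg \<Gamma> I A \<Longrightarrow> palg \<Delta> I A"
  by (auto simp: palg_def intro: plat_ext el_ext)

lemma alg_ext: "ext \<Gamma> \<Delta> \<Longrightarrow> alg \<Gamma> I A \<Longrightarrow> alg \<Delta> I A"
  by (auto simp: alg_def intro: lat_ext el_ext tr_ext)

lemma palg_exalg: "palg \<Gamma> I A \<Longrightarrow> exalg (length \<Gamma>) A"
  by (auto simp: palg_def exalg_def intro: plat_exlat el_ex)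

lemma el_str: "palg \<Gamma> I A \<Longrightarrow> el \<Gamma> (carr I) r \<Longrightarrow> el \<Gamma> (carr A) (str A \<cdot> r)"
  unfolding palg_def using el_arr plat_ty by blast

lemma exlat_fields:
  assumes "exlat d L"
  shows "ex d (carr L)" "ex d (lbot L)" "ex d (ltop L)" "ex d (lmeet L)" "ex d (ljoin L)"
  using assms by (auto simp: exlat_def)

lemma lat_hom_laws_iff:
  assumes A: "plat \<Gamma> A" and B: "plat \<Gamma> B" and f: "el \<Gamma> (carr A \<rightarrow> carr B) f"
  shows "ty \<Gamma> (lat_hom_laws A B f)"
    "tr \<Gamma> (lat_hom_laws A B f) \<longleftrightarrow>
      tr \<Gamma> (f \<cdot> lbot A =\<^bsub>carr B\<^esub> lbot B) \<and> tr \<Gamma> (f \<cdot> ltop A =\<^bsub>carr B\<^esub> ltop B) \<and>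
      (\<forall>\<Delta> x y. ext \<Gamma> \<Delta> \<longrightarrow> el \<Delta> (carr A) x \<longrightarrow> el \<Delta> (carr A) y \<longrightarrow>
        tr \<Delta> (f \<cdot> (lmeet A \<cdot> x \<cdot> y) =\<^bsub>carr B\<^esub> lmeet B \<cdot> (f \<cdot> x) \<cdot> (f \<cdot> y))) \<and>
      (\<forall>\<Delta> x y. ext \<Gamma> \<Delta> \<longrightarrow> el \<Delta> (carr A) x \<longrightarrow> el \<Delta> (carr A) y \<longrightarrow>
        tr \<Delta> (f \<cdot> (ljoin A \<cdot> x \<cdot> y) =\<^bsub>carr B\<^esub> ljoin B \<cdot> (f \<cdot> x) \<cdot> (f \<cdot> y)))"
    (is "_ \<longleftrightarrow> ?laws")
    "tr \<Gamma> (is_set (carr B)) \<Longrightarrow> tr \<Gamma> (is_prop (lat_hom_laws A B f))"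
proof -
  note exs = exlat_fields[OF plat_exlat[OF A]] exlat_fields[OF plat_exlat[OF B]] el_ex[OF f]
  have fams: "fam2 (length \<Gamma>) (\<lambda>x y. f \<cdot> (lmeet A \<cdot> x \<cdot> y) =\<^bsub>carr B\<^esub> lmeet B \<cdot> (f \<cdot> x) \<cdot> (f \<cdot> y))"
    "fam2 (length \<Gamma>) (\<lambda>x y. f \<cdot> (ljoin A \<cdot> x \<cdot> y) =\<^bsub>carr B\<^esub> ljoin B \<cdot> (f \<cdot> x) \<cdot> (f \<cdot> y))"
    by (insert exs, (assumption | rule par | rule par_leaf)+)
  note C = plat_ty[OF A]
  have Q: "ty \<in> {ty, tr}" by simp
  have cl: "el \<Delta> (carr B) (f \<cdot> x)" if "ext \<Gamma> \<Delta>" "el \<Delta> (carr A) x" for \<Delta> x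
    using el_arr[OF _ el_ext[OF that(1) f] that(2)] plat_ty[OF plat_ext[OF that(1) B]] .
  note A' = plat_ext[OF _ A] and B' = plat_ext[OF _ B] and e = ext_refl[OF C]
  have ids: "ty \<Gamma> (f \<cdot> lbot A =\<^bsub>carr B\<^esub> lbot B)" "ty \<Gamma> (f \<cdot> ltop A =\<^bsub>carr B\<^esub> ltop B)"
    using cl[OF e] A B by (auto intro: ty_id el_bot el_top)
  have ty: "ty \<Delta> (f \<cdot> (lmeet A \<cdot> x \<cdot> y) =\<^bsub>carr B\<^esub> lmeet B \<cdot> (f \<cdot> x) \<cdot> (f \<cdot> y))"
      "ty \<Delta> (f \<cdot> (ljoin A \<cdot> x \<cdot> y) =\<^bsub>carr B\<^esub> ljoin B \<cdot> (f \<cdot> x) \<cdot> (f \<cdot> y))"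
    if "ext \<Gamma> \<Delta>" "el \<Delta> (carr A) x" "el \<Delta> (carr A) y" for \<Delta> x y
    using that A'[OF that(1)] B'[OF that(1)] by (auto intro!: ty_id cl el_meet el_join)
  note tys = pi2_intro[OF Q C C fams(1) ty(1)] pi2_intro[OF Q C C fams(2) ty(2)] ids
  show t: "ty \<Gamma> (lat_hom_laws A B f)"
    unfolding lat_hom_laws_def by (intro ty_prod tys)
  note iffs = tr_pi2_iff[OF C C fams(1)] tr_pi2_iff[OF C C fams(2)]
  show "tr \<Gamma> (lat_hom_laws A B f) \<longleftrightarrow> ?laws"
    unfolding lat_hom_laws_def by (intro tr_prod_cong ty_prod tys iffs refl)
  assume S: "tr \<Gamma> (is_set (carr B))"
  have p: "tr \<Delta> (is_prop (a =\<^bsub>carr B\<^esub> b))" if "ext \<Gamma> \<Delta>" "ty \<Delta> (a =\<^bsub>carr B\<^esub> b)" for \<Delta> a b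
    using is_prop_id[OF tr_ext[OF that(1) S]] id_inversion[OF that(2)] by blast
  have prop2: "tr \<Gamma> (is_prop (\<Pi> x : carr A. \<Pi> y : carr A. P x y))"
    if "fam2 (length \<Gamma>) P"
      "\<And>\<Delta> x y. ext \<Gamma> \<Delta> \<Longrightarrow> el \<Delta> (carr A) x \<Longrightarrow> el \<Delta> (carr A) y \<Longrightarrow> tr \<Delta> (is_prop (P x y))" for P
  proof (rule is_prop_pi[OF C])
    show "fam (length \<Gamma>) (\<lambda>x. \<Pi> y : carr A. P x y)"
      by (insert exs, (assumption | rule par fam2_rel[OF _ that(1)] | rule par_leaf)+)
    fix \<Delta> x assume e: "ext \<Gamma> \<Delta>" and x: "el \<Delta> (carr A) x"
    show "tr \<Delta> (is_prop (\<Pi> y : carr A. P x y))"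
    proof (rule is_prop_pi[OF ty_ext[OF e C]])
      show "fam (length \<Delta>) (\<lambda>y. P x y)"
        by (insert el_ex[OF x], (assumption | rule par fam2_rel[OF _ fam2_ext[OF e that(1)]] | rule par_leaf)+)
    qed (auto intro: that(2) ext_trans[OF e] el_ext x)
  qed
  show "tr \<Gamma> (is_prop (lat_hom_laws A B f))"
    unfolding lat_hom_laws_def by (intro is_prop_prod prop2 fams p e ids ty)
qed

context
  fixes \<Gamma> I A B
  assumes I: "plat \<Gamma> I" and A: "palg \<Gamma> I A" and B: "palg \<Gamma> I B"
begin

lemma fam_alg_hom_laws: "fam (length \<Gamma>) (alg_hom_laws I A B)"
  by (insert palg_exalg[OF A] palg_exalg[OF B] plat_exlat[OF I], (assumption | rule par_struct | rule leaf_struct)+)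

lemma alg_hom_laws_iff:
  assumes f: "el \<Gamma> (carr A \<rightarrow> carr B) f"
  shows "ty \<Gamma> (alg_hom_laws I A B f)"
    "tr \<Gamma> (alg_hom_laws I A B f) \<longleftrightarrow> tr \<Gamma> (lat_hom_laws A B f) \<and>
      (\<forall>\<Delta> r. ext \<Gamma> \<Delta> \<longrightarrow> el \<Delta> (carr I) r \<longrightarrow> tr \<Delta> (f \<cdot> (str A \<cdot> r) =\<^bsub>carr B\<^esub> str B \<cdot> r))"
    "tr \<Gamma> (is_set (carr B)) \<Longrightarrow> tr \<Gamma> (is_prop (alg_hom_laws I A B f))"
proof -
  note PA = palg_plat[OF A] and PB = palg_plat[OF B]
  note exs = exlat_fields[OF plat_exlat[OF PB]] exlat_fields[OF plat_exlat[OF I]] el_ex[OF f]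
    palg_exalg[OF A, unfolded exalg_def, THEN conjunct2] palg_exalg[OF B, unfolded exalg_def, THEN conjunct2]
  have fam: "fam (length \<Gamma>) (\<lambda>r. f \<cdot> (str A \<cdot> r) =\<^bsub>carr B\<^esub> str B \<cdot> r)"
    by (insert exs, (assumption | rule par | rule par_leaf)+)
  have ty: "ty \<Delta> (f \<cdot> (str A \<cdot> r) =\<^bsub>carr B\<^esub> str B \<cdot> r)" if "ext \<Gamma> \<Delta>" "el \<Delta> (carr I) r" for \<Delta> r
    using el_str[OF palg_ext[OF that(1) A] that(2)] el_str[OF palg_ext[OF that(1) B] that(2)]
      el_arr[OF plat_ty[OF plat_ext[OF that(1) PB]] el_ext[OF that(1) f]] by (auto intro: ty_id)
  note C = plat_ty[OF I] and laws = lat_hom_laws_iff[OF PA PB f]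
  note ty' = ty_pi[OF C fam ty]
  show "ty \<Gamma> (alg_hom_laws I A B f)" unfolding alg_hom_laws_def by (intro ty_prod laws ty')
  show "tr \<Gamma> (alg_hom_laws I A B f) \<longleftrightarrow> tr \<Gamma> (lat_hom_laws A B f) \<and>
      (\<forall>\<Delta> r. ext \<Gamma> \<Delta> \<longrightarrow> el \<Delta> (carr I) r \<longrightarrow> tr \<Delta> (f \<cdot> (str A \<cdot> r) =\<^bsub>carr B\<^esub> str B \<cdot> r))"
    unfolding alg_hom_laws_def by (intro tr_prod_cong laws(1) ty' refl tr_pi_iff C fam)
  assume S: "tr \<Gamma> (is_set (carr B))"
  have p: "tr \<Delta> (is_prop (a =\<^bsub>carr B\<^esub> b))" if "ext \<Gamma> \<Delta>" "ty \<Delta> (a =\<^bsub>carr B\<^esub> b)" for \<Delta> a b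
    using is_prop_id[OF tr_ext[OF that(1) S]] id_inversion[OF that(2)] by blast
  show "tr \<Gamma> (is_prop (alg_hom_laws I A B f))"
    unfolding alg_hom_laws_def by (intro is_prop_prod is_prop_pi C fam p laws(3) S ty)
qed

lemma ty_carr_arr: "ty \<Gamma> (carr A \<rightarrow> carr B)"
  by (rule ty_arr[OF plat_ty[OF palg_plat[OF A]] plat_ty[OF palg_plat[OF B]]])

end

lemma ty_alg_hom:
  assumes "plat \<Gamma> I" "palg \<Gamma> I A" "palg \<Gamma> I B"
  shows "ty \<Gamma> (alg_hom I A B)"
  unfolding alg_hom_def
proof (rule ty_sig)
  fix \<Delta> f assume e: "ext \<Gamma> \<Delta>" and "el \<Delta> (carr A \<rightarrow> carr B) f"
  then show "ty \<Delta> (alg_hom_laws I A B f)"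
    using alg_hom_laws_iff(1)[OF plat_ext[OF e assms(1)] palg_ext[OF e assms(2)] palg_ext[OF e assms(3)]] by blast
qed (fact ty_carr_arr[OF assms] fam_alg_hom_laws[OF assms])+

context
  fixes \<Gamma> I A B
  assumes I: "plat \<Gamma> I" and A: "palg \<Gamma> I A" and B: "palg \<Gamma> I B"
begin

lemma el_hom_fun: "el \<Gamma> (alg_hom I A B) u \<Longrightarrow> el \<Gamma> (carr A \<rightarrow> carr B) (pr1 u)"
  unfolding alg_hom_def by (rule el_pr1)

lemma el_hom_app: "el \<Gamma> (alg_hom I A B) u \<Longrightarrow> el \<Gamma> (carr A) a \<Longrightarrow> el \<Gamma> (carr B) (pr1 u \<cdot> a)"
  by (rule el_arr[OF plat_ty[OF palg_plat[OF B]] el_hom_fun])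

lemma el_hom_laws: "el \<Gamma> (alg_hom I A B) u \<Longrightarrow> tr \<Gamma> (alg_hom_laws I A B (pr1 u))"
  unfolding alg_hom_def by (rule el_tr, rule el_pr2[OF _ fam_alg_hom_laws[OF I A B]])

text \<open>The proof of the laws is merely known to exist, so the homomorphism is obtained with an
  underlying function that is identical to \<open>f\<close> by the first projection rule. That
  suffices, because homomorphisms are compared through their values.\<close>

lemma hom_exists:
  assumes "el \<Gamma> (carr A \<rightarrow> carr B) f" "tr \<Gamma> (alg_hom_laws I A B f)"
  shows "\<exists>u. el \<Gamma> (alg_hom I A B) u \<and> tr \<Gamma> (pr1 u =\<^bsub>carr A \<rightarrow> carr B\<^esub> f)"
proof -
  obtain q where q: "el \<Gamma> (alg_hom_laws I A B f) q" using assms(2) by (auto simp: tr_def)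
  note * = assms(1) q fam_alg_hom_laws[OF I A B] ty_alg_hom[OF I A B, unfolded alg_hom_def]
  show ?thesis unfolding alg_hom_def using el_pair[OF *] id_pr1_beta[OF *] by blast
qed

text \<open>The laws are identities in a set and hence propositions, so only the underlying
  functions matter, and for these function extensionality applies.\<close>

lemma id_hom:
  assumes S: "tr \<Gamma> (is_set (carr B))" and u: "el \<Gamma> (alg_hom I A B) u" and v: "el \<Gamma> (alg_hom I A B) v"
    and *: "\<And>\<Delta> a. ext \<Gamma> \<Delta> \<Longrightarrow> el \<Delta> (carr A) a \<Longrightarrow> tr \<Delta> (pr1 u \<cdot> a =\<^bsub>carr B\<^esub> pr1 v \<cdot> a)"
  shows "tr \<Gamma> (u =\<^bsub>alg_hom I A B\<^esub> v)"
  unfolding alg_hom_def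
proof (rule id_sig_prop[OF u[unfolded alg_hom_def] v[unfolded alg_hom_def] fam_alg_hom_laws[OF I A B]])
  show "tr \<Gamma> (pr1 u =\<^bsub>carr A \<rightarrow> carr B\<^esub> pr1 v)"
    using * u v by (intro id_funext_arr plat_ty[OF palg_plat[OF B]] el_hom_fun)
  fix \<Delta> f assume e: "ext \<Gamma> \<Delta>" and "el \<Delta> (carr A \<rightarrow> carr B) f"
  then show "tr \<Delta> (is_prop (alg_hom_laws I A B f))"
    using alg_hom_laws_iff(3)[OF plat_ext[OF e I] palg_ext[OF e A] palg_ext[OF e B]] tr_ext[OF e S] by blast
qed

end

lemma base_alg_fields [simp]:
  "carr (base_alg I) = carr I" "lbot (base_alg I) = lbot I" "ltop (base_alg I) = ltop I"
  "lmeet (base_alg I) = lmeet I" "ljoin (base_alg I) = ljoin I" "str (base_alg I) = (\<^bold>\<lambda> r : carr I. r)"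
  by (simp_all add: base_alg_def lat.extend_def)

lemma id_identity: "el \<Gamma> A a \<Longrightarrow> tr \<Gamma> ((\<^bold>\<lambda> x : A. x) \<cdot> a =\<^bsub>A\<^esub> a)"
  using el_ty by (intro id_beta_arr) (auto simp: fam_def)

lemma el_identity: "ty \<Gamma> A \<Longrightarrow> el \<Gamma> (A \<rightarrow> A) (\<^bold>\<lambda> x : A. x)"
  by (intro el_lam_arr) (auto simp: fam_def)

text \<open>The structure map is a lambda term, so even the identity map preserves the operations
  only up to beta; hence the steps through \<open>id_identity\<close>.\<close>

lemma alg_base_alg:
  assumes "lat \<Gamma> I"
  shows "alg \<Gamma> I (base_alg I)"
proof -
  note P = lat_plat[OF assms]
  have P': "plat \<Gamma> (base_alg I)" using P by (simp add: plat_def)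
  have "lattice_laws (base_alg I) = lattice_laws I" by (simp add: lattice_laws_def)
  then have L: "lat \<Gamma> (base_alg I)" using assms P' by (simp add: lat_def)
  let ?i = "\<^bold>\<lambda> r : carr I. r"
  have i: "el \<Gamma> (carr I \<rightarrow> carr (base_alg I)) ?i" using el_identity[OF plat_ty[OF P]] by simp
  have "tr \<Gamma> (lat_hom_laws I (base_alg I) ?i)"
    unfolding lat_hom_laws_iff(2)[OF P P' i] base_alg_fields
  proof (intro conjI allI impI)
    fix \<Delta> x y assume e: "ext \<Gamma> \<Delta>" and *: "el \<Delta> (carr I) x" "el \<Delta> (carr I) y"
    note P1 = plat_ext[OF e P]
    show "tr \<Delta> (?i \<cdot> (lmeet I \<cdot> x \<cdot> y) =\<^bsub>carr I\<^esub> lmeet I \<cdot> (?i \<cdot> x) \<cdot> (?i \<cdot> y))"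
      by (rule id_trans[OF id_identity[OF el_meet[OF P1 *]]
          id_meet[OF P1 id_sym[OF id_identity[OF *(1)]] id_sym[OF id_identity[OF *(2)]]]])
    show "tr \<Delta> (?i \<cdot> (ljoin I \<cdot> x \<cdot> y) =\<^bsub>carr I\<^esub> ljoin I \<cdot> (?i \<cdot> x) \<cdot> (?i \<cdot> y))"
      by (rule id_trans[OF id_identity[OF el_join[OF P1 *]]
          id_join[OF P1 id_sym[OF id_identity[OF *(1)]] id_sym[OF id_identity[OF *(2)]]]])
  qed (intro id_identity el_bot el_top P)+
  then show ?thesis using L i by (simp add: alg_def)
qed

text \<open>For the well-formedness of \<open>quasi_coherent\<close>: this algebra, on the spectrum,
  is the codomain of \<open>iota\<close>.\<close>

lemma palg_fun_alg:
  assumes I: "plat \<Gamma> I" and X: "ty \<Gamma> X"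
  shows "palg \<Gamma> I (fun_alg I X)"
proof -
  note C = plat_ty[OF I]
  note XC = ty_arr[OF X C]
  note exs = exlat_fields[OF plat_exlat[OF I]] ty_ex[OF X]
  have const: "el \<Delta> (X \<rightarrow> carr I) (\<^bold>\<lambda> x : X. r)" if "ext \<Gamma> \<Delta>" "el \<Delta> (carr I) r" for \<Delta> r
    using mono(2)[OF that(1)] X C that(2) by (intro el_lam_arr fam_const el_ex) (auto intro: el_ext)
  have op: "el \<Gamma> ((X \<rightarrow> carr I) \<rightarrow> (X \<rightarrow> carr I) \<rightarrow> X \<rightarrow> carr I)
      (\<^bold>\<lambda> f : X \<rightarrow> carr I. \<^bold>\<lambda> g : X \<rightarrow> carr I. \<^bold>\<lambda> x : X. m \<cdot> (f \<cdot> x) \<cdot> (g \<cdot> x))"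
    if m: "el \<Gamma> (carr I \<rightarrow> carr I \<rightarrow> carr I) m" for m
  proof (rule el_lam_arr)
    show "fam (length \<Gamma>) (\<lambda>f. \<^bold>\<lambda> g : X \<rightarrow> carr I. \<^bold>\<lambda> x : X. m \<cdot> (f \<cdot> x) \<cdot> (g \<cdot> x))"
      by (insert exs el_ex[OF m], (assumption | rule par | rule par_leaf)+)
    fix \<Delta> f assume e: "ext \<Gamma> \<Delta>" and f: "el \<Delta> (X \<rightarrow> carr I) f"
    show "el \<Delta> ((X \<rightarrow> carr I) \<rightarrow> X \<rightarrow> carr I) (\<^bold>\<lambda> g : X \<rightarrow> carr I. \<^bold>\<lambda> x : X. m \<cdot> (f \<cdot> x) \<cdot> (g \<cdot> x))"
    proof (rule el_lam_arr)
      show "fam (length \<Delta>) (\<lambda>g. \<^bold>\<lambda> x : X. m \<cdot> (f \<cdot> x) \<cdot> (g \<cdot> x))"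
        by (insert exs[THEN ex_ext[OF e]] ex_ext[OF e el_ex[OF m]] el_ex[OF f], (assumption | rule par | rule par_leaf)+)
      fix \<Theta> g assume e': "ext \<Delta> \<Theta>" and g: "el \<Theta> (X \<rightarrow> carr I) g"
      note e2 = ext_trans[OF e e']
      show "el \<Theta> (X \<rightarrow> carr I) (\<^bold>\<lambda> x : X. m \<cdot> (f \<cdot> x) \<cdot> (g \<cdot> x))"
      proof (rule el_lam_arr)
        show "fam (length \<Theta>) (\<lambda>x. m \<cdot> (f \<cdot> x) \<cdot> (g \<cdot> x))"
          by (insert ex_ext[OF e2 el_ex[OF m]] ex_ext[OF e' el_ex[OF f]] el_ex[OF g], (assumption | rule par | rule par_leaf)+)
        fix \<Xi> x assume e'': "ext \<Theta> \<Xi>" and x: "el \<Xi> X x"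
        note e3 = ext_trans[OF e2 e'']
        show "el \<Xi> (carr I) (m \<cdot> (f \<cdot> x) \<cdot> (g \<cdot> x))"
          using el_ext[OF e3 m] el_ext[OF ext_trans[OF e' e''] f] el_ext[OF e'' g] x ty_ext[OF e3 C]
          by (intro el_arr2[of _ "carr I" _ "carr I"] el_arr[of _ _ X])
      qed (intro ty_ext[OF e2] X C)+
    qed (intro ty_ext[OF e] XC)+
  qed (intro ty_arr XC)+
  have fc: "fam (length \<Gamma>) (\<lambda>r. \<^bold>\<lambda> x : X. r)"
    by (insert exs, (assumption | rule par | rule par_leaf)+)
  note e = ext_refl[OF C]
  show ?thesis
    using op el_lam_arr[OF C XC fc const] const[OF e] XC I
    unfolding palg_def plat_def fun_alg_def by simp
qed

lemma alg_homI:
  assumes I: "plat \<Gamma> I" and A: "palg \<Gamma> I A" and B: "palg \<Gamma> I B" and f: "el \<Gamma> (carr A \<rightarrow> carr B) f"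
    and "tr \<Gamma> (f \<cdot> lbot A =\<^bsub>carr B\<^esub> lbot B)" "tr \<Gamma> (f \<cdot> ltop A =\<^bsub>carr B\<^esub> ltop B)"
    and "\<And>\<Delta> x y. ext \<Gamma> \<Delta> \<Longrightarrow> el \<Delta> (carr A) x \<Longrightarrow> el \<Delta> (carr A) y \<Longrightarrow>
      tr \<Delta> (f \<cdot> (lmeet A \<cdot> x \<cdot> y) =\<^bsub>carr B\<^esub> lmeet B \<cdot> (f \<cdot> x) \<cdot> (f \<cdot> y))"
    and "\<And>\<Delta> x y. ext \<Gamma> \<Delta> \<Longrightarrow> el \<Delta> (carr A) x \<Longrightarrow> el \<Delta> (carr A) y \<Longrightarrow>
      tr \<Delta> (f \<cdot> (ljoin A \<cdot> x \<cdot> y) =\<^bsub>carr B\<^esub> ljoin B \<cdot> (f \<cdot> x) \<cdot> (f \<cdot> y))"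
    and "\<And>\<Delta> r. ext \<Gamma> \<Delta> \<Longrightarrow> el \<Delta> (carr I) r \<Longrightarrow> tr \<Delta> (f \<cdot> (str A \<cdot> r) =\<^bsub>carr B\<^esub> str B \<cdot> r)"
  shows "tr \<Gamma> (alg_hom_laws I A B f)"
  unfolding alg_hom_laws_iff(2)[OF I A B f] lat_hom_laws_iff(2)[OF palg_plat[OF A] palg_plat[OF B] f]
  using assms(5-) by simp

lemma alg_homD:
  assumes I: "plat \<Gamma> I" and A: "palg \<Gamma> I A" and B: "palg \<Gamma> I B" and f: "el \<Gamma> (carr A \<rightarrow> carr B) f"
    and h: "tr \<Gamma> (alg_hom_laws I A B f)"
  shows "tr \<Gamma> (f \<cdot> lbot A =\<^bsub>carr B\<^esub> lbot B)" "tr \<Gamma> (f \<cdot> ltop A =\<^bsub>carr B\<^esub> ltop B)"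
    and "el \<Gamma> (carr A) x \<Longrightarrow> el \<Gamma> (carr A) y \<Longrightarrow>
      tr \<Gamma> (f \<cdot> (lmeet A \<cdot> x \<cdot> y) =\<^bsub>carr B\<^esub> lmeet B \<cdot> (f \<cdot> x) \<cdot> (f \<cdot> y))"
    and "el \<Gamma> (carr A) x \<Longrightarrow> el \<Gamma> (carr A) y \<Longrightarrow>
      tr \<Gamma> (f \<cdot> (ljoin A \<cdot> x \<cdot> y) =\<^bsub>carr B\<^esub> ljoin B \<cdot> (f \<cdot> x) \<cdot> (f \<cdot> y))"
    and "el \<Gamma> (carr I) r \<Longrightarrow> tr \<Gamma> (f \<cdot> (str A \<cdot> r) =\<^bsub>carr B\<^esub> str B \<cdot> r)"
  using h[unfolded alg_hom_laws_iff(2)[OF I A B f] lat_hom_laws_iff(2)[OF palg_plat[OF A] palg_plat[OF B] f]]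
    ext_refl[OF plat_ty[OF I]] by simp_all

text \<open>Serves to follow the lift of the generator into the affine maps by evaluation at an
  element, which gives a second homomorphism to compare with a point.\<close>

lemma hom_compose:
  assumes I: "plat \<Gamma> I" and A: "palg \<Gamma> I A" and B: "palg \<Gamma> I B" and D: "palg \<Gamma> I D"
    and g: "el \<Gamma> (carr A \<rightarrow> carr B) g" "tr \<Gamma> (alg_hom_laws I A B g)"
    and f: "el \<Gamma> (carr B \<rightarrow> carr D) f" "tr \<Gamma> (alg_hom_laws I B D f)"
  shows "\<exists>h. el \<Gamma> (carr A \<rightarrow> carr D) h \<and> tr \<Gamma> (alg_hom_laws I A D h) \<and>
    (\<forall>a. el \<Gamma> (carr A) a \<longrightarrow> tr \<Gamma> (h \<cdot> a =\<^bsub>carr D\<^esub> f \<cdot> (g \<cdot> a)))"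
proof -
  define h where "h = (\<^bold>\<lambda> a : carr A. f \<cdot> (g \<cdot> a))"
  note CA = plat_ty[OF palg_plat[OF A]] and CB = plat_ty[OF palg_plat[OF B]] and CD = plat_ty[OF palg_plat[OF D]]
  have fam: "fam (length \<Gamma>) (\<lambda>a. f \<cdot> (g \<cdot> a))"
    by (insert el_ex[OF f(1)] el_ex[OF g(1)], (assumption | rule par | rule par_leaf)+)
  have ga: "el \<Delta> (carr B) (g \<cdot> a)" if "ext \<Gamma> \<Delta>" "el \<Delta> (carr A) a" for \<Delta> a
    by (rule el_arr[OF ty_ext[OF that(1) CB] el_ext[OF that(1) g(1)] that(2)])
  have fga: "el \<Delta> (carr D) (f \<cdot> (g \<cdot> a))" if "ext \<Gamma> \<Delta>" "el \<Delta> (carr A) a" for \<Delta> a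
    by (rule el_arr[OF ty_ext[OF that(1) CD] el_ext[OF that(1) f(1)] ga[OF that]])
  have h: "el \<Gamma> (carr A \<rightarrow> carr D) h" unfolding h_def by (rule el_lam_arr[OF CA CD fam fga])
  have beta: "tr \<Delta> (h \<cdot> a =\<^bsub>carr D\<^esub> f \<cdot> (g \<cdot> a))" if "ext \<Gamma> \<Delta>" "el \<Delta> (carr A) a" for \<Delta> a
    unfolding h_def
    by (rule id_beta_arr[OF ty_ext[OF that(1) CA] ty_ext[OF that(1) CD] fam_ext[OF that(1) fam] fga[OF ext_trans[OF that(1)]] that(2)])
  have fc: "tr \<Delta> (f \<cdot> x =\<^bsub>carr D\<^esub> f \<cdot> y)" if "ext \<Gamma> \<Delta>" "tr \<Delta> (x =\<^bsub>carr B\<^esub> y)" for \<Delta> x y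
    by (rule id_app_arr[OF ty_ext[OF that(1) CD] id_refl[OF el_ext[OF that(1) f(1)]] that(2)])
  have gl: "plat \<Delta> I" "palg \<Delta> I A" "palg \<Delta> I B" "el \<Delta> (carr A \<rightarrow> carr B) g" "tr \<Delta> (alg_hom_laws I A B g)"
    and fl: "plat \<Delta> I" "palg \<Delta> I B" "palg \<Delta> I D" "el \<Delta> (carr B \<rightarrow> carr D) f" "tr \<Delta> (alg_hom_laws I B D f)"
    if "ext \<Gamma> \<Delta>" for \<Delta>
    using that I A B D f g by (auto intro: plat_ext palg_ext mono)
  note e = ext_refl[OF CA]
  note gD = alg_homD[OF gl] and fD = alg_homD[OF fl]
  have "tr \<Gamma> (alg_hom_laws I A D h)"
  proof (rule alg_homI[OF I A D h])
    show "tr \<Gamma> (h \<cdot> lbot A =\<^bsub>carr D\<^esub> lbot D)"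
      by (rule id_trans[OF beta[OF e el_bot[OF palg_plat[OF A]]] id_trans[OF fc[OF e gD(1)[OF e e e e e]] fD(1)[OF e e e e e]]])
    show "tr \<Gamma> (h \<cdot> ltop A =\<^bsub>carr D\<^esub> ltop D)"
      by (rule id_trans[OF beta[OF e el_top[OF palg_plat[OF A]]] id_trans[OF fc[OF e gD(2)[OF e e e e e]] fD(2)[OF e e e e e]]])
    fix \<Delta> assume e: "ext \<Gamma> \<Delta>"
    note PA = palg_plat[OF palg_ext[OF e A]] and PD = palg_plat[OF palg_ext[OF e D]]
    { fix x y assume x: "el \<Delta> (carr A) x" and y: "el \<Delta> (carr A) y"
      show "tr \<Delta> (h \<cdot> (lmeet A \<cdot> x \<cdot> y) =\<^bsub>carr D\<^esub> lmeet D \<cdot> (h \<cdot> x) \<cdot> (h \<cdot> y))"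
        by (rule id_trans[OF beta[OF e el_meet[OF PA x y]] id_trans[OF fc[OF e gD(3)[OF e e e e e x y]]
            id_trans[OF fD(3)[OF e e e e e ga[OF e x] ga[OF e y]]
              id_meet[OF PD id_sym[OF beta[OF e x]] id_sym[OF beta[OF e y]]]]]])
      show "tr \<Delta> (h \<cdot> (ljoin A \<cdot> x \<cdot> y) =\<^bsub>carr D\<^esub> ljoin D \<cdot> (h \<cdot> x) \<cdot> (h \<cdot> y))"
        by (rule id_trans[OF beta[OF e el_join[OF PA x y]] id_trans[OF fc[OF e gD(4)[OF e e e e e x y]]
            id_trans[OF fD(4)[OF e e e e e ga[OF e x] ga[OF e y]]
              id_join[OF PD id_sym[OF beta[OF e x]] id_sym[OF beta[OF e y]]]]]]) }
    fix r assume r: "el \<Delta> (carr I) r"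
    show "tr \<Delta> (h \<cdot> (str A \<cdot> r) =\<^bsub>carr D\<^esub> str D \<cdot> r)"
      by (rule id_trans[OF beta[OF e el_str[OF palg_ext[OF e A] r]]
          id_trans[OF fc[OF e gD(5)[OF e e e e e r]] fD(5)[OF e e e e e r]]])
  qed
  then show ?thesis using h beta[OF e] by blast
qed


section \<open>Quantification over structures\<close>

text \<open>The counterpart of \<open>fam\<close> for HOL functions whose argument is a structure:
  quantification over structures needs it where a \<open>\<Pi>\<close>-type needs
  \<open>fam\<close>.\<close>

definition flat :: "nat \<Rightarrow> (lat \<Rightarrow> expr) \<Rightarrow> bool" where
  "flat d P \<longleftrightarrow> (\<forall>w L L'. fixes_outer d w \<longrightarrow> rlat w L L' \<longrightarrow> rel w (P L) (P L'))"

definition falg :: "nat \<Rightarrow> (alg \<Rightarrow> expr) \<Rightarrow> bool" where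
  "falg d P \<longleftrightarrow> (\<forall>w A A'. fixes_outer d w \<longrightarrow> ralg w A A' \<longrightarrow> rel w (P A) (P A'))"

lemma flat_rel: "fixes_outer d w \<Longrightarrow> flat d P \<Longrightarrow> rlat w L L' \<Longrightarrow> rel w (P L) (P L')"
  unfolding flat_def by blast

lemma flatI: "(\<And>w L L'. fixes_outer d w \<Longrightarrow> rlat w L L' \<Longrightarrow> rel w (P L) (P L')) \<Longrightarrow> flat d P"
  unfolding flat_def by blast

lemma falg_rel: "fixes_outer d w \<Longrightarrow> falg d P \<Longrightarrow> ralg w L L' \<Longrightarrow> rel w (P L) (P L')"
  unfolding falg_def by blast

lemma falgI: "(\<And>w L L'. fixes_outer d w \<Longrightarrow> ralg w L L' \<Longrightarrow> rel w (P L) (P L')) \<Longrightarrow> falg d P"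
  unfolding falg_def by blast

lemma flat_ext: "ext \<Gamma> \<Delta> \<Longrightarrow> flat (length \<Gamma>) B \<Longrightarrow> flat (length \<Delta>) B"
  using ext_length fixes_outer_mono unfolding flat_def by blast

lemma falg_ext: "ext \<Gamma> \<Delta> \<Longrightarrow> falg (length \<Gamma>) B \<Longrightarrow> falg (length \<Delta>) B"
  using ext_length fixes_outer_mono unfolding falg_def by blast

lemma rlat_record:
  "rel w C C' \<Longrightarrow> rel w b b' \<Longrightarrow> rel w t t' \<Longrightarrow> rel w m m' \<Longrightarrow> rel w j j' \<Longrightarrow>
    rlat w \<lparr>carr = C, lbot = b, ltop = t, lmeet = m, ljoin = j\<rparr>
      \<lparr>carr = C', lbot = b', ltop = t', lmeet = m', ljoin = j'\<rparr>"
  by (simp add: rlat_def)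

lemma ralg_extend:
  "rlat w L L' \<Longrightarrow> rel w s s' \<Longrightarrow> ralg w (lat.extend L \<lparr>str = s\<rparr>) (lat.extend L' \<lparr>str = s'\<rparr>)"
  by (simp add: ralg_def rlat_def lat.extend_def)

lemma tr_arrD: "ex (length \<Gamma>) B \<Longrightarrow> tr \<Gamma> (A \<rightarrow> B) \<Longrightarrow> tr \<Gamma> A \<Longrightarrow> tr \<Gamma> B"
  unfolding arr_def tr_def using el_app[of \<Gamma> A "\<lambda>_. B"] fam_const by blast

lemma all_lat_intro:
  assumes Q: "Q \<in> {ty, tr}" and c: "ctx \<Gamma>" and P: "flat (length \<Gamma>) P"
    and q: "\<And>\<Delta> L. ext \<Gamma> \<Delta> \<Longrightarrow> lat \<Delta> L \<Longrightarrow> tp \<Delta> l (carr L) \<Longrightarrow> Q \<Delta> (P L)"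
  shows "Q \<Gamma> (all_lat l P)"
proof -
  let ?L = "\<lambda>C b t m j. \<lparr>carr = C, lbot = b, ltop = t, lmeet = m, ljoin = j\<rparr>"
  let ?P1 = "\<lambda>C b t m j. lattice_laws (?L C b t m j) \<rightarrow> P (?L C b t m j)"
  let ?P2 = "\<lambda>C b t m. \<Pi> j : C \<rightarrow> C \<rightarrow> C. ?P1 C b t m j"
  let ?P3 = "\<lambda>C b t. \<Pi> m : C \<rightarrow> C \<rightarrow> C. ?P2 C b t m"
  let ?P4 = "\<lambda>C b. \<Pi> t : C. ?P3 C b t"
  let ?P5 = "\<lambda>C. \<Pi> b : C. ?P4 C b"
  have "Q \<Gamma> (\<Pi> C : univ l. ?P5 C)"
  proof (rule pi_intro[OF Q ty_univ[OF c]])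
    show "fam (length \<Gamma>) ?P5"
      by (assumption | rule par rel_lattice_laws rlat_record flat_rel[OF _ P] | rule par_leaf)+
    fix \<Gamma>1 C assume e1: "ext \<Gamma> \<Gamma>1" and "el \<Gamma>1 (univ l) C"
    then have C: "tp \<Gamma>1 l C" by (simp add: el_univ)
    show "Q \<Gamma>1 (?P5 C)"
    proof (rule pi_intro[OF Q tp_ty[OF C]])
      show "fam (length \<Gamma>1) (?P4 C)"
        by (insert tp_ex[OF C],
          (assumption | rule par rel_lattice_laws rlat_record flat_rel[OF _ flat_ext[OF e1 P]] | rule par_leaf)+)
      fix \<Gamma>2 b assume e2: "ext \<Gamma>1 \<Gamma>2" and b: "el \<Gamma>2 C b"
      note C2 = tp_ext[OF e2 C] and e12 = ext_trans[OF e1 e2]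
      show "Q \<Gamma>2 (?P4 C b)"
      proof (rule pi_intro[OF Q tp_ty[OF C2]])
        show "fam (length \<Gamma>2) (?P3 C b)"
          by (insert tp_ex[OF C2] el_ex[OF b],
            (assumption | rule par rel_lattice_laws rlat_record flat_rel[OF _ flat_ext[OF e12 P]] | rule par_leaf)+)
        fix \<Gamma>3 t assume e3: "ext \<Gamma>2 \<Gamma>3" and t: "el \<Gamma>3 C t"
        note C3 = tp_ext[OF e3 C2] and e13 = ext_trans[OF e12 e3] and b3 = el_ext[OF e3 b]
        have CC: "ty \<Delta> (C \<rightarrow> C \<rightarrow> C)" if "ext \<Gamma>3 \<Delta>" for \<Delta>
          using ty_ext[OF that tp_ty[OF C3]] by (intro ty_arr)
        show "Q \<Gamma>3 (?P3 C b t)"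
        proof (rule pi_intro[OF Q CC[OF ext_refl[OF tp_ty[OF C3]]]])
          show "fam (length \<Gamma>3) (?P2 C b t)"
            by (insert tp_ex[OF C3] el_ex[OF b3] el_ex[OF t],
              (assumption | rule par rel_lattice_laws rlat_record flat_rel[OF _ flat_ext[OF e13 P]] | rule par_leaf)+)
          fix \<Gamma>4 m assume e4: "ext \<Gamma>3 \<Gamma>4" and m: "el \<Gamma>4 (C \<rightarrow> C \<rightarrow> C) m"
          note C4 = tp_ext[OF e4 C3] and e14 = ext_trans[OF e13 e4] and b4 = el_ext[OF e4 b3]
            and t4 = el_ext[OF e4 t]
          show "Q \<Gamma>4 (?P2 C b t m)"
          proof (rule pi_intro[OF Q CC[OF e4]])
            show "fam (length \<Gamma>4) (?P1 C b t m)"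
              by (insert tp_ex[OF C4] el_ex[OF b4] el_ex[OF t4] el_ex[OF m],
                (assumption | rule par rel_lattice_laws rlat_record flat_rel[OF _ flat_ext[OF e14 P]] | rule par_leaf)+)
            fix \<Gamma>5 j assume e5: "ext \<Gamma>4 \<Gamma>5" and j: "el \<Gamma>5 (C \<rightarrow> C \<rightarrow> C) j"
            note e15 = ext_trans[OF e14 e5]
            let ?L' = "?L C b t m j"
            have L: "plat \<Gamma>5 ?L'" "tp \<Gamma>5 l (carr ?L')"
              using tp_ext[OF e5 C4] el_ext[OF e5 b4] el_ext[OF e5 t4] el_ext[OF e5 m] j
              by (auto simp: plat_def intro: tp_ty)
            show "Q \<Gamma>5 (?P1 C b t m j)"
            proof (rule arr_intro[OF Q lattice_laws_iff(1)[OF L(1)]])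
              show "ex (length \<Gamma>5) (P ?L')"
                using flat_rel[OF _ flat_ext[OF e15 P] exlat_rlat[OF _ plat_exlat[OF L(1)]]] by (auto simp: ex_def)
              fix \<Delta> assume e6: "ext \<Gamma>5 \<Delta>" and "tr \<Delta> (lattice_laws ?L')"
              then show "Q \<Delta> (P ?L')"
                using L plat_ext[OF e6] tp_ext[OF e6] by (intro q[OF ext_trans[OF e15 e6]]) (auto simp: lat_def)
            qed
          qed
        qed
      qed
    qed
  qed
  then show ?thesis unfolding all_lat_def Let_def .
qed

lemma all_latD:
  assumes all: "tr \<Gamma> (all_lat l P)" and P: "flat (length \<Gamma>) P" and L: "lat \<Gamma> L" and l: "tp \<Gamma> l (carr L)"
  shows "tr \<Gamma> (P L)"
proof (cases L)
  case (fields C b t m j)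
  let ?L = "\<lambda>C b t m j. \<lparr>carr = C, lbot = b, ltop = t, lmeet = m, ljoin = j\<rparr>"
  let ?P1 = "\<lambda>C b t m j. lattice_laws (?L C b t m j) \<rightarrow> P (?L C b t m j)"
  let ?P2 = "\<lambda>C b t m. \<Pi> j : C \<rightarrow> C \<rightarrow> C. ?P1 C b t m j"
  let ?P3 = "\<lambda>C b t. \<Pi> m : C \<rightarrow> C \<rightarrow> C. ?P2 C b t m"
  let ?P4 = "\<lambda>C b. \<Pi> t : C. ?P3 C b t"
  let ?P5 = "\<lambda>C. \<Pi> b : C. ?P4 C b"
  have f: "tp \<Gamma> l C" "el \<Gamma> C b" "el \<Gamma> C t" "el \<Gamma> (C \<rightarrow> C \<rightarrow> C) m" "el \<Gamma> (C \<rightarrow> C \<rightarrow> C) j"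
    using lat_plat[OF L] l by (simp_all add: fields plat_def)
  note exs = tp_ex[OF f(1)] f(2-5)[THEN el_ex]
  have fams: "fam (length \<Gamma>) ?P5" "fam (length \<Gamma>) (?P4 C)" "fam (length \<Gamma>) (?P3 C b)"
      "fam (length \<Gamma>) (?P2 C b t)" "fam (length \<Gamma>) (?P1 C b t m)"
    by (insert exs, (assumption | rule par rel_lattice_laws rlat_record flat_rel[OF _ P] | rule par_leaf)+)
  have "tr \<Gamma> (?P5 C)"
    using tr_piD[OF all[unfolded all_lat_def Let_def] fams(1)] f(1) by (simp add: el_univ)
  from tr_piD[OF tr_piD[OF tr_piD[OF tr_piD[OF this fams(2) f(2)] fams(3) f(3)] fams(4) f(4)] fams(5) f(5)]
  have "tr \<Gamma> (lattice_laws L \<rightarrow> P L)" by (simp add: fields)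
  moreover have "ex (length \<Gamma>) (P L)"
    using flat_rel[OF _ P exlat_rlat[OF _ plat_exlat[OF lat_plat[OF L]]]] by (auto simp: ex_def)
  ultimately show ?thesis using tr_arrD L by (auto simp: lat_def)
qed

lemma flat_all_alg_body:
  assumes "exlat d I" "falg d P"
  shows "flat d (\<lambda>L. \<Pi> s : carr I \<rightarrow> carr L. lat_hom_laws I L s \<rightarrow> P (lat.extend L \<lparr>str = s\<rparr>))"
  by (rule flatI, insert assms(1) exlat_fields[OF assms(1)],
    (assumption | rule par rel_lat_hom_laws ralg_extend falg_rel[OF _ assms(2)] | (rule rlat_fields, assumption) |
      rule leaf_struct)+)

lemma extend_fields [simp]:
  "carr (lat.extend L \<lparr>str = s\<rparr>) = carr L" "str (lat.extend L \<lparr>str = s\<rparr>) = s"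
  "lat_hom_laws I (lat.extend L \<lparr>str = s\<rparr>) f = lat_hom_laws I L f"
  "lat \<Gamma> (lat.extend L \<lparr>str = s\<rparr>) = lat \<Gamma> L"
  by (simp_all add: lat.extend_def lat_hom_laws_def lat_def plat_def lattice_laws_def)

lemma all_alg_intro:
  assumes Q: "Q \<in> {ty, tr}" and I: "plat \<Gamma> I" and P: "falg (length \<Gamma>) P"
    and q: "\<And>\<Delta> A. ext \<Gamma> \<Delta> \<Longrightarrow> alg \<Delta> I A \<Longrightarrow> tp \<Delta> l (carr A) \<Longrightarrow> Q \<Delta> (P A)"
  shows "Q \<Gamma> (all_alg l I P)"
  unfolding all_alg_def
proof (rule all_lat_intro[OF Q ty_ctx[OF plat_ty[OF I]] flat_all_alg_body[OF plat_exlat[OF I] P]])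
  fix \<Delta> and L :: lat assume e: "ext \<Gamma> \<Delta>" and L: "lat \<Delta> L" and l: "tp \<Delta> l (carr L)"
  note I1 = plat_ext[OF e I]
  show "Q \<Delta> (\<Pi> s : carr I \<rightarrow> carr L. lat_hom_laws I L s \<rightarrow> P (lat.extend L \<lparr>str = s\<rparr>))"
  proof (rule pi_intro[OF Q ty_arr[OF plat_ty[OF I1] tp_ty[OF l]]])
    show "fam (length \<Delta>) (\<lambda>s. lat_hom_laws I L s \<rightarrow> P (lat.extend L \<lparr>str = s\<rparr>))"
      by (insert plat_exlat[OF I1] plat_exlat[OF lat_plat[OF L]],
        (assumption | rule par rel_lat_hom_laws ralg_extend falg_rel[OF _ falg_ext[OF e P]] | rule leaf_struct)+)
    fix \<Theta> s assume e1: "ext \<Delta> \<Theta>" and s: "el \<Theta> (carr I \<rightarrow> carr L) s"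
    note L1 = lat_ext[OF e1 L] and I2 = plat_ext[OF e1 I1] and e2 = ext_trans[OF e e1]
    let ?A = "lat.extend L \<lparr>str = s\<rparr>"
    show "Q \<Theta> (lat_hom_laws I L s \<rightarrow> P ?A)"
    proof (rule arr_intro[OF Q lat_hom_laws_iff(1)[OF I2 lat_plat[OF L1] s]])
      have "exalg (length \<Theta>) ?A"
        using plat_exlat[OF lat_plat[OF L1]] el_ex[OF s] by (simp add: exalg_def exlat_def lat.extend_def)
      then show "ex (length \<Theta>) (P ?A)"
        using falg_rel[OF _ falg_ext[OF e2 P] exalg_ralg] by (auto simp: ex_def)
      fix \<Xi> assume e3: "ext \<Theta> \<Xi>" and h: "tr \<Xi> (lat_hom_laws I L s)"
      then show "Q \<Xi> (P ?A)"
        using lat_ext[OF e3 L1] el_ext[OF e3 s] tp_ext[OF e3 tp_ext[OF e1 l]]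
        by (intro q[OF ext_trans[OF e2 e3]]) (auto simp: alg_def)
    qed
  qed
qed

lemma all_algD:
  assumes all: "tr \<Gamma> (all_alg l I P)" and I: "plat \<Gamma> I" and P: "falg (length \<Gamma>) P"
    and A: "alg \<Gamma> I A" and l: "tp \<Gamma> l (carr A)"
  shows "tr \<Gamma> (P A)"
proof -
  \<comment> \<open>\<open>all_alg\<close> quantifies over a bare lattice and a separate structure
    map. Truncation splits \<open>A\<close> accordingly, and extending by \<open>str A\<close>
    restores it.\<close>
  let ?L = "lat.truncate A"
  have AL: "lat.extend ?L \<lparr>str = str A\<rparr> = A"
    by (cases A) (simp add: lat.extend_def lat.truncate_def)
  have L: "lat \<Gamma> ?L" using alg_lat[OF A] extend_fields(4)[of \<Gamma> ?L "str A"] by (simp add: AL)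
  have C: "carr ?L = carr A" by (simp add: lat.truncate_def)
  have "tr \<Gamma> (\<Pi> s : carr I \<rightarrow> carr ?L. lat_hom_laws I ?L s \<rightarrow> P (lat.extend ?L \<lparr>str = s\<rparr>))"
    using all_latD[OF all[unfolded all_alg_def] flat_all_alg_body[OF plat_exlat[OF I] P] L] l by (simp add: C)
  moreover have "fam (length \<Gamma>) (\<lambda>s. lat_hom_laws I ?L s \<rightarrow> P (lat.extend ?L \<lparr>str = s\<rparr>))"
    by (insert plat_exlat[OF I] plat_exlat[OF lat_plat[OF L]],
      (assumption | rule par rel_lat_hom_laws ralg_extend falg_rel[OF _ P] | rule leaf_struct)+)
  moreover have s: "el \<Gamma> (carr I \<rightarrow> carr ?L) (str A)" using A by (simp add: alg_def C)
  ultimately have "tr \<Gamma> (lat_hom_laws I ?L (str A) \<rightarrow> P (lat.extend ?L \<lparr>str = str A\<rparr>))"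
    by (rule tr_piD)
  moreover have "ex (length \<Gamma>) (P A)"
    using falg_rel[OF _ P exalg_ralg[OF _ palg_exalg[OF alg_palg[OF A]]]] by (auto simp: ex_def)
  moreover have "lat_hom_laws I ?L (str A) = lat_hom_laws I A (str A)"
    using extend_fields(3)[of I ?L "str A" "str A"] by (simp add: AL)
  ultimately show ?thesis using tr_arrD A by (simp add: AL alg_def)
qed


section \<open>Freeness and quasi-coherence\<close>

lemma fam_contr:
  assumes "ex (length \<Gamma>) A"
  shows "fam (length \<Gamma>) (\<lambda>c. \<Pi> x : A. c =\<^bsub>A\<^esub> x)"
  by (insert assms, (assumption | rule par | rule par_leaf)+)

lemma ty_is_contr:
  assumes A: "ty \<Gamma> A"
  shows "ty \<Gamma> (is_contr A)"
  unfolding is_contr_def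
proof (rule ty_sig[OF A fam_contr[OF ty_ex[OF A]]])
  fix \<Delta> c assume e: "ext \<Gamma> \<Delta>" and c: "el \<Delta> A c"
  show "ty \<Delta> (\<Pi> x : A. c =\<^bsub>A\<^esub> x)"
    by (rule ty_pi[OF ty_ext[OF e A] fam_id(1)[OF c]]) (blast intro: ty_id el_ext c)
qed

lemma tr_is_contrD:
  assumes A: "tr \<Gamma> (is_contr A)"
  shows "tr \<Gamma> A" "el \<Gamma> A a \<Longrightarrow> el \<Gamma> A b \<Longrightarrow> tr \<Gamma> (a =\<^bsub>A\<^esub> b)"
proof -
  obtain s where s: "el \<Gamma> (\<Sigma> c : A. \<Pi> x : A. c =\<^bsub>A\<^esub> x) s" using A by (auto simp: tr_def is_contr_def)
  note s1 = el_pr1[OF s]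
  then show "tr \<Gamma> A" by (rule el_tr)
  have *: "tr \<Gamma> (pr1 s =\<^bsub>A\<^esub> x)" if "el \<Gamma> A x" for x
    using el_tr[OF el_pr2[OF s fam_contr[OF el_ex_ty[OF s1]]]] fam_id(1)[OF s1] that by (rule tr_piD)
  then show "el \<Gamma> A a \<Longrightarrow> el \<Gamma> A b \<Longrightarrow> tr \<Gamma> (a =\<^bsub>A\<^esub> b)" by (blast intro: id_sym id_trans)
qed

definition lifts :: "lat \<Rightarrow> alg \<Rightarrow> expr \<Rightarrow> alg \<Rightarrow> expr \<Rightarrow> expr" where
  "lifts I F i B b = (\<Sigma> h : alg_hom I F B. pr1 h \<cdot> i =\<^bsub>carr B\<^esub> b)"

lemma rel_lifts:
  "rlat w I I' \<Longrightarrow> ralg w F F' \<Longrightarrow> rel w i i' \<Longrightarrow> ralg w B B' \<Longrightarrow> rel w b b' \<Longrightarrow>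
    rel w (lifts I F i B b) (lifts I' F' i' B' b')"
  unfolding lifts_def
  by (assumption | rule par rel_alg_hom | (rule par_fields, assumption) | rule par_leaf rlat_lift ralg_lift)+

context
  fixes \<Gamma> I F i
  assumes I: "plat \<Gamma> I" and F: "palg \<Gamma> I F" and i: "el \<Gamma> (carr F) i"
begin

lemma falg_lifts: "falg (length \<Gamma>) (\<lambda>B. \<Pi> b : carr B. is_contr (lifts I F i B b))"
  by (rule falgI, insert plat_exlat[OF I] palg_exalg[OF F] el_ex[OF i],
    (assumption | rule par rel_is_contr rel_lifts | (rule par_fields, assumption) | rule leaf_struct)+)

lemma fam_lifts: "exalg (length \<Gamma>) B \<Longrightarrow> fam (length \<Gamma>) (\<lambda>b. is_contr (lifts I F i B b))"
  by (insert plat_exlat[OF I] palg_exalg[OF F] el_ex[OF i],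
    (assumption | rule par rel_is_contr rel_lifts | rule leaf_struct)+)

lemma fam_lift: "palg \<Gamma> I B \<Longrightarrow> el \<Gamma> (carr B) b \<Longrightarrow> fam (length \<Gamma>) (\<lambda>h. pr1 h \<cdot> i =\<^bsub>carr B\<^esub> b)"
  by (insert exlat_fields[OF plat_exlat[OF palg_plat, of \<Gamma> I B]] el_ex[of \<Gamma> "carr B" b] el_ex[OF i],
    (assumption | simp | rule par | rule par_leaf)+)

end

lemma ty_lifts:
  assumes I: "plat \<Gamma> I" and F: "palg \<Gamma> I F" and i: "el \<Gamma> (carr F) i" and B: "palg \<Gamma> I B" and b: "el \<Gamma> (carr B) b"
  shows "ty \<Gamma> (lifts I F i B b)"
  unfolding lifts_def
proof (rule ty_sig[OF ty_alg_hom[OF I F B] fam_lift[OF I F i B b]])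
  fix \<Delta> h assume e: "ext \<Gamma> \<Delta>" and h: "el \<Delta> (alg_hom I F B) h"
  show "ty \<Delta> (pr1 h \<cdot> i =\<^bsub>carr B\<^esub> b)"
    by (rule ty_id[OF el_hom_app[OF plat_ext[OF e I] palg_ext[OF e F] palg_ext[OF e B] h el_ext[OF e i]]
        el_ext[OF e b]])
qed

lemma is_free_on_eq: "is_free_on l I F i = all_alg l I (\<lambda>B. \<Pi> b : carr B. is_contr (lifts I F i B b))"
  by (simp add: is_free_on_def lifts_def)

lemma ty_is_free_on:
  assumes I: "plat \<Gamma> I" and F: "palg \<Gamma> I F" and i: "el \<Gamma> (carr F) i"
  shows "ty \<Gamma> (is_free_on l I F i)"
  unfolding is_free_on_eq
proof (rule all_alg_intro[OF _ I falg_lifts[OF I F i]])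
  fix \<Delta> B assume e: "ext \<Gamma> \<Delta>" and B: "alg \<Delta> I B"
  note * = plat_ext[OF e I] palg_ext[OF e F] el_ext[OF e i]
  show "ty \<Delta> (\<Pi> b : carr B. is_contr (lifts I F i B b))"
  proof (rule ty_pi[OF plat_ty[OF palg_plat[OF alg_palg[OF B]]] fam_lifts[OF * palg_exalg[OF alg_palg[OF B]]]])
    fix \<Theta> b assume e1: "ext \<Delta> \<Theta>" and b: "el \<Theta> (carr B) b"
    show "ty \<Theta> (is_contr (lifts I F i B b))"
      using b alg_palg[OF alg_ext[OF e1 B]] *
      by (intro ty_is_contr ty_lifts) (auto intro: plat_ext[OF e1] palg_ext[OF e1] el_ext[OF e1])
  qed
qed simp

context
  fixes \<Gamma> I F i l B b
  assumes I: "plat \<Gamma> I" and F: "palg \<Gamma> I F" and i: "el \<Gamma> (carr F) i"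
    and free: "tr \<Gamma> (is_free_on l I F i)"
    and B: "alg \<Gamma> I B" and l: "tp \<Gamma> l (carr B)" and b: "el \<Gamma> (carr B) b"
begin

lemma contr_lifts: "tr \<Gamma> (is_contr (lifts I F i B b))"
  using all_algD[OF free[unfolded is_free_on_eq] I falg_lifts[OF I F i] B l]
    fam_lifts[OF I F i palg_exalg[OF alg_palg[OF B]]] b by (rule tr_piD)

lemma lift_exists: "\<exists>h. el \<Gamma> (alg_hom I F B) h \<and> tr \<Gamma> (pr1 h \<cdot> i =\<^bsub>carr B\<^esub> b)"
proof -
  obtain s where s: "el \<Gamma> (\<Sigma> h : alg_hom I F B. pr1 h \<cdot> i =\<^bsub>carr B\<^esub> b) s"
    using tr_is_contrD(1)[OF contr_lifts] by (auto simp: tr_def lifts_def)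
  show ?thesis using el_pr1[OF s] el_tr[OF el_pr2[OF s fam_lift[OF I F i alg_palg[OF B] b]]] by blast
qed

text \<open>Contractibility identifies pairs of a homomorphism and a proof about its value at the
  generator; the first projection forgets the proof.\<close>

lemma lift_unique:
  assumes u: "el \<Gamma> (alg_hom I F B) u" "tr \<Gamma> (pr1 u \<cdot> i =\<^bsub>carr B\<^esub> b)"
    and v: "el \<Gamma> (alg_hom I F B) v" "tr \<Gamma> (pr1 v \<cdot> i =\<^bsub>carr B\<^esub> b)"
  shows "tr \<Gamma> (u =\<^bsub>alg_hom I F B\<^esub> v)"
proof -
  let ?S = "\<Sigma> h : alg_hom I F B. pr1 h \<cdot> i =\<^bsub>carr B\<^esub> b"
  note fam = fam_lift[OF I F i alg_palg[OF B] b]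
  note S = ty_lifts[OF I F i alg_palg[OF B] b, unfolded lifts_def]
  obtain p q where p: "el \<Gamma> (pr1 u \<cdot> i =\<^bsub>carr B\<^esub> b) p" and q: "el \<Gamma> (pr1 v \<cdot> i =\<^bsub>carr B\<^esub> b) q"
    using u v by (auto simp: tr_def)
  have "tr \<Gamma> (pair u p =\<^bsub>?S\<^esub> pair v q)"
    using el_pair[OF u(1) p fam S] el_pair[OF v(1) q fam S] tr_is_contrD(2)[OF contr_lifts] by (simp add: lifts_def)
  from id_pr1[OF this] show ?thesis
    using id_pr1_beta[OF u(1) p fam S] id_pr1_beta[OF v(1) q fam S] by (blast intro: id_sym id_trans)
qed

end

section \<open>Isomorphisms of algebras\<close>

context
  fixes \<Gamma> I A B f
  assumes I: "plat \<Gamma> I" and A: "palg \<Gamma> I A" and B: "palg \<Gamma> I B" and f: "el \<Gamma> (carr A \<rightarrow> carr B) f"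
begin

lemma fam_inverse:
  "fam (length \<Gamma>) (\<lambda>g. (\<Pi> a : carr A. pr1 g \<cdot> (f \<cdot> a) =\<^bsub>carr A\<^esub> a) \<otimes> (\<Pi> b : carr B. f \<cdot> (pr1 g \<cdot> b) =\<^bsub>carr B\<^esub> b))"
  "ex (length \<Gamma>) g \<Longrightarrow> fam (length \<Gamma>) (\<lambda>a. pr1 g \<cdot> (f \<cdot> a) =\<^bsub>carr A\<^esub> a)"
  "ex (length \<Gamma>) g \<Longrightarrow> fam (length \<Gamma>) (\<lambda>b. f \<cdot> (pr1 g \<cdot> b) =\<^bsub>carr B\<^esub> b)"
  by (insert exlat_fields[OF plat_exlat[OF palg_plat[OF A]]] exlat_fields[OF plat_exlat[OF palg_plat[OF B]]] el_ex[OF f],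
    (assumption | rule par | rule par_leaf)+)

lemma ty_inverse:
  assumes g: "el \<Gamma> (alg_hom I B A) g"
  shows "ty \<Gamma> (\<Pi> a : carr A. pr1 g \<cdot> (f \<cdot> a) =\<^bsub>carr A\<^esub> a)" "ty \<Gamma> (\<Pi> b : carr B. f \<cdot> (pr1 g \<cdot> b) =\<^bsub>carr B\<^esub> b)"
proof -
  note CA = plat_ty[OF palg_plat[OF A]] and CB = plat_ty[OF palg_plat[OF B]] and g1 = el_hom_fun[OF I B A g]
  show "ty \<Gamma> (\<Pi> a : carr A. pr1 g \<cdot> (f \<cdot> a) =\<^bsub>carr A\<^esub> a)"
    by (rule ty_pi[OF CA fam_inverse(2)[OF el_ex[OF g]]], intro ty_id el_arr[OF _ el_ext[OF _ g1]]
        el_arr[OF _ el_ext[OF _ f]] ty_ext[OF _ CA] ty_ext[OF _ CB])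
  show "ty \<Gamma> (\<Pi> b : carr B. f \<cdot> (pr1 g \<cdot> b) =\<^bsub>carr B\<^esub> b)"
    by (rule ty_pi[OF CB fam_inverse(3)[OF el_ex[OF g]]], intro ty_id el_arr[OF _ el_ext[OF _ g1]]
        el_arr[OF _ el_ext[OF _ f]] ty_ext[OF _ CA] ty_ext[OF _ CB])
qed

end

context
  fixes \<Gamma> I A B f
  assumes I: "plat \<Gamma> I" and A: "palg \<Gamma> I A" and B: "palg \<Gamma> I B" and f: "el \<Gamma> (carr A \<rightarrow> carr B) f"
begin

lemma ty_inverses:
  "ty \<Gamma> (\<Sigma> g : alg_hom I B A.
    (\<Pi> a : carr A. pr1 g \<cdot> (f \<cdot> a) =\<^bsub>carr A\<^esub> a) \<otimes> (\<Pi> b : carr B. f \<cdot> (pr1 g \<cdot> b) =\<^bsub>carr B\<^esub> b))"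
proof (rule ty_sig[OF ty_alg_hom[OF I B A] fam_inverse(1)[OF I A B f]])
  fix \<Delta> g assume e: "ext \<Gamma> \<Delta>" and g: "el \<Delta> (alg_hom I B A) g"
  show "ty \<Delta> ((\<Pi> a : carr A. pr1 g \<cdot> (f \<cdot> a) =\<^bsub>carr A\<^esub> a) \<otimes> (\<Pi> b : carr B. f \<cdot> (pr1 g \<cdot> b) =\<^bsub>carr B\<^esub> b))"
    by (intro ty_prod ty_inverse[OF plat_ext[OF e I] palg_ext[OF e A] palg_ext[OF e B] el_ext[OF e f] g])
qed

lemma ty_is_alg_iso: "ty \<Gamma> (is_alg_iso I A B f)"
  unfolding is_alg_iso_def by (intro ty_prod alg_hom_laws_iff(1)[OF I A B f] ty_inverses)

text \<open>The preimage is the value of the inverse homomorphism at \<open>b\<close>.\<close>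

lemma is_alg_iso_surj:
  assumes "tr \<Gamma> (is_alg_iso I A B f)" and b: "el \<Gamma> (carr B) b"
  shows "\<exists>a. el \<Gamma> (carr A) a \<and> tr \<Gamma> (f \<cdot> a =\<^bsub>carr B\<^esub> b)"
proof -
  obtain s where s: "el \<Gamma> (\<Sigma> g : alg_hom I B A. (\<Pi> a : carr A. pr1 g \<cdot> (f \<cdot> a) =\<^bsub>carr A\<^esub> a) \<otimes>
      (\<Pi> b : carr B. f \<cdot> (pr1 g \<cdot> b) =\<^bsub>carr B\<^esub> b)) s"
    using tr_prod2[OF ty_inverses assms(1)[unfolded is_alg_iso_def]] by (auto simp: tr_def)
  note g = el_pr1[OF s]
  have "tr \<Gamma> (\<Pi> b : carr B. f \<cdot> (pr1 (pr1 s) \<cdot> b) =\<^bsub>carr B\<^esub> b)"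
    by (rule tr_prod2[OF ty_inverse(2)[OF I A B f g] el_tr[OF el_pr2[OF s fam_inverse(1)[OF I A B f]]]])
  from tr_piD[OF this fam_inverse(3)[OF I A B f el_ex[OF g]] b] show ?thesis
    using el_hom_app[OF I B A g b] by blast
qed

end

section \<open>Spectra, evaluation and quasi-coherence\<close>

lemma fun_alg_carr [simp]: "carr (fun_alg I X) = (X \<rightarrow> carr I)"
  by (simp add: fun_alg_def)

context
  fixes \<Gamma> I A
  assumes I: "lat \<Gamma> I" and A: "palg \<Gamma> I A"
begin

lemma palg_base: "palg \<Gamma> I (base_alg I)"
  by (rule alg_palg[OF alg_base_alg[OF I]])

lemma ty_Spec: "ty \<Gamma> (Spec I A)"
  unfolding Spec_def by (rule ty_alg_hom[OF lat_plat[OF I] A palg_base])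

lemma el_point: "el \<Gamma> (Spec I A) x \<Longrightarrow> el \<Gamma> (carr A) a \<Longrightarrow> el \<Gamma> (carr I) (pr1 x \<cdot> a)"
  unfolding Spec_def using el_hom_app[OF lat_plat[OF I] A palg_base] by simp

end

context
  fixes \<Gamma> I A
  assumes I: "lat \<Gamma> I" and A: "palg \<Gamma> I A"
begin

lemma el_eval: "ext \<Gamma> \<Delta> \<Longrightarrow> el \<Delta> (carr A) a \<Longrightarrow> el \<Delta> (Spec I A \<rightarrow> carr I) (\<^bold>\<lambda> x : Spec I A. pr1 x \<cdot> a)"
proof -
  assume e: "ext \<Gamma> \<Delta>" and a: "el \<Delta> (carr A) a"
  note I1 = lat_ext[OF e I] and A1 = palg_ext[OF e A]
  show ?thesis
  proof (rule el_lam_arr[OF ty_Spec[OF I1 A1] plat_ty[OF lat_plat[OF I1]]])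
    show "fam (length \<Delta>) (\<lambda>x. pr1 x \<cdot> a)"
      by (insert el_ex[OF a], (assumption | rule par | rule par_leaf)+)
    fix \<Theta> x assume e1: "ext \<Delta> \<Theta>" and x: "el \<Theta> (Spec I A) x"
    then show "el \<Theta> (carr I) (pr1 x \<cdot> a)"
      using el_point[OF lat_ext[OF e1 I1] palg_ext[OF e1 A1] x] el_ext[OF e1 a] by blast
  qed
qed

lemma fam_eval: "fam (length \<Gamma>) (\<lambda>a. \<^bold>\<lambda> x : Spec I A. pr1 x \<cdot> a)"
  by (insert ty_ex[OF ty_Spec[OF I A]], (assumption | rule par | rule par_leaf)+)

lemma el_iota: "el \<Gamma> (carr A \<rightarrow> carr (fun_alg I (Spec I A))) (iota I A)"
  unfolding iota_def fun_alg_carr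
  by (rule el_lam_arr[OF plat_ty[OF palg_plat[OF A]] ty_arr[OF ty_Spec[OF I A] plat_ty[OF lat_plat[OF I]]]
      fam_eval el_eval])

lemma id_iota:
  assumes p: "el \<Gamma> (carr A) p" and x: "el \<Gamma> (Spec I A) x"
  shows "tr \<Gamma> (iota I A \<cdot> p \<cdot> x =\<^bsub>carr I\<^esub> pr1 x \<cdot> p)"
proof -
  note C = plat_ty[OF lat_plat[OF I]] and S = ty_Spec[OF I A]
  have "tr \<Gamma> (iota I A \<cdot> p =\<^bsub>Spec I A \<rightarrow> carr I\<^esub> (\<^bold>\<lambda> x : Spec I A. pr1 x \<cdot> p))"
    unfolding iota_def
    by (rule id_beta_arr[OF plat_ty[OF palg_plat[OF A]] ty_arr[OF S C] fam_eval el_eval p])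
  from id_app_arr[OF C this id_refl[OF x]]
  have "tr \<Gamma> (iota I A \<cdot> p \<cdot> x =\<^bsub>carr I\<^esub> (\<^bold>\<lambda> x : Spec I A. pr1 x \<cdot> p) \<cdot> x)" .
  also have "tr \<Gamma> ((\<^bold>\<lambda> x : Spec I A. pr1 x \<cdot> p) \<cdot> x =\<^bsub>carr I\<^esub> pr1 x \<cdot> p)"
  proof (rule id_beta_arr[OF S C _ _ x])
    show "fam (length \<Gamma>) (\<lambda>x. pr1 x \<cdot> p)"
      by (insert el_ex[OF p], (assumption | rule par | rule par_leaf)+)
    fix \<Theta> x assume e1: "ext \<Gamma> \<Theta>" and x: "el \<Theta> (Spec I A) x"
    then show "el \<Theta> (carr I) (pr1 x \<cdot> p)"
      using el_point[OF lat_ext[OF e1 I] palg_ext[OF e1 A] x] el_ext[OF e1 p] by blast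
  qed
  finally show ?thesis .
qed

lemma ty_quasi_coherent: "ty \<Gamma> (quasi_coherent I A)"
  unfolding quasi_coherent_def
  by (rule ty_is_alg_iso[OF lat_plat[OF I] A palg_fun_alg[OF lat_plat[OF I] ty_Spec[OF I A]] el_iota])

text \<open>Surjectivity of \<open>iota\<close>, read at each point by means of
  \<open>id_iota\<close>.\<close>

lemma quasi_coherentD:
  assumes "tr \<Gamma> (quasi_coherent I A)" and b: "el \<Gamma> (Spec I A \<rightarrow> carr I) b"
  shows "\<exists>p. el \<Gamma> (carr A) p \<and> (\<forall>x. el \<Gamma> (Spec I A) x \<longrightarrow> tr \<Gamma> (pr1 x \<cdot> p =\<^bsub>carr I\<^esub> b \<cdot> x))"
proof -
  obtain p where p: "el \<Gamma> (carr A) p" "tr \<Gamma> (iota I A \<cdot> p =\<^bsub>Spec I A \<rightarrow> carr I\<^esub> b)"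
    using is_alg_iso_surj[OF lat_plat[OF I] A palg_fun_alg[OF lat_plat[OF I] ty_Spec[OF I A]] el_iota] assms
    unfolding quasi_coherent_def fun_alg_carr by blast
  have "tr \<Gamma> (pr1 x \<cdot> p =\<^bsub>carr I\<^esub> b \<cdot> x)" if x: "el \<Gamma> (Spec I A) x" for x
    using id_sym[OF id_iota[OF p(1) x]] id_app_arr[OF plat_ty[OF lat_plat[OF I]] p(2) id_refl[OF x]]
    by (rule id_trans)
  then show ?thesis using p(1) by blast
qed

end


section \<open>The algebra of affine maps\<close>

text \<open>The normal form of a lattice polynomial in the variable \<open>r\<close>. When
  \<open>x\<close> lies below \<open>y\<close> it runs from \<open>x\<close> at \<open>lbot\<close>
  to \<open>y\<close> at \<open>ltop\<close>.\<close>

abbreviation seg :: "'a lat_scheme \<Rightarrow> expr \<Rightarrow> expr \<Rightarrow> expr \<Rightarrow> expr" where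
  "seg L x y r \<equiv> ljoin L \<cdot> x \<cdot> (lmeet L \<cdot> y \<cdot> r)"

text \<open>The coefficients are the end values of \<open>f\<close> itself and are not quantified
  existentially. The condition is therefore a family of identities in a set, hence a proposition,
  and two affine maps with the same values are identical.\<close>

definition affine :: "lat \<Rightarrow> expr \<Rightarrow> expr" where
  "affine I f = (\<Pi> r : carr I. f \<cdot> r =\<^bsub>carr I\<^esub> seg I (f \<cdot> lbot I) (f \<cdot> ltop I) r)"

definition affine_maps :: "lat \<Rightarrow> expr" where
  "affine_maps I = (\<Sigma> f : carr I \<rightarrow> carr I. affine I f)"

lemma rel_affine: "rlat w I I' \<Longrightarrow> rel w f f' \<Longrightarrow> rel w (affine I f) (affine I' f')"
  unfolding affine_def
  by (assumption | rule par | (rule rlat_fields, assumption) | rule par_leaf rlat_lift)+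

lemma id_seg:
  "plat \<Gamma> L \<Longrightarrow> tr \<Gamma> (x =\<^bsub>carr L\<^esub> x') \<Longrightarrow> tr \<Gamma> (y =\<^bsub>carr L\<^esub> y') \<Longrightarrow> el \<Gamma> (carr L) r \<Longrightarrow>
    tr \<Gamma> (seg L x y r =\<^bsub>carr L\<^esub> seg L x' y' r)"
  by (intro id_join id_meet id_refl)

lemma el_seg:
  "plat \<Gamma> L \<Longrightarrow> el \<Gamma> (carr L) x \<Longrightarrow> el \<Gamma> (carr L) y \<Longrightarrow> el \<Gamma> (carr L) r \<Longrightarrow> el \<Gamma> (carr L) (seg L x y r)"
  by (intro el_join el_meet)

context
  fixes \<Gamma> and I :: lat
  assumes I: "lat \<Gamma> I"
begin

private lemmas P_a = lat_plat[OF I]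
private lemmas C_a = plat_ty[OF P_a]
private lemmas exs_a = exlat_fields[OF plat_exlat[OF P_a]]

lemma fam_affine: "fam (length \<Gamma>) (affine I)"
  by (insert plat_exlat[OF P_a], (assumption | rule par rel_affine | rule leaf_struct)+)

lemma el_fun_app: "ext \<Gamma> \<Delta> \<Longrightarrow> el \<Gamma> (carr I \<rightarrow> carr I) f \<Longrightarrow> el \<Delta> (carr I) r \<Longrightarrow> el \<Delta> (carr I) (f \<cdot> r)"
  using el_arr[OF ty_ext[OF _ C_a] el_ext] by blast

context
  fixes f
  assumes f: "el \<Gamma> (carr I \<rightarrow> carr I) f"
begin

private lemma fam: "fam (length \<Gamma>) (\<lambda>r. f \<cdot> r =\<^bsub>carr I\<^esub> seg I (f \<cdot> lbot I) (f \<cdot> ltop I) r)"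
  by (insert exs_a el_ex[OF f], (assumption | rule par | rule par_leaf)+)

private lemma seg: "ext \<Gamma> \<Delta> \<Longrightarrow> el \<Delta> (carr I) r \<Longrightarrow> el \<Delta> (carr I) (seg I (f \<cdot> lbot I) (f \<cdot> ltop I) r)"
  using plat_ext[OF _ P_a] f by (intro el_seg el_fun_app el_bot el_top)

lemma tp_affine:
  assumes l: "tp \<Gamma> l (carr I)"
  shows "tp \<Gamma> l (affine I f)"
proof -
  have "tp \<Gamma> (max l l) (affine I f)"
    unfolding affine_def by (rule tp_pi[OF C_a fam l]) (intro tp_id tp_ext[OF _ l] el_fun_app[OF _ f] seg)
  then show ?thesis by simp
qed

lemma ty_affine: "ty \<Gamma> (affine I f)"
  using C_a tp_affine by (auto simp: ty_def)

lemma tr_affine_iff: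
  "tr \<Gamma> (affine I f) \<longleftrightarrow> (\<forall>\<Delta> r. ext \<Gamma> \<Delta> \<longrightarrow> el \<Delta> (carr I) r \<longrightarrow>
    tr \<Delta> (f \<cdot> r =\<^bsub>carr I\<^esub> seg I (f \<cdot> lbot I) (f \<cdot> ltop I) r))"
  unfolding affine_def by (rule tr_pi_iff[OF C_a fam])

lemma is_prop_affine: "tr \<Gamma> (is_prop (affine I f))"
  unfolding affine_def
  by (rule is_prop_pi[OF C_a fam], rule is_prop_id) (auto intro: tr_ext lat_is_set[OF I] el_fun_app f seg)

end

end

context
  fixes \<Gamma> and I :: lat
  assumes I: "lat \<Gamma> I"
begin

private lemmas P_b = lat_plat[OF I]
private lemmas C_b = plat_ty[OF P_b]
private lemmas CC_b = ty_arr[OF C_b C_b]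

lemma ty_affine_maps: "ty \<Gamma> (affine_maps I)"
  unfolding affine_maps_def
  by (rule ty_sig[OF CC_b fam_affine[OF I]]) (rule ty_affine[OF lat_ext[OF _ I]])

text \<open>Freeness can be applied only to carriers in the universe of level \<open>l\<close>. All
  ingredients have this level, and product and sum types take the maximum of the levels.\<close>

lemma tp_affine_maps:
  assumes l: "tp \<Gamma> l (carr I)"
  shows "tp \<Gamma> l (affine_maps I)"
  unfolding affine_maps_def
  using tp_sig[OF CC_b fam_affine[OF I], of "max l l" l] tp_arr[OF l l] tp_affine[OF lat_ext[OF _ I] _ tp_ext[OF _ l]]
  by simp

lemma el_affine_fun: "el \<Gamma> (affine_maps I) u \<Longrightarrow> el \<Gamma> (carr I \<rightarrow> carr I) (pr1 u)"
  unfolding affine_maps_def by (rule el_pr1)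

lemma el_affine_app: "el \<Gamma> (affine_maps I) u \<Longrightarrow> el \<Gamma> (carr I) r \<Longrightarrow> el \<Gamma> (carr I) (pr1 u \<cdot> r)"
  by (rule el_arr[OF C_b el_affine_fun])

lemma affine_app:
  assumes u: "el \<Gamma> (affine_maps I) u" and r: "el \<Gamma> (carr I) r"
  shows "tr \<Gamma> (pr1 u \<cdot> r =\<^bsub>carr I\<^esub> seg I (pr1 u \<cdot> lbot I) (pr1 u \<cdot> ltop I) r)"
  using el_tr[OF el_pr2[OF u[unfolded affine_maps_def] fam_affine[OF I]]] r ext_refl[OF C_b]
  unfolding tr_affine_iff[OF I el_affine_fun[OF u]] by blast

text \<open>The affine equation at \<open>ltop\<close>, combined with \<open>leq_line\<close>. It
  supplies the order hypotheses of \<open>id_line_meet\<close>.\<close>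

lemma affine_leq:
  assumes u: "el \<Gamma> (affine_maps I) u"
  shows "tr \<Gamma> (leq I (pr1 u \<cdot> lbot I) (pr1 u \<cdot> ltop I))"
  by (rule leq_line[OF I el_affine_app[OF u el_bot[OF P_b]] el_affine_app[OF u el_top[OF P_b]]
      affine_app[OF u el_top[OF P_b]]])

lemma el_affine_pair:
  "el \<Gamma> (carr I \<rightarrow> carr I) f \<Longrightarrow> el \<Gamma> (affine I f) p \<Longrightarrow> el \<Gamma> (affine_maps I) (pair f p)"
  using el_pair[OF _ _ fam_affine[OF I]] ty_affine_maps unfolding affine_maps_def by blast

lemma id_affine_pair:
  assumes "el \<Gamma> (carr I \<rightarrow> carr I) f" "el \<Gamma> (affine I f) p" "el \<Gamma> (carr I) r"
  shows "tr \<Gamma> (pr1 (pair f p) \<cdot> r =\<^bsub>carr I\<^esub> f \<cdot> r)"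
  using id_pr1_beta[OF assms(1,2) fam_affine[OF I]] ty_affine_maps assms(3)
  by (intro id_app_arr[OF C_b] id_refl) (simp_all add: affine_maps_def)

lemma id_affine_cong:
  "tr \<Gamma> (u =\<^bsub>affine_maps I\<^esub> v) \<Longrightarrow> el \<Gamma> (carr I) r \<Longrightarrow> tr \<Gamma> (pr1 u \<cdot> r =\<^bsub>carr I\<^esub> pr1 v \<cdot> r)"
  unfolding affine_maps_def by (intro id_app_arr[OF C_b] id_pr1 id_refl)

end

lemma id_affine:
  assumes I: "lat \<Gamma> I" and u: "el \<Gamma> (affine_maps I) u" and v: "el \<Gamma> (affine_maps I) v"
    and *: "\<And>\<Delta> r. ext \<Gamma> \<Delta> \<Longrightarrow> el \<Delta> (carr I) r \<Longrightarrow> tr \<Delta> (pr1 u \<cdot> r =\<^bsub>carr I\<^esub> pr1 v \<cdot> r)"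
  shows "tr \<Gamma> (u =\<^bsub>affine_maps I\<^esub> v)"
  unfolding affine_maps_def
proof (rule id_sig_prop[OF u[unfolded affine_maps_def] v[unfolded affine_maps_def] fam_affine[OF I]])
  show "tr \<Gamma> (pr1 u =\<^bsub>carr I \<rightarrow> carr I\<^esub> pr1 v)"
    by (rule id_funext_arr[OF plat_ty[OF lat_plat[OF I]] el_affine_fun[OF I u] el_affine_fun[OF I v] *])
qed (rule is_prop_affine[OF lat_ext[OF _ I]])

text \<open>The lattice laws include that the carrier is a set. As relation serves pointwise
  identity of the underlying functions: it is a proposition because the carrier of \<open>I\<close>
  is a set, and it implies identity by function extensionality.\<close>

lemma is_set_affine_maps:
  assumes I: "lat \<Gamma> I"
  shows "tr \<Gamma> (is_set (affine_maps I))"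
proof (rule is_setI_rel[OF ty_affine_maps[OF I], where R = "\<lambda>u v. \<Pi> r : carr I. pr1 u \<cdot> r =\<^bsub>carr I\<^esub> pr1 v \<cdot> r"])
  note P = lat_plat[OF I]
  show "fam2 (length \<Gamma>) (\<lambda>u v. \<Pi> r : carr I. pr1 u \<cdot> r =\<^bsub>carr I\<^esub> pr1 v \<cdot> r)"
    by (insert exlat_fields[OF plat_exlat[OF P]], (assumption | rule par | rule par_leaf)+)
  fix \<Delta> u assume e: "ext \<Gamma> \<Delta>" and u: "el \<Delta> (affine_maps I) u"
  note I1 = lat_ext[OF e I]
  note P1 = lat_plat[OF I1]
  have fam: "fam (length \<Delta>) (\<lambda>r. pr1 u \<cdot> r =\<^bsub>carr I\<^esub> pr1 v \<cdot> r)" if "el \<Delta> (affine_maps I) v" for v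
    by (insert exlat_fields[OF plat_exlat[OF P1]] el_ex[OF u] el_ex[OF that], (assumption | rule par | rule par_leaf)+)
  have app: "el \<Theta> (carr I) (pr1 v \<cdot> r)" if "el \<Delta> (affine_maps I) v" "ext \<Delta> \<Theta>" "el \<Theta> (carr I) r" for v r \<Theta>
    by (rule el_affine_app[OF lat_ext[OF that(2) I1] el_ext[OF that(2,1)] that(3)])
  show "tr \<Delta> (\<Pi> r : carr I. pr1 u \<cdot> r =\<^bsub>carr I\<^esub> pr1 u \<cdot> r)"
    by (rule tr_piI[OF plat_ty[OF P1] fam[OF u] id_refl[OF app[OF u]]])
  fix v assume v: "el \<Delta> (affine_maps I) v"
  show "tr \<Delta> (is_prop (\<Pi> r : carr I. pr1 u \<cdot> r =\<^bsub>carr I\<^esub> pr1 v \<cdot> r))"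
    by (rule is_prop_pi[OF plat_ty[OF P1] fam[OF v] is_prop_id[OF lat_is_set[OF lat_ext[OF _ I1]] app[OF u] app[OF v]]])
  assume "tr \<Delta> (\<Pi> r : carr I. pr1 u \<cdot> r =\<^bsub>carr I\<^esub> pr1 v \<cdot> r)"
  then show "tr \<Delta> (u =\<^bsub>affine_maps I\<^esub> v)"
    using tr_pi_iff[OF plat_ty[OF P1] fam[OF v]] by (intro id_affine[OF I1 u v]) blast
qed

text \<open>Treats meet and join at once: a pointwise operation on affine maps again has affine
  values as soon as it acts on segments through their end points, which is the hypothesis
  \<open>closed\<close>.\<close>

lemma affine_operation:
  assumes I: "lat \<Gamma> I" and m: "el \<Gamma> (carr I \<rightarrow> carr I \<rightarrow> carr I) m"
    and closed: "\<And>\<Delta> u v r. ext \<Gamma> \<Delta> \<Longrightarrow> el \<Delta> (affine_maps I) u \<Longrightarrow> el \<Delta> (affine_maps I) v \<Longrightarrow> el \<Delta> (carr I) r \<Longrightarrow>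
      tr \<Delta> (m \<cdot> (pr1 u \<cdot> r) \<cdot> (pr1 v \<cdot> r) =\<^bsub>carr I\<^esub>
        seg I (m \<cdot> (pr1 u \<cdot> lbot I) \<cdot> (pr1 v \<cdot> lbot I)) (m \<cdot> (pr1 u \<cdot> ltop I) \<cdot> (pr1 v \<cdot> ltop I)) r)"
  shows "\<exists>M. el \<Gamma> (affine_maps I \<rightarrow> affine_maps I \<rightarrow> affine_maps I) M \<and>
    (\<forall>\<Delta> u v r. ext \<Gamma> \<Delta> \<longrightarrow> el \<Delta> (affine_maps I) u \<longrightarrow> el \<Delta> (affine_maps I) v \<longrightarrow> el \<Delta> (carr I) r \<longrightarrow>
      tr \<Delta> (pr1 (M \<cdot> u \<cdot> v) \<cdot> r =\<^bsub>carr I\<^esub> m \<cdot> (pr1 u \<cdot> r) \<cdot> (pr1 v \<cdot> r)))"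
proof -
  let ?C = "carr I" and ?G = "affine_maps I"
  define f where "f = (\<lambda>u v. \<^bold>\<lambda> r : ?C. m \<cdot> (pr1 u \<cdot> r) \<cdot> (pr1 v \<cdot> r))"
  note exs = exlat_fields[OF plat_exlat[OF lat_plat[OF I]]] el_ex[OF m] plat_exlat[OF lat_plat[OF I]]
  note G = ty_affine_maps[OF I] and C = plat_ty[OF lat_plat[OF I]]
  have mm: "el \<Delta> ?C (m \<cdot> (pr1 u \<cdot> r) \<cdot> (pr1 v \<cdot> r))"
    if "ext \<Gamma> \<Delta>" "el \<Delta> ?G u" "el \<Delta> ?G v" "el \<Delta> ?C r" for \<Delta> u v r
    using el_affine_app[OF lat_ext[OF that(1) I]] that
    by (intro el_arr2[OF ty_ext[OF that(1) C] ty_ext[OF that(1) C] el_ext[OF that(1) m]])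
  have fm: "fam (length \<Delta>) (\<lambda>r. m \<cdot> (pr1 u \<cdot> r) \<cdot> (pr1 v \<cdot> r))"
    if "ext \<Gamma> \<Delta>" "el \<Delta> ?G u" "el \<Delta> ?G v" for \<Delta> u v
    by (insert ex_ext[OF that(1) el_ex[OF m]] el_ex[OF that(2)] el_ex[OF that(3)], (assumption | rule par | rule par_leaf)+)
  have mm': "el \<Theta> ?C (m \<cdot> (pr1 u \<cdot> r) \<cdot> (pr1 v \<cdot> r))"
    if "ext \<Gamma> \<Delta>" "el \<Delta> ?G u" "el \<Delta> ?G v" "ext \<Delta> \<Theta>" "el \<Theta> ?C r" for \<Delta> \<Theta> u v r
    by (rule mm[OF ext_trans[OF that(1,4)] el_ext[OF that(4,2)] el_ext[OF that(4,3)] that(5)])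
  have f: "el \<Delta> (?C \<rightarrow> ?C) (f u v)" if "ext \<Gamma> \<Delta>" "el \<Delta> ?G u" "el \<Delta> ?G v" for \<Delta> u v
    unfolding f_def using ty_ext[OF that(1) C] by (intro el_lam_arr fm[OF that] mm'[OF that])
  have fb: "tr \<Delta> (f u v \<cdot> r =\<^bsub>?C\<^esub> m \<cdot> (pr1 u \<cdot> r) \<cdot> (pr1 v \<cdot> r))"
    if "ext \<Gamma> \<Delta>" "el \<Delta> ?G u" "el \<Delta> ?G v" "el \<Delta> ?C r" for \<Delta> u v r
    unfolding f_def using ty_ext[OF that(1) C] that(4)
    by (intro id_beta_arr fm[OF that(1-3)] mm'[OF that(1-3)])
  have aff: "tr \<Delta> (affine I (f u v))" if "ext \<Gamma> \<Delta>" "el \<Delta> ?G u" "el \<Delta> ?G v" for \<Delta> u v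
    unfolding tr_affine_iff[OF lat_ext[OF that(1) I] f[OF that]]
  proof (intro allI impI)
    fix \<Theta> r assume e: "ext \<Delta> \<Theta>" and r: "el \<Theta> ?C r"
    note P = lat_plat[OF lat_ext[OF ext_trans[OF that(1) e] I]]
    note uv = ext_trans[OF that(1) e] el_ext[OF e that(2)] el_ext[OF e that(3)]
    show "tr \<Theta> (f u v \<cdot> r =\<^bsub>?C\<^esub> seg I (f u v \<cdot> lbot I) (f u v \<cdot> ltop I) r)"
      \<comment> \<open>\<open>closed\<close> gives a segment whose coefficients are the operation
        on the end values of \<open>u\<close> and \<open>v\<close>; \<open>fb\<close>, read
        backwards at \<open>lbot\<close> and \<open>ltop\<close>, recognises these as the end values
        of \<open>f u v\<close>.\<close>
      by (rule id_trans[OF fb[OF uv r] id_trans[OF closed[OF uv r]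
          id_seg[OF P id_sym[OF fb[OF uv el_bot[OF P]]] id_sym[OF fb[OF uv el_top[OF P]]] r]]])
  qed
  \<comment> \<open>To be abstracted over \<open>u\<close> and \<open>v\<close>, the pair must be
    natural in them, and a proof chosen anew in each context is not. The proofs are therefore
    gathered in one element \<open>p\<close> of a product type, and
    \<open>p \<cdot> u \<cdot> v\<close> is natural.\<close>
  have "tr \<Gamma> (\<Pi> u : ?G. \<Pi> v : ?G. affine I (f u v))"
  proof (rule pi2_intro[of tr, OF _ G G _ aff])
    show "fam2 (length \<Gamma>) (\<lambda>u v. affine I (f u v))"
      unfolding f_def by (insert exs, (assumption | rule par rel_affine | rule leaf_struct)+)
  qed simp
  then obtain p where p: "el \<Gamma> (\<Pi> u : ?G. \<Pi> v : ?G. affine I (f u v)) p" by (auto simp: tr_def)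
  have puv: "el \<Delta> (affine I (f u v)) (p \<cdot> u \<cdot> v)" if "ext \<Gamma> \<Delta>" "el \<Delta> ?G u" "el \<Delta> ?G v" for \<Delta> u v
  proof -
    have "fam (length \<Delta>) (\<lambda>u. \<Pi> v : ?G. affine I (f u v))" "fam (length \<Delta>) (\<lambda>v. affine I (f u v))"
      unfolding f_def
      by (insert exs(1-6)[THEN ex_ext[OF that(1)]] plat_exlat[OF lat_plat[OF lat_ext[OF that(1) I]]]
          ty_ex[OF ty_ext[OF that(1) G]] el_ex[OF that(2)],
        (assumption | rule par rel_affine | rule leaf_struct)+)
    then show ?thesis using el_app[OF el_app[OF el_ext[OF that(1) p] _ that(2)] _ that(3)] by blast
  qed
  have pr: "el \<Delta> ?G (pair (f u v) (p \<cdot> u \<cdot> v))" if "ext \<Gamma> \<Delta>" "el \<Delta> ?G u" "el \<Delta> ?G v" for \<Delta> u v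
    by (rule el_affine_pair[OF lat_ext[OF that(1) I] f[OF that] puv[OF that]])
  have fam2: "fam2 (length \<Gamma>) (\<lambda>u v. pair (f u v) (p \<cdot> u \<cdot> v))"
    unfolding f_def by (insert exs el_ex[OF p], (assumption | rule par | rule par_leaf)+)
  define M where "M = (\<^bold>\<lambda> u : ?G. \<^bold>\<lambda> v : ?G. pair (f u v) (p \<cdot> u \<cdot> v))"
  have M: "el \<Gamma> (?G \<rightarrow> ?G \<rightarrow> ?G) M" unfolding M_def by (rule beta2_arr(1)[OF G G G fam2 pr])
  have "tr \<Delta> (pr1 (M \<cdot> u \<cdot> v) \<cdot> r =\<^bsub>?C\<^esub> m \<cdot> (pr1 u \<cdot> r) \<cdot> (pr1 v \<cdot> r))"
    if e: "ext \<Gamma> \<Delta>" and u: "el \<Delta> ?G u" and v: "el \<Delta> ?G v" and r: "el \<Delta> ?C r" for \<Delta> u v r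
  proof -
    note G1 = ty_ext[OF e G] and I1 = lat_ext[OF e I]
    have "tr \<Delta> (M \<cdot> u \<cdot> v =\<^bsub>?G\<^esub> pair (f u v) (p \<cdot> u \<cdot> v))"
      unfolding M_def by (rule beta2_arr(2)[OF G1 G1 G1 fam2_ext[OF e fam2] pr[OF ext_trans[OF e]] u v])
    from id_affine_cong[OF I1 this r]
    show ?thesis
      by (rule id_trans[OF _ id_trans[OF id_affine_pair[OF I1 f[OF e u v] puv[OF e u v] r] fb[OF e u v r]]])
  qed
  then show ?thesis using M by blast
qed

text \<open>For a constant \<open>s\<close> the affine equation is the absorption law
  \<open>s = s \<or> (s \<and> r)\<close>.\<close>

lemma affine_constants:
  assumes I: "lat \<Gamma> I"
  shows "\<exists>S. el \<Gamma> (carr I \<rightarrow> affine_maps I) S \<and>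
    (\<forall>\<Delta> s r. ext \<Gamma> \<Delta> \<longrightarrow> el \<Delta> (carr I) s \<longrightarrow> el \<Delta> (carr I) r \<longrightarrow> tr \<Delta> (pr1 (S \<cdot> s) \<cdot> r =\<^bsub>carr I\<^esub> s))"
proof -
  let ?C = "carr I" and ?G = "affine_maps I"
  define f where "f = (\<lambda>s. \<^bold>\<lambda> r : ?C. s)"
  note exs = exlat_fields[OF plat_exlat[OF lat_plat[OF I]]] plat_exlat[OF lat_plat[OF I]]
  note G = ty_affine_maps[OF I] and C = plat_ty[OF lat_plat[OF I]]
  have f: "el \<Delta> (?C \<rightarrow> ?C) (f s)" if "ext \<Gamma> \<Delta>" "el \<Delta> ?C s" for \<Delta> s
    unfolding f_def using ty_ext[OF that(1) C] fam_const[OF el_ex[OF that(2)]]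
    by (intro el_lam_arr) (auto intro: el_ext that(2))
  have fb: "tr \<Delta> (f s \<cdot> r =\<^bsub>?C\<^esub> s)" if "ext \<Gamma> \<Delta>" "el \<Delta> ?C s" "el \<Delta> ?C r" for \<Delta> s r
    unfolding f_def using ty_ext[OF that(1) C] fam_const[OF el_ex[OF that(2)]] that(3)
    by (intro id_beta_arr) (auto intro: el_ext that(2))
  have aff: "tr \<Delta> (affine I (f s))" if "ext \<Gamma> \<Delta>" "el \<Delta> ?C s" for \<Delta> s
    unfolding tr_affine_iff[OF lat_ext[OF that(1) I] f[OF that]]
  proof (intro allI impI)
    fix \<Theta> r assume e: "ext \<Delta> \<Theta>" and r: "el \<Theta> ?C r"
    note I2 = lat_ext[OF ext_trans[OF that(1) e] I]
    note P = lat_plat[OF I2] and s = ext_trans[OF that(1) e] el_ext[OF e that(2)]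
    show "tr \<Theta> (f s \<cdot> r =\<^bsub>?C\<^esub> seg I (f s \<cdot> lbot I) (f s \<cdot> ltop I) r)"
      by (rule id_trans[OF fb[OF s r] id_trans[OF id_sym[OF id_absorb_join[OF I2 s(2) r]]
          id_seg[OF P id_sym[OF fb[OF s el_bot[OF P]]] id_sym[OF fb[OF s el_top[OF P]]] r]]])
  qed
  have fama: "fam (length \<Gamma>) (\<lambda>s. affine I (f s))"
    unfolding f_def by (insert exs, (assumption | rule par rel_affine | rule leaf_struct)+)
  then have "tr \<Gamma> (\<Pi> s : ?C. affine I (f s))" by (rule tr_piI[OF C _ aff])
  then obtain p where p: "el \<Gamma> (\<Pi> s : ?C. affine I (f s)) p" by (auto simp: tr_def)
  have ps: "el \<Delta> (affine I (f s)) (p \<cdot> s)" if "ext \<Gamma> \<Delta>" "el \<Delta> ?C s" for \<Delta> s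
    by (rule el_app[OF el_ext[OF that(1) p] fam_ext[OF that(1) fama] that(2)])
  have pr: "el \<Delta> ?G (pair (f s) (p \<cdot> s))" if "ext \<Gamma> \<Delta>" "el \<Delta> ?C s" for \<Delta> s
    by (rule el_affine_pair[OF lat_ext[OF that(1) I] f[OF that] ps[OF that]])
  have fam: "fam (length \<Gamma>) (\<lambda>s. pair (f s) (p \<cdot> s))"
    unfolding f_def by (insert exs el_ex[OF p], (assumption | rule par | rule par_leaf)+)
  define S where "S = (\<^bold>\<lambda> s : ?C. pair (f s) (p \<cdot> s))"
  have S: "el \<Gamma> (?C \<rightarrow> ?G) S" unfolding S_def by (rule el_lam_arr[OF C G fam pr])
  have "tr \<Delta> (pr1 (S \<cdot> s) \<cdot> r =\<^bsub>?C\<^esub> s)" if e: "ext \<Gamma> \<Delta>" and s: "el \<Delta> ?C s" and r: "el \<Delta> ?C r" for \<Delta> s r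
  proof -
    note I1 = lat_ext[OF e I]
    have "tr \<Delta> (S \<cdot> s =\<^bsub>?G\<^esub> pair (f s) (p \<cdot> s))"
      unfolding S_def by (rule id_beta_arr[OF ty_ext[OF e C] ty_ext[OF e G] fam_ext[OF e fam] pr[OF ext_trans[OF e]] s])
    from id_affine_cong[OF I1 this r]
    show ?thesis
      by (rule id_trans[OF _ id_trans[OF id_affine_pair[OF I1 f[OF e s] ps[OF e s] r] fb[OF e s r]]])
  qed
  then show ?thesis using S by blast
qed

text \<open>For the identity the affine equation is \<open>r = 0 \<or> (1 \<and> r)\<close>.\<close>

lemma affine_identity:
  assumes I: "lat \<Gamma> I"
  shows "\<exists>g. el \<Gamma> (affine_maps I) g \<and> (\<forall>r. el \<Gamma> (carr I) r \<longrightarrow> tr \<Gamma> (pr1 g \<cdot> r =\<^bsub>carr I\<^esub> r))"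
proof -
  let ?i = "\<^bold>\<lambda> r : carr I. r"
  have i: "el \<Gamma> (carr I \<rightarrow> carr I) ?i" by (rule el_identity[OF plat_ty[OF lat_plat[OF I]]])
  have "tr \<Gamma> (affine I ?i)"
    unfolding tr_affine_iff[OF I i]
  proof (intro allI impI)
    fix \<Delta> r assume e: "ext \<Gamma> \<Delta>" and r: "el \<Delta> (carr I) r"
    note I1 = lat_ext[OF e I]
    note P = lat_plat[OF I1]
    show "tr \<Delta> (?i \<cdot> r =\<^bsub>carr I\<^esub> seg I (?i \<cdot> lbot I) (?i \<cdot> ltop I) r)"
      by (rule id_trans[OF id_identity[OF r] id_trans[OF id_sym[OF id_line_unit[OF I1 r]]
          id_seg[OF P id_sym[OF id_identity[OF el_bot[OF P]]] id_sym[OF id_identity[OF el_top[OF P]]] r]]])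
  qed
  then obtain p where p: "el \<Gamma> (affine I ?i) p" by (auto simp: tr_def)
  show ?thesis
    using el_affine_pair[OF I i p] id_trans[OF id_affine_pair[OF I i p] id_identity] by blast
qed

text \<open>The operations are known only through their values, and nothing more is needed: identity
  of affine maps is pointwise. Evaluation at each \<open>s\<close> is exported together with the
  algebra, to be compared with the points of the free algebra.\<close>

lemma affine_algebra:
  assumes I: "lat \<Gamma> I"
  shows "\<exists>G g. alg \<Gamma> I G \<and> carr G = affine_maps I \<and> el \<Gamma> (affine_maps I) g \<and>
    (\<forall>r. el \<Gamma> (carr I) r \<longrightarrow> tr \<Gamma> (pr1 g \<cdot> r =\<^bsub>carr I\<^esub> r)) \<and>
    (\<forall>s. el \<Gamma> (carr I) s \<longrightarrow> (\<exists>h. el \<Gamma> (carr G \<rightarrow> carr (base_alg I)) h \<and> tr \<Gamma> (alg_hom_laws I G (base_alg I) h) \<and>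
      (\<forall>u. el \<Gamma> (affine_maps I) u \<longrightarrow> tr \<Gamma> (h \<cdot> u =\<^bsub>carr I\<^esub> pr1 u \<cdot> s))))"
proof -
  let ?C = "carr I" and ?A = "affine_maps I"
  note P = lat_plat[OF I] and A = ty_affine_maps[OF I]
  note C = plat_ty[OF P]
  have ops: "el \<Gamma> (?C \<rightarrow> ?C \<rightarrow> ?C) (lmeet I)" "el \<Gamma> (?C \<rightarrow> ?C \<rightarrow> ?C) (ljoin I)"
    using P by (auto simp: plat_def)
  obtain S where S: "el \<Gamma> (?C \<rightarrow> ?A) S"
      and S': "\<And>\<Delta> s r. ext \<Gamma> \<Delta> \<Longrightarrow> el \<Delta> ?C s \<Longrightarrow> el \<Delta> ?C r \<Longrightarrow> tr \<Delta> (pr1 (S \<cdot> s) \<cdot> r =\<^bsub>?C\<^esub> s)"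
    using affine_constants[OF I] by blast
  \<comment> \<open>Both values are rewritten as segments, and the operation then passes to the end
    points. For meets the order of the end points comes from \<open>affine_leq\<close>.\<close>
  have "tr \<Delta> (lmeet I \<cdot> (pr1 u \<cdot> r) \<cdot> (pr1 v \<cdot> r) =\<^bsub>?C\<^esub>
        seg I (lmeet I \<cdot> (pr1 u \<cdot> lbot I) \<cdot> (pr1 v \<cdot> lbot I)) (lmeet I \<cdot> (pr1 u \<cdot> ltop I) \<cdot> (pr1 v \<cdot> ltop I)) r)"
      "tr \<Delta> (ljoin I \<cdot> (pr1 u \<cdot> r) \<cdot> (pr1 v \<cdot> r) =\<^bsub>?C\<^esub>
        seg I (ljoin I \<cdot> (pr1 u \<cdot> lbot I) \<cdot> (pr1 v \<cdot> lbot I)) (ljoin I \<cdot> (pr1 u \<cdot> ltop I) \<cdot> (pr1 v \<cdot> ltop I)) r)"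
    if e: "ext \<Gamma> \<Delta>" and u: "el \<Delta> ?A u" and v: "el \<Delta> ?A v" and r: "el \<Delta> ?C r" for \<Delta> u v r
  proof -
    note I1 = lat_ext[OF e I]
    note P1 = lat_plat[OF I1]
    note ends = el_affine_app[OF I1 u el_bot[OF P1]] el_affine_app[OF I1 u el_top[OF P1]]
      el_affine_app[OF I1 v el_bot[OF P1]] el_affine_app[OF I1 v el_top[OF P1]]
    show "tr \<Delta> (lmeet I \<cdot> (pr1 u \<cdot> r) \<cdot> (pr1 v \<cdot> r) =\<^bsub>?C\<^esub>
        seg I (lmeet I \<cdot> (pr1 u \<cdot> lbot I) \<cdot> (pr1 v \<cdot> lbot I)) (lmeet I \<cdot> (pr1 u \<cdot> ltop I) \<cdot> (pr1 v \<cdot> ltop I)) r)"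
      by (rule id_trans[OF id_meet[OF P1 affine_app[OF I1 u r] affine_app[OF I1 v r]]
          id_line_meet[OF I1 ends r affine_leq[OF I1 u] affine_leq[OF I1 v]]])
    show "tr \<Delta> (ljoin I \<cdot> (pr1 u \<cdot> r) \<cdot> (pr1 v \<cdot> r) =\<^bsub>?C\<^esub>
        seg I (ljoin I \<cdot> (pr1 u \<cdot> lbot I) \<cdot> (pr1 v \<cdot> lbot I)) (ljoin I \<cdot> (pr1 u \<cdot> ltop I) \<cdot> (pr1 v \<cdot> ltop I)) r)"
      by (rule id_trans[OF id_join[OF P1 affine_app[OF I1 u r] affine_app[OF I1 v r]]
          id_line_join[OF I1 ends r]])
  qed
  note closed = this
  obtain M where M: "el \<Gamma> (?A \<rightarrow> ?A \<rightarrow> ?A) M"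
      and M': "\<And>\<Delta> u v r. ext \<Gamma> \<Delta> \<Longrightarrow> el \<Delta> ?A u \<Longrightarrow> el \<Delta> ?A v \<Longrightarrow> el \<Delta> ?C r \<Longrightarrow>
        tr \<Delta> (pr1 (M \<cdot> u \<cdot> v) \<cdot> r =\<^bsub>?C\<^esub> lmeet I \<cdot> (pr1 u \<cdot> r) \<cdot> (pr1 v \<cdot> r))"
    using affine_operation[OF I ops(1) closed(1)] by blast
  obtain J where J: "el \<Gamma> (?A \<rightarrow> ?A \<rightarrow> ?A) J"
      and J': "\<And>\<Delta> u v r. ext \<Gamma> \<Delta> \<Longrightarrow> el \<Delta> ?A u \<Longrightarrow> el \<Delta> ?A v \<Longrightarrow> el \<Delta> ?C r \<Longrightarrow>
        tr \<Delta> (pr1 (J \<cdot> u \<cdot> v) \<cdot> r =\<^bsub>?C\<^esub> ljoin I \<cdot> (pr1 u \<cdot> r) \<cdot> (pr1 v \<cdot> r))"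
    using affine_operation[OF I ops(2) closed(2)] by blast
  obtain g where g: "el \<Gamma> ?A g" "\<And>r. el \<Gamma> ?C r \<Longrightarrow> tr \<Gamma> (pr1 g \<cdot> r =\<^bsub>?C\<^esub> r)"
    using affine_identity[OF I] by blast
  have els: "el \<Delta> ?A (S \<cdot> s)" if "ext \<Gamma> \<Delta>" "el \<Delta> ?C s" for \<Delta> s
    by (rule el_arr[OF ty_ext[OF that(1) A] el_ext[OF that(1) S] that(2)])
  have elm: "el \<Delta> ?A (M \<cdot> u \<cdot> v)" and elj: "el \<Delta> ?A (J \<cdot> u \<cdot> v)"
    if "ext \<Gamma> \<Delta>" "el \<Delta> ?A u" "el \<Delta> ?A v" for \<Delta> u v
    by (rule el_arr2[OF ty_ext[OF that(1) A] ty_ext[OF that(1) A] el_ext[OF that(1)] that(2,3)], fact M J)+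
  define G where "G = \<lparr>carr = ?A, lbot = S \<cdot> lbot I, ltop = S \<cdot> ltop I, lmeet = M, ljoin = J, str = S\<rparr>"
  have G [simp]: "carr G = ?A" "lbot G = S \<cdot> lbot I" "ltop G = S \<cdot> ltop I" "lmeet G = M" "ljoin G = J" "str G = S"
    by (simp_all add: G_def)
  note e0 = ext_refl[OF C]
  have PG: "plat \<Gamma> G"
    using A M J els[OF e0 el_bot[OF P]] els[OF e0 el_top[OF P]] by (simp add: plat_def)
  have palg: "palg \<Gamma> I G" using PG S by (simp add: palg_def)
  \<comment> \<open>The premise asks for equal classes instead of an identity, so that each law
    reduces to a HOL equation within the reach of the simplifier.\<close>
  have pointwise: "tr \<Delta> (x =\<^bsub>?A\<^esub> y)"
    if e: "ext \<Gamma> \<Delta>" and x: "el \<Delta> ?A x" and y: "el \<Delta> ?A y"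
      and eq: "\<And>\<Theta> r. ext \<Gamma> \<Theta> \<Longrightarrow> ext \<Delta> \<Theta> \<Longrightarrow> el \<Theta> ?C r \<Longrightarrow> cls \<Theta> ?C (pr1 x \<cdot> r) = cls \<Theta> ?C (pr1 y \<cdot> r)"
    for \<Delta> x y
  proof (rule id_affine[OF lat_ext[OF e I] x y])
    fix \<Theta> r assume e': "ext \<Delta> \<Theta>" and r: "el \<Theta> ?C r"
    note e2 = ext_trans[OF e e']
    note app = el_affine_app[OF lat_ext[OF e2 I] el_ext[OF e'] r]
    show "tr \<Theta> (pr1 x \<cdot> r =\<^bsub>?C\<^esub> pr1 y \<cdot> r)"
      using eq[OF e2 e' r] cls_eq_iff[OF app[OF x] app[OF y]] by blast
  qed
  \<comment> \<open>At a fixed \<open>r\<close>, evaluation turns \<open>M\<close>, \<open>J\<close>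
    and \<open>S \<cdot> s\<close> into meet, join and \<open>s\<close>, so every law is inherited
    from \<open>I\<close>. The last two equations say that the structure map \<open>S\<close>
    preserves the operations.\<close>
  have laws:
    "el \<Theta> ?A u \<Longrightarrow> el \<Theta> ?A v \<Longrightarrow> el \<Theta> ?A w \<Longrightarrow>
      cls \<Theta> ?C (pr1 (M \<cdot> (M \<cdot> u \<cdot> v) \<cdot> w) \<cdot> r) = cls \<Theta> ?C (pr1 (M \<cdot> u \<cdot> (M \<cdot> v \<cdot> w)) \<cdot> r)"
    "el \<Theta> ?A u \<Longrightarrow> el \<Theta> ?A v \<Longrightarrow> el \<Theta> ?A w \<Longrightarrow>
      cls \<Theta> ?C (pr1 (J \<cdot> (J \<cdot> u \<cdot> v) \<cdot> w) \<cdot> r) = cls \<Theta> ?C (pr1 (J \<cdot> u \<cdot> (J \<cdot> v \<cdot> w)) \<cdot> r)"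
    "el \<Theta> ?A u \<Longrightarrow> el \<Theta> ?A v \<Longrightarrow> cls \<Theta> ?C (pr1 (M \<cdot> u \<cdot> v) \<cdot> r) = cls \<Theta> ?C (pr1 (M \<cdot> v \<cdot> u) \<cdot> r)"
    "el \<Theta> ?A u \<Longrightarrow> el \<Theta> ?A v \<Longrightarrow> cls \<Theta> ?C (pr1 (J \<cdot> u \<cdot> v) \<cdot> r) = cls \<Theta> ?C (pr1 (J \<cdot> v \<cdot> u) \<cdot> r)"
    "el \<Theta> ?A u \<Longrightarrow> el \<Theta> ?A v \<Longrightarrow> cls \<Theta> ?C (pr1 (M \<cdot> u \<cdot> (J \<cdot> u \<cdot> v)) \<cdot> r) = cls \<Theta> ?C (pr1 u \<cdot> r)"
    "el \<Theta> ?A u \<Longrightarrow> el \<Theta> ?A v \<Longrightarrow> cls \<Theta> ?C (pr1 (J \<cdot> u \<cdot> (M \<cdot> u \<cdot> v)) \<cdot> r) = cls \<Theta> ?C (pr1 u \<cdot> r)"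
    "el \<Theta> ?A u \<Longrightarrow> cls \<Theta> ?C (pr1 (M \<cdot> u \<cdot> (S \<cdot> ltop I)) \<cdot> r) = cls \<Theta> ?C (pr1 u \<cdot> r)"
    "el \<Theta> ?A u \<Longrightarrow> cls \<Theta> ?C (pr1 (J \<cdot> u \<cdot> (S \<cdot> lbot I)) \<cdot> r) = cls \<Theta> ?C (pr1 u \<cdot> r)"
    "el \<Theta> ?A u \<Longrightarrow> el \<Theta> ?A v \<Longrightarrow> el \<Theta> ?A w \<Longrightarrow>
      cls \<Theta> ?C (pr1 (M \<cdot> u \<cdot> (J \<cdot> v \<cdot> w)) \<cdot> r) = cls \<Theta> ?C (pr1 (J \<cdot> (M \<cdot> u \<cdot> v) \<cdot> (M \<cdot> u \<cdot> w)) \<cdot> r)"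
    "el \<Theta> ?C s \<Longrightarrow> el \<Theta> ?C t \<Longrightarrow>
      cls \<Theta> ?C (pr1 (S \<cdot> (lmeet I \<cdot> s \<cdot> t)) \<cdot> r) = cls \<Theta> ?C (pr1 (M \<cdot> (S \<cdot> s) \<cdot> (S \<cdot> t)) \<cdot> r)"
    "el \<Theta> ?C s \<Longrightarrow> el \<Theta> ?C t \<Longrightarrow>
      cls \<Theta> ?C (pr1 (S \<cdot> (ljoin I \<cdot> s \<cdot> t)) \<cdot> r) = cls \<Theta> ?C (pr1 (J \<cdot> (S \<cdot> s) \<cdot> (S \<cdot> t)) \<cdot> r)"
    if e: "ext \<Gamma> \<Theta>" and r: "el \<Theta> ?C r" for \<Theta> r u v w s t
  proof -
    note I1 = lat_ext[OF e I]
    note P1 = lat_plat[OF I1]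
    interpret bdl "cls \<Theta> ?C ` {a. el \<Theta> ?C a}" "cop \<Theta> ?C (lmeet I)" "cop \<Theta> ?C (ljoin I)"
        "cls \<Theta> ?C (lbot I)" "cls \<Theta> ?C (ltop I)"
      by (rule lat_bdl[OF I1])
    have mem: "el \<Theta> ?A u \<Longrightarrow> cls \<Theta> ?C (pr1 u \<cdot> r) \<in> cls \<Theta> ?C ` {a. el \<Theta> ?C a}" for u
      using el_affine_app[OF I1 _ r] by blast
    have cop: "cls \<Theta> ?C (lmeet I \<cdot> a \<cdot> b) = cop \<Theta> ?C (lmeet I) (cls \<Theta> ?C a) (cls \<Theta> ?C b)"
        "cls \<Theta> ?C (ljoin I \<cdot> a \<cdot> b) = cop \<Theta> ?C (ljoin I) (cls \<Theta> ?C a) (cls \<Theta> ?C b)"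
      if "el \<Theta> ?C a" "el \<Theta> ?C b" for a b
      using cop_cls[OF ty_ext[OF e C] el_ext[OF e ops(1)] that] cop_cls[OF ty_ext[OF e C] el_ext[OF e ops(2)] that]
      by auto
    have ev: "cls \<Theta> ?C (pr1 (M \<cdot> u \<cdot> v) \<cdot> r) = cop \<Theta> ?C (lmeet I) (cls \<Theta> ?C (pr1 u \<cdot> r)) (cls \<Theta> ?C (pr1 v \<cdot> r))"
        "cls \<Theta> ?C (pr1 (J \<cdot> u \<cdot> v) \<cdot> r) = cop \<Theta> ?C (ljoin I) (cls \<Theta> ?C (pr1 u \<cdot> r)) (cls \<Theta> ?C (pr1 v \<cdot> r))"
      if "el \<Theta> ?A u" "el \<Theta> ?A v" for u v
      using cls_eq_iff[OF tr_idD(2,3)[OF M'[OF e that r]]] M'[OF e that r] cop el_affine_app[OF I1 _ r] that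
        cls_eq_iff[OF tr_idD(2,3)[OF J'[OF e that r]]] J'[OF e that r] by auto
    have evs: "cls \<Theta> ?C (pr1 (S \<cdot> s) \<cdot> r) = cls \<Theta> ?C s" if "el \<Theta> ?C s" for s
      using cls_eq_iff[OF tr_idD(2,3)[OF S'[OF e that r]]] S'[OF e that r] by auto
    note simps = mem ev evs elm[OF e] elj[OF e] els[OF e] el_bot[OF P1] el_top[OF P1]
    show "el \<Theta> ?A u \<Longrightarrow> el \<Theta> ?A v \<Longrightarrow> el \<Theta> ?A w \<Longrightarrow>
      cls \<Theta> ?C (pr1 (M \<cdot> (M \<cdot> u \<cdot> v) \<cdot> w) \<cdot> r) = cls \<Theta> ?C (pr1 (M \<cdot> u \<cdot> (M \<cdot> v \<cdot> w)) \<cdot> r)"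
      by (simp add: simps m_assoc)
    show "el \<Theta> ?A u \<Longrightarrow> el \<Theta> ?A v \<Longrightarrow> el \<Theta> ?A w \<Longrightarrow>
      cls \<Theta> ?C (pr1 (J \<cdot> (J \<cdot> u \<cdot> v) \<cdot> w) \<cdot> r) = cls \<Theta> ?C (pr1 (J \<cdot> u \<cdot> (J \<cdot> v \<cdot> w)) \<cdot> r)"
      by (simp add: simps j_assoc)
    show "el \<Theta> ?A u \<Longrightarrow> el \<Theta> ?A v \<Longrightarrow> cls \<Theta> ?C (pr1 (M \<cdot> u \<cdot> v) \<cdot> r) = cls \<Theta> ?C (pr1 (M \<cdot> v \<cdot> u) \<cdot> r)"
      by (simp add: simps m_comm)
    show "el \<Theta> ?A u \<Longrightarrow> el \<Theta> ?A v \<Longrightarrow> cls \<Theta> ?C (pr1 (J \<cdot> u \<cdot> v) \<cdot> r) = cls \<Theta> ?C (pr1 (J \<cdot> v \<cdot> u) \<cdot> r)"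
      by (simp add: simps j_comm)
    show "el \<Theta> ?A u \<Longrightarrow> el \<Theta> ?A v \<Longrightarrow>
      cls \<Theta> ?C (pr1 (M \<cdot> u \<cdot> (J \<cdot> u \<cdot> v)) \<cdot> r) = cls \<Theta> ?C (pr1 u \<cdot> r)"
      by (simp add: simps)
    show "el \<Theta> ?A u \<Longrightarrow> el \<Theta> ?A v \<Longrightarrow>
      cls \<Theta> ?C (pr1 (J \<cdot> u \<cdot> (M \<cdot> u \<cdot> v)) \<cdot> r) = cls \<Theta> ?C (pr1 u \<cdot> r)"
      by (simp add: simps)
    show "el \<Theta> ?A u \<Longrightarrow> cls \<Theta> ?C (pr1 (M \<cdot> u \<cdot> (S \<cdot> ltop I)) \<cdot> r) = cls \<Theta> ?C (pr1 u \<cdot> r)"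
      by (simp add: simps)
    show "el \<Theta> ?A u \<Longrightarrow> cls \<Theta> ?C (pr1 (J \<cdot> u \<cdot> (S \<cdot> lbot I)) \<cdot> r) = cls \<Theta> ?C (pr1 u \<cdot> r)"
      by (simp add: simps)
    show "el \<Theta> ?A u \<Longrightarrow> el \<Theta> ?A v \<Longrightarrow> el \<Theta> ?A w \<Longrightarrow>
      cls \<Theta> ?C (pr1 (M \<cdot> u \<cdot> (J \<cdot> v \<cdot> w)) \<cdot> r) = cls \<Theta> ?C (pr1 (J \<cdot> (M \<cdot> u \<cdot> v) \<cdot> (M \<cdot> u \<cdot> w)) \<cdot> r)"
      by (simp add: simps distrib)
    show "el \<Theta> ?C s \<Longrightarrow> el \<Theta> ?C t \<Longrightarrow>
      cls \<Theta> ?C (pr1 (S \<cdot> (lmeet I \<cdot> s \<cdot> t)) \<cdot> r) = cls \<Theta> ?C (pr1 (M \<cdot> (S \<cdot> s) \<cdot> (S \<cdot> t)) \<cdot> r)"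
      by (simp add: simps cop el_meet[OF P1])
    show "el \<Theta> ?C s \<Longrightarrow> el \<Theta> ?C t \<Longrightarrow>
      cls \<Theta> ?C (pr1 (S \<cdot> (ljoin I \<cdot> s \<cdot> t)) \<cdot> r) = cls \<Theta> ?C (pr1 (J \<cdot> (S \<cdot> s) \<cdot> (S \<cdot> t)) \<cdot> r)"
      by (simp add: simps cop el_join[OF P1])
  qed
  have bt: "el \<Delta> ?A (S \<cdot> lbot I)" "el \<Delta> ?A (S \<cdot> ltop I)" if "ext \<Gamma> \<Delta>" for \<Delta>
    using els[OF that] el_bot el_top plat_ext[OF that P] by blast+
  have LG: "lat \<Gamma> G"
    unfolding lat_def lattice_laws_iff(2)[OF PG] G
    by (intro conjI allI impI PG is_set_affine_maps I; rule pointwise;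
        (assumption | intro elm elj bt | (rule laws; (assumption | erule (1) el_ext))))
  have "tr \<Gamma> (lat_hom_laws I G S)"
    unfolding lat_hom_laws_iff(2)[OF P PG S[folded G(1)]] G
    by (intro conjI allI impI id_refl bt[OF e0]; rule pointwise;
        (assumption | (intro elm els el_meet el_join plat_ext[OF _ P]; assumption) |
          (intro elj els; assumption) | (rule laws; (assumption | erule (1) el_ext))))
  then have alg: "alg \<Gamma> I G" using LG S by (simp add: alg_def)
  \<comment> \<open>Evaluation at \<open>s\<close> is a homomorphism because the operations are
    pointwise; it is compatible with the structure maps because a constant takes its own value at
    \<open>s\<close>.\<close>
  have ev: "\<exists>h. el \<Gamma> (?A \<rightarrow> ?C) h \<and> tr \<Gamma> (alg_hom_laws I G (base_alg I) h) \<and>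
      (\<forall>u. el \<Gamma> ?A u \<longrightarrow> tr \<Gamma> (h \<cdot> u =\<^bsub>?C\<^esub> pr1 u \<cdot> s))" if s: "el \<Gamma> ?C s" for s
  proof -
    define h where "h = (\<^bold>\<lambda> u : ?A. pr1 u \<cdot> s)"
    have fam: "fam (length \<Gamma>) (\<lambda>u. pr1 u \<cdot> s)"
      by (insert el_ex[OF s], (assumption | rule par | rule par_leaf)+)
    have app: "el \<Delta> ?C (pr1 u \<cdot> s)" if "ext \<Gamma> \<Delta>" "el \<Delta> ?A u" for \<Delta> u
      by (rule el_affine_app[OF lat_ext[OF that(1) I] that(2) el_ext[OF that(1) s]])
    have h: "el \<Gamma> (?A \<rightarrow> ?C) h" unfolding h_def by (rule el_lam_arr[OF A C fam app])
    have beta: "tr \<Delta> (h \<cdot> u =\<^bsub>?C\<^esub> pr1 u \<cdot> s)" if "ext \<Gamma> \<Delta>" "el \<Delta> ?A u" for \<Delta> u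
      unfolding h_def
      by (rule id_beta_arr[OF ty_ext[OF that(1) A] ty_ext[OF that(1) C] fam_ext[OF that(1) fam] app[OF ext_trans[OF that(1)]] that(2)])
    note hs = id_trans[OF beta[OF _ els] S'[OF _ _ el_ext[OF _ s]]]
    have "tr \<Gamma> (alg_hom_laws I G (base_alg I) h)"
    proof (rule alg_homI[OF P palg alg_palg[OF alg_base_alg[OF I]]]; simp only: G base_alg_fields)
      show "el \<Gamma> (?A \<rightarrow> ?C) h" by (rule h)
      show "tr \<Gamma> (h \<cdot> (S \<cdot> lbot I) =\<^bsub>?C\<^esub> lbot I)" "tr \<Gamma> (h \<cdot> (S \<cdot> ltop I) =\<^bsub>?C\<^esub> ltop I)"
        using hs e0 el_bot[OF P] el_top[OF P] by blast+
      fix \<Delta> assume e: "ext \<Gamma> \<Delta>"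
      note P1 = plat_ext[OF e P] and s1 = el_ext[OF e s]
      { fix x y assume x: "el \<Delta> ?A x" and y: "el \<Delta> ?A y"
        show "tr \<Delta> (h \<cdot> (M \<cdot> x \<cdot> y) =\<^bsub>?C\<^esub> lmeet I \<cdot> (h \<cdot> x) \<cdot> (h \<cdot> y))"
          by (rule id_trans[OF beta[OF e elm[OF e x y]] id_trans[OF M'[OF e x y s1]
              id_meet[OF P1 id_sym[OF beta[OF e x]] id_sym[OF beta[OF e y]]]]])
        show "tr \<Delta> (h \<cdot> (J \<cdot> x \<cdot> y) =\<^bsub>?C\<^esub> ljoin I \<cdot> (h \<cdot> x) \<cdot> (h \<cdot> y))"
          by (rule id_trans[OF beta[OF e elj[OF e x y]] id_trans[OF J'[OF e x y s1]
              id_join[OF P1 id_sym[OF beta[OF e x]] id_sym[OF beta[OF e y]]]]]) }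
      fix r assume r: "el \<Delta> ?C r"
      show "tr \<Delta> (h \<cdot> (S \<cdot> r) =\<^bsub>?C\<^esub> (\<^bold>\<lambda> r : ?C. r) \<cdot> r)"
        by (rule id_trans[OF hs[OF e e r e r e] id_sym[OF id_identity[OF r]]])
    qed
    then show ?thesis using h beta[OF e0] by blast
  qed
  show ?thesis
    by (rule exI[of _ G], rule exI[of _ g]) (use alg g ev in simp)
qed


section \<open>Functions on the lattice are affine\<close>

lemma fun_affine:
  assumes I: "lat \<Gamma> I" and l: "tp \<Gamma> l (carr I)" and F: "palg \<Gamma> I F" and i: "el \<Gamma> (carr F) i"
    and free: "tr \<Gamma> (is_free_on l I F i)" and qc: "tr \<Gamma> (quasi_coherent I F)"
    and f: "el \<Gamma> (carr I \<rightarrow> carr I) f" and r: "el \<Gamma> (carr I) r"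
  shows "tr \<Gamma> (f \<cdot> r =\<^bsub>carr I\<^esub> seg I (f \<cdot> lbot I) (f \<cdot> ltop I) r)"
proof -
  let ?C = "carr I" and ?A = "affine_maps I" and ?B = "base_alg I"
  note P = lat_plat[OF I] and A = ty_affine_maps[OF I]
  note C = plat_ty[OF P] and B = alg_base_alg[OF I]
  have lB: "tp \<Gamma> l (carr ?B)" using l by simp
  note e0 = ext_refl[OF C]
  obtain G g where G: "alg \<Gamma> I G" and CG: "carr G = ?A" and g: "el \<Gamma> ?A g"
      and g': "\<And>r. el \<Gamma> ?C r \<Longrightarrow> tr \<Gamma> (pr1 g \<cdot> r =\<^bsub>?C\<^esub> r)"
      and ev: "\<And>s. el \<Gamma> ?C s \<Longrightarrow> \<exists>h. el \<Gamma> (carr G \<rightarrow> carr ?B) h \<and> tr \<Gamma> (alg_hom_laws I G ?B h) \<and>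
        (\<forall>u. el \<Gamma> ?A u \<longrightarrow> tr \<Gamma> (h \<cdot> u =\<^bsub>?C\<^esub> pr1 u \<cdot> s))"
    using affine_algebra[OF I] by blast
  have lG: "tp \<Gamma> l (carr G)" unfolding CG by (rule tp_affine_maps[OF I l])
  note pG = alg_palg[OF G] and pB = alg_palg[OF B]
  \<comment> \<open>The lift that sends the generator to the identity map \<open>g\<close>. It
    exists because the affine maps form an algebra at level \<open>l\<close>.\<close>
  obtain k where k: "el \<Gamma> (alg_hom I F G) k" and ki: "tr \<Gamma> (pr1 k \<cdot> i =\<^bsub>?A\<^esub> g)"
    using lift_exists[OF P F i free G lG] g unfolding CG by blast
  \<comment> \<open>\<open>f\<close> moved to the spectrum of \<open>F\<close>, along the
    correspondence that sends a point to its value at the generator.\<close>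
  let ?b = "\<^bold>\<lambda> x : Spec I F. f \<cdot> (pr1 x \<cdot> i)"
  have fam: "fam (length \<Gamma>) (\<lambda>x. f \<cdot> (pr1 x \<cdot> i))"
    by (insert el_ex[OF f] el_ex[OF i], (assumption | rule par | rule par_leaf)+)
  have pt: "el \<Delta> ?C (f \<cdot> (pr1 x \<cdot> i))" if "ext \<Gamma> \<Delta>" "el \<Delta> (Spec I F) x" for \<Delta> x
    by (rule el_arr[OF ty_ext[OF that(1) C] el_ext[OF that(1) f]
        el_point[OF lat_ext[OF that(1) I] palg_ext[OF that(1) F] that(2) el_ext[OF that(1) i]]])
  note S = ty_Spec[OF I F]
  have b: "el \<Gamma> (Spec I F \<rightarrow> ?C) ?b" by (rule el_lam_arr[OF S C fam pt])
  obtain p where p: "el \<Gamma> (carr F) p"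
      and pb: "\<And>x. el \<Gamma> (Spec I F) x \<Longrightarrow> tr \<Gamma> (pr1 x \<cdot> p =\<^bsub>?C\<^esub> ?b \<cdot> x)"
    using quasi_coherentD[OF I F qc b] by blast
  \<comment> \<open>The affine map that will turn out to have the same values as
    \<open>f\<close>.\<close>
  define q where "q = pr1 k \<cdot> p"
  have q: "el \<Gamma> ?A q" unfolding q_def using el_hom_app[OF P F pG k p] by (simp add: CG)
  have main: "tr \<Gamma> (f \<cdot> s =\<^bsub>?C\<^esub> pr1 q \<cdot> s)" if s: "el \<Gamma> ?C s" for s
  proof -
    have sB: "el \<Gamma> (carr ?B) s" using s by simp
    \<comment> \<open>The point of the spectrum that corresponds to \<open>s\<close>, found by
      freeness with the base algebra as target.\<close>
    obtain x where x: "el \<Gamma> (alg_hom I F ?B) x" and xi: "tr \<Gamma> (pr1 x \<cdot> i =\<^bsub>?C\<^esub> s)"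
      using lift_exists[OF P F i free B lB sB] by auto
    obtain h where h: "el \<Gamma> (carr G \<rightarrow> carr ?B) h" "tr \<Gamma> (alg_hom_laws I G ?B h)"
        and hu: "\<And>u. el \<Gamma> ?A u \<Longrightarrow> tr \<Gamma> (h \<cdot> u =\<^bsub>?C\<^esub> pr1 u \<cdot> s)"
      using ev[OF s] by blast
    \<comment> \<open>\<open>k\<close> followed by evaluation at \<open>s\<close>; its value at the
      generator is the identity map evaluated at \<open>s\<close>, that is, \<open>s\<close>
      again.\<close>
    obtain c where c: "el \<Gamma> (carr F \<rightarrow> carr ?B) c" "tr \<Gamma> (alg_hom_laws I F ?B c)"
        and ca: "\<And>a. el \<Gamma> (carr F) a \<Longrightarrow> tr \<Gamma> (c \<cdot> a =\<^bsub>?C\<^esub> h \<cdot> (pr1 k \<cdot> a))"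
      using hom_compose[OF P F pG pB el_hom_fun[OF P F pG k] el_hom_laws[OF P F pG k] h] by auto
    obtain y where y: "el \<Gamma> (alg_hom I F ?B) y" and yc: "tr \<Gamma> (pr1 y =\<^bsub>carr F \<rightarrow> carr ?B\<^esub> c)"
      using hom_exists[OF P F pB c] by blast
    have ya: "tr \<Gamma> (pr1 y \<cdot> a =\<^bsub>?C\<^esub> h \<cdot> (pr1 k \<cdot> a))" if a: "el \<Gamma> (carr F) a" for a
      using id_trans[OF id_app_arr[OF C yc[simplified] id_refl[OF a]] ca[OF a]] .
    have "tr \<Gamma> (h \<cdot> (pr1 k \<cdot> i) =\<^bsub>?C\<^esub> h \<cdot> g)"
      using id_app_arr[OF C id_refl[OF h(1)[unfolded CG base_alg_fields]] ki] .
    from id_trans[OF ya[OF i] id_trans[OF this id_trans[OF hu[OF g] g'[OF s]]]]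
    have yi: "tr \<Gamma> (pr1 y \<cdot> i =\<^bsub>?C\<^esub> s)" .
    \<comment> \<open>Both homomorphisms lift \<open>s\<close>, so uniqueness identifies them, and
      in particular their values at \<open>p\<close>.\<close>
    have "tr \<Gamma> (x =\<^bsub>alg_hom I F ?B\<^esub> y)"
      using lift_unique[OF P F i free B lB sB x _ y] xi yi by simp
    from id_pr1[OF this[unfolded alg_hom_def]] have "tr \<Gamma> (pr1 x =\<^bsub>carr F \<rightarrow> ?C\<^esub> pr1 y)" by simp
    from id_app_arr[OF C this id_refl[OF p]] have xp: "tr \<Gamma> (pr1 x \<cdot> p =\<^bsub>?C\<^esub> pr1 y \<cdot> p)" .
    have yp: "tr \<Gamma> (pr1 y \<cdot> p =\<^bsub>?C\<^esub> pr1 q \<cdot> s)"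
      using id_trans[OF ya[OF p] hu[OF q, unfolded q_def]] by (simp add: q_def)
    have xS: "el \<Gamma> (Spec I F) x" using x by (simp add: Spec_def)
    \<comment> \<open>The chain is \<open>f(s) = f(x(i)) = x(p) = y(p) = q(s)\<close>, where the
      second step is the choice of \<open>p\<close>.\<close>
    have "tr \<Gamma> (?b \<cdot> x =\<^bsub>?C\<^esub> f \<cdot> (pr1 x \<cdot> i))" by (rule id_beta_arr[OF S C fam pt xS])
    moreover have "tr \<Gamma> (f \<cdot> (pr1 x \<cdot> i) =\<^bsub>?C\<^esub> f \<cdot> s)" by (rule id_app_arr[OF C id_refl[OF f] xi])
    ultimately have "tr \<Gamma> (pr1 x \<cdot> p =\<^bsub>?C\<^esub> f \<cdot> s)" by (rule id_trans[OF pb[OF xS] id_trans])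
    then show ?thesis by (rule id_trans[OF id_sym id_trans[OF xp yp]])
  qed
  \<comment> \<open>\<open>q\<close> satisfies the affine equation, and \<open>main\<close> at
    \<open>r\<close>, \<open>lbot\<close> and \<open>ltop\<close> carries it over to
    \<open>f\<close>.\<close>
  show ?thesis
    by (rule id_trans[OF main[OF r] id_trans[OF affine_app[OF I q r]
        id_seg[OF P id_sym[OF main[OF el_bot[OF P]]] id_sym[OF main[OF el_top[OF P]]] r]]])
qed


section \<open>Paths in spectra\<close>

text \<open>Everything that the study of paths takes from the free algebra, as a property of
  \<open>I\<close>. It is stated for all extensions because it is applied to functions that depend
  on variables bound later.\<close>

definition funs_affine :: "tm list \<Rightarrow> lat \<Rightarrow> bool" where
  "funs_affine \<Gamma> I \<longleftrightarrow> (\<forall>\<Delta> f r. ext \<Gamma> \<Delta> \<longrightarrow> el \<Delta> (carr I \<rightarrow> carr I) f \<longrightarrow> el \<Delta> (carr I) r \<longrightarrow>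
    tr \<Delta> (f \<cdot> r =\<^bsub>carr I\<^esub> seg I (f \<cdot> lbot I) (f \<cdot> ltop I) r))"

lemma funs_affine_ext: "ext \<Gamma> \<Delta> \<Longrightarrow> funs_affine \<Gamma> I \<Longrightarrow> funs_affine \<Delta> I"
  unfolding funs_affine_def using ext_trans by blast

context
  fixes \<Gamma> I A
  assumes I: "lat \<Gamma> I" and A: "palg \<Gamma> I A"
begin

private lemmas P_c = lat_plat[OF I]
private lemmas C_c = plat_ty[OF P_c]
private lemmas CA_c = plat_ty[OF palg_plat[OF A]]
private lemmas S_c = ty_Spec[OF I A]
private lemmas base_c = palg_base[OF I A]
private lemmas exs_c = exlat_fields[OF plat_exlat[OF P_c]] plat_exlat[OF P_c] palg_exalg[OF A] ty_ex[OF S_c] ty_ex[OF CA_c]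

lemma point_cong:
  assumes "tr \<Gamma> (x =\<^bsub>Spec I A\<^esub> y)" "el \<Gamma> (carr A) a"
  shows "tr \<Gamma> (pr1 x \<cdot> a =\<^bsub>carr I\<^esub> pr1 y \<cdot> a)"
  using id_pr1[OF assms(1)[unfolded Spec_def alg_hom_def]] id_refl[OF assms(2)]
  by (intro id_app_arr[OF C_c]) simp_all

lemma point_eq:
  assumes "el \<Gamma> (Spec I A) x" "el \<Gamma> (Spec I A) y"
    and "\<And>\<Delta> a. ext \<Gamma> \<Delta> \<Longrightarrow> el \<Delta> (carr A) a \<Longrightarrow> tr \<Delta> (pr1 x \<cdot> a =\<^bsub>carr I\<^esub> pr1 y \<cdot> a)"
  shows "tr \<Gamma> (x =\<^bsub>Spec I A\<^esub> y)"
  using assms lat_is_set[OF I] unfolding Spec_def by (intro id_hom[OF P_c A base_c]) simp_all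

lemma point_laws:
  assumes x: "el \<Gamma> (Spec I A) x"
  shows "tr \<Gamma> (pr1 x \<cdot> lbot A =\<^bsub>carr I\<^esub> lbot I)" "tr \<Gamma> (pr1 x \<cdot> ltop A =\<^bsub>carr I\<^esub> ltop I)"
    and "el \<Gamma> (carr A) a \<Longrightarrow> el \<Gamma> (carr A) b \<Longrightarrow>
      tr \<Gamma> (pr1 x \<cdot> (lmeet A \<cdot> a \<cdot> b) =\<^bsub>carr I\<^esub> lmeet I \<cdot> (pr1 x \<cdot> a) \<cdot> (pr1 x \<cdot> b))"
    and "el \<Gamma> (carr A) a \<Longrightarrow> el \<Gamma> (carr A) b \<Longrightarrow>
      tr \<Gamma> (pr1 x \<cdot> (ljoin A \<cdot> a \<cdot> b) =\<^bsub>carr I\<^esub> ljoin I \<cdot> (pr1 x \<cdot> a) \<cdot> (pr1 x \<cdot> b))"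
    and "el \<Gamma> (carr I) r \<Longrightarrow> tr \<Gamma> (pr1 x \<cdot> (str A \<cdot> r) =\<^bsub>carr I\<^esub> str (base_alg I) \<cdot> r)"
  using alg_homD[OF P_c A base_c el_hom_fun[OF P_c A base_c] el_hom_laws[OF P_c A base_c]] x
  unfolding Spec_def base_alg_fields by blast+

lemma el_seg_points:
  assumes y: "el \<Gamma> (Spec I A \<otimes> Spec I A) y" and "el \<Gamma> (carr A) a" "el \<Gamma> (carr I) r"
  shows "el \<Gamma> (carr I) (seg I (pr1 (pr1 y) \<cdot> a) (pr1 (pr2 y) \<cdot> a) r)"
  using el_point[OF I A el_prod1[OF y]] el_point[OF I A el_prod2[OF S_c y]] assms by (intro el_seg P_c)

lemma path_affine:
  assumes aff: "funs_affine \<Gamma> I" and c: "el \<Gamma> (carr I \<rightarrow> Spec I A) c" and a: "el \<Gamma> (carr A) a" and r: "el \<Gamma> (carr I) r"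
  shows "tr \<Gamma> (pr1 (c \<cdot> r) \<cdot> a =\<^bsub>carr I\<^esub> seg I (pr1 (c \<cdot> lbot I) \<cdot> a) (pr1 (c \<cdot> ltop I) \<cdot> a) r)"
proof -
  let ?f = "\<^bold>\<lambda> r : carr I. pr1 (c \<cdot> r) \<cdot> a"
  have fam: "fam (length \<Gamma>) (\<lambda>r. pr1 (c \<cdot> r) \<cdot> a)"
    by (insert el_ex[OF c] el_ex[OF a], (assumption | rule par | rule par_leaf)+)
  have app: "el \<Delta> (carr I) (pr1 (c \<cdot> r) \<cdot> a)" if "ext \<Gamma> \<Delta>" "el \<Delta> (carr I) r" for \<Delta> r
    by (rule el_point[OF lat_ext[OF that(1) I] palg_ext[OF that(1) A]
        el_arr[OF ty_ext[OF that(1) S_c] el_ext[OF that(1) c] that(2)] el_ext[OF that(1) a]])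
  have f: "el \<Gamma> (carr I \<rightarrow> carr I) ?f" by (rule el_lam_arr[OF C_c C_c fam app])
  note beta = id_beta_arr[OF C_c C_c fam app r] id_beta_arr[OF C_c C_c fam app el_bot[OF P_c]]
    id_beta_arr[OF C_c C_c fam app el_top[OF P_c]]
  have "tr \<Gamma> (?f \<cdot> r =\<^bsub>carr I\<^esub> seg I (?f \<cdot> lbot I) (?f \<cdot> ltop I) r)"
    using aff f r ext_refl[OF C_c] unfolding funs_affine_def by blast
  from id_trans[OF id_sym[OF beta(1)] id_trans[OF this id_seg[OF P_c beta(2) beta(3) r]]]
  show ?thesis .
qed

lemma fam_endpoints: "fam (length \<Gamma>) (\<lambda>c. pair (c \<cdot> lbot I) (c \<cdot> ltop I))"
  by (insert exs_c, (assumption | rule par | rule par_leaf)+)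

end

section \<open>The end point map and its fibres\<close>

context
  fixes \<Gamma> I A
  assumes I: "lat \<Gamma> I" and A: "palg \<Gamma> I A"
begin

private lemmas P_d = lat_plat[OF I]
private lemmas C_d = plat_ty[OF P_d]
private lemmas S_d = ty_Spec[OF I A]

lemma ty_paths: "ty \<Gamma> (path_space I (Spec I A))" "ty \<Gamma> (Spec I A \<otimes> Spec I A)"
  unfolding path_space_def using ty_arr[OF C_d S_d] ty_prod[OF S_d S_d] .

lemma el_ends:
  assumes "ext \<Gamma> \<Delta>" "el \<Delta> (path_space I (Spec I A)) c"
  shows "el \<Delta> (Spec I A) (c \<cdot> lbot I)" "el \<Delta> (Spec I A) (c \<cdot> ltop I)"
    "el \<Delta> (Spec I A \<otimes> Spec I A) (pair (c \<cdot> lbot I) (c \<cdot> ltop I))"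
proof -
  note P = plat_ext[OF assms(1) P_d]
  note c = el_arr[OF ty_ext[OF assms(1) S_d] assms(2)[unfolded path_space_def]]
  from c[OF el_bot[OF P]] c[OF el_top[OF P]]
  show "el \<Delta> (Spec I A) (c \<cdot> lbot I)" "el \<Delta> (Spec I A) (c \<cdot> ltop I)"
    "el \<Delta> (Spec I A \<otimes> Spec I A) (pair (c \<cdot> lbot I) (c \<cdot> ltop I))"
    by (auto intro: el_prodI)
qed

lemma el_endpoints: "el \<Gamma> (path_space I (Spec I A) \<rightarrow> Spec I A \<otimes> Spec I A) (endpoints I (Spec I A))"
  unfolding endpoints_def by (rule el_lam_arr[OF ty_paths fam_endpoints[OF I A] el_ends(3)])

lemma id_endpoints:
  assumes c: "el \<Gamma> (path_space I (Spec I A)) c"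
  shows "tr \<Gamma> (pr1 (endpoints I (Spec I A) \<cdot> c) =\<^bsub>Spec I A\<^esub> c \<cdot> lbot I)"
    "tr \<Gamma> (pr2 (endpoints I (Spec I A) \<cdot> c) =\<^bsub>Spec I A\<^esub> c \<cdot> ltop I)"
proof -
  note ends = el_ends[OF ext_refl[OF C_d] c]
  have *: "tr \<Gamma> (endpoints I (Spec I A) \<cdot> c =\<^bsub>Spec I A \<otimes> Spec I A\<^esub> pair (c \<cdot> lbot I) (c \<cdot> ltop I))"
    unfolding endpoints_def by (rule id_beta_arr[OF ty_paths fam_endpoints[OF I A] el_ends(3) c])
  show "tr \<Gamma> (pr1 (endpoints I (Spec I A) \<cdot> c) =\<^bsub>Spec I A\<^esub> c \<cdot> lbot I)"
    by (rule id_trans[OF id_pr1[OF *[unfolded prod_ty_def]] id_pr1_pair[OF ends(1,2)]])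
  show "tr \<Gamma> (pr2 (endpoints I (Spec I A) \<cdot> c) =\<^bsub>Spec I A\<^esub> c \<cdot> ltop I)"
    by (rule id_trans[OF id_pr2[OF S_d *] id_pr2_pair[OF ends(1,2)]])
qed

lemma fam_fiber:
  assumes y: "ex (length \<Gamma>) y"
  shows "fam (length \<Gamma>) (\<lambda>c. endpoints I (Spec I A) \<cdot> c =\<^bsub>Spec I A \<otimes> Spec I A\<^esub> y)"
  by (insert y el_ex[OF el_endpoints] ty_ex[OF ty_paths(2)], (assumption | rule famI rel_id rel_app | rule par_leaf)+)

lemma fam_fibers:
  "fam (length \<Gamma>) (\<lambda>y. is_prop (fiber (path_space I (Spec I A)) (Spec I A \<otimes> Spec I A) (endpoints I (Spec I A)) y))"
  "fam (length \<Gamma>) (\<lambda>y. (fiber (path_space I (Spec I A)) (Spec I A \<otimes> Spec I A) (endpoints I (Spec I A)) y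
      \<rightarrow> satisfaction_order I A y) \<otimes>
    (satisfaction_order I A y \<rightarrow> fiber (path_space I (Spec I A)) (Spec I A \<otimes> Spec I A) (endpoints I (Spec I A)) y))"
  by (insert plat_exlat[OF P_d] palg_exalg[OF A], (assumption | rule par_struct | rule leaf_struct)+)

end

context
  fixes \<Gamma> I A y
  assumes I: "lat \<Gamma> I" and A: "palg \<Gamma> I A" and y: "el \<Gamma> (Spec I A \<otimes> Spec I A) y"
begin

private abbreviation (input) fib where
  "fib \<equiv> fiber (path_space I (Spec I A)) (Spec I A \<otimes> Spec I A) (endpoints I (Spec I A)) y"

private lemmas S_e = ty_Spec[OF I A]
private lemmas y1_e = el_prod1[OF y]
private lemmas y2_e = el_prod2[OF S_e y]
private lemmas P_e = lat_plat[OF I]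

lemma ty_fiber: "ty \<Gamma> fib"
  unfolding fiber_def
proof (rule ty_sig[OF ty_paths(1)[OF I A] fam_fiber[OF I A el_ex[OF y]]])
  fix \<Delta> c assume e: "ext \<Gamma> \<Delta>" and c: "el \<Delta> (path_space I (Spec I A)) c"
  show "ty \<Delta> (endpoints I (Spec I A) \<cdot> c =\<^bsub>Spec I A \<otimes> Spec I A\<^esub> y)"
    by (rule ty_id[OF el_arr[OF ty_ext[OF e ty_paths(2)[OF I A]] el_ext[OF e el_endpoints[OF I A]] c] el_ext[OF e y]])
qed

lemma el_fiber:
  assumes "el \<Gamma> fib u"
  shows "el \<Gamma> (carr I \<rightarrow> Spec I A) (pr1 u)"
    "tr \<Gamma> (endpoints I (Spec I A) \<cdot> pr1 u =\<^bsub>Spec I A \<otimes> Spec I A\<^esub> y)"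
  using el_pr1[OF assms[unfolded fiber_def]] el_tr[OF el_pr2[OF assms[unfolded fiber_def] fam_fiber[OF I A el_ex[OF y]]]]
  by (simp_all add: path_space_def)

lemma fiber_ends:
  assumes u: "el \<Gamma> fib u"
  shows "tr \<Gamma> (pr1 u \<cdot> lbot I =\<^bsub>Spec I A\<^esub> pr1 y)" "tr \<Gamma> (pr1 u \<cdot> ltop I =\<^bsub>Spec I A\<^esub> pr2 y)"
proof -
  note c = el_fiber[OF u]
  note e = id_endpoints[OF I A c(1)[folded path_space_def]]
  show "tr \<Gamma> (pr1 u \<cdot> lbot I =\<^bsub>Spec I A\<^esub> pr1 y)"
    by (rule id_trans[OF id_sym[OF e(1)] id_pr1[OF c(2)[unfolded prod_ty_def]]])
  show "tr \<Gamma> (pr1 u \<cdot> ltop I =\<^bsub>Spec I A\<^esub> pr2 y)"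
    by (rule id_trans[OF id_sym[OF e(2)] id_pr2[OF S_e c(2)]])
qed

text \<open>The affine description of a path, with its ends replaced by the components of
  \<open>y\<close>. The right hand side no longer mentions \<open>u\<close>, which is why a fibre
  has at most one element.\<close>

lemma fiber_affine:
  assumes "funs_affine \<Gamma> I" "el \<Gamma> fib u" "el \<Gamma> (carr A) a" "el \<Gamma> (carr I) r"
  shows "tr \<Gamma> (pr1 (pr1 u \<cdot> r) \<cdot> a =\<^bsub>carr I\<^esub> seg I (pr1 (pr1 y) \<cdot> a) (pr1 (pr2 y) \<cdot> a) r)"
  by (rule id_trans[OF path_affine[OF I A assms(1) el_fiber(1)[OF assms(2)] assms(3,4)]
      id_seg[OF P_e point_cong[OF I A fiber_ends(1)[OF assms(2)] assms(3)]
        point_cong[OF I A fiber_ends(2)[OF assms(2)] assms(3)] assms(4)]])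

lemma fam_order: "fam (length \<Gamma>) (\<lambda>a. leq I (pr1 (pr1 y) \<cdot> a) (pr1 (pr2 y) \<cdot> a))"
  by (insert plat_exlat[OF P_e] el_ex[OF y], (assumption | rule par_struct | rule leaf_struct)+)

lemma ty_satisfaction_order: "ty \<Gamma> (satisfaction_order I A y)"
  unfolding satisfaction_order_def
proof (rule ty_pi[OF plat_ty[OF palg_plat[OF A]] fam_order])
  fix \<Delta> a assume e: "ext \<Gamma> \<Delta>" and a: "el \<Delta> (carr A) a"
  note app = el_point[OF lat_ext[OF e I] palg_ext[OF e A] el_ext[OF e] a]
  show "ty \<Delta> (leq I (pr1 (pr1 y) \<cdot> a) (pr1 (pr2 y) \<cdot> a))"
    unfolding leq_def by (rule ty_id[OF el_meet[OF plat_ext[OF e P_e] app[OF y1_e] app[OF y2_e]] app[OF y1_e]])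
qed

lemma tr_satisfaction_order_iff:
  "tr \<Gamma> (satisfaction_order I A y) \<longleftrightarrow>
    (\<forall>\<Delta> a. ext \<Gamma> \<Delta> \<longrightarrow> el \<Delta> (carr A) a \<longrightarrow> tr \<Delta> (leq I (pr1 (pr1 y) \<cdot> a) (pr1 (pr2 y) \<cdot> a)))"
  unfolding satisfaction_order_def by (rule tr_pi_iff[OF plat_ty[OF palg_plat[OF A]] fam_order])

end

text \<open>At \<open>ltop\<close> the affine description of the path presents the second end point
  as its join with the first.\<close>

lemma fiber_order:
  assumes I: "lat \<Gamma> I" and A: "palg \<Gamma> I A" and aff: "funs_affine \<Gamma> I"
    and y: "el \<Gamma> (Spec I A \<otimes> Spec I A) y"
    and u: "el \<Gamma> (fiber (path_space I (Spec I A)) (Spec I A \<otimes> Spec I A) (endpoints I (Spec I A)) y) u"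
  shows "tr \<Gamma> (satisfaction_order I A y)"
  unfolding tr_satisfaction_order_iff[OF I A y]
proof (intro allI impI)
  fix \<Delta> a assume e: "ext \<Gamma> \<Delta>" and a: "el \<Delta> (carr A) a"
  note I1 = lat_ext[OF e I] and A1 = palg_ext[OF e A] and y1 = el_ext[OF e y] and u1 = el_ext[OF e u]
  note P = lat_plat[OF I1]
  note top = el_top[OF P]
  note app = el_point[OF I1 A1 _ a]
  have "tr \<Delta> (pr1 (pr2 y) \<cdot> a =\<^bsub>carr I\<^esub> seg I (pr1 (pr1 y) \<cdot> a) (pr1 (pr2 y) \<cdot> a) (ltop I))"
    by (rule id_trans[OF id_sym[OF point_cong[OF I1 A1 fiber_ends(2)[OF I1 A1 y1 u1] a]]
        fiber_affine[OF I1 A1 y1 funs_affine_ext[OF e aff] u1 a top]])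
  then show "tr \<Delta> (leq I (pr1 (pr1 y) \<cdot> a) (pr1 (pr2 y) \<cdot> a))"
    by (rule leq_line[OF I1 app[OF el_prod1[OF y1]] app[OF el_prod2[OF ty_Spec[OF I1 A1] y1]]])
qed

text \<open>The order enters at two places: for the segment to preserve meets, and for its value at
  \<open>ltop\<close> to be the second component of \<open>y\<close>.\<close>

lemma order_fiber:
  assumes I: "lat \<Gamma> I" and A: "palg \<Gamma> I A" and y: "el \<Gamma> (Spec I A \<otimes> Spec I A) y"
    and le: "tr \<Gamma> (satisfaction_order I A y)"
  shows "tr \<Gamma> (fiber (path_space I (Spec I A)) (Spec I A \<otimes> Spec I A) (endpoints I (Spec I A)) y)"
proof -
  let ?C = "carr I" and ?B = "base_alg I" and ?S = "Spec I A" and ?CA = "carr A"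
  let ?z = "\<lambda>a r. seg I (pr1 (pr1 y) \<cdot> a) (pr1 (pr2 y) \<cdot> a) r"
  define f where "f = (\<lambda>r. \<^bold>\<lambda> a : ?CA. ?z a r)"
  note S = ty_Spec[OF I A] and P = lat_plat[OF I]
  note C = plat_ty[OF P] and CA = plat_ty[OF palg_plat[OF A]] and base = palg_base[OF I A]
  note exs = exlat_fields[OF plat_exlat[OF P]] ty_ex[OF CA] el_ex[OF y]
  note exs' = plat_exlat[OF P] palg_exalg[OF A]
  have fz: "fam (length \<Delta>) (\<lambda>a. ?z a r)" if "ext \<Gamma> \<Delta>" "el \<Delta> ?C r" for \<Delta> r
    by (insert exs[THEN ex_ext[OF that(1)]] el_ex[OF that(2)], (assumption | rule par | rule par_leaf)+)
  have z: "el \<Theta> ?C (?z a r)" if "ext \<Gamma> \<Delta>" "el \<Delta> ?C r" "ext \<Delta> \<Theta>" "el \<Theta> ?CA a" for \<Delta> \<Theta> r a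
    using ext_trans[OF that(1,3)] I A y that(4) el_ext[OF that(3,2)]
    by (intro el_seg_points) (auto intro: lat_ext palg_ext el_ext)
  have f: "el \<Delta> (?CA \<rightarrow> carr ?B) (f r)" if "ext \<Gamma> \<Delta>" "el \<Delta> ?C r" for \<Delta> r
    unfolding f_def base_alg_fields
    by (rule el_lam_arr[OF ty_ext[OF that(1) CA] ty_ext[OF that(1) C] fz[OF that] z[OF that]])
  have fa: "tr \<Theta> (f r \<cdot> a =\<^bsub>?C\<^esub> ?z a r)" if "ext \<Gamma> \<Theta>" "el \<Theta> ?C r" "el \<Theta> ?CA a" for \<Theta> r a
    unfolding f_def
    by (rule id_beta_arr[OF ty_ext[OF that(1) CA] ty_ext[OF that(1) C] fz[OF that(1,2)] z[OF that(1,2)] that(3)])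
  have hom: "tr \<Delta> (alg_hom_laws I A ?B (f r))" if e: "ext \<Gamma> \<Delta>" and r: "el \<Delta> ?C r" for \<Delta> r
  proof (rule alg_homI[OF plat_ext[OF e P] palg_ext[OF e A] palg_ext[OF e base] f[OF e r]]; unfold base_alg_fields)
    \<comment> \<open>Handles bottom, top and the structure map together: where all points take the
      same value \<open>c\<close>, both ends of the segment are \<open>c\<close>, and absorption
      makes the segment constant.\<close>
    have const: "tr \<Theta> (f r \<cdot> a =\<^bsub>?C\<^esub> c)"
      if e': "ext \<Delta> \<Theta>" and a: "el \<Theta> ?CA a" and c: "\<And>x. el \<Theta> ?S x \<Longrightarrow> tr \<Theta> (pr1 x \<cdot> a =\<^bsub>?C\<^esub> c)" for \<Theta> a c
    proof -
      note e2 = ext_trans[OF e e']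
      note I2 = lat_ext[OF e2 I] and r2 = el_ext[OF e' r] and y2 = el_ext[OF e2 y]
      note c1 = c[OF el_prod1[OF y2]] and c2 = c[OF el_prod2[OF ty_ext[OF e2 S] y2]]
      show ?thesis
        by (rule id_trans[OF fa[OF e2 r2 a] id_trans[OF id_seg[OF lat_plat[OF I2] c1 c2 r2]
            id_absorb_join[OF I2 tr_idD(3)[OF c1] r2]]])
    qed
    note PA = palg_plat[OF palg_ext[OF e A]] and e1 = ext_refl[OF ty_ext[OF e C]]
    show "tr \<Delta> (f r \<cdot> lbot A =\<^bsub>?C\<^esub> lbot I)" "tr \<Delta> (f r \<cdot> ltop A =\<^bsub>?C\<^esub> ltop I)"
      using const[OF e1 el_bot[OF PA]] const[OF e1 el_top[OF PA]] point_laws(1,2)[OF lat_ext[OF e I] palg_ext[OF e A]]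
      by blast+
    fix \<Theta> assume e': "ext \<Delta> \<Theta>"
    note e2 = ext_trans[OF e e']
    note I2 = lat_ext[OF e2 I] and A2 = palg_ext[OF e2 A] and r2 = el_ext[OF e' r] and y2 = el_ext[OF e2 y]
    note P2 = lat_plat[OF I2] and PA2 = palg_plat[OF A2] and y21 = el_prod1[OF y2] and y22 = el_prod2[OF ty_ext[OF e2 S] y2]
    note pt1 = el_point[OF I2 A2 y21] and pt2 = el_point[OF I2 A2 y22]
    { fix a b assume a: "el \<Theta> ?CA a" and b: "el \<Theta> ?CA b"
      have le: "tr \<Theta> (leq I (pr1 (pr1 y) \<cdot> a) (pr1 (pr2 y) \<cdot> a))" if "el \<Theta> ?CA a" for a
        using le e2 that unfolding tr_satisfaction_order_iff[OF I A y] by blast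
      show "tr \<Theta> (f r \<cdot> (lmeet A \<cdot> a \<cdot> b) =\<^bsub>?C\<^esub> lmeet I \<cdot> (f r \<cdot> a) \<cdot> (f r \<cdot> b))"
        by (rule id_trans[OF fa[OF e2 r2 el_meet[OF PA2 a b]]
            id_trans[OF id_seg[OF P2 point_laws(3)[OF I2 A2 y21 a b] point_laws(3)[OF I2 A2 y22 a b] r2]
            id_trans[OF id_sym[OF id_line_meet[OF I2 pt1[OF a] pt2[OF a] pt1[OF b] pt2[OF b] r2 le[OF a] le[OF b]]]
              id_meet[OF P2 id_sym[OF fa[OF e2 r2 a]] id_sym[OF fa[OF e2 r2 b]]]]]])
      show "tr \<Theta> (f r \<cdot> (ljoin A \<cdot> a \<cdot> b) =\<^bsub>?C\<^esub> ljoin I \<cdot> (f r \<cdot> a) \<cdot> (f r \<cdot> b))"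
        by (rule id_trans[OF fa[OF e2 r2 el_join[OF PA2 a b]]
            id_trans[OF id_seg[OF P2 point_laws(4)[OF I2 A2 y21 a b] point_laws(4)[OF I2 A2 y22 a b] r2]
            id_trans[OF id_sym[OF id_line_join[OF I2 pt1[OF a] pt2[OF a] pt1[OF b] pt2[OF b] r2]]
              id_join[OF P2 id_sym[OF fa[OF e2 r2 a]] id_sym[OF fa[OF e2 r2 b]]]]]]) }
    fix s assume s: "el \<Theta> ?C s"
    show "tr \<Theta> (f r \<cdot> (str A \<cdot> s) =\<^bsub>?C\<^esub> (\<^bold>\<lambda> r : ?C. r) \<cdot> s)"
      by (rule const[OF e' el_str[OF A2 s] point_laws(5)[OF I2 A2 _ s, unfolded base_alg_fields]])
  qed
  have fam: "fam (length \<Gamma>) (\<lambda>r. alg_hom_laws I A ?B (f r))"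
    unfolding f_def by (insert exs exs', (assumption | rule par_struct | rule leaf_struct)+)
  \<comment> \<open>The proofs of the homomorphism laws are gathered in a single element
    \<open>h\<close>, so that the pair formed from \<open>f r\<close> and \<open>h \<cdot> r\<close>
    is natural in \<open>r\<close> and can be abstracted to a path.\<close>
  have "tr \<Gamma> (\<Pi> r : ?C. alg_hom_laws I A ?B (f r))" by (rule tr_piI[OF C fam hom])
  then obtain h where h: "el \<Gamma> (\<Pi> r : ?C. alg_hom_laws I A ?B (f r)) h" by (auto simp: tr_def)
  have hr: "el \<Delta> (alg_hom_laws I A ?B (f r)) (h \<cdot> r)" if "ext \<Gamma> \<Delta>" "el \<Delta> ?C r" for \<Delta> r
    by (rule el_app[OF el_ext[OF that(1) h] fam_ext[OF that(1) fam] that(2)])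
  have S_eq: "?S = (\<Sigma> f : ?CA \<rightarrow> carr ?B. alg_hom_laws I A ?B f)" by (simp add: Spec_def alg_hom_def)
  have famS: "fam (length \<Delta>) (alg_hom_laws I A ?B)" if "ext \<Gamma> \<Delta>" for \<Delta>
    by (rule fam_alg_hom_laws[OF plat_ext[OF that P] palg_ext[OF that A] palg_ext[OF that base]])
  have pr: "el \<Delta> ?S (pair (f r) (h \<cdot> r))" if "ext \<Gamma> \<Delta>" "el \<Delta> ?C r" for \<Delta> r
    unfolding S_eq by (rule el_pair[OF f[OF that] hr[OF that] famS[OF that(1)] ty_ext[OF that(1) S, unfolded S_eq]])
  have fampr: "fam (length \<Gamma>) (\<lambda>r. pair (f r) (h \<cdot> r))"
    unfolding f_def by (insert exs el_ex[OF h], (assumption | rule par | rule par_leaf)+)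
  define c where "c = (\<^bold>\<lambda> r : ?C. pair (f r) (h \<cdot> r))"
  have c: "el \<Gamma> (path_space I ?S) c"
    unfolding c_def path_space_def by (rule el_lam_arr[OF C S fampr pr])
  have ca: "tr \<Delta> (pr1 (c \<cdot> r) \<cdot> a =\<^bsub>?C\<^esub> ?z a r)" if e: "ext \<Gamma> \<Delta>" and r: "el \<Delta> ?C r" and a: "el \<Delta> ?CA a" for \<Delta> r a
  proof -
    have "tr \<Delta> (c \<cdot> r =\<^bsub>?S\<^esub> pair (f r) (h \<cdot> r))"
      unfolding c_def
      by (rule id_beta_arr[OF ty_ext[OF e C] ty_ext[OF e S] fam_ext[OF e fampr] pr[OF ext_trans[OF e]] r])
    moreover have "tr \<Delta> (pr1 (pair (f r) (h \<cdot> r)) =\<^bsub>?CA \<rightarrow> carr ?B\<^esub> f r)"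
      by (rule id_pr1_beta[OF f[OF e r] hr[OF e r] famS[OF e] ty_ext[OF e S, unfolded S_eq]])
    ultimately have "tr \<Delta> (pr1 (c \<cdot> r) =\<^bsub>?CA \<rightarrow> ?C\<^esub> f r)"
      unfolding S_eq base_alg_fields by (rule id_trans[OF id_pr1])
    from id_app_arr[OF ty_ext[OF e C] this id_refl[OF a]] show ?thesis by (rule id_trans[OF _ fa[OF e r a]])
  qed
  note e0 = ext_refl[OF C]
  note ends = el_ends[OF I A e0 c] and ep = id_endpoints[OF I A c]
  note y1 = el_prod1[OF y] and y2 = el_prod2[OF S y]
  have c0: "tr \<Gamma> (c \<cdot> lbot I =\<^bsub>?S\<^esub> pr1 y)"
  proof (rule point_eq[OF I A ends(1) y1])
    fix \<Delta> a assume e: "ext \<Gamma> \<Delta>" and a: "el \<Delta> ?CA a"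
    note I1 = lat_ext[OF e I]
    note pt = el_point[OF I1 palg_ext[OF e A] el_ext[OF e] a]
    show "tr \<Delta> (pr1 (c \<cdot> lbot I) \<cdot> a =\<^bsub>?C\<^esub> pr1 (pr1 y) \<cdot> a)"
      by (rule id_trans[OF ca[OF e el_bot[OF lat_plat[OF I1]] a] id_line_bot[OF I1 pt[OF y1] pt[OF y2]]])
  qed
  have c1: "tr \<Gamma> (c \<cdot> ltop I =\<^bsub>?S\<^esub> pr2 y)"
  proof (rule point_eq[OF I A ends(2) y2])
    fix \<Delta> a assume e: "ext \<Gamma> \<Delta>" and a: "el \<Delta> ?CA a"
    note I1 = lat_ext[OF e I]
    note pt = el_point[OF I1 palg_ext[OF e A] el_ext[OF e] a]
    have "tr \<Delta> (leq I (pr1 (pr1 y) \<cdot> a) (pr1 (pr2 y) \<cdot> a))"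
      using le e a unfolding tr_satisfaction_order_iff[OF I A y] by blast
    from id_line_top[OF I1 pt[OF y1] pt[OF y2] this]
    show "tr \<Delta> (pr1 (c \<cdot> ltop I) \<cdot> a =\<^bsub>?C\<^esub> pr1 (pr2 y) \<cdot> a)"
      by (rule id_trans[OF ca[OF e el_top[OF lat_plat[OF I1]] a]])
  qed
  have "tr \<Gamma> (endpoints I ?S \<cdot> c =\<^bsub>?S \<otimes> ?S\<^esub> y)"
    by (rule id_prodI[OF S el_arr[OF ty_paths(2)[OF I A] el_endpoints[OF I A] c] y id_trans[OF ep(1) c0] id_trans[OF ep(2) c1]])
  then show ?thesis
    unfolding fiber_def using c fam_fiber[OF I A el_ex[OF y]] ty_fiber[OF I A y, unfolded fiber_def] by (intro tr_sigI)
qed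

text \<open>Makes the identity in the second component of a fibre a proposition, so that elements of
  a fibre are compared through their paths. The relation used is pointwise identity in both
  components.\<close>

lemma is_set_Spec_pairs:
  assumes I: "lat \<Gamma> I" and A: "palg \<Gamma> I A"
  shows "tr \<Gamma> (is_set (Spec I A \<otimes> Spec I A))"
proof -
  let ?R = "\<lambda>p q. (\<Pi> a : carr A. pr1 (pr1 p) \<cdot> a =\<^bsub>carr I\<^esub> pr1 (pr1 q) \<cdot> a) \<otimes>
    (\<Pi> a : carr A. pr1 (pr2 p) \<cdot> a =\<^bsub>carr I\<^esub> pr1 (pr2 q) \<cdot> a)"
  note CA = plat_ty[OF palg_plat[OF A]] and S = ty_Spec[OF I A]
  note exs = ty_ex[OF CA] ty_ex[OF plat_ty[OF lat_plat[OF I]]]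
  have pi: "tr \<Delta> (is_prop (\<Pi> a : carr A. pr1 x \<cdot> a =\<^bsub>carr I\<^esub> pr1 x' \<cdot> a))"
    "tr \<Delta> (\<Pi> a : carr A. pr1 x \<cdot> a =\<^bsub>carr I\<^esub> pr1 x \<cdot> a)"
    "tr \<Delta> (\<Pi> a : carr A. pr1 x \<cdot> a =\<^bsub>carr I\<^esub> pr1 x' \<cdot> a) \<Longrightarrow> tr \<Delta> (x =\<^bsub>Spec I A\<^esub> x')"
    if e: "ext \<Gamma> \<Delta>" and x: "el \<Delta> (Spec I A) x" and x': "el \<Delta> (Spec I A) x'" for \<Delta> x x'
  proof -
    note I1 = lat_ext[OF e I] and A1 = palg_ext[OF e A] and CA1 = ty_ext[OF e CA]
    have fam: "fam (length \<Delta>) (\<lambda>a. pr1 x \<cdot> a =\<^bsub>carr I\<^esub> pr1 x' \<cdot> a)" if "el \<Delta> (Spec I A) x'" for x'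
      by (insert exs[THEN ex_ext[OF e]] el_ex[OF x] el_ex[OF that], (assumption | rule par | rule par_leaf)+)
    have pt: "el \<Theta> (carr I) (pr1 x \<cdot> a)" if "el \<Delta> (Spec I A) x" "ext \<Delta> \<Theta>" "el \<Theta> (carr A) a" for \<Theta> x a
      by (rule el_point[OF lat_ext[OF that(2) I1] palg_ext[OF that(2) A1] el_ext[OF that(2,1)] that(3)])
    show "tr \<Delta> (is_prop (\<Pi> a : carr A. pr1 x \<cdot> a =\<^bsub>carr I\<^esub> pr1 x' \<cdot> a))"
      by (rule is_prop_pi[OF CA1 fam[OF x'] is_prop_id[OF lat_is_set[OF lat_ext[OF _ I1]] pt[OF x] pt[OF x']]])
    show "tr \<Delta> (\<Pi> a : carr A. pr1 x \<cdot> a =\<^bsub>carr I\<^esub> pr1 x \<cdot> a)"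
      by (rule tr_piI[OF CA1 fam[OF x] id_refl[OF pt[OF x]]])
    show "tr \<Delta> (\<Pi> a : carr A. pr1 x \<cdot> a =\<^bsub>carr I\<^esub> pr1 x' \<cdot> a) \<Longrightarrow> tr \<Delta> (x =\<^bsub>Spec I A\<^esub> x')"
      unfolding tr_pi_iff[OF CA1 fam[OF x']] by (rule point_eq[OF I1 A1 x x']) blast
  qed
  show ?thesis
  proof (rule is_setI_rel[OF ty_prod[OF S S], where R = ?R])
    show "fam2 (length \<Gamma>) ?R" by (insert exs, (assumption | rule par | rule par_leaf)+)
    fix \<Delta> p assume e: "ext \<Gamma> \<Delta>" and p: "el \<Delta> (Spec I A \<otimes> Spec I A) p"
    note S1 = ty_ext[OF e S]
    note p1 = el_prod1[OF p] and p2 = el_prod2[OF S1 p]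
    show "tr \<Delta> (?R p p)" by (rule tr_prodI[OF pi(2)[OF e p1 p1] pi(2)[OF e p2 p2]])
    fix q assume q: "el \<Delta> (Spec I A \<otimes> Spec I A) q"
    note q1 = el_prod1[OF q] and q2 = el_prod2[OF S1 q]
    show "tr \<Delta> (is_prop (?R p q))" by (intro is_prop_prod pi[OF e] p1 p2 q1 q2)
    assume R: "tr \<Delta> (?R p q)"
    show "tr \<Delta> (p =\<^bsub>Spec I A \<otimes> Spec I A\<^esub> q)"
      by (rule id_prodI[OF S1 p q pi(3)[OF e p1 q1 tr_prod1[OF R]]
          pi(3)[OF e p2 q2 tr_prod2[OF tr_is_prop_ty[OF pi(1)[OF e p2 q2]] R]]])
  qed
qed

text \<open>Two elements of the fibre over \<open>y\<close> are compared at each \<open>r\<close>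
  and each \<open>a\<close>, where \<open>fiber_affine\<close> gives both the same segment. Function
  extensionality, pointwise identity of points and the set property above lift this to the
  fibre.\<close>

lemma is_embedding_endpoints:
  assumes I: "lat \<Gamma> I" and A: "palg \<Gamma> I A" and aff: "funs_affine \<Gamma> I"
  shows "tr \<Gamma> (is_embedding (path_space I (Spec I A)) (Spec I A \<otimes> Spec I A) (endpoints I (Spec I A)))"
  unfolding is_embedding_def
proof (rule tr_piI[OF ty_paths(2)[OF I A] fam_fibers(1)[OF I A]])
  let ?X = "path_space I (Spec I A)" and ?Y = "Spec I A \<otimes> Spec I A" and ?e = "endpoints I (Spec I A)"
  fix \<Delta> y assume e: "ext \<Gamma> \<Delta>" and y: "el \<Delta> ?Y y"
  show "tr \<Delta> (is_prop (fiber ?X ?Y ?e y))"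
  proof (rule tr_is_propI[OF ty_fiber[OF lat_ext[OF e I] palg_ext[OF e A] y]])
    fix \<Theta> u v assume e': "ext \<Delta> \<Theta>" and u: "el \<Theta> (fiber ?X ?Y ?e y) u" and v: "el \<Theta> (fiber ?X ?Y ?e y) v"
    note e2 = ext_trans[OF e e']
    note I2 = lat_ext[OF e2 I] and A2 = palg_ext[OF e2 A] and y2 = el_ext[OF e' y]
    note cu = el_fiber(1)[OF I2 A2 y2 u] and cv = el_fiber(1)[OF I2 A2 y2 v]
    have "tr \<Theta> (pr1 u =\<^bsub>carr I \<rightarrow> Spec I A\<^esub> pr1 v)"
    proof (rule id_funext_arr[OF ty_Spec[OF I2 A2] cu cv])
      fix \<Xi> r assume e3: "ext \<Theta> \<Xi>" and r: "el \<Xi> (carr I) r"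
      note I3 = lat_ext[OF e3 I2] and A3 = palg_ext[OF e3 A2]
      note S3 = ty_Spec[OF I3 A3]
      show "tr \<Xi> (pr1 u \<cdot> r =\<^bsub>Spec I A\<^esub> pr1 v \<cdot> r)"
      proof (rule point_eq[OF I3 A3 el_arr[OF S3 el_ext[OF e3 cu] r] el_arr[OF S3 el_ext[OF e3 cv] r]])
        fix \<Omega> a assume e4: "ext \<Xi> \<Omega>" and a: "el \<Omega> (carr A) a"
        note e34 = ext_trans[OF e3 e4]
        note * = fiber_affine[OF lat_ext[OF e4 I3] palg_ext[OF e4 A3] el_ext[OF e34 y2]
            funs_affine_ext[OF ext_trans[OF e2 e34] aff] el_ext[OF e34] a el_ext[OF e4 r]]
        show "tr \<Omega> (pr1 (pr1 u \<cdot> r) \<cdot> a =\<^bsub>carr I\<^esub> pr1 (pr1 v \<cdot> r) \<cdot> a)"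
          by (rule id_trans[OF *[OF u] id_sym[OF *[OF v]]])
      qed
    qed
    then show "tr \<Theta> (u =\<^bsub>fiber ?X ?Y ?e y\<^esub> v)"
      unfolding fiber_def
    proof (intro id_sig_prop[OF u[unfolded fiber_def] v[unfolded fiber_def] fam_fiber[OF I2 A2 el_ex[OF y2]]])
      fix \<Xi> c assume e3: "ext \<Theta> \<Xi>" and c: "el \<Xi> ?X c"
      note I3 = lat_ext[OF e3 I2] and A3 = palg_ext[OF e3 A2]
      show "tr \<Xi> (is_prop (?e \<cdot> c =\<^bsub>?Y\<^esub> y))"
        by (rule is_prop_id[OF is_set_Spec_pairs[OF I3 A3] el_arr[OF ty_paths(2)[OF I3 A3] el_endpoints[OF I3 A3] c]
            el_ext[OF e3 y2]])
    qed (simp add: path_space_def)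
  qed
qed

lemma has_image_endpoints:
  assumes I: "lat \<Gamma> I" and A: "palg \<Gamma> I A" and aff: "funs_affine \<Gamma> I"
  shows "tr \<Gamma> (has_image (path_space I (Spec I A)) (Spec I A \<otimes> Spec I A) (endpoints I (Spec I A))
    (satisfaction_order I A))"
  unfolding has_image_def
proof (rule tr_piI[OF ty_paths(2)[OF I A] fam_fibers(2)[OF I A]], intro tr_prodI tr_arrI)
  let ?F = "fiber (path_space I (Spec I A)) (Spec I A \<otimes> Spec I A) (endpoints I (Spec I A))"
  fix \<Delta> y assume e: "ext \<Gamma> \<Delta>" and y: "el \<Delta> (Spec I A \<otimes> Spec I A) y"
  note I1 = lat_ext[OF e I] and A1 = palg_ext[OF e A]
  show "ty \<Delta> (?F y)" "ty \<Delta> (satisfaction_order I A y)" "ty \<Delta> (?F y)" "ty \<Delta> (satisfaction_order I A y)"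
    by (rule ty_fiber[OF I1 A1 y] ty_satisfaction_order[OF I1 A1 y])+
  fix \<Theta> assume e': "ext \<Delta> \<Theta>"
  note e2 = ext_trans[OF e e']
  note * = lat_ext[OF e' I1] palg_ext[OF e' A1]
  show "tr \<Theta> (?F y) \<Longrightarrow> tr \<Theta> (satisfaction_order I A y)"
    using fiber_order[OF * funs_affine_ext[OF e2 aff] el_ext[OF e' y]] by (auto simp: tr_def[of _ "?F y"])
  show "tr \<Theta> (satisfaction_order I A y) \<Longrightarrow> tr \<Theta> (?F y)"
    by (rule order_fiber[OF * el_ext[OF e' y]])
qed

text \<open>The levels are independent: freeness at level \<open>l\<close> is applied to the base
  algebra and to the affine maps, both at the level of \<open>I\<close>, whereas \<open>A\<close>
  enters only through its points with values in \<open>I\<close>.\<close>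

theorem theorem7p7:
  fixes l m :: nat
  shows "inhabited
    (all_lat l (\<lambda>I.
      all_alg l I (\<lambda>F. \<Pi> i : carr F. is_free_on l I F i \<rightarrow> quasi_coherent I F \<rightarrow>
        all_alg m I (\<lambda>A.
            is_embedding (path_space I (Spec I A)) (Spec I A \<otimes> Spec I A) (endpoints I (Spec I A))
          \<otimes> has_image (path_space I (Spec I A)) (Spec I A \<otimes> Spec I A) (endpoints I (Spec I A))
              (satisfaction_order I A)))))"
proof -
  let ?goal = "\<lambda>I A. is_embedding (path_space I (Spec I A)) (Spec I A \<otimes> Spec I A) (endpoints I (Spec I A))
    \<otimes> has_image (path_space I (Spec I A)) (Spec I A \<otimes> Spec I A) (endpoints I (Spec I A)) (satisfaction_order I A)"
  let ?Q = "\<lambda>I. all_alg m I (?goal I)"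
  let ?P = "\<lambda>I F. \<Pi> i : carr F. is_free_on l I F i \<rightarrow> quasi_coherent I F \<rightarrow> ?Q I"
  have tr: "tr \<in> {ty, tr}" by simp
  have "tr [] (all_lat l (\<lambda>I. all_alg l I (?P I)))"
  proof (rule all_lat_intro[OF tr ctx_nil])
    show "flat (length []) (\<lambda>I. all_alg l I (?P I))"
      by (rule flatI, (assumption | rule par_struct rel_all_alg | (rule rlat_fields, assumption) |
            (rule par_fields, assumption) | rule leaf_struct)+)
    fix \<Gamma>1 and I :: lat assume I: "lat \<Gamma>1 I" and l: "tp \<Gamma>1 l (carr I)"
    note P = lat_plat[OF I]
    show "tr \<Gamma>1 (all_alg l I (?P I))"
    proof (rule all_alg_intro[OF tr P])
      show "falg (length \<Gamma>1) (?P I)"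
        by (insert plat_exlat[OF P] exlat_fields[OF plat_exlat[OF P]], rule falgI,
          (assumption | rule par_struct rel_all_alg | (rule par_fields, assumption) | rule leaf_struct)+)
      fix \<Gamma>2 F assume e2: "ext \<Gamma>1 \<Gamma>2" and F': "alg \<Gamma>2 I F"
      note F = alg_palg[OF F'] and I2 = lat_ext[OF e2 I]
      note P2 = lat_plat[OF I2]
      show "tr \<Gamma>2 (?P I F)"
      proof (rule tr_piI[OF plat_ty[OF palg_plat[OF F]]])
        show "fam (length \<Gamma>2) (\<lambda>i. is_free_on l I F i \<rightarrow> quasi_coherent I F \<rightarrow> ?Q I)"
          by (insert plat_exlat[OF P2] exlat_fields[OF plat_exlat[OF P2]] palg_exalg[OF F],
            (assumption | rule par_struct rel_all_alg | (rule par_fields, assumption) | rule leaf_struct)+)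
        fix \<Gamma>3 i assume e3: "ext \<Gamma>2 \<Gamma>3" and i: "el \<Gamma>3 (carr F) i"
        note I3 = lat_ext[OF e3 I2] and F3 = palg_ext[OF e3 F] and l3 = tp_ext[OF ext_trans[OF e2 e3] l]
        note P3 = lat_plat[OF I3]
        \<comment> \<open>An implication can be entered only once its conclusion is known to be
          natural, so this is settled before the hypotheses on \<open>F\<close> are
          introduced.\<close>
        have exs: "ex (length \<Gamma>3) (quasi_coherent I F)" "ex (length \<Gamma>3) (?Q I)"
          by (rule ex_intro, insert plat_exlat[OF P3] exlat_fields[OF plat_exlat[OF P3]] palg_exalg[OF F3],
            (assumption | rule par_struct rel_all_alg | (rule par_fields, assumption) | rule leaf_struct)+)+
        have ex2: "ex (length \<Gamma>3) (quasi_coherent I F \<rightarrow> ?Q I)"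
          by (rule ex_intro, insert exs, (assumption | rule rel_arr | rule par_leaf)+)
        show "tr \<Gamma>3 (is_free_on l I F i \<rightarrow> quasi_coherent I F \<rightarrow> ?Q I)"
        proof (rule arr_intro[OF tr ty_is_free_on[OF P3 F3 i] ex2])
          fix \<Gamma>4 assume e4: "ext \<Gamma>3 \<Gamma>4" and free: "tr \<Gamma>4 (is_free_on l I F i)"
          note I4 = lat_ext[OF e4 I3] and F4 = palg_ext[OF e4 F3]
          show "tr \<Gamma>4 (quasi_coherent I F \<rightarrow> ?Q I)"
          proof (rule arr_intro[OF tr ty_quasi_coherent[OF I4 F4] ex_ext[OF e4 exs(2)]])
            fix \<Gamma>5 assume e5: "ext \<Gamma>4 \<Gamma>5" and qc: "tr \<Gamma>5 (quasi_coherent I F)"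
            note I5 = lat_ext[OF e5 I4]
            note P5 = lat_plat[OF I5]
            \<comment> \<open>The functions concerned may live in any later context, so the free
              algebra, its generator and both hypotheses on it are weakened to that context
              first.\<close>
            have aff: "funs_affine \<Gamma>5 I"
              unfolding funs_affine_def
            proof (intro allI impI)
              fix \<Delta> f r assume e: "ext \<Gamma>5 \<Delta>" and *: "el \<Delta> (carr I \<rightarrow> carr I) f" "el \<Delta> (carr I) r"
              note e4' = ext_trans[OF e5 e]
              note e3' = ext_trans[OF e4 e4']
              show "tr \<Delta> (f \<cdot> r =\<^bsub>carr I\<^esub> seg I (f \<cdot> lbot I) (f \<cdot> ltop I) r)"
                by (rule fun_affine[OF lat_ext[OF e I5] tp_ext[OF e3' l3] palg_ext[OF e3' F3] el_ext[OF e3' i]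
                      tr_ext[OF e4' free] tr_ext[OF e qc] *])
            qed
            show "tr \<Gamma>5 (?Q I)"
            proof (rule all_alg_intro[OF tr P5])
              show "falg (length \<Gamma>5) (?goal I)"
                by (insert plat_exlat[OF P5] exlat_fields[OF plat_exlat[OF P5]], rule falgI,
                  (assumption | rule par_struct | (rule par_fields, assumption) | rule leaf_struct)+)
              fix \<Gamma>6 A assume e6: "ext \<Gamma>5 \<Gamma>6" and A: "alg \<Gamma>6 I A"
              show "tr \<Gamma>6 (?goal I A)"
                by (rule tr_prodI[OF is_embedding_endpoints has_image_endpoints];
                    rule lat_ext[OF e6 I5] alg_palg[OF A] funs_affine_ext[OF e6 aff])
            qed
          qed
        qed
      qed
    qed
  qed
  then show ?thesis by (auto simp: inhabited_def tr_def el_def)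
qed

end
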